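(* The $2$-category $\mathbf{UC}$ is Q-system complete. That is, for every $0$-cell $b$ of $\mathbf{UC}$ and every Q-system $(Q,m,i)$ with $Q\in\mathbf{UC}_1(b,b)$, there exist a $0$-cell $c$ of $\mathbf{UC}$ and a dualizable $1$-cell $X\in\mathbf{UC}_1(c,b)$ admitting a unitarily separable dual $(\overline X,\mathrm{ev}_X,\mathrm{coev}_X)$ such that $(Q,m,i)$ is isomorphic, as a Q-system, to $X\boxtimes\overline X$ equipped with multiplication $\mathrm{id}_X\boxtimes \mathrm{ev}_X\boxtimes \mathrm{id}_{\overline X}$ and unit $\mathrm{coev}_X$.
   Context: **Categories and functors.** A finite semisimple C*-category is a semisimple C*-category with finitely many isomorphism classes of simple objects. All functors between such categories are $*$-linear; each has a (two-sided) adjoint. A functor is *bi-faithful* if both it and its adjoint are faithful. $\mathrm{NT}(F,G)$ denotes the natural transformations $F\to G$. Composition of functors is written from right to left; for $\eta:F\to G$, $\eta_H$ denotes the transformation $FH\to GH$ and $K(\eta)$ the transformation $KF\to KG$. **The $2$-category $\mathbf{UC}$.** - A $0$-cell $\Gamma_\bullet$ is a sequence $\{\Gamma_k:\mathcal M_{k-1}\to\mathcal M_k\}_{k\ge1}$ of $*$-linear bi-faithful functors between finite semisimple C*-categories. - A $1$-cell from $\{\Gamma_k:\mathcal M_{k-1}\to\mathcal M_k\}_{k\ge1}$ to $\{\Delta_k:\mathcal N_{k-1}\to\mathcal N_k\}_{k\ge1}$ is a pair $(\Lambda_\bullet,W_\bullet)$ consisting of $*$-linear bi-faithful functors $\Lambda_k:\mathcal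 M_k\to\mathcal N_k$ ($k\ge0$) and natural unitaries $W_k:\Delta_k\Lambda_{k-1}\to\Lambda_k\Gamma_k$ ($k\ge1$). The set of these is $\mathbf{UC}_1(\Gamma_\bullet,\Delta_\bullet)$. - For $1$-cells $(\Lambda_\bullet,W^\Lambda_\bullet),(\Omega_\bullet,W^\Omega_\bullet)\in \mathbf{UC}_1(\Gamma_\bullet,\Delta_\bullet)$, a pair $(\eta,\kappa)\in\mathrm{NT}(\Lambda_k,\Omega_k)\times\mathrm{NT}(\Lambda_{k+1},\Omega_{k+1})$ satisfies the *exchange relation* if $W^\Omega_{k+1}\circ\Delta_{k+1}(\eta)=\kappa_{\Gamma_{k+1}}\circ W^\Lambda_{k+1}$. A $2$-cell $\Lambda_\bullet\to\Omega_\bullet$ is a sequence $\{\eta^{(k)}\in\mathrm{NT}(\Lambda_k,\Omega_k)\}_{k\ge0}$ for which there is $N$ such that $(\eta^{(k)},\eta^{(k+1)})$ satisfies the exchange relation for all $k\ge N$, modulo sequences that are eventually $0$. Thus two $2$-cells are equal iff their terms agree eventually, and only the tail of the sequence needs to be specified. - Vertical composition, horizontal composition and the adjoint $*$ of $2$-cells are computed levelwise. For $\Omega_\bullet\in\mathbf{UC}_1(\Delta_\bullet,\Sigma_\bullet)$ and $\Lambda_\bullet\in\mathbf{UC}_1(\Gamma_\bullet,\Delta_\bullet)$, the composite $1$-cell $\Omega_\bullet\boxtimes\Lambda_\bullet$ has functors $\Omega_k\Lambda_k$ and connection $\Omega_k(W^\Lambda_k)\circ(W^\Omega_k)_{\Lambda_{k-1}}:\Sigma_k\Omega_{k-1}\Lambda_{k-1}\to\Omega_k\Lambda_k\Gamma_k$.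 The identity $1$-cell $1_{\Gamma_\bullet}$ consists of identity functors and identity unitaries. **Q-systems.** Let $\mathcal C$ be a $2$-category with an adjoint operation $*$ on $2$-cells (a pre-C*-2-category, such as $\mathbf{UC}$; this is a $2$-category whose hom-categories satisfy all axioms of a C*-category except completeness). $\mathcal C_1(a,b)$ denotes $1$-cells from $a$ to $b$, and $\boxtimes$ is composition of $1$-cells written from right to left. A Q-system is a $1$-cell $Q\in\mathcal C_1(b,b)$ with $2$-cells $m:Q\boxtimes Q\to Q$, $i:1_b\to Q$ such that (suppressing coherence): (Q1) $m(m\boxtimes\mathrm{id}_Q)=m(\mathrm{id}_Q\boxtimes m)$; (Q2) $m(i\boxtimes\mathrm{id}_Q)=\mathrm{id}_Q=m(\mathrm{id}_Q\boxtimes i)$; (Q3) $(\mathrm{id}_Q\boxtimes m)(m^*\boxtimes\mathrm{id}_Q)=m^*m=(m\boxtimes\mathrm{id}_Q)(\mathrm{id}_Q\boxtimes m^* )$; (Q4) $mm^*=\mathrm{id}_Q$. An isomorphism of Q-systems is a unitary $2$-cell intertwining the multiplications and the units. **Unitarily separable duals.** A dual of $X\in\mathcal C_1(a,b)$ is $(\overline X,\mathrm{ev}_X,\mathrm{coev}_X)$ with $\overline X\in\mathcal C_1(b,a)$, $\mathrm{ev}_X:\overline X\boxtimes X\to 1_a$, $\mathrm{coev}_X:1_b\to X\boxtimes\overline X$ satisfying the zig-zag (conjugate) equations; it is *unitarily separable* if $\mathrm{ev}_X\circ\mathrm{ev}_X^*=\mathrm{id}_{1_a}$. In that case $X\boxtimes\overline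 X$ with multiplication $\mathrm{id}_X\boxtimes \mathrm{ev}_X\boxtimes \mathrm{id}_{\overline X}$ and unit $\mathrm{coev}_X$ is a Q-system. *)

theory Defs
  imports Complex_Main "HOL-Library.FuncSet"
begin

section \<open>Finite semisimple C*-categories\<close>

text \<open>Objects and arrows are taken from one type \<open>'u\<close>, which plays the role of the universe in
  which the 2-category \<open>UC\<close> is formed. The operations matter only on composable, parallel, etc.
  arguments. There is no loss of generality: a category with objects in \<open>'o\<close> and arrows in
  \<open>'m\<close> can be viewed over \<open>'o + 'm\<close>.\<close>

record 'u cat =
  Obj :: "'u set"
  Arr :: "'u set"
  Dom :: "'u \<Rightarrow> 'u"
  Cod :: "'u \<Rightarrow> 'u"
  Idn :: "'u \<Rightarrow> 'u"
  Cmp :: "'u \<Rightarrow> 'u \<Rightarrow> 'u" (infixr "\<cdot>\<index>" 70)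
  Zer :: "'u \<Rightarrow> 'u \<Rightarrow> 'u"
  Add :: "'u \<Rightarrow> 'u \<Rightarrow> 'u" (infixl "\<oplus>\<index>" 65)
  Scl :: "complex \<Rightarrow> 'u \<Rightarrow> 'u" (infixr "\<odot>\<index>" 75)
  Str :: "'u \<Rightarrow> 'u"
  Nrm :: "'u \<Rightarrow> real"

definition Hom :: "'u cat \<Rightarrow> 'u \<Rightarrow> 'u \<Rightarrow> 'u set" where
  "Hom C x y = {f \<in> Arr C. Dom C f = x \<and> Cod C f = y}"

locale category =
  fixes C :: "'u cat" (structure)
  assumes Dom_in: "f \<in> Arr C \<Longrightarrow> Dom C f \<in> Obj C"
    and Cod_in: "f \<in> Arr C \<Longrightarrow> Cod C f \<in> Obj C"
    and Idn_in: "x \<in> Obj C \<Longrightarrow> Idn C x \<in> Hom C x x"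
    and Cmp_in: "\<lbrakk>g \<in> Hom C y z; f \<in> Hom C x y\<rbrakk> \<Longrightarrow> g \<cdot> f \<in> Hom C x z"
    and Cmp_Idn: "f \<in> Hom C x y \<Longrightarrow> f \<cdot> Idn C x = f"
    and Idn_Cmp: "f \<in> Hom C x y \<Longrightarrow> Idn C y \<cdot> f = f"
    and Cmp_assoc: "\<lbrakk>h \<in> Hom C y z; g \<in> Hom C x y; f \<in> Hom C w x\<rbrakk>
        \<Longrightarrow> (h \<cdot> g) \<cdot> f = h \<cdot> (g \<cdot> f)"

locale linear_category = category +
  assumes Zer_in: "\<lbrakk>x \<in> Obj C; y \<in> Obj C\<rbrakk> \<Longrightarrow> Zer C x y \<in> Hom C x y"
    and Add_in: "\<lbrakk>f \<in> Hom C x y; g \<in> Hom C x y\<rbrakk> \<Longrightarrow> f \<oplus> g \<in> Hom C x y"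
    and Scl_in: "f \<in> Hom C x y \<Longrightarrow> a \<odot> f \<in> Hom C x y"
    and Add_assoc: "\<lbrakk>f \<in> Hom C x y; g \<in> Hom C x y; h \<in> Hom C x y\<rbrakk>
        \<Longrightarrow> (f \<oplus> g) \<oplus> h = f \<oplus> (g \<oplus> h)"
    and Add_commute: "\<lbrakk>f \<in> Hom C x y; g \<in> Hom C x y\<rbrakk> \<Longrightarrow> f \<oplus> g = g \<oplus> f"
    and Add_Zer: "f \<in> Hom C x y \<Longrightarrow> f \<oplus> Zer C x y = f"
    and Add_neg: "f \<in> Hom C x y \<Longrightarrow> f \<oplus> (- 1) \<odot> f = Zer C x y"
    and Scl_Add: "\<lbrakk>f \<in> Hom C x y; g \<in> Hom C x y\<rbrakk> \<Longrightarrow> a \<odot> (f \<oplus> g) = a \<odot> f \<oplus> a \<odot> g"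
    and add_Scl: "f \<in> Hom C x y \<Longrightarrow> (a + b) \<odot> f = a \<odot> f \<oplus> b \<odot> f"
    and Scl_Scl: "f \<in> Hom C x y \<Longrightarrow> a \<odot> (b \<odot> f) = (a * b) \<odot> f"
    and Scl_one: "f \<in> Hom C x y \<Longrightarrow> 1 \<odot> f = f"
    and Cmp_Add: "\<lbrakk>g \<in> Hom C y z; f \<in> Hom C x y; f' \<in> Hom C x y\<rbrakk>
        \<Longrightarrow> g \<cdot> (f \<oplus> f') = g \<cdot> f \<oplus> g \<cdot> f'"
    and Add_Cmp: "\<lbrakk>g \<in> Hom C y z; g' \<in> Hom C y z; f \<in> Hom C x y\<rbrakk>
        \<Longrightarrow> (g \<oplus> g') \<cdot> f = g \<cdot> f \<oplus> g' \<cdot> f"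
    and Cmp_Scl: "\<lbrakk>g \<in> Hom C y z; f \<in> Hom C x y\<rbrakk> \<Longrightarrow> g \<cdot> (a \<odot> f) = a \<odot> (g \<cdot> f)"
    and Scl_Cmp: "\<lbrakk>g \<in> Hom C y z; f \<in> Hom C x y\<rbrakk> \<Longrightarrow> (a \<odot> g) \<cdot> f = a \<odot> (g \<cdot> f)"

locale star_category = linear_category +
  assumes Str_in: "f \<in> Hom C x y \<Longrightarrow> Str C f \<in> Hom C y x"
    and Str_Str: "f \<in> Arr C \<Longrightarrow> Str C (Str C f) = f"
    and Str_Cmp: "\<lbrakk>g \<in> Hom C y z; f \<in> Hom C x y\<rbrakk> \<Longrightarrow> Str C (g \<cdot> f) = Str C f \<cdot> Str C g"
    and Str_Add: "\<lbrakk>f \<in> Hom C x y; g \<in> Hom C x y\<rbrakk> \<Longrightarrow> Str C (f \<oplus> g) = Str C f \<oplus> Str C g"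
    and Str_Scl: "f \<in> Arr C \<Longrightarrow> Str C (a \<odot> f) = cnj a \<odot> Str C f"

locale cstar_category = star_category +
  assumes Nrm_ge_0: "f \<in> Arr C \<Longrightarrow> 0 \<le> Nrm C f"
    and Nrm_eq_0: "f \<in> Hom C x y \<Longrightarrow> Nrm C f = 0 \<longleftrightarrow> f = Zer C x y"
    and Nrm_Add: "\<lbrakk>f \<in> Hom C x y; g \<in> Hom C x y\<rbrakk> \<Longrightarrow> Nrm C (f \<oplus> g) \<le> Nrm C f + Nrm C g"
    and Nrm_Scl: "f \<in> Arr C \<Longrightarrow> Nrm C (a \<odot> f) = cmod a * Nrm C f"
    and Nrm_Cmp: "\<lbrakk>g \<in> Hom C y z; f \<in> Hom C x y\<rbrakk> \<Longrightarrow> Nrm C (g \<cdot> f) \<le> Nrm C g * Nrm C f"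
    and complete:
      "\<lbrakk>\<And>n. s n \<in> Hom C x y;
        \<And>e. 0 < e \<Longrightarrow> \<exists>N. \<forall>m\<ge>N. \<forall>n\<ge>N. Nrm C (s m \<oplus> (- 1) \<odot> s n) < e\<rbrakk>
        \<Longrightarrow> \<exists>f \<in> Hom C x y. (\<lambda>n. Nrm C (s n \<oplus> (- 1) \<odot> f)) \<longlonglongrightarrow> 0"
    and cstar_identity: "f \<in> Arr C \<Longrightarrow> Nrm C (Str C f \<cdot> f) = (Nrm C f)\<^sup>2"
    and positivity: "f \<in> Hom C x y \<Longrightarrow> \<exists>g \<in> Hom C x x. Str C f \<cdot> f = Str C g \<cdot> g"

definition iso_obj :: "'u cat \<Rightarrow> 'u \<Rightarrow> 'u \<Rightarrow> bool" where
  "iso_obj C x y \<longleftrightarrow>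
    (\<exists>f \<in> Hom C x y. \<exists>g \<in> Hom C y x. g \<cdot>\<^bsub>C\<^esub> f = Idn C x \<and> f \<cdot>\<^bsub>C\<^esub> g = Idn C y)"

definition unitary :: "'u cat \<Rightarrow> 'u \<Rightarrow> bool" where
  "unitary C u \<longleftrightarrow> u \<in> Arr C \<and>
    Str C u \<cdot>\<^bsub>C\<^esub> u = Idn C (Dom C u) \<and> u \<cdot>\<^bsub>C\<^esub> Str C u = Idn C (Cod C u)"

primrec arr_sum :: "'u cat \<Rightarrow> 'u \<Rightarrow> 'u \<Rightarrow> nat \<Rightarrow> (nat \<Rightarrow> 'u) \<Rightarrow> 'u" where
  "arr_sum C x y 0 f = Zer C x y"
| "arr_sum C x y (Suc n) f = arr_sum C x y n f \<oplus>\<^bsub>C\<^esub> f n"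

text \<open>Orthogonal direct sums; for \<open>n = 0\<close> this says that \<open>z\<close> is a zero object.\<close>

definition is_direct_sum :: "'u cat \<Rightarrow> nat \<Rightarrow> (nat \<Rightarrow> 'u) \<Rightarrow> 'u \<Rightarrow> (nat \<Rightarrow> 'u) \<Rightarrow> bool" where
  "is_direct_sum C n x z v \<longleftrightarrow>
    z \<in> Obj C \<and> (\<forall>i<n. v i \<in> Hom C (x i) z) \<and>
    (\<forall>i<n. \<forall>j<n. Str C (v i) \<cdot>\<^bsub>C\<^esub> v j = (if i = j then Idn C (x i) else Zer C (x j) (x i))) \<and>
    arr_sum C z z n (\<lambda>i. v i \<cdot>\<^bsub>C\<^esub> Str C (v i)) = Idn C z"

definition simple :: "'u cat \<Rightarrow> 'u \<Rightarrow> bool" where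
  "simple C s \<longleftrightarrow> s \<in> Obj C \<and> Idn C s \<noteq> Zer C s s \<and>
    Hom C s s = range (\<lambda>a. a \<odot>\<^bsub>C\<^esub> Idn C s)"

locale semisimple_cstar_category = cstar_category +
  assumes direct_sums: "(\<And>i. i < n \<Longrightarrow> xs i \<in> Obj C) \<Longrightarrow> \<exists>z v. is_direct_sum C n xs z v"
    and projections_split:
      "\<lbrakk>p \<in> Hom C x x; p \<cdot> p = p; Str C p = p\<rbrakk>
        \<Longrightarrow> \<exists>y \<in> Obj C. \<exists>v \<in> Hom C y x. Str C v \<cdot> v = Idn C y \<and> v \<cdot> Str C v = p"
    and semisimple:
      "x \<in> Obj C \<Longrightarrow> \<exists>n s v. (\<forall>i<n. simple C (s i)) \<and> is_direct_sum C n s x v"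

locale finite_semisimple_cstar_category = semisimple_cstar_category +
  assumes finite_simples:
    "finite ({s. simple C s} // {(s, t). simple C s \<and> simple C t \<and> iso_obj C s t})"


section \<open>Functors and natural transformations\<close>

text \<open>Functors and natural transformations are extensional, i.e. \<open>undefined\<close> outside the source
  category. This makes composition of functors strictly associative and unital, and makes
  equality of natural transformations the equality of HOL.\<close>

record 'u func =
  fobj :: "'u \<Rightarrow> 'u"
  farr :: "'u \<Rightarrow> 'u"

locale star_functor =
  fixes A :: "'u cat" and B :: "'u cat" and F :: "'u func"
  assumes fobj_ext: "fobj F \<in> extensional (Obj A)"
    and farr_ext: "farr F \<in> extensional (Arr A)"
    and fobj_in: "x \<in> Obj A \<Longrightarrow> fobj F x \<in> Obj B"
    and farr_in: "f \<in> Hom A x y \<Longrightarrow> farr F f \<in> Hom B (fobj F x) (fobj F y)"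
    and farr_Idn: "x \<in> Obj A \<Longrightarrow> farr F (Idn A x) = Idn B (fobj F x)"
    and farr_Cmp: "\<lbrakk>g \<in> Hom A y z; f \<in> Hom A x y\<rbrakk>
        \<Longrightarrow> farr F (g \<cdot>\<^bsub>A\<^esub> f) = farr F g \<cdot>\<^bsub>B\<^esub> farr F f"
    and farr_Add: "\<lbrakk>f \<in> Hom A x y; g \<in> Hom A x y\<rbrakk>
        \<Longrightarrow> farr F (f \<oplus>\<^bsub>A\<^esub> g) = farr F f \<oplus>\<^bsub>B\<^esub> farr F g"
    and farr_Scl: "f \<in> Arr A \<Longrightarrow> farr F (a \<odot>\<^bsub>A\<^esub> f) = a \<odot>\<^bsub>B\<^esub> farr F f"
    and farr_Str: "f \<in> Arr A \<Longrightarrow> farr F (Str A f) = Str B (farr F f)"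

definition id_func :: "'u cat \<Rightarrow> 'u func" where
  "id_func A = \<lparr>fobj = (\<lambda>x \<in> Obj A. x), farr = (\<lambda>f \<in> Arr A. f)\<rparr>"

definition func_comp :: "'u cat \<Rightarrow> 'u func \<Rightarrow> 'u func \<Rightarrow> 'u func" where
  "func_comp A G F =
    \<lparr>fobj = compose (Obj A) (fobj G) (fobj F), farr = compose (Arr A) (farr G) (farr F)\<rparr>"

definition faithful :: "'u cat \<Rightarrow> 'u func \<Rightarrow> bool" where
  "faithful A F \<longleftrightarrow> (\<forall>x \<in> Obj A. \<forall>y \<in> Obj A. inj_on (farr F) (Hom A x y))"

definition NT :: "'u cat \<Rightarrow> 'u cat \<Rightarrow> 'u func \<Rightarrow> 'u func \<Rightarrow> ('u \<Rightarrow> 'u) set" where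
  "NT A B F G = {\<eta> \<in> extensional (Obj A).
    (\<forall>x \<in> Obj A. \<eta> x \<in> Hom B (fobj F x) (fobj G x)) \<and>
    (\<forall>x \<in> Obj A. \<forall>y \<in> Obj A. \<forall>f \<in> Hom A x y. \<eta> y \<cdot>\<^bsub>B\<^esub> farr F f = farr G f \<cdot>\<^bsub>B\<^esub> \<eta> x)}"

definition natural_unitary ::
  "'u cat \<Rightarrow> 'u cat \<Rightarrow> 'u func \<Rightarrow> 'u func \<Rightarrow> ('u \<Rightarrow> 'u) \<Rightarrow> bool" where
  "natural_unitary A B F G \<eta> \<longleftrightarrow> \<eta> \<in> NT A B F G \<and> (\<forall>x \<in> Obj A. unitary B (\<eta> x))"

definition nt_id :: "'u cat \<Rightarrow> 'u cat \<Rightarrow> 'u func \<Rightarrow> 'u \<Rightarrow> 'u" where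
  "nt_id A B F = (\<lambda>x \<in> Obj A. Idn B (fobj F x))"

definition nt_comp :: "'u cat \<Rightarrow> 'u cat \<Rightarrow> ('u \<Rightarrow> 'u) \<Rightarrow> ('u \<Rightarrow> 'u) \<Rightarrow> 'u \<Rightarrow> 'u" where
  "nt_comp A B \<kappa> \<eta> = (\<lambda>x \<in> Obj A. \<kappa> x \<cdot>\<^bsub>B\<^esub> \<eta> x)"

definition nt_star :: "'u cat \<Rightarrow> 'u cat \<Rightarrow> ('u \<Rightarrow> 'u) \<Rightarrow> 'u \<Rightarrow> 'u" where
  "nt_star A B \<eta> = (\<lambda>x \<in> Obj A. Str B (\<eta> x))"

text \<open>\<open>whisk_right A \<eta> H\<close> is $\eta_H$ and \<open>whisk_left A K \<eta>\<close> is $K(\eta)$; here \<open>A\<close> is the source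
  category of the resulting transformation.\<close>

definition whisk_right :: "'u cat \<Rightarrow> ('u \<Rightarrow> 'u) \<Rightarrow> 'u func \<Rightarrow> 'u \<Rightarrow> 'u" where
  "whisk_right A \<eta> H = (\<lambda>x \<in> Obj A. \<eta> (fobj H x))"

definition whisk_left :: "'u cat \<Rightarrow> 'u func \<Rightarrow> ('u \<Rightarrow> 'u) \<Rightarrow> 'u \<Rightarrow> 'u" where
  "whisk_left A K \<eta> = (\<lambda>x \<in> Obj A. farr K (\<eta> x))"

definition adjunction ::
  "'u cat \<Rightarrow> 'u cat \<Rightarrow> 'u func \<Rightarrow> 'u func \<Rightarrow> ('u \<Rightarrow> 'u) \<Rightarrow> ('u \<Rightarrow> 'u) \<Rightarrow> bool" where
  "adjunction A B F G \<eta> \<epsilon> \<longleftrightarrow>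
    \<eta> \<in> NT A A (id_func A) (func_comp A G F) \<and>
    \<epsilon> \<in> NT B B (func_comp B F G) (id_func B) \<and>
    nt_comp A B (whisk_right A \<epsilon> F) (whisk_left A F \<eta>) = nt_id A B F \<and>
    nt_comp B A (whisk_left B G \<epsilon>) (whisk_right B \<eta> G) = nt_id B A G"

definition two_sided_adjoint :: "'u cat \<Rightarrow> 'u cat \<Rightarrow> 'u func \<Rightarrow> 'u func \<Rightarrow> bool" where
  "two_sided_adjoint A B F G \<longleftrightarrow>
    (\<exists>\<eta> \<epsilon>. adjunction A B F G \<eta> \<epsilon>) \<and> (\<exists>\<eta> \<epsilon>. adjunction B A G F \<eta> \<epsilon>)"

text \<open>The adjoint is unique up to natural isomorphism, so ``the adjoint is faithful'' may be
  expressed with an existential quantifier.\<close>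

definition bi_faithful :: "'u cat \<Rightarrow> 'u cat \<Rightarrow> 'u func \<Rightarrow> bool" where
  "bi_faithful A B F \<longleftrightarrow> star_functor A B F \<and> faithful A F \<and>
    (\<exists>G. star_functor B A G \<and> two_sided_adjoint A B F G \<and> faithful B G)"


section \<open>Q-systems in a 2-category with an adjoint operation on 2-cells\<close>

text \<open>Composition of 1-cells is assumed to be strict, which is the case for \<open>UC\<close> below; so there
  are no coherence cells. All compositions are written from right to left.\<close>

record ('z, 'f, 't) two_cat =
  cell0 :: "'z set"
  cell1 :: "'z \<Rightarrow> 'z \<Rightarrow> 'f set"
  cell2 :: "'f \<Rightarrow> 'f \<Rightarrow> 't set"
  one1 :: "'z \<Rightarrow> 'f"
  one2 :: "'f \<Rightarrow> 't"
  comp1 :: "'f \<Rightarrow> 'f \<Rightarrow> 'f" (infixr "\<box>\<index>" 75)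
  hcomp :: "'t \<Rightarrow> 't \<Rightarrow> 't" (infixr "\<otimes>\<index>" 75)
  vcomp :: "'t \<Rightarrow> 't \<Rightarrow> 't" (infixr "\<bullet>\<index>" 70)
  star2 :: "'t \<Rightarrow> 't"

definition Q_system :: "('z, 'f, 't) two_cat \<Rightarrow> 'z \<Rightarrow> 'f \<Rightarrow> 't \<Rightarrow> 't \<Rightarrow> bool" where
  "Q_system \<C> b Q m i \<longleftrightarrow>
    Q \<in> cell1 \<C> b b \<and> m \<in> cell2 \<C> (Q \<box>\<^bsub>\<C>\<^esub> Q) Q \<and> i \<in> cell2 \<C> (one1 \<C> b) Q \<and>
    m \<bullet>\<^bsub>\<C>\<^esub> (m \<otimes>\<^bsub>\<C>\<^esub> one2 \<C> Q) = m \<bullet>\<^bsub>\<C>\<^esub> (one2 \<C> Q \<otimes>\<^bsub>\<C>\<^esub> m) \<and>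
    m \<bullet>\<^bsub>\<C>\<^esub> (i \<otimes>\<^bsub>\<C>\<^esub> one2 \<C> Q) = one2 \<C> Q \<and>
    m \<bullet>\<^bsub>\<C>\<^esub> (one2 \<C> Q \<otimes>\<^bsub>\<C>\<^esub> i) = one2 \<C> Q \<and>
    (one2 \<C> Q \<otimes>\<^bsub>\<C>\<^esub> m) \<bullet>\<^bsub>\<C>\<^esub> (star2 \<C> m \<otimes>\<^bsub>\<C>\<^esub> one2 \<C> Q) = star2 \<C> m \<bullet>\<^bsub>\<C>\<^esub> m \<and>
    (m \<otimes>\<^bsub>\<C>\<^esub> one2 \<C> Q) \<bullet>\<^bsub>\<C>\<^esub> (one2 \<C> Q \<otimes>\<^bsub>\<C>\<^esub> star2 \<C> m) = star2 \<C> m \<bullet>\<^bsub>\<C>\<^esub> m \<and>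
    m \<bullet>\<^bsub>\<C>\<^esub> star2 \<C> m = one2 \<C> Q"

definition Q_system_iso ::
  "('z, 'f, 't) two_cat \<Rightarrow> 'f \<Rightarrow> 't \<Rightarrow> 't \<Rightarrow> 'f \<Rightarrow> 't \<Rightarrow> 't \<Rightarrow> 't \<Rightarrow> bool" where
  "Q_system_iso \<C> Q m i Q' m' i' u \<longleftrightarrow>
    u \<in> cell2 \<C> Q Q' \<and>
    star2 \<C> u \<bullet>\<^bsub>\<C>\<^esub> u = one2 \<C> Q \<and> u \<bullet>\<^bsub>\<C>\<^esub> star2 \<C> u = one2 \<C> Q' \<and>
    u \<bullet>\<^bsub>\<C>\<^esub> m = m' \<bullet>\<^bsub>\<C>\<^esub> (u \<otimes>\<^bsub>\<C>\<^esub> u) \<and> u \<bullet>\<^bsub>\<C>\<^esub> i = i'"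

definition is_dual :: "('z, 'f, 't) two_cat \<Rightarrow> 'z \<Rightarrow> 'z \<Rightarrow> 'f \<Rightarrow> 'f \<Rightarrow> 't \<Rightarrow> 't \<Rightarrow> bool" where
  "is_dual \<C> a b X Xbar ev coev \<longleftrightarrow>
    X \<in> cell1 \<C> a b \<and> Xbar \<in> cell1 \<C> b a \<and>
    ev \<in> cell2 \<C> (Xbar \<box>\<^bsub>\<C>\<^esub> X) (one1 \<C> a) \<and> coev \<in> cell2 \<C> (one1 \<C> b) (X \<box>\<^bsub>\<C>\<^esub> Xbar) \<and>
    (one2 \<C> X \<otimes>\<^bsub>\<C>\<^esub> ev) \<bullet>\<^bsub>\<C>\<^esub> (coev \<otimes>\<^bsub>\<C>\<^esub> one2 \<C> X) = one2 \<C> X \<and>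
    (ev \<otimes>\<^bsub>\<C>\<^esub> one2 \<C> Xbar) \<bullet>\<^bsub>\<C>\<^esub> (one2 \<C> Xbar \<otimes>\<^bsub>\<C>\<^esub> coev) = one2 \<C> Xbar"

definition unitarily_separable_dual ::
  "('z, 'f, 't) two_cat \<Rightarrow> 'z \<Rightarrow> 'z \<Rightarrow> 'f \<Rightarrow> 'f \<Rightarrow> 't \<Rightarrow> 't \<Rightarrow> bool" where
  "unitarily_separable_dual \<C> a b X Xbar ev coev \<longleftrightarrow>
    is_dual \<C> a b X Xbar ev coev \<and> ev \<bullet>\<^bsub>\<C>\<^esub> star2 \<C> ev = one2 \<C> (one1 \<C> a)"

definition Q_system_complete :: "('z, 'f, 't) two_cat \<Rightarrow> bool" where
  "Q_system_complete \<C> \<longleftrightarrow>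
    (\<forall>b \<in> cell0 \<C>. \<forall>Q m i. Q_system \<C> b Q m i \<longrightarrow>
      (\<exists>c \<in> cell0 \<C>. \<exists>X Xbar ev coev. unitarily_separable_dual \<C> c b X Xbar ev coev \<and>
        (\<exists>u. Q_system_iso \<C> Q m i
          (X \<box>\<^bsub>\<C>\<^esub> Xbar) (one2 \<C> X \<otimes>\<^bsub>\<C>\<^esub> ev \<otimes>\<^bsub>\<C>\<^esub> one2 \<C> Xbar) coev u)))"


section \<open>The 2-category \<open>UC\<close>\<close>

text \<open>Index shift: \<open>step \<Gamma> k\<close> is $\Gamma_{k+1} : \mathcal M_k \to \mathcal M_{k+1}$, and \<open>conn \<Lambda> k\<close>
  is $W_{k+1} : \Delta_{k+1}\Lambda_k \to \Lambda_{k+1}\Gamma_{k+1}$.\<close>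

record 'u zero_cell =
  level :: "nat \<Rightarrow> 'u cat"
  step :: "nat \<Rightarrow> 'u func"

record 'u one_cell =
  src0 :: "'u zero_cell"
  trg0 :: "'u zero_cell"
  fun1 :: "nat \<Rightarrow> 'u func"
  conn :: "nat \<Rightarrow> 'u \<Rightarrow> 'u"

definition UC_0 :: "'u zero_cell set" where
  "UC_0 = {\<Gamma>. \<forall>k. finite_semisimple_cstar_category (level \<Gamma> k) \<and>
    bi_faithful (level \<Gamma> k) (level \<Gamma> (Suc k)) (step \<Gamma> k)}"

definition UC_1 :: "'u zero_cell \<Rightarrow> 'u zero_cell \<Rightarrow> 'u one_cell set" where
  "UC_1 \<Gamma> \<Delta> = {\<Lambda>. src0 \<Lambda> = \<Gamma> \<and> trg0 \<Lambda> = \<Delta> \<and>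
    (\<forall>k. bi_faithful (level \<Gamma> k) (level \<Delta> k) (fun1 \<Lambda> k) \<and>
      natural_unitary (level \<Gamma> k) (level \<Delta> (Suc k))
        (func_comp (level \<Gamma> k) (step \<Delta> k) (fun1 \<Lambda> k))
        (func_comp (level \<Gamma> k) (fun1 \<Lambda> (Suc k)) (step \<Gamma> k))
        (conn \<Lambda> k))}"

definition exchange ::
  "'u one_cell \<Rightarrow> 'u one_cell \<Rightarrow> nat \<Rightarrow> ('u \<Rightarrow> 'u) \<Rightarrow> ('u \<Rightarrow> 'u) \<Rightarrow> bool" where
  "exchange \<Lambda> \<Omega> k \<eta> \<kappa> \<longleftrightarrow>
    (let \<Gamma> = src0 \<Lambda>; \<Delta> = trg0 \<Lambda>; A = level \<Gamma> k; B = level \<Delta> (Suc k) in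
      nt_comp A B (conn \<Omega> k) (whisk_left A (step \<Delta> k) \<eta>) =
      nt_comp A B (whisk_right A \<kappa> (step \<Gamma> k)) (conn \<Lambda> k))"

definition exchange_seqs :: "'u one_cell \<Rightarrow> 'u one_cell \<Rightarrow> (nat \<Rightarrow> 'u \<Rightarrow> 'u) set" where
  "exchange_seqs \<Lambda> \<Omega> = {\<eta>.
    (\<forall>k. \<eta> k \<in> NT (level (src0 \<Lambda>) k) (level (trg0 \<Lambda>) k) (fun1 \<Lambda> k) (fun1 \<Omega> k)) \<and>
    (\<exists>N. \<forall>k\<ge>N. exchange \<Lambda> \<Omega> k (\<eta> k) (\<eta> (Suc k)))}"

text \<open>A 2-cell is a class of sequences modulo eventual equality, that is, modulo sequences that
  are eventually 0.\<close>

record 'u two_cell =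
  src1 :: "'u one_cell"
  trg1 :: "'u one_cell"
  cls :: "(nat \<Rightarrow> 'u \<Rightarrow> 'u) set"

definition eventually_equal ::
  "'u one_cell \<Rightarrow> 'u one_cell \<Rightarrow> ((nat \<Rightarrow> 'u \<Rightarrow> 'u) \<times> (nat \<Rightarrow> 'u \<Rightarrow> 'u)) set" where
  "eventually_equal \<Lambda> \<Omega> = {(\<eta>, \<zeta>). \<eta> \<in> exchange_seqs \<Lambda> \<Omega> \<and> \<zeta> \<in> exchange_seqs \<Lambda> \<Omega> \<and>
    (\<forall>\<^sub>F k in sequentially. \<eta> k = \<zeta> k)}"

definition UC_2 :: "'u one_cell \<Rightarrow> 'u one_cell \<Rightarrow> 'u two_cell set" where
  "UC_2 \<Lambda> \<Omega> = {\<mu>. src1 \<mu> = \<Lambda> \<and> trg1 \<mu> = \<Omega> \<and>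
    cls \<mu> \<in> exchange_seqs \<Lambda> \<Omega> // eventually_equal \<Lambda> \<Omega>}"

definition mk2 :: "'u one_cell \<Rightarrow> 'u one_cell \<Rightarrow> (nat \<Rightarrow> 'u \<Rightarrow> 'u) \<Rightarrow> 'u two_cell" where
  "mk2 \<Lambda> \<Omega> \<eta> = \<lparr>src1 = \<Lambda>, trg1 = \<Omega>, cls = eventually_equal \<Lambda> \<Omega> `` {\<eta>}\<rparr>"

text \<open>An arbitrary representative; the operations below do not depend on this choice.\<close>

definition rep2 :: "'u two_cell \<Rightarrow> nat \<Rightarrow> 'u \<Rightarrow> 'u" where
  "rep2 \<mu> = (SOME \<eta>. \<eta> \<in> cls \<mu>)"

definition UC_one1 :: "'u zero_cell \<Rightarrow> 'u one_cell" where
  "UC_one1 \<Gamma> = \<lparr>src0 = \<Gamma>, trg0 = \<Gamma>, fun1 = (\<lambda>k. id_func (level \<Gamma> k)),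
    conn = (\<lambda>k. nt_id (level \<Gamma> k) (level \<Gamma> (Suc k)) (step \<Gamma> k))\<rparr>"

definition UC_comp1 :: "'u one_cell \<Rightarrow> 'u one_cell \<Rightarrow> 'u one_cell" where
  "UC_comp1 \<Omega> \<Lambda> = \<lparr>src0 = src0 \<Lambda>, trg0 = trg0 \<Omega>,
    fun1 = (\<lambda>k. func_comp (level (src0 \<Lambda>) k) (fun1 \<Omega> k) (fun1 \<Lambda> k)),
    conn = (\<lambda>k. nt_comp (level (src0 \<Lambda>) k) (level (trg0 \<Omega>) (Suc k))
      (whisk_left (level (src0 \<Lambda>) k) (fun1 \<Omega> (Suc k)) (conn \<Lambda> k))
      (whisk_right (level (src0 \<Lambda>) k) (conn \<Omega> k) (fun1 \<Lambda> k)))\<rparr>"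

definition UC_one2 :: "'u one_cell \<Rightarrow> 'u two_cell" where
  "UC_one2 \<Lambda> = mk2 \<Lambda> \<Lambda> (\<lambda>k. nt_id (level (src0 \<Lambda>) k) (level (trg0 \<Lambda>) k) (fun1 \<Lambda> k))"

definition UC_vcomp :: "'u two_cell \<Rightarrow> 'u two_cell \<Rightarrow> 'u two_cell" where
  "UC_vcomp \<nu> \<mu> = mk2 (src1 \<mu>) (trg1 \<nu>)
    (\<lambda>k. nt_comp (level (src0 (src1 \<mu>)) k) (level (trg0 (src1 \<mu>)) k) (rep2 \<nu> k) (rep2 \<mu> k))"

text \<open>For $\eta : F \to F'$ and $\kappa : G \to G'$ the horizontal composite $GF \to G'F'$ is
  $\kappa_{F'} \circ G(\eta)$.\<close>

definition UC_hcomp :: "'u two_cell \<Rightarrow> 'u two_cell \<Rightarrow> 'u two_cell" where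
  "UC_hcomp \<nu> \<mu> = mk2 (UC_comp1 (src1 \<nu>) (src1 \<mu>)) (UC_comp1 (trg1 \<nu>) (trg1 \<mu>))
    (\<lambda>k. let A = level (src0 (src1 \<mu>)) k; B = level (trg0 (src1 \<nu>)) k in
      nt_comp A B (whisk_right A (rep2 \<nu> k) (fun1 (trg1 \<mu>) k))
                  (whisk_left A (fun1 (src1 \<nu>) k) (rep2 \<mu> k)))"

definition UC_star2 :: "'u two_cell \<Rightarrow> 'u two_cell" where
  "UC_star2 \<mu> = mk2 (trg1 \<mu>) (src1 \<mu>)
    (\<lambda>k. nt_star (level (src0 (src1 \<mu>)) k) (level (trg0 (src1 \<mu>)) k) (rep2 \<mu> k))"

definition UC :: "('u zero_cell, 'u one_cell, 'u two_cell) two_cat" where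
  "UC = \<lparr>cell0 = UC_0, cell1 = UC_1, cell2 = UC_2, one1 = UC_one1, one2 = UC_one2,
    comp1 = UC_comp1, hcomp = UC_hcomp, vcomp = UC_vcomp, star2 = UC_star2\<rparr>"

end

theory Submission
  imports Defs "HOL-Computational_Algebra.Fundamental_Theorem_Algebra"
begin

text \<open>An equation between 2-cells of \<open>UC\<close> says that the representing sequences agree eventually. Hence
a Q-system \<open>(Q, m, i)\<close> on a 0-cell \<open>b\<close> is, from some level \<open>N\<close> on, a sequence of monads
\<open>(Q\<^sub>k, m\<^sub>k, i\<^sub>k)\<close> on the categories \<open>b\<^sub>k\<close> that satisfy the Frobenius equations and are compatible
with the steps \<open>\<Gamma>\<^sub>k\<close> through the connection \<open>W\<close> of \<open>Q\<close>. It splits by the Eilenberg-Moore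
construction. For \<open>k \<ge> N\<close> let \<open>c\<^sub>k\<close> be the category of unitary modules \<open>r : Q\<^sub>k x \<rightarrow> x\<close>, those for which
\<open>r\<^sup>*\<close> is the coaction that the Frobenius structure attaches to \<open>r\<close>. The steps of \<open>c\<close> send \<open>r\<close> to
\<open>\<Gamma>(r) W\<^sup>*\<close>, the functors \<open>X\<^sub>k\<close> forget the action, the dual consists of the free module functors, and
\<open>ev\<close> is given by the actions. For \<open>k < N\<close>, where the equations may fail, take \<open>c\<^sub>k = b\<^sub>k\<close>, \<open>X\<^sub>k = Q\<^sub>k\<close> and
the identity as dual; the step from \<open>N - 1\<close> to \<open>N\<close> is \<open>\<Gamma>\<close> followed by the free module functor. Then
\<open>X \<box> Xbar\<close> is equal to \<open>Q\<close> as a 1-cell (\<open>X_Xbar\<close>), and the identity is an isomorphism of Q-systems.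

The substance is that \<open>c\<close> is a 0-cell, and this has two parts.

First, the unitary modules form a finite semisimple C*-category (\<open>finite_semisimple_D\<close>). Module maps
between unitary modules are closed under adjoints (\<open>hom_Str\<close>), and endomorphisms of a module form a
*-subalgebra of a finite-dimensional one. If \<open>(X - \<lambda>) q\<close> is the minimal polynomial of a self-adjoint
endomorphism \<open>h\<close>, then \<open>q(h)\<close> is a multiple of a projection (\<open>eigenprojection\<close>). So an endomorphism
algebra without nontrivial projections consists of scalars, and a maximal orthogonal family of
projections decomposes a module into simple ones (\<open>semisimple_if_fin_dim_end\<close>). Square roots of
\<open>f\<^sup>* f\<close> are obtained along such a decomposition as in the Cholesky algorithm
(\<open>square_root_if_semisimple\<close>). Finitely many simple modules suffice, because each of them is a summand
of the free module on a simple object (\<open>finite_simples_D\<close>).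

Second, the steps of \<open>c\<close> are bi-faithful (\<open>bi_faithful_Ind\<close>). For *-functors a one-sided adjoint is
two-sided (\<open>adjunction_star\<close>). The adjoint \<open>H\<close> of \<open>\<Gamma>\<close> turns a module on \<open>y\<close> into an action \<open>t\<close> on
\<open>H y\<close>, which need not be unitary. It becomes unitary after conjugation with any invertible \<open>S\<close> such that
\<open>S\<^sup>* S = (t t\<^sup>*)\<^sup>-\<^sup>1\<close> (\<open>unitarize\<close>), and since \<open>t t\<^sup>*\<close> is natural, conjugation with \<open>S\<close> does not destroy
compatibility with adjoints (\<open>Ind_adjoint\<close>).

An arrow of the module category has to be coded as a triple, which requires an injection of
\<open>'u \<times> 'u \<times> 'u\<close> into \<open>'u\<close> and hence an infinite type \<open>'u\<close>. Over a finite type all arrows are zero, because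
a nonzero arrow has infinitely many multiples; parallel 2-cells are then equal, and the identity
1-cell splits every Q-system (\<open>Q_system_splits_finite\<close>).\<close>

section \<open>Rewriting in linear *-categories\<close>

context category
begin

declare Dom_in [simp] Cod_in [simp]

lemma in_Hom_iff: "f \<in> Hom C x y \<longleftrightarrow> f \<in> Arr C \<and> Dom C f = x \<and> Cod C f = y"
  by (simp add: Hom_def)

lemma Arr_in_Hom: "f \<in> Arr C \<Longrightarrow> f \<in> Hom C (Dom C f) (Cod C f)"
  by (simp add: Hom_def)

text \<open>The axioms of the locales speak of hom-sets, whose end points cannot be found by matching. The
versions below, in terms of \<open>Arr\<close>, \<open>Dom\<close> and \<open>Cod\<close>, let the simplifier compute with composites in
right-nested normal form and discharge the typing conditions by itself.\<close>

lemma Cmp_typ [simp]: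
  assumes "g \<in> Arr C" "f \<in> Arr C" "Dom C g = Cod C f"
  shows "g \<cdot> f \<in> Arr C" "Dom C (g \<cdot> f) = Dom C f" "Cod C (g \<cdot> f) = Cod C g"
  using Cmp_in[of g "Cod C f" "Cod C g" f "Dom C f"] assms by (auto simp: Hom_def)

lemma Idn_typ [simp]:
  assumes "x \<in> Obj C"
  shows "Idn C x \<in> Arr C" "Dom C (Idn C x) = x" "Cod C (Idn C x) = x"
  using Idn_in[OF assms] by (auto simp: Hom_def)

lemma Cmp_Idn' [simp]: "\<lbrakk>f \<in> Arr C; Dom C f = x\<rbrakk> \<Longrightarrow> f \<cdot> Idn C x = f"
  using Cmp_Idn[of f x "Cod C f"] by (simp add: Hom_def)

lemma Idn_Cmp' [simp]: "\<lbrakk>f \<in> Arr C; Cod C f = x\<rbrakk> \<Longrightarrow> Idn C x \<cdot> f = f"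
  using Idn_Cmp[of f "Dom C f" x] by (simp add: Hom_def)

lemma assoc [simp]:
  "\<lbrakk>h \<in> Arr C; g \<in> Arr C; f \<in> Arr C; Dom C h = Cod C g; Dom C g = Cod C f\<rbrakk>
    \<Longrightarrow> (h \<cdot> g) \<cdot> f = h \<cdot> (g \<cdot> f)"
  using Cmp_assoc[of h "Cod C g" "Cod C h" g "Cod C f" f "Dom C f"] by (simp add: Hom_def)

text \<open>Applies an equation between composites at the head of a longer right-nested composite.\<close>

lemma reduce:
  "\<lbrakk>a \<cdot> b = e; a \<in> Arr C; b \<in> Arr C; z \<in> Arr C; Dom C a = Cod C b; Dom C b = Cod C z\<rbrakk>
    \<Longrightarrow> a \<cdot> (b \<cdot> z) = e \<cdot> z"
  by (metis assoc)

lemma iso_obj_sym: "iso_obj C x y \<Longrightarrow> iso_obj C y x"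
  unfolding iso_obj_def by blast

lemma iso_obj_refl: "x \<in> Obj C \<Longrightarrow> iso_obj C x x"
  unfolding iso_obj_def in_Hom_iff by (rule bexI[of _ "Idn C x"]; simp add: in_Hom_iff)

lemma iso_obj_trans:
  assumes "iso_obj C x y" "iso_obj C y z" shows "iso_obj C x z"
proof -
  obtain f g where 1: "f \<in> Hom C x y" "g \<in> Hom C y x" "g \<cdot> f = Idn C x" "f \<cdot> g = Idn C y"
    using assms(1) unfolding iso_obj_def by blast
  obtain f' g' where 2: "f' \<in> Hom C y z" "g' \<in> Hom C z y" "g' \<cdot> f' = Idn C y" "f' \<cdot> g' = Idn C z"
    using assms(2) unfolding iso_obj_def by blast
  have "(g \<cdot> g') \<cdot> (f' \<cdot> f) = Idn C x" "(f' \<cdot> f) \<cdot> (g \<cdot> g') = Idn C z"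
    using 1 2 reduce[OF 2(3), of f] reduce[OF 1(4), of g'] by (simp_all add: in_Hom_iff)
  moreover have "f' \<cdot> f \<in> Hom C x z" "g \<cdot> g' \<in> Hom C z x"
    using 1 2 by (simp_all add: in_Hom_iff)
  ultimately show ?thesis unfolding iso_obj_def by blast
qed

end

context linear_category
begin

lemma Zer_typ [simp]:
  assumes "x \<in> Obj C" "y \<in> Obj C"
  shows "Zer C x y \<in> Arr C" "Dom C (Zer C x y) = x" "Cod C (Zer C x y) = y"
  using Zer_in[OF assms] by (auto simp: Hom_def)

lemma Add_typ [simp]:
  assumes "f \<in> Arr C" "g \<in> Arr C" "Dom C f = Dom C g" "Cod C f = Cod C g"
  shows "f \<oplus> g \<in> Arr C" "Dom C (f \<oplus> g) = Dom C g" "Cod C (f \<oplus> g) = Cod C g"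
  using Add_in[of f "Dom C g" "Cod C g" g] assms by (auto simp: Hom_def)

lemma Scl_typ [simp]:
  assumes "f \<in> Arr C"
  shows "a \<odot> f \<in> Arr C" "Dom C (a \<odot> f) = Dom C f" "Cod C (a \<odot> f) = Cod C f"
  using Scl_in[of f "Dom C f" "Cod C f" a] assms by (auto simp: Hom_def)

lemma Add_assoc':
  "\<lbrakk>f \<in> Arr C; g \<in> Arr C; h \<in> Arr C; Dom C f = Dom C g; Dom C g = Dom C h;
    Cod C f = Cod C g; Cod C g = Cod C h\<rbrakk> \<Longrightarrow> (f \<oplus> g) \<oplus> h = f \<oplus> (g \<oplus> h)"
  using Add_assoc[of f "Dom C f" "Cod C f" g h] by (simp add: Hom_def)

lemma Add_commute':
  "\<lbrakk>f \<in> Arr C; g \<in> Arr C; Dom C f = Dom C g; Cod C f = Cod C g\<rbrakk> \<Longrightarrow> f \<oplus> g = g \<oplus> f"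
  using Add_commute[of f "Dom C f" "Cod C f" g] by (simp add: Hom_def)

lemma Add_left_commute':
  assumes "f \<in> Arr C" "g \<in> Arr C" "h \<in> Arr C" "Dom C f = Dom C g" "Dom C g = Dom C h"
    "Cod C f = Cod C g" "Cod C g = Cod C h"
  shows "f \<oplus> (g \<oplus> h) = g \<oplus> (f \<oplus> h)"
  using assms by (metis Add_assoc' Add_commute')

lemmas Add_ac = Add_assoc' Add_commute' Add_left_commute'

lemma Add_Zer' [simp]: "\<lbrakk>f \<in> Arr C; Dom C f = x; Cod C f = y\<rbrakk> \<Longrightarrow> f \<oplus> Zer C x y = f"
  using Add_Zer[of f x y] by (simp add: Hom_def)

lemma Zer_Add' [simp]: "\<lbrakk>f \<in> Arr C; Dom C f = x; Cod C f = y\<rbrakk> \<Longrightarrow> Zer C x y \<oplus> f = f"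
  by (metis Add_Zer' Add_commute' Zer_typ Dom_in Cod_in)

lemma Add_neg' [simp]: "f \<in> Arr C \<Longrightarrow> f \<oplus> (- 1) \<odot> f = Zer C (Dom C f) (Cod C f)"
  using Add_neg[of f "Dom C f" "Cod C f"] by (simp add: Hom_def)

lemma Scl_Add':
  "\<lbrakk>f \<in> Arr C; g \<in> Arr C; Dom C f = Dom C g; Cod C f = Cod C g\<rbrakk>
    \<Longrightarrow> a \<odot> (f \<oplus> g) = a \<odot> f \<oplus> a \<odot> g"
  using Scl_Add[of f "Dom C f" "Cod C f" g] by (simp add: Hom_def)

lemma add_Scl': "f \<in> Arr C \<Longrightarrow> (a + b) \<odot> f = a \<odot> f \<oplus> b \<odot> f"
  using add_Scl[of f "Dom C f" "Cod C f"] by (simp add: Hom_def)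

lemma Scl_Scl' [simp]: "f \<in> Arr C \<Longrightarrow> a \<odot> (b \<odot> f) = (a * b) \<odot> f"
  using Scl_Scl[of f "Dom C f" "Cod C f"] by (simp add: Hom_def)

lemma Scl_one' [simp]: "f \<in> Arr C \<Longrightarrow> 1 \<odot> f = f"
  using Scl_one[of f "Dom C f" "Cod C f"] by (simp add: Hom_def)

lemma Cmp_Add':
  "\<lbrakk>g \<in> Arr C; f \<in> Arr C; f' \<in> Arr C; Dom C g = Cod C f; Cod C f = Cod C f'; Dom C f = Dom C f'\<rbrakk>
    \<Longrightarrow> g \<cdot> (f \<oplus> f') = g \<cdot> f \<oplus> g \<cdot> f'"
  using Cmp_Add[of g "Cod C f" "Cod C g" f "Dom C f" f'] by (simp add: Hom_def)

lemma Add_Cmp':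
  "\<lbrakk>g \<in> Arr C; g' \<in> Arr C; f \<in> Arr C; Dom C g = Cod C f; Dom C g' = Cod C f; Cod C g = Cod C g'\<rbrakk>
    \<Longrightarrow> (g \<oplus> g') \<cdot> f = g \<cdot> f \<oplus> g' \<cdot> f"
  using Add_Cmp[of g "Cod C f" "Cod C g" g' f "Dom C f"] by (simp add: Hom_def)

lemma Cmp_Scl' [simp]:
  "\<lbrakk>g \<in> Arr C; f \<in> Arr C; Dom C g = Cod C f\<rbrakk> \<Longrightarrow> g \<cdot> (a \<odot> f) = a \<odot> (g \<cdot> f)"
  using Cmp_Scl[of g "Cod C f" "Cod C g" f "Dom C f"] by (simp add: Hom_def)

lemma Scl_Cmp' [simp]:
  "\<lbrakk>g \<in> Arr C; f \<in> Arr C; Dom C g = Cod C f\<rbrakk> \<Longrightarrow> (a \<odot> g) \<cdot> f = a \<odot> (g \<cdot> f)"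
  using Scl_Cmp[of g "Cod C f" "Cod C g" f "Dom C f"] by (simp add: Hom_def)

lemma Scl_zero [simp]: 
  assumes f: "f \<in> Arr C" shows "0 \<odot> f = Zer C (Dom C f) (Cod C f)"
proof -
  have "(1 + - 1) \<odot> f = 1 \<odot> f \<oplus> (- 1) \<odot> f" by (rule add_Scl'[OF f])
  then show ?thesis using f by simp
qed

lemma Scl_Zer [simp]: 
  assumes "x \<in> Obj C" "y \<in> Obj C" shows "a \<odot> Zer C x y = Zer C x y"
proof -
  have "a \<odot> (0 \<odot> Zer C x y) = 0 \<odot> Zer C x y" using assms by (simp del: Scl_zero)
  then show ?thesis using assms by simp
qed

lemma Cmp_Zer [simp]:
  assumes "g \<in> Arr C" "x \<in> Obj C" "Dom C g = y" 
  shows "g \<cdot> Zer C x y = Zer C x (Cod C g)"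
proof -
  have y: "y \<in> Obj C" using assms by auto
  have "g \<cdot> (0 \<odot> Zer C x y) = 0 \<odot> (g \<cdot> Zer C x y)" 
    using assms y by (intro Cmp_Scl') auto
  then show ?thesis using assms y by simp
qed

lemma Zer_Cmp [simp]:
  assumes "f \<in> Arr C" "z \<in> Obj C" "Cod C f = y" 
  shows "Zer C y z \<cdot> f = Zer C (Dom C f) z"
proof -
  have y: "y \<in> Obj C" using assms by auto
  have "(0 \<odot> Zer C y z) \<cdot> f = 0 \<odot> (Zer C y z \<cdot> f)" 
    using assms y by (intro Scl_Cmp') auto
  then show ?thesis using assms y by simp
qed

lemma Add_left_cancel:
  assumes "f \<in> Arr C" "g \<in> Arr C" "h \<in> Arr C" "Dom C f = Dom C g" "Dom C g = Dom C h"
    "Cod C f = Cod C g" "Cod C g = Cod C h" "f \<oplus> g = f \<oplus> h"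
  shows "g = h"
proof -
  have "(-1) \<odot> f \<oplus> (f \<oplus> g) = (-1) \<odot> f \<oplus> (f \<oplus> h)" using assms by simp
  then have "((-1) \<odot> f \<oplus> f) \<oplus> g = ((-1) \<odot> f \<oplus> f) \<oplus> h" 
    using assms by (simp add: Add_assoc')
  moreover have "(-1) \<odot> f \<oplus> f = f \<oplus> (-1) \<odot> f" using assms(1) by (intro Add_commute') auto
  ultimately show ?thesis using assms by simp
qed

lemma diff_eq_Zer:
  assumes "f \<in> Arr C" "g \<in> Arr C" "Dom C f = Dom C g" "Cod C f = Cod C g"
  shows "f \<oplus> (-1) \<odot> g = Zer C (Dom C g) (Cod C g) \<longleftrightarrow> f = g"
proof
  assume *: "f \<oplus> (-1) \<odot> g = Zer C (Dom C g) (Cod C g)"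
  have "(-1) \<odot> g \<oplus> f = f \<oplus> (-1) \<odot> g" using assms by (intro Add_commute') auto
  moreover have "(-1) \<odot> g \<oplus> g = g \<oplus> (-1) \<odot> g" using assms by (intro Add_commute') auto
  ultimately have "(-1) \<odot> g \<oplus> f = (-1) \<odot> g \<oplus> g" using assms(2) * by simp
  then show "f = g" using assms by (metis Add_left_cancel Scl_typ)
qed (use assms in simp)

lemma Scl_eq_Zer:
  assumes "f \<in> Arr C" "a \<odot> f = Zer C (Dom C f) (Cod C f)" "a \<noteq> 0"
  shows "f = Zer C (Dom C f) (Cod C f)"
proof -
  have "(1/a) \<odot> (a \<odot> f) = (1/a) \<odot> Zer C (Dom C f) (Cod C f)" using assms by simp
  then show ?thesis using assms(1,3) by (simp del: Scl_zero)
qed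

lemma arr_sum_typ [simp]:
  assumes "x \<in> Obj C" "y \<in> Obj C" "\<And>i. i < n \<Longrightarrow> f i \<in> Hom C x y"
  shows "arr_sum C x y n f \<in> Arr C" "Dom C (arr_sum C x y n f) = x" "Cod C (arr_sum C x y n f) = y"
  using assms(3) by (induction n) (use assms(1,2) in \<open>simp_all add: in_Hom_iff\<close>)

lemma arr_sum_cong: "(\<And>i. i < n \<Longrightarrow> f i = g i) \<Longrightarrow> arr_sum C x y n f = arr_sum C x y n g"
  by (induction n) auto

lemma Cmp_arr_sum:
  assumes "x \<in> Obj C" "y \<in> Obj C" "\<And>i. i < n \<Longrightarrow> f i \<in> Hom C x y" "g \<in> Arr C" "Dom C g = y"
  shows "g \<cdot> arr_sum C x y n f = arr_sum C x (Cod C g) n (\<lambda>i. g \<cdot> f i)"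
  using assms(3) by (induction n) (use assms in \<open>simp_all add: in_Hom_iff Cmp_Add'\<close>)

lemma arr_sum_Cmp:
  assumes "x \<in> Obj C" "y \<in> Obj C" "\<And>i. i < n \<Longrightarrow> f i \<in> Hom C x y" "g \<in> Arr C" "Cod C g = x"
  shows "arr_sum C x y n f \<cdot> g = arr_sum C (Dom C g) y n (\<lambda>i. f i \<cdot> g)"
  using assms(3) by (induction n) (use assms in \<open>simp_all add: in_Hom_iff Add_Cmp'\<close>)

lemma arr_sum_Zer:
  assumes "x \<in> Obj C" "y \<in> Obj C" "\<And>i. i < n \<Longrightarrow> f i = Zer C x y"
  shows "arr_sum C x y n f = Zer C x y"
  using assms(3) by (induction n) (use assms in simp_all)

lemma arr_sum_delta:
  assumes "x \<in> Obj C" "y \<in> Obj C" "j < n" "f j \<in> Hom C x y"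
    and "\<And>i. i < n \<Longrightarrow> i \<noteq> j \<Longrightarrow> f i = Zer C x y"
  shows "arr_sum C x y n f = f j"
  using assms(3,5)
proof (induction n)
  case (Suc n)
  show ?case
  proof (cases "j = n")
    case True
    then have "arr_sum C x y n f = Zer C x y" using Suc assms by (intro arr_sum_Zer) auto
    then show ?thesis using True assms by (simp add: in_Hom_iff)
  next
    case False
    then have "arr_sum C x y n f = f j" using Suc by auto
    moreover have "f n = Zer C x y" using False Suc by auto
    ultimately show ?thesis using assms by (simp add: in_Hom_iff)
  qed
qed simp

end

context star_category
begin

lemma Str_typ [simp]:
  assumes "f \<in> Arr C"
  shows "Str C f \<in> Arr C" "Dom C (Str C f) = Cod C f" "Cod C (Str C f) = Dom C f"
  using Str_in[of f "Dom C f" "Cod C f"] assms by (auto simp: Hom_def)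

lemma Str_Str' [simp]: "f \<in> Arr C \<Longrightarrow> Str C (Str C f) = f" 
  by (rule Str_Str)

lemma Str_Cmp' [simp]:
  "\<lbrakk>g \<in> Arr C; f \<in> Arr C; Dom C g = Cod C f\<rbrakk> \<Longrightarrow> Str C (g \<cdot> f) = Str C f \<cdot> Str C g"
  using Str_Cmp[of g "Cod C f" "Cod C g" f "Dom C f"] by (simp add: Hom_def)

lemma Str_Add' [simp]:
  "\<lbrakk>f \<in> Arr C; g \<in> Arr C; Dom C f = Dom C g; Cod C f = Cod C g\<rbrakk>
    \<Longrightarrow> Str C (f \<oplus> g) = Str C f \<oplus> Str C g"
  using Str_Add[of f "Dom C f" "Cod C f" g] by (simp add: Hom_def)

lemma Str_Scl' [simp]: "f \<in> Arr C \<Longrightarrow> Str C (a \<odot> f) = cnj a \<odot> Str C f"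
  by (rule Str_Scl)

lemma Str_Idn [simp]: assumes "x \<in> Obj C" shows "Str C (Idn C x) = Idn C x"
proof -
  have "Str C (Str C (Idn C x) \<cdot> Idn C x) = Str C (Idn C x) \<cdot> Str C (Str C (Idn C x))"
    using assms Str_Cmp'[of "Str C (Idn C x)" "Idn C x"] by (simp only: Str_typ Idn_typ)
  then show ?thesis using assms by simp
qed

lemma Str_Zer [simp]: assumes "x \<in> Obj C" "y \<in> Obj C" shows "Str C (Zer C x y) = Zer C y x"
  using assms Str_Scl[of "Zer C x y" 0] by simp

lemma Str_inj: "\<lbrakk>f \<in> Arr C; g \<in> Arr C; Str C f = Str C g\<rbrakk> \<Longrightarrow> f = g"
  by (metis Str_Str)

lemma Str_arr_sum:
  assumes "x \<in> Obj C" "y \<in> Obj C" "\<And>i. i < n \<Longrightarrow> f i \<in> Hom C x y"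
  shows "Str C (arr_sum C x y n f) = arr_sum C y x n (\<lambda>i. Str C (f i))"
  using assms(3) by (induction n) (use assms in \<open>simp_all add: in_Hom_iff\<close>)

lemma is_direct_sum_typ:
  assumes "is_direct_sum C n x z v" 
  shows "z \<in> Obj C" "\<And>i. i < n \<Longrightarrow> v i \<in> Arr C" "\<And>i. i < n \<Longrightarrow> Dom C (v i) = x i"
    "\<And>i. i < n \<Longrightarrow> Cod C (v i) = z" "\<And>i. i < n \<Longrightarrow> x i \<in> Obj C"
  using assms unfolding is_direct_sum_def in_Hom_iff by (auto, metis Dom_in)

text \<open>Both arrows are recovered from their restrictions, since \<open>v\<^sub>i v\<^sub>i\<^sup>*\<close> sum up to the identity.\<close>

lemma direct_sum_jointly_epi:
  assumes v: "is_direct_sum C n x z v"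
    and "f \<in> Hom C z y" "g \<in> Hom C z y" "\<And>i. i < n \<Longrightarrow> f \<cdot> v i = g \<cdot> v i"
  shows "f = g"
proof -
  note t = is_direct_sum_typ[OF v]
  have *: "h = arr_sum C z y n (\<lambda>i. (h \<cdot> v i) \<cdot> Str C (v i))" if "h \<in> Hom C z y" for h
  proof -
    have "h = h \<cdot> arr_sum C z z n (\<lambda>i. v i \<cdot> Str C (v i))"
      using v that unfolding is_direct_sum_def by (simp add: in_Hom_iff)
    also have "\<dots> = arr_sum C z y n (\<lambda>i. h \<cdot> (v i \<cdot> Str C (v i)))"
      using t that by (subst Cmp_arr_sum) (auto simp: in_Hom_iff)
    also have "\<dots> = arr_sum C z y n (\<lambda>i. (h \<cdot> v i) \<cdot> Str C (v i))"
      using t that by (intro arr_sum_cong) (auto simp: in_Hom_iff)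
    finally show ?thesis .
  qed
  have "f = arr_sum C z y n (\<lambda>i. (g \<cdot> v i) \<cdot> Str C (v i))"
    using *[OF assms(2)] assms(4) by (simp cong: arr_sum_cong)
  then show ?thesis using *[OF assms(3)] by simp
qed

lemma direct_sum_jointly_mono:
  assumes v: "is_direct_sum C n x z v"
    and f: "f \<in> Hom C y z" and g: "g \<in> Hom C y z" 
    and eq: "\<And>i. i < n \<Longrightarrow> Str C (v i) \<cdot> f = Str C (v i) \<cdot> g"
  shows "f = g"
proof -
  note t = is_direct_sum_typ[OF v]
  have "Str C f = Str C g"
  proof (rule direct_sum_jointly_epi[OF v])
    fix i assume i: "i < n"
    show "Str C f \<cdot> v i = Str C g \<cdot> v i"
      using arg_cong[OF eq[OF i], of "Str C"] t i f g by (simp add: in_Hom_iff)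
  qed (use f g in \<open>auto simp: in_Hom_iff\<close>)
  then show ?thesis using f g Str_inj by (simp add: in_Hom_iff)
qed

end

context star_functor
begin

lemma farr_typ:
  assumes "f \<in> Arr A"
  shows "farr F f \<in> Arr B" "Dom B (farr F f) = fobj F (Dom A f)" "Cod B (farr F f) = fobj F (Cod A f)"
  using farr_in[of f "Dom A f" "Cod A f"] assms by (auto simp: Hom_def)

lemma farr_Cmp':
  "\<lbrakk>g \<in> Arr A; f \<in> Arr A; Dom A g = Cod A f\<rbrakk> \<Longrightarrow> farr F (g \<cdot>\<^bsub>A\<^esub> f) = farr F g \<cdot>\<^bsub>B\<^esub> farr F f"
  using farr_Cmp[of g "Cod A f" "Cod A g" f "Dom A f"] by (simp add: Hom_def)

lemma farr_Add':
  "\<lbrakk>f \<in> Arr A; g \<in> Arr A; Dom A f = Dom A g; Cod A f = Cod A g\<rbrakk>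
    \<Longrightarrow> farr F (f \<oplus>\<^bsub>A\<^esub> g) = farr F f \<oplus>\<^bsub>B\<^esub> farr F g"
  using farr_Add[of f "Dom A f" "Cod A f" g] by (simp add: Hom_def)

lemmas farr_simps [simp] = fobj_in farr_typ farr_Idn farr_Cmp' farr_Add' farr_Scl farr_Str

end

locale functor_pair = star_functor A B F + A: star_category A + B: star_category B 
  for A :: "'u cat" and B :: "'u cat" and F :: "'u func"
begin

lemma farr_Zer [simp]:
  assumes "x \<in> Obj A" "y \<in> Obj A" shows "farr F (Zer A x y) = Zer B (fobj F x) (fobj F y)"
  using assms farr_Scl[of "Zer A x y" 0] by simp

lemma farr_arr_sum:
  assumes "x \<in> Obj A" "y \<in> Obj A" "\<And>i. i < n \<Longrightarrow> f i \<in> Hom A x y"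
  shows "farr F (arr_sum A x y n f) = arr_sum B (fobj F x) (fobj F y) n (\<lambda>i. farr F (f i))"
  using assms(3) by (induction n) (use assms in \<open>simp_all add: A.in_Hom_iff\<close>)

lemma farr_direct_sum:
  assumes v: "is_direct_sum A n x z v"
  shows "is_direct_sum B n (\<lambda>i. fobj F (x i)) (fobj F z) (\<lambda>i. farr F (v i))"
proof -
  note t = A.is_direct_sum_typ[OF v]
  have 1: "Str B (farr F (v i)) \<cdot>\<^bsub>B\<^esub> farr F (v j) = 
    (if i = j then Idn B (fobj F (x i)) else Zer B (fobj F (x j)) (fobj F (x i)))" 
    if ij: "i < n" "j < n" for i j
  proof -
    have "Str B (farr F (v i)) \<cdot>\<^bsub>B\<^esub> farr F (v j) = farr F (Str A (v i) \<cdot>\<^bsub>A\<^esub> v j)"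
      using t ij by simp
    also have "Str A (v i) \<cdot>\<^bsub>A\<^esub> v j = (if i = j then Idn A (x i) else Zer A (x j) (x i))"
      using v ij unfolding is_direct_sum_def by blast
    finally show ?thesis using t ij by simp
  qed
  have "arr_sum B (fobj F z) (fobj F z) n (\<lambda>i. farr F (v i) \<cdot>\<^bsub>B\<^esub> Str B (farr F (v i)))
    = arr_sum B (fobj F z) (fobj F z) n (\<lambda>i. farr F (v i \<cdot>\<^bsub>A\<^esub> Str A (v i)))"
    using t by (intro B.arr_sum_cong) simp
  also have "\<dots> = farr F (arr_sum A z z n (\<lambda>i. v i \<cdot>\<^bsub>A\<^esub> Str A (v i)))"
    using t by (intro farr_arr_sum[symmetric]) (auto simp: A.in_Hom_iff)
  also have "\<dots> = Idn B (fobj F z)" using v t unfolding is_direct_sum_def by simp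
  finally show ?thesis using 1 t unfolding is_direct_sum_def 
    by (auto simp: B.in_Hom_iff)
qed

end

section \<open>Finite-dimensional endomorphism algebras\<close>

text \<open>Gaussian elimination, by induction on the equations: a coefficient \<open>a i k \<noteq> 0\<close> serves to eliminate the
unknown \<open>k\<close> from the other equations.\<close>

lemma underdetermined_system:
  fixes a :: "'i \<Rightarrow> 'j \<Rightarrow> complex"
  assumes "finite I" "finite J" "card I < card J"
  shows "\<exists>c. (\<exists>j\<in>J. c j \<noteq> 0) \<and> (\<forall>i\<in>I. (\<Sum>j\<in>J. c j * a i j) = 0)"
  using assms
proof (induction I arbitrary: J a rule: finite_induct)
  case empty
  then have "J \<noteq> {}" by auto
  then show ?case by (intro exI[of _ "\<lambda>_. 1"]) auto
next
  case (insert i I)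
  show ?case
  proof (cases "\<forall>j\<in>J. a i j = 0")
    case True
    have "card I < card J" using insert by simp
    then obtain c where "\<exists>j\<in>J. c j \<noteq> 0" "\<forall>i\<in>I. (\<Sum>j\<in>J. c j * a i j) = 0"
      using insert.IH[of J a] insert.prems(1) by blast
    then show ?thesis using True by (intro exI[of _ c]) auto
  next
    case False
    then obtain k where k: "k \<in> J" "a i k \<noteq> 0" by blast
    define J' where "J' = J - {k}"
    have "finite J'" "card I < card J'" using insert k unfolding J'_def by auto
    then obtain c where c: "\<exists>j\<in>J'. c j \<noteq> 0"
      "\<forall>l\<in>I. (\<Sum>j\<in>J'. c j * (a l j - a i j * a l k / a i k)) = 0"
      using insert.IH[of J' "\<lambda>l j. a l j - a i j * a l k / a i k"] by blast
    \<comment> \<open>The value of the unknown \<open>k\<close> solves equation \<open>i\<close>.\<close>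
    define d where "d = c(k := - (\<Sum>j\<in>J'. c j * a i j) / a i k)"
    have d: "(\<Sum>j\<in>J. d j * a l j) = (\<Sum>j\<in>J'. c j * a l j) - (\<Sum>j\<in>J'. c j * a i j) * a l k / a i k" for l
    proof -
      have "(\<Sum>j\<in>J. d j * a l j) = d k * a l k + (\<Sum>j\<in>J'. d j * a l j)"
        unfolding J'_def using insert k by (simp add: sum.remove)
      also have "(\<Sum>j\<in>J'. d j * a l j) = (\<Sum>j\<in>J'. c j * a l j)"
        by (rule sum.cong) (auto simp: d_def J'_def)
      finally show ?thesis by (simp add: d_def)
    qed
    have "(\<Sum>j\<in>J. d j * a l j) = 0" if "l \<in> insert i I" for l
    proof (cases "l = i")
      case True
      then show ?thesis using d[of i] k by simp
    next
      case False
      then have "(\<Sum>j\<in>J'. c j * (a l j - a i j * a l k / a i k)) = 0" using c(2) that by auto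
      then show ?thesis unfolding d
        by (simp add: algebra_simps sum_subtractf sum_distrib_left sum_divide_distrib)
    qed
    moreover have "\<exists>j\<in>J. d j \<noteq> 0" using c(1) by (auto simp: d_def J'_def)
    ultimately show ?thesis by blast
  qed
qed

text \<open>Finite dimension is witnessed by finitely many linear functionals that separate the endomorphisms.
For a space whose carrier is a hom-set this is easier to handle than bases, and it is all that
\<open>underdetermined_system\<close> asks for.\<close>

definition fin_dim_end :: "'u cat \<Rightarrow> 'u \<Rightarrow> bool" where
  "fin_dim_end C x \<longleftrightarrow> (\<exists>K :: ('u \<Rightarrow> complex) set. finite K \<and>
    (\<forall>\<kappa>\<in>K. \<forall>f\<in>Hom C x x. \<forall>g\<in>Hom C x x. \<kappa> (f \<oplus>\<^bsub>C\<^esub> g) = \<kappa> f + \<kappa> g) \<and>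
    (\<forall>\<kappa>\<in>K. \<forall>a. \<forall>f\<in>Hom C x x. \<kappa> (a \<odot>\<^bsub>C\<^esub> f) = a * \<kappa> f) \<and>
    (\<forall>f\<in>Hom C x x. (\<forall>\<kappa>\<in>K. \<kappa> f = 0) \<longrightarrow> f = Zer C x x))"

context linear_category
begin

text \<open>The value of a polynomial at the endomorphism \<open>h\<close>, by Horner's scheme.\<close>

definition peval :: "'a \<Rightarrow> complex poly \<Rightarrow> 'a" where
  "peval h p = fold_coeffs (\<lambda>a f. a \<odot> Idn C (Dom C h) \<oplus> h \<cdot> f) p (Zer C (Dom C h) (Dom C h))"

context
  fixes h x assumes h: "h \<in> Arr C" "Dom C h = x" "Cod C h = x"
begin

lemma x_obj: "x \<in> Obj C" using h by auto

lemma peval_0 [simp]: "peval h 0 = Zer C x x"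
  using h by (simp add: peval_def)

lemma peval_pCons [simp]: "peval h (pCons a p) = a \<odot> Idn C x \<oplus> h \<cdot> peval h p"
proof (cases "pCons a p = 0")
  case True
  then show ?thesis using h x_obj by (simp add: peval_def)
next
  case False
  then have "a \<noteq> 0 \<or> p \<noteq> 0" by auto
  then show ?thesis using h by (auto simp: peval_def fold_coeffs_pCons_coeff_not_0_eq fold_coeffs_pCons_not_0_0_eq)
qed

lemma peval_typ [simp]: "peval h p \<in> Arr C" "Dom C (peval h p) = x" "Cod C (peval h p) = x"
  by (induction p) (use h x_obj in simp_all)

lemma peval_add: "peval h (p + q) = peval h p \<oplus> peval h q"
proof (induction p q rule: poly_induct2)
  case (pCons a p b q)
  have "peval h (pCons a p + pCons b q)
      = (a \<odot> Idn C x \<oplus> b \<odot> Idn C x) \<oplus> (h \<cdot> peval h p \<oplus> h \<cdot> peval h q)"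
    using h x_obj pCons by (simp add: add_Scl' Cmp_Add')
  then show ?case using h x_obj by (simp add: Add_ac)
qed (use x_obj in simp)

lemma peval_smult: "peval h (smult c p) = c \<odot> peval h p"
  by (induction p) (use h x_obj in \<open>simp_all add: Scl_Add'\<close>)

lemma peval_commute: "peval h p \<cdot> h = h \<cdot> peval h p"
  by (induction p) (use h x_obj in \<open>simp_all add: Cmp_Add' Add_Cmp'\<close>)

lemma peval_eigen:
  assumes v: "v \<in> Arr C" "Cod C v = x" "h \<cdot> v = l \<odot> v"
  shows "peval h p \<cdot> v = poly p l \<odot> v"
proof (induction p)
  case (pCons a p)
  then show ?case using h x_obj v by (simp add: Add_Cmp' add_Scl' algebra_simps)
qed (use x_obj v in simp)

lemma peval_sum_smult:
  assumes "finite J" and \<kappa>: "\<And>f g. f \<in> Hom C x x \<Longrightarrow> g \<in> Hom C x x \<Longrightarrow> \<kappa> (f \<oplus> g) = \<kappa> f + \<kappa> g"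
    "\<And>a f. f \<in> Hom C x x \<Longrightarrow> \<kappa> (a \<odot> f) = a * (\<kappa> f :: complex)"
  shows "\<kappa> (peval h (\<Sum>j\<in>J. smult (c j) (q j))) = (\<Sum>j\<in>J. c j * \<kappa> (peval h (q j)))"
  using assms(1)
proof (induction J)
  case empty
  have "\<kappa> (0 \<odot> Zer C x x) = 0 * \<kappa> (Zer C x x)" using x_obj by (intro \<kappa>) (simp add: in_Hom_iff)
  then show ?case using x_obj by simp
next
  case (insert j J)
  then show ?case using x_obj h by (simp add: peval_add peval_smult \<kappa> in_Hom_iff)
qed

text \<open>With \<open>d\<close> separating functionals the powers \<open>1, h, \<dots>, h\<^sup>d\<close> are linearly dependent. An annihilating
polynomial of least degree is the minimal polynomial up to a scalar.\<close>

lemma annihilating_polynomial: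
  assumes fd: "fin_dim_end C x"
  obtains p where "p \<noteq> 0" "peval h p = Zer C x x"
    "\<And>q. q \<noteq> 0 \<Longrightarrow> peval h q = Zer C x x \<Longrightarrow> degree p \<le> degree q"
proof -
  obtain K :: "('a \<Rightarrow> complex) set" where K: "finite K" 
    "\<forall>\<kappa>\<in>K. \<forall>f\<in>Hom C x x. \<forall>g\<in>Hom C x x. \<kappa> (f \<oplus> g) = \<kappa> f + \<kappa> g"
    "\<forall>\<kappa>\<in>K. \<forall>a. \<forall>f\<in>Hom C x x. \<kappa> (a \<odot> f) = a * \<kappa> f"
    "\<forall>f\<in>Hom C x x. (\<forall>\<kappa>\<in>K. \<kappa> f = 0) \<longrightarrow> f = Zer C x x"
    using fd unfolding fin_dim_end_def by (elim exE conjE) (rule that)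
  obtain c where c: "\<exists>j\<in>{..card K}. c j \<noteq> 0"
    "\<forall>\<kappa>\<in>K. (\<Sum>j\<in>{..card K}. c j * \<kappa> (peval h (monom 1 j))) = 0"
    using underdetermined_system[of K "{..card K}" "\<lambda>\<kappa> j. \<kappa> (peval h (monom 1 j))"] K(1) by auto
  define p where "p = (\<Sum>j\<in>{..card K}. smult (c j) (monom 1 j))"
  have "\<kappa> (peval h p) = 0" if "\<kappa> \<in> K" for \<kappa>
    unfolding p_def using that K(2,3) c(2) by (subst peval_sum_smult) auto
  then have 1: "peval h p = Zer C x x" using K(4) by (simp add: in_Hom_iff)
  have "coeff p j = c j" if "j \<le> card K" for j
    using that unfolding p_def by (simp add: coeff_sum if_distrib cong: if_cong)
  then have 2: "p \<noteq> 0" using c(1) by force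
  define P where "P q \<longleftrightarrow> q \<noteq> 0 \<and> peval h q = Zer C x x" for q
  have "\<exists>q. P q \<and> (\<forall>q'. P q' \<longrightarrow> degree q \<le> degree q')"
    using ex_has_least_nat[of P p degree] 1 2 unfolding P_def by blast
  then show ?thesis using that unfolding P_def by blast
qed

text \<open>Let \<open>a + X q\<close> be the minimal polynomial. If \<open>a = 0\<close>, then \<open>h q(h) = 0\<close> and so \<open>q(h) = 0\<close>, contrary to
minimality. Hence \<open>a \<noteq> 0\<close>, and \<open>- q(h) / a\<close> is the inverse.\<close>

lemma injective_invertible:
  assumes fd: "fin_dim_end C x" and inj: "\<And>f. f \<in> Hom C x x \<Longrightarrow> h \<cdot> f = Zer C x x \<Longrightarrow> f = Zer C x x"
  obtains s where "s \<in> Hom C x x" "h \<cdot> s = Idn C x" "s \<cdot> h = Idn C x"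
proof -
  obtain p where p: "p \<noteq> 0" "peval h p = Zer C x x"
    "\<And>q. q \<noteq> 0 \<Longrightarrow> peval h q = Zer C x x \<Longrightarrow> degree p \<le> degree q"
    using annihilating_polynomial[OF fd] by metis
  obtain a q where pq: "p = pCons a q" by (rule pCons_cases)
  have a: "a \<noteq> 0"
  proof
    assume "a = 0"
    then have "h \<cdot> peval h q = Zer C x x" using p(2) pq x_obj h by simp
    then have "peval h q = Zer C x x" using inj[of "peval h q"] by (simp add: in_Hom_iff)
    then show False using p(3)[of q] p(1) pq \<open>a = 0\<close> by auto
  qed
  define s where "s = (- 1 / a) \<odot> peval h q"
  have "a \<odot> (h \<cdot> s) = (- 1) \<odot> (h \<cdot> peval h q)" using a h by (simp add: s_def)
  moreover have "a \<odot> Idn C x = (- 1) \<odot> (h \<cdot> peval h q)"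
  proof -
    have "a \<odot> Idn C x \<oplus> (- 1) \<odot> ((- 1) \<odot> (h \<cdot> peval h q)) = Zer C x x" using p(2) pq h x_obj by simp
    then show ?thesis using diff_eq_Zer[of "a \<odot> Idn C x" "(- 1) \<odot> (h \<cdot> peval h q)"] h x_obj by simp
  qed
  ultimately have "(1 / a) \<odot> (a \<odot> (h \<cdot> s)) = (1 / a) \<odot> (a \<odot> Idn C x)" by simp
  then have 1: "h \<cdot> s = Idn C x" using a h x_obj by (simp add: s_def)
  moreover have "s \<cdot> h = h \<cdot> s" using h by (simp add: s_def peval_commute)
  ultimately show ?thesis using that[of s] h by (simp add: s_def in_Hom_iff)
qed

end

end

text \<open>Definiteness of \<open>f\<^sup>* f\<close> is what the decomposition of objects needs of the C*-norm. Isolating it makes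
the decomposition applicable to module categories, where the positivity axiom is only derived from
the decomposition.\<close>

locale proper_star_category = star_category +
  assumes proper: "\<lbrakk>f \<in> Arr C; Str C f \<cdot> f = Zer C (Dom C f) (Dom C f)\<rbrakk>
    \<Longrightarrow> f = Zer C (Dom C f) (Cod C f)"

sublocale cstar_category \<subseteq> proper_star_category
proof
  fix f assume f: "f \<in> Arr C" "Str C f \<cdot> f = Zer C (Dom C f) (Dom C f)"
  have "(Nrm C f)\<^sup>2 = Nrm C (Zer C (Dom C f) (Dom C f))" using cstar_identity[OF f(1)] f(2) by simp
  also have "\<dots> = 0" using f by (subst Nrm_eq_0[of _ "Dom C f" "Dom C f"]) (auto simp: in_Hom_iff)
  finally show "f = Zer C (Dom C f) (Cod C f)"
    using Nrm_eq_0[of f "Dom C f" "Cod C f"] f by (simp add: in_Hom_iff)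
qed

context star_category
begin

lemma peval_Str:
  assumes h: "h \<in> Arr C" "Dom C h = x" "Cod C h = x" "Str C h = h"
  shows "Str C (peval h p) = peval h (map_poly cnj p)"
proof (induction p)
  case (pCons a p)
  then show ?case using h x_obj[of h x] peval_commute[of h x "map_poly cnj p"] 
    by (simp add: map_poly_pCons)
qed (use h x_obj[of h x] in simp)

end

context proper_star_category
begin

lemma proper_right:
  assumes "f \<in> Arr C" "f \<cdot> Str C f = Zer C (Cod C f) (Cod C f)" 
  shows "f = Zer C (Dom C f) (Cod C f)"
proof -
  have "Str C f = Zer C (Cod C f) (Dom C f)"
    using proper[of "Str C f"] assms by simp
  then have "Str C (Str C f) = Str C (Zer C (Cod C f) (Dom C f))" by simp
  then show ?thesis using assms(1) by simp
qed

text \<open>Let \<open>(X - l) q\<close> be the minimal polynomial of \<open>h\<close> and \<open>v = q(h) \<noteq> 0\<close>. From \<open>h v = l v\<close> one gets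
\<open>v\<^sup>* v = c v\<close>, where \<open>c\<close> is the value at \<open>l\<close> of the conjugate of \<open>q\<close>, and \<open>c \<noteq> 0\<close> by definiteness. So
\<open>v\<^sup>* v / |c|\<^sup>2\<close> is a nonzero projection, on whose range \<open>h\<close> is the scalar \<open>l\<close>; it is not the identity
unless \<open>h = l\<close>.\<close>

lemma eigenprojection:
  assumes fd: "fin_dim_end C x" and h: "h \<in> Arr C" "Dom C h = x" "Cod C h = x" "Str C h = h"
    and nonscalar: "h \<notin> range (\<lambda>a. a \<odot> Idn C x)"
  obtains p where "p \<in> Hom C x x" "p \<cdot> p = p" "Str C p = p" "p \<noteq> Zer C x x" "p \<noteq> Idn C x"
proof -
  note h3 = h(1-3)
  note [simp] = peval_typ[OF h3] peval_pCons[OF h3] peval_0[OF h3] x_obj[OF h3]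
  obtain p where p: "p \<noteq> 0" "peval h p = Zer C x x"
    "\<And>q. q \<noteq> 0 \<Longrightarrow> peval h q = Zer C x x \<Longrightarrow> degree p \<le> degree q"
    using annihilating_polynomial[OF h3 fd] by metis
  have ne: "Idn C x \<noteq> Zer C x x"
  proof
    assume *: "Idn C x = Zer C x x"
    have "h = h \<cdot> Idn C x" using h by simp
    also have "\<dots> = 0 \<odot> Idn C x" using h by (simp add: *)
    finally show False using nonscalar by blast
  qed
  have "degree p \<noteq> 0"
  proof
    assume "degree p = 0"
    then obtain a where a: "p = [:a:]" by (rule degree_eq_zeroE)
    then have "a \<odot> Idn C x = Zer C x x" using p(2) h by simp
    then show False using Scl_eq_Zer[of "Idn C x" a] p(1) a ne by simp
  qed
  then obtain l where "poly p l = 0"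
    using fundamental_theorem_of_algebra[of p] constant_degree[of p] by auto
  then obtain q where q: "p = [:- l, 1:] * q" by (metis poly_eq_0_iff_dvd dvdE)
  define v where "v = peval h q"
  have q0: "q \<noteq> 0" using p(1) q by auto
  have "degree q < degree p" using q0 by (subst q, subst degree_mult_eq) auto
  then have v0: "v \<noteq> Zer C x x" using p(3)[of q] q0 unfolding v_def by auto
  have vt [simp]: "v \<in> Arr C" "Dom C v = x" "Cod C v = x" by (simp_all add: v_def)
  have "p = smult (- l) q + pCons 0 q" unfolding q by simp
  then have "peval h p = (- l) \<odot> v \<oplus> h \<cdot> v"
    using h by (simp only: peval_add[OF h3] peval_smult[OF h3]) (simp add: v_def)
  then have "h \<cdot> v \<oplus> (- 1) \<odot> (l \<odot> v) = Zer C x x"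
    using p(2) h Add_commute'[of "(- l) \<odot> v" "h \<cdot> v"] by simp
  then have hv: "h \<cdot> v = l \<odot> v" using diff_eq_Zer[of "h \<cdot> v" "l \<odot> v"] h by simp
  define c where "c = poly (map_poly cnj q) l"
  have vv: "Str C v \<cdot> v = c \<odot> v"
    using peval_eigen[OF h3 _ _ hv, of "map_poly cnj q"] h by (simp add: c_def v_def peval_Str)
  have c0: "c \<noteq> 0"
  proof
    assume "c = 0"
    then have "v = Zer C x x" using proper[of v] vv by simp
    then show False using v0 by simp
  qed
  define e where "e = (1 / (c * cnj c)) \<odot> (Str C v \<cdot> v)"
  have e: "e = (1 / cnj c) \<odot> v" using c0 by (simp add: e_def vv)
  have et [simp]: "e \<in> Arr C" "Dom C e = x" "Cod C e = x" by (simp_all add: e)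
  have es: "Str C e = e" by (simp add: e_def mult.commute)
  have "e \<cdot> e = Str C e \<cdot> e" using es by simp
  also have "\<dots> = (1 / c) \<odot> ((1 / cnj c) \<odot> (Str C v \<cdot> v))" by (simp add: e mult.commute)
  also have "\<dots> = e" by (simp add: e_def mult.commute)
  finally have ee: "e \<cdot> e = e" .
  have "e \<noteq> Zer C x x"
  proof
    assume "e = Zer C x x"
    then have "(1 / cnj c) \<odot> v = Zer C x x" using e by simp
    then show False using Scl_eq_Zer[of v "1 / cnj c"] c0 v0 by simp
  qed
  moreover have "e \<noteq> Idn C x"
  proof
    assume *: "e = Idn C x"
    have "h \<cdot> e = l \<odot> e" using hv h by (simp add: e mult.commute)
    then have "h = l \<odot> Idn C x" using h by (simp add: *)
    then show False using nonscalar by blast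
  qed
  ultimately show ?thesis using that[of e] es ee by (simp add: in_Hom_iff)
qed

end

section \<open>Decomposition into simple objects\<close>

definition orthogonal_projections :: "'u cat \<Rightarrow> 'u \<Rightarrow> nat \<Rightarrow> (nat \<Rightarrow> 'u) \<Rightarrow> bool" where
  "orthogonal_projections C x n P \<longleftrightarrow> 
    (\<forall>i<n. P i \<in> Hom C x x \<and> P i \<noteq> Zer C x x \<and> Str C (P i) = P i) \<and>
    (\<forall>i<n. \<forall>j<n. P i \<cdot>\<^bsub>C\<^esub> P j = (if i = j then P i else Zer C x x))"

context proper_star_category
begin

text \<open>Nonzero orthogonal projections are linearly independent: multiplying a linear relation with one of
them isolates its coefficient.\<close>

lemma orthogonal_projections_bounded:
  assumes fd: "fin_dim_end C x" and x: "x \<in> Obj C"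
  shows "\<exists>D. \<forall>n P. orthogonal_projections C x n P \<longrightarrow> n \<le> D"
proof -
  obtain K :: "('a \<Rightarrow> complex) set" where K: "finite K" 
    "\<forall>\<kappa>\<in>K. \<forall>f\<in>Hom C x x. \<forall>g\<in>Hom C x x. \<kappa> (f \<oplus> g) = \<kappa> f + \<kappa> g"
    "\<forall>\<kappa>\<in>K. \<forall>a. \<forall>f\<in>Hom C x x. \<kappa> (a \<odot> f) = a * \<kappa> f"
    "\<forall>f\<in>Hom C x x. (\<forall>\<kappa>\<in>K. \<kappa> f = 0) \<longrightarrow> f = Zer C x x"
    using fd unfolding fin_dim_end_def by (elim exE conjE) (rule that)
  have "n \<le> card K" if P: "orthogonal_projections C x n P" for n P
  proof (rule ccontr)
    have Pt [simp]: "P i \<in> Arr C" "Dom C (P i) = x" "Cod C (P i) = x" if "i < n" for i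
      using P that unfolding orthogonal_projections_def in_Hom_iff by auto
    assume "\<not> n \<le> card K"
    then obtain c where c: "\<exists>j<n. c j \<noteq> 0" "\<forall>\<kappa>\<in>K. (\<Sum>j<n. c j * \<kappa> (P j)) = 0"
      using underdetermined_system[of K "{..<n}" "\<lambda>\<kappa> j. \<kappa> (P j)"] K(1) by auto
    define S where "S m = arr_sum C x x m (\<lambda>j. c j \<odot> P j)" for m
    have St: "S m \<in> Hom C x x" if "m \<le> n" for m
      using that x unfolding S_def in_Hom_iff by (auto simp: in_Hom_iff intro!: arr_sum_typ)
    have "\<kappa> (S m) = (\<Sum>j<m. c j * \<kappa> (P j))" if "m \<le> n" "\<kappa> \<in> K" for m \<kappa>
      using that(1)
    proof (induction m)
      case 0
      have "\<kappa> (0 \<odot> Zer C x x) = 0 * \<kappa> (Zer C x x)" 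
        using x K(3) that(2) by (auto simp: in_Hom_iff simp del: Scl_zero Scl_Zer)
      then show ?case using x by (simp add: S_def)
    next
      case (Suc m)
      have "\<kappa> (S (Suc m)) = \<kappa> (S m) + \<kappa> (c m \<odot> P m)"
        using K(2)[rule_format, OF that(2), of "S m" "c m \<odot> P m"] St[of m] Suc(2) by (simp add: S_def in_Hom_iff)
      then show ?case using Suc K(3) that(2) by (simp add: in_Hom_iff)
    qed
    then have S0: "S n = Zer C x x" using K(4) St[of n] c(2) by auto
    obtain k where k: "k < n" "c k \<noteq> 0" using c(1) by blast
    have "P k \<cdot> S n = arr_sum C x x n (\<lambda>j. P k \<cdot> (c j \<odot> P j))"
      unfolding S_def using k x by (subst Cmp_arr_sum) (auto simp: in_Hom_iff)
    also have "\<dots> = P k \<cdot> (c k \<odot> P k)"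
      using P k x unfolding orthogonal_projections_def
      by (intro arr_sum_delta) (auto simp: in_Hom_iff)
    also have "\<dots> = c k \<odot> P k" using P k unfolding orthogonal_projections_def by simp
    finally have "c k \<odot> P k = Zer C x x" using S0 k x by simp
    then show False using P k Scl_eq_Zer[of "P k" "c k"] unfolding orthogonal_projections_def by simp
  qed
  then show ?thesis by blast
qed

text \<open>The map \<open>f \<mapsto> v f v\<^sup>*\<close> embeds the endomorphisms of \<open>y\<close> into those of \<open>x\<close>.\<close>

lemma fin_dim_end_transfer:
  assumes fd: "fin_dim_end C x" and v: "v \<in> Hom C y x" "Str C v \<cdot> v = Idn C y"
  shows "fin_dim_end C y"
proof -
  have vt [simp]: "v \<in> Arr C" "Dom C v = y" "Cod C v = x" and [simp]: "x \<in> Obj C" "y \<in> Obj C" 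
    using v by (auto simp: in_Hom_iff)
  obtain K :: "('a \<Rightarrow> complex) set" where K: "finite K" 
    "\<forall>\<kappa>\<in>K. \<forall>f\<in>Hom C x x. \<forall>g\<in>Hom C x x. \<kappa> (f \<oplus> g) = \<kappa> f + \<kappa> g"
    "\<forall>\<kappa>\<in>K. \<forall>a. \<forall>f\<in>Hom C x x. \<kappa> (a \<odot> f) = a * \<kappa> f"
    "\<forall>f\<in>Hom C x x. (\<forall>\<kappa>\<in>K. \<kappa> f = 0) \<longrightarrow> f = Zer C x x"
    using fd unfolding fin_dim_end_def by (elim exE conjE) (rule that)
  define K' where "K' = (\<lambda>\<kappa> f. \<kappa> (v \<cdot> f \<cdot> Str C v)) ` K"
  have "f = Zer C y y" if f: "f \<in> Hom C y y" "\<forall>\<kappa>\<in>K'. \<kappa> f = 0" for f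
  proof -
    have ft [simp]: "f \<in> Arr C" "Dom C f = y" "Cod C f = y" using f by (auto simp: in_Hom_iff)
    have "v \<cdot> f \<cdot> Str C v = Zer C x x" using K(4) f unfolding K'_def by (simp add: in_Hom_iff)
    then have "Str C v \<cdot> (v \<cdot> f \<cdot> Str C v) \<cdot> v = Zer C y y" by simp
    then show ?thesis using v(2) by (simp add: reduce[OF v(2)])
  qed
  moreover have "finite K'" using K(1) by (simp add: K'_def)
  moreover have "\<forall>\<kappa>\<in>K'. \<forall>f\<in>Hom C y y. \<forall>g\<in>Hom C y y. \<kappa> (f \<oplus> g) = \<kappa> f + \<kappa> g"
    using K(2) by (simp add: K'_def in_Hom_iff Cmp_Add' Add_Cmp')
  moreover have "\<forall>\<kappa>\<in>K'. \<forall>a. \<forall>f\<in>Hom C y y. \<kappa> (a \<odot> f) = a * \<kappa> f"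
    using K(3) by (simp add: K'_def in_Hom_iff)
  ultimately show ?thesis unfolding fin_dim_end_def by blast
qed

text \<open>Self-adjoint endomorphisms are scalars by \<open>eigenprojection\<close>, and every \<open>f\<close> is a linear combination of
the self-adjoint \<open>f + f\<^sup>*\<close> and \<open>i f - i f\<^sup>*\<close>.\<close>

lemma simple_from_no_projection:
  assumes fd: "fin_dim_end C y" and y: "y \<in> Obj C" "Idn C y \<noteq> Zer C y y"
    and no: "\<And>p. \<lbrakk>p \<in> Hom C y y; p \<cdot> p = p; Str C p = p\<rbrakk> \<Longrightarrow> p = Zer C y y \<or> p = Idn C y"
  shows "simple C y"
proof -
  have sa: "\<exists>a. h = a \<odot> Idn C y" if "h \<in> Hom C y y" "Str C h = h" for h
  proof (rule ccontr)
    assume "\<nexists>a. h = a \<odot> Idn C y"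
    then have "h \<notin> range (\<lambda>a. a \<odot> Idn C y)" by blast
    then show False using eigenprojection[OF fd, of h] that no by (metis in_Hom_iff)
  qed
  have "f \<in> range (\<lambda>a. a \<odot> Idn C y)" if f: "f \<in> Hom C y y" for f
  proof -
    have ft [simp]: "f \<in> Arr C" "Dom C f = y" "Cod C f = y" using f by (auto simp: in_Hom_iff)
    obtain a where a: "f \<oplus> Str C f = a \<odot> Idn C y"
      using sa[of "f \<oplus> Str C f"] Add_commute'[of f "Str C f"] by (auto simp: in_Hom_iff)
    obtain b where b: "\<i> \<odot> f \<oplus> (- \<i>) \<odot> Str C f = b \<odot> Idn C y"
      using sa[of "\<i> \<odot> f \<oplus> (- \<i>) \<odot> Str C f"] Add_commute'[of "\<i> \<odot> f" "(- \<i>) \<odot> Str C f"]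
      by (auto simp: in_Hom_iff)
    have "(f \<oplus> Str C f) \<oplus> (- \<i>) \<odot> (\<i> \<odot> f \<oplus> (- \<i>) \<odot> Str C f) = (f \<oplus> Str C f) \<oplus> (f \<oplus> (-1) \<odot> Str C f)"
      by (simp add: Scl_Add')
    also have "\<dots> = (f \<oplus> f) \<oplus> (Str C f \<oplus> (-1) \<odot> Str C f)"
      by (simp add: Add_ac del: Add_neg')
    also have "\<dots> = 2 \<odot> f" using add_Scl'[of f 1 1] y by simp
    finally have "2 \<odot> f = a \<odot> Idn C y \<oplus> (- \<i> * b) \<odot> Idn C y" unfolding a b using y by simp
    then have "(1/2) \<odot> (2 \<odot> f) = (1/2) \<odot> ((a + (- \<i> * b)) \<odot> Idn C y)" 
      using y by (simp only: add_Scl' Idn_typ)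
    then have "f = ((1/2) * (a + (- \<i> * b))) \<odot> Idn C y" using y by simp
    then show ?thesis by (rule range_eqI)
  qed
  then show ?thesis using y unfolding simple_def by (auto simp: in_Hom_iff)
qed

text \<open>A family of nonzero orthogonal projections of the greatest possible length sums up to the identity,
since the complement of the sum could be adjoined. The object that splits one of its members \<open>P k\<close>
has no nontrivial projection \<open>p\<close>, since \<open>P k\<close> could be replaced by the two projections that
correspond to \<open>p\<close> and \<open>1 - p\<close>. So these objects are simple.\<close>

lemma semisimple_if_fin_dim_end:
  assumes split: "\<And>y p. \<lbrakk>p \<in> Hom C y y; p \<cdot> p = p; Str C p = p\<rbrakk>
        \<Longrightarrow> \<exists>z \<in> Obj C. \<exists>v \<in> Hom C z y. Str C v \<cdot> v = Idn C z \<and> v \<cdot> Str C v = p"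
    and fd: "fin_dim_end C x" and x: "x \<in> Obj C"
  shows "\<exists>n s v. (\<forall>i<n. simple C (s i)) \<and> is_direct_sum C n s x v"
proof -
  obtain D where D: "\<And>n P. orthogonal_projections C x n P \<Longrightarrow> n \<le> D"
    using orthogonal_projections_bounded[OF fd x] by blast
  have "orthogonal_projections C x 0 P" for P by (simp add: orthogonal_projections_def)
  then have "\<exists>n. (\<exists>P. orthogonal_projections C x n P) \<and> (\<forall>m. (\<exists>P. orthogonal_projections C x m P) \<longrightarrow> m \<le> n)"
    using Nat.ex_has_greatest_nat[of "\<lambda>n. \<exists>P. orthogonal_projections C x n P" 0 D] D by auto
  then obtain n P where P: "orthogonal_projections C x n P"
    and max: "\<And>P. \<not> orthogonal_projections C x (Suc n) P"
    by (metis Suc_n_not_le_n)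
  have Pt [simp]: "P i \<in> Arr C" "Dom C (P i) = x" "Cod C (P i) = x" and PS [simp]: "Str C (P i) = P i"
    and PP [simp]: "P i \<cdot> P i = P i" and P0: "P i \<noteq> Zer C x x" if "i < n" for i
    using P that unfolding orthogonal_projections_def in_Hom_iff by auto
  have PZ: "P i \<cdot> P j = Zer C x x" if "i < n" "j < n" "i \<noteq> j" for i j
    using P that unfolding orthogonal_projections_def by auto
  define S where "S = arr_sum C x x n P"
  have St [simp]: "S \<in> Arr C" "Dom C S = x" "Cod C S = x" using x by (simp_all add: S_def in_Hom_iff)
  have SS: "Str C S = S" unfolding S_def using x
    by (subst Str_arr_sum) (auto simp: in_Hom_iff intro!: arr_sum_cong)
  have PSm: "P j \<cdot> S = P j" if "j < n" for j
  proof -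
    have "P j \<cdot> S = arr_sum C x x n (\<lambda>i. P j \<cdot> P i)"
      unfolding S_def using x that by (subst Cmp_arr_sum) (auto simp: in_Hom_iff)
    also have "\<dots> = P j \<cdot> P j" using that x PZ by (intro arr_sum_delta) (auto simp: in_Hom_iff)
    finally show ?thesis using that by simp
  qed
  have SPm: "S \<cdot> P j = P j" if "j < n" for j
    using arg_cong[OF PSm[OF that], of "Str C"] SS that by simp
  have S1: "S = Idn C x"
  proof (rule ccontr)
    assume ne: "S \<noteq> Idn C x"
    define e where "e = Idn C x \<oplus> (-1) \<odot> S"
    have et [simp]: "e \<in> Arr C" "Dom C e = x" "Cod C e = x" using x by (simp_all add: e_def)
    have e0: "e \<noteq> Zer C x x" using ne diff_eq_Zer[of "Idn C x" S] x by (simp add: e_def)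
    have eS: "Str C e = e" using x SS by (simp add: e_def)
    have Pe: "P j \<cdot> e = Zer C x x" if "j < n" for j
      using that x by (simp add: e_def Cmp_Add' PSm)
    have eP: "e \<cdot> P j = Zer C x x" if "j < n" for j
      using that x by (simp add: e_def Add_Cmp' SPm)
    have "e \<cdot> S = Zer C x x"
      unfolding S_def using x eP 
      by (subst Cmp_arr_sum) (auto simp: in_Hom_iff intro!: arr_sum_Zer)
    moreover have "e \<cdot> e = e \<cdot> Idn C x \<oplus> (-1) \<odot> (e \<cdot> S)" 
      using x by (subst (2) e_def) (simp add: Cmp_Add')
    ultimately have "e \<cdot> e = e" using x by simp
    then have "orthogonal_projections C x (Suc n) (P(n := e))"
      using P e0 eS Pe eP unfolding orthogonal_projections_def by (auto simp: less_Suc_eq in_Hom_iff)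
    then show False using max by blast
  qed
  have "\<exists>z v. z \<in> Obj C \<and> v \<in> Hom C z x \<and> Str C v \<cdot> v = Idn C z \<and> v \<cdot> Str C v = P i" if "i < n" for i
  proof -
    have "\<exists>z \<in> Obj C. \<exists>v \<in> Hom C z x. Str C v \<cdot> v = Idn C z \<and> v \<cdot> Str C v = P i"
      using that by (intro split) (simp_all add: in_Hom_iff)
    then show ?thesis by blast
  qed
  then obtain s v where sv: "\<And>i. i < n \<Longrightarrow> s i \<in> Obj C \<and> v i \<in> Hom C (s i) x \<and> 
      Str C (v i) \<cdot> v i = Idn C (s i) \<and> v i \<cdot> Str C (v i) = P i"
    by metis
  have vt [simp]: "s i \<in> Obj C" "v i \<in> Arr C" "Dom C (v i) = s i" "Cod C (v i) = x" 
    and vv [simp]: "Str C (v i) \<cdot> v i = Idn C (s i)" and vP: "v i \<cdot> Str C (v i) = P i" if "i < n" for i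
    using sv[OF that] by (auto simp: in_Hom_iff)
  have vP': "v i \<cdot> Str C (v i) \<cdot> f = P i \<cdot> f" if "i < n" "f \<in> Arr C" "Cod C f = x" for i f
    using that by (subst reduce[OF vP[OF that(1)]]) auto
  have vv': "Str C (v i) \<cdot> v i \<cdot> f = f" if "i < n" "f \<in> Arr C" "Cod C f = s i" for i f
    using that by (subst reduce[OF vv[OF that(1)]]) auto
  have orth: "Str C (v i) \<cdot> v j = Zer C (s j) (s i)" if "i < n" "j < n" "i \<noteq> j" for i j
  proof -
    have "v i \<cdot> (Str C (v i) \<cdot> v j) \<cdot> Str C (v j) = Zer C x x"
      using that PZ[OF that] by (simp add: vP vP')
    then have "Str C (v i) \<cdot> (v i \<cdot> (Str C (v i) \<cdot> v j) \<cdot> Str C (v j)) \<cdot> v j = Zer C (s j) (s i)"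
      using that x by simp
    then show ?thesis using that by (simp add: vv')
  qed
  have ds: "is_direct_sum C n s x v"
    unfolding is_direct_sum_def using x orth S1 unfolding S_def
    by (auto simp: in_Hom_iff vP cong: arr_sum_cong)
  have "simple C (s k)" if k: "k < n" for k
  proof (rule simple_from_no_projection)
    show "fin_dim_end C (s k)" by (rule fin_dim_end_transfer[OF fd]) (use sv[OF k] in auto)
    show "s k \<in> Obj C" using k by simp
    show "Idn C (s k) \<noteq> Zer C (s k) (s k)"
    proof
      assume "Idn C (s k) = Zer C (s k) (s k)"
      then have "v k \<cdot> Idn C (s k) = v k \<cdot> Zer C (s k) (s k)" by simp
      then have "v k = Zer C (s k) x" using k by simp
      then show False using vP[OF k] P0[OF k] x k by simp
    qed
    fix p assume p: "p \<in> Hom C (s k) (s k)" "p \<cdot> p = p" "Str C p = p"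
    show "p = Zer C (s k) (s k) \<or> p = Idn C (s k)"
    proof (rule ccontr)
      assume neg: "\<not> (p = Zer C (s k) (s k) \<or> p = Idn C (s k))"
      have pt [simp]: "p \<in> Arr C" "Dom C p = s k" "Cod C p = s k" using p by (auto simp: in_Hom_iff)
      define q where "q = Idn C (s k) \<oplus> (-1) \<odot> p"
      have qt [simp]: "q \<in> Arr C" "Dom C q = s k" "Cod C q = s k" using k by (simp_all add: q_def)
      have q: "Str C q = q" "q \<cdot> q = q" "p \<cdot> q = Zer C (s k) (s k)" "q \<cdot> p = Zer C (s k) (s k)"
        using p k by (simp_all add: q_def Cmp_Add' Add_Cmp')
      have q0: "q \<noteq> Zer C (s k) (s k)" 
        using neg diff_eq_Zer[of "Idn C (s k)" p] k by (auto simp add: q_def)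
      define e where "e r = v k \<cdot> r \<cdot> Str C (v k)" for r
      have et: "e r \<in> Arr C" "Dom C (e r) = x" "Cod C (e r) = x" 
        if "r \<in> Arr C" "Dom C r = s k" "Cod C r = s k" for r 
        using k that by (simp_all add: e_def)
      have e0: "e r \<noteq> Zer C x x" if "r \<in> Arr C" "Dom C r = s k" "Cod C r = s k" "r \<noteq> Zer C (s k) (s k)" for r
      proof
        assume "e r = Zer C x x"
        then have "Str C (v k) \<cdot> e r \<cdot> v k = Zer C (s k) (s k)" using k x by simp
        then show False using that k by (simp add: e_def vv')
      qed
      have ee: "e r \<cdot> e t = e (r \<cdot> t)" if "r \<in> Arr C" "Dom C r = s k" "Cod C r = s k" 
        "t \<in> Arr C" "Dom C t = s k" "Cod C t = s k" for r t
        using k that by (simp add: e_def vv')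
      have eZ: "e (Zer C (s k) (s k)) = Zer C x x" using k x by (simp add: e_def)
      have eP: "e r \<cdot> P j = Zer C x x" "P j \<cdot> e r = Zer C x x" 
        if "r \<in> Arr C" "Dom C r = s k" "Cod C r = s k" "j < n" "j \<noteq> k" for r j
      proof -
        have 1: "e r \<cdot> P k = e r" using k that by (simp add: e_def vv' flip: vP)
        have "e r \<cdot> P j = (e r \<cdot> P k) \<cdot> P j" by (simp only: 1)
        also have "\<dots> = e r \<cdot> (P k \<cdot> P j)" using et[of r] that k by simp
        finally have "e r \<cdot> P j = e r \<cdot> (P k \<cdot> P j)" .
        then show "e r \<cdot> P j = Zer C x x" using PZ[of k j] that k et[of r] x by simp
        have 2: "P k \<cdot> e r = e r" using k that by (simp add: e_def vv' flip: vP)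
        have "P j \<cdot> e r = P j \<cdot> (P k \<cdot> e r)" by (simp only: 2)
        also have "\<dots> = (P j \<cdot> P k) \<cdot> e r" using et[of r] that k by simp
        finally have "P j \<cdot> e r = (P j \<cdot> P k) \<cdot> e r" .
        then show "P j \<cdot> e r = Zer C x x" using PZ[of j k] that k et[of r] x by simp
      qed
      have eStr: "Str C (e r) = e r" if "r \<in> Arr C" "Dom C r = s k" "Cod C r = s k" "Str C r = r" for r
        using that k by (simp add: e_def)
      have "orthogonal_projections C x (Suc n) (P(k := e p, n := e q))"
        using k neg q0 p q
        unfolding orthogonal_projections_def 
        by (auto simp: less_Suc_eq in_Hom_iff et e0 ee eZ eP eStr P0 PZ)
      then show False using max by blast
    qed
  qed
  then show ?thesis using ds by blast
qed


definition scal :: "'a \<Rightarrow> 'a \<Rightarrow> complex" where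
  "scal s f = (THE a. f = a \<odot> Idn C s)"

lemma simple_obj [simp]: "simple C s \<Longrightarrow> s \<in> Obj C"
  by (simp add: simple_def)

lemma simple_Scl_inj:
  assumes s: "simple C s" and eq: "a \<odot> Idn C s = b \<odot> Idn C s" shows "a = b"
proof -
  have "(a - b) \<odot> Idn C s = (a + - b) \<odot> Idn C s" by simp
  also have "\<dots> = a \<odot> Idn C s \<oplus> (- b) \<odot> Idn C s" using s by (subst add_Scl') auto
  also have "\<dots> = b \<odot> Idn C s \<oplus> (-1) \<odot> (b \<odot> Idn C s)" using s eq by simp
  also have "\<dots> = Zer C s s" using s by (subst Add_neg') auto
  finally show ?thesis using Scl_eq_Zer[of "Idn C s" "a - b"] s unfolding simple_def by auto
qed

lemma scal_eqI: "simple C s \<Longrightarrow> f = a \<odot> Idn C s \<Longrightarrow> scal s f = a"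
  unfolding scal_def by (rule the_equality) (auto dest: simple_Scl_inj)

lemma scal:
  assumes "simple C s" "f \<in> Arr C" "Dom C f = s" "Cod C f = s" shows "f = scal s f \<odot> Idn C s"
proof -
  have "f \<in> Hom C s s" using assms by (simp add: in_Hom_iff)
  then obtain a where "f = a \<odot> Idn C s" using assms(1) unfolding simple_def by blast
  then show ?thesis using scal_eqI[OF assms(1)] by metis
qed

lemma scal_Add:
  assumes "simple C s" "f \<in> Hom C s s" "g \<in> Hom C s s" 
  shows "scal s (f \<oplus> g) = scal s f + scal s g"
  using scal[of s f] scal[of s g] assms by (intro scal_eqI) (auto simp: in_Hom_iff add_Scl')

lemma scal_Scl:
  assumes "simple C s" "f \<in> Hom C s s" shows "scal s (a \<odot> f) = a * scal s f"
  using scal[of s f] assms by (intro scal_eqI) (auto simp: in_Hom_iff, metis Scl_Scl' Idn_typ(1) simple_obj)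

text \<open>Schur's lemma: \<open>u\<^sup>* u\<close> and \<open>u u\<^sup>*\<close> are scalars, and nonzero by definiteness.\<close>

lemma simple_arrow:
  assumes s: "simple C s" "simple C t" and u: "u \<in> Hom C s t" "u \<noteq> Zer C s t"
  obtains c d where "c \<noteq> 0" "d \<noteq> 0" "Str C u \<cdot> u = c \<odot> Idn C s" "u \<cdot> Str C u = d \<odot> Idn C t"
proof -
  have ut [simp]: "u \<in> Arr C" "Dom C u = s" "Cod C u = t" using u by (auto simp: in_Hom_iff)
  have 1: "Str C u \<cdot> u = scal s (Str C u \<cdot> u) \<odot> Idn C s" "u \<cdot> Str C u = scal t (u \<cdot> Str C u) \<odot> Idn C t"
    using s by (auto intro!: scal)
  moreover have "scal s (Str C u \<cdot> u) \<noteq> 0"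
    using 1(1) proper[of u] u s by auto
  moreover have "scal t (u \<cdot> Str C u) \<noteq> 0"
    using 1(2) proper_right[of u] u s by auto
  ultimately show ?thesis using that by blast
qed

lemma simple_arrow_iso:
  assumes s: "simple C s" "simple C t" and u: "u \<in> Hom C s t" "u \<noteq> Zer C s t"
  shows "iso_obj C s t"
proof -
  have ut [simp]: "u \<in> Arr C" "Dom C u = s" "Cod C u = t" using u by (auto simp: in_Hom_iff)
  obtain c d where cd: "c \<noteq> 0" "d \<noteq> 0" "Str C u \<cdot> u = c \<odot> Idn C s" "u \<cdot> Str C u = d \<odot> Idn C t"
    using simple_arrow[OF assms] by metis
  have "d \<odot> u = (u \<cdot> Str C u) \<cdot> u" using s by (simp only: cd) simp
  also have "\<dots> = c \<odot> u" using s by (simp add: cd(3))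
  finally have "Str C u \<cdot> (d \<odot> u) = Str C u \<cdot> (c \<odot> u)" by simp
  then have "(d * c) \<odot> Idn C s = (c * c) \<odot> Idn C s" using s by (simp add: cd)
  then have "d = c" using simple_Scl_inj[OF s(1)] cd by fastforce
  then have "((1/c) \<odot> Str C u) \<cdot> u = Idn C s" "u \<cdot> ((1/c) \<odot> Str C u) = Idn C t"
    using cd s by simp_all
  then show ?thesis unfolding iso_obj_def in_Hom_iff by (intro bexI[of _ u] bexI[of _ "(1/c) \<odot> Str C u"]) (auto simp: in_Hom_iff)
qed

text \<open>There is at most one dimension: if \<open>u \<noteq> 0\<close>, then \<open>f\<close> is determined by the scalar \<open>u\<^sup>* f\<close>, because
\<open>u u\<^sup>*\<close> is a nonzero scalar.\<close>

lemma simple_hom_functional: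
  assumes s: "simple C s" "simple C t"
  shows "\<exists>\<kappa> :: 'a \<Rightarrow> complex. (\<forall>f\<in>Hom C s t. \<forall>g\<in>Hom C s t. \<kappa> (f \<oplus> g) = \<kappa> f + \<kappa> g) \<and>
    (\<forall>a. \<forall>f\<in>Hom C s t. \<kappa> (a \<odot> f) = a * \<kappa> f) \<and> (\<forall>f\<in>Hom C s t. \<kappa> f = 0 \<longrightarrow> f = Zer C s t)"
proof (cases "\<exists>u\<in>Hom C s t. u \<noteq> Zer C s t")
  case False
  then show ?thesis by (intro exI[of _ "\<lambda>_. 0"]) auto
next
  case True
  then obtain u where u: "u \<in> Hom C s t" "u \<noteq> Zer C s t" by blast
  have ut [simp]: "u \<in> Arr C" "Dom C u = s" "Cod C u = t" using u by (auto simp: in_Hom_iff)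
  obtain c d where cd: "c \<noteq> 0" "d \<noteq> 0" "Str C u \<cdot> u = c \<odot> Idn C s" "u \<cdot> Str C u = d \<odot> Idn C t"
    using simple_arrow[OF s u] by metis
  have "f = Zer C s t" if f: "f \<in> Hom C s t" "scal s (Str C u \<cdot> f) = 0" for f
  proof -
    have ft [simp]: "f \<in> Arr C" "Dom C f = s" "Cod C f = t" using f by (auto simp: in_Hom_iff)
    have "Str C u \<cdot> f = Zer C s s" using scal[of s "Str C u \<cdot> f"] f s by simp
    then have "(u \<cdot> Str C u) \<cdot> f = Zer C s t" using s by simp
    then have "d \<odot> f = Zer C s t" using s by (simp only: cd) simp
    then show ?thesis using Scl_eq_Zer[of f d] cd by simp
  qed
  then show ?thesis using s
    by (intro exI[of _ "\<lambda>f. scal s (Str C u \<cdot> f)"]) (auto simp: in_Hom_iff Cmp_Add' scal_Add scal_Scl)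
qed

text \<open>The separating functionals are those of the matrix entries \<open>v\<^sub>i\<^sup>* f v\<^sub>j\<close> between simple objects.\<close>

lemma fin_dim_end_if_semisimple:
  assumes s: "\<And>i. i < n \<Longrightarrow> simple C (s i)" and v: "is_direct_sum C n s x v"
  shows "fin_dim_end C x"
proof -
  note t = is_direct_sum_typ[OF v]
  have "\<exists>\<kappa> :: 'a \<Rightarrow> complex. (\<forall>f\<in>Hom C (s j) (s i). \<forall>g\<in>Hom C (s j) (s i). \<kappa> (f \<oplus> g) = \<kappa> f + \<kappa> g) \<and>
    (\<forall>a. \<forall>f\<in>Hom C (s j) (s i). \<kappa> (a \<odot> f) = a * \<kappa> f) \<and> 
    (\<forall>f\<in>Hom C (s j) (s i). \<kappa> f = 0 \<longrightarrow> f = Zer C (s j) (s i))" if "i < n" "j < n" for i j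
    using simple_hom_functional[of "s j" "s i"] s that by blast
  then have "\<forall>i j. \<exists>\<kappa> :: 'a \<Rightarrow> complex. i < n \<and> j < n \<longrightarrow> 
    (\<forall>f\<in>Hom C (s j) (s i). \<forall>g\<in>Hom C (s j) (s i). \<kappa> (f \<oplus> g) = \<kappa> f + \<kappa> g) \<and>
    (\<forall>a. \<forall>f\<in>Hom C (s j) (s i). \<kappa> (a \<odot> f) = a * \<kappa> f) \<and> 
    (\<forall>f\<in>Hom C (s j) (s i). \<kappa> f = 0 \<longrightarrow> f = Zer C (s j) (s i))" by metis
  then obtain \<kappa> :: "nat \<Rightarrow> nat \<Rightarrow> 'a \<Rightarrow> complex" where \<kappa>: "\<And>i j. i < n \<and> j < n \<longrightarrow> 
    (\<forall>f\<in>Hom C (s j) (s i). \<forall>g\<in>Hom C (s j) (s i). \<kappa> i j (f \<oplus> g) = \<kappa> i j f + \<kappa> i j g) \<and>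
    (\<forall>a. \<forall>f\<in>Hom C (s j) (s i). \<kappa> i j (a \<odot> f) = a * \<kappa> i j f) \<and> 
    (\<forall>f\<in>Hom C (s j) (s i). \<kappa> i j f = 0 \<longrightarrow> f = Zer C (s j) (s i))" by metis
  define K where "K = (\<lambda>(i, j) f. \<kappa> i j (Str C (v i) \<cdot> f \<cdot> v j)) ` ({..<n} \<times> {..<n})"
  have "finite K" by (simp add: K_def)
  moreover have "\<forall>\<kappa>\<in>K. \<forall>f\<in>Hom C x x. \<forall>g\<in>Hom C x x. \<kappa> (f \<oplus> g) = \<kappa> f + \<kappa> g"
    using \<kappa> t by (auto simp: K_def in_Hom_iff Cmp_Add' Add_Cmp')
  moreover have "\<forall>\<kappa>\<in>K. \<forall>a. \<forall>f\<in>Hom C x x. \<kappa> (a \<odot> f) = a * \<kappa> f"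
    using \<kappa> t by (auto simp: K_def in_Hom_iff)
  moreover have "\<forall>f\<in>Hom C x x. (\<forall>\<kappa>\<in>K. \<kappa> f = 0) \<longrightarrow> f = Zer C x x"
  proof -
  have "f = Zer C x x" if f: "f \<in> Hom C x x" "\<forall>\<kappa>\<in>K. \<kappa> f = 0" for f
  proof -
    have ft [simp]: "f \<in> Arr C" "Dom C f = x" "Cod C f = x" using f by (auto simp: in_Hom_iff)
    have *: "Str C (v i) \<cdot> (f \<cdot> v j) = Zer C (s j) (s i)" if "i < n" "j < n" for i j
      using f(2) \<kappa>[of i j] that t unfolding K_def by (force simp: in_Hom_iff)
    have "f \<cdot> v j = Zer C x x \<cdot> v j" if "j < n" for j
      by (rule direct_sum_jointly_mono[OF v, of _ "s j"]) (use t that * in \<open>auto simp: in_Hom_iff\<close>)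
    then show ?thesis by (intro direct_sum_jointly_epi[OF v f(1) Zer_in[OF t(1) t(1)]])
  qed
  then show ?thesis by blast
  qed
  ultimately show ?thesis unfolding fin_dim_end_def by (intro exI[of _ K] conjI)
qed

text \<open>A step of the Cholesky algorithm, by induction on the number \<open>m\<close> of summands on which \<open>f\<close> lives. Let
\<open>u = f v\<^sub>m\<close> and \<open>u\<^sup>* u = c > 0\<close>. Then \<open>q = u u\<^sup>* / c\<close> is a projection with \<open>q u = u\<close>, and \<open>f\<^sup>* f\<close> is the sum of
\<open>f'\<^sup>* f'\<close> for \<open>f' = (1 - q) f\<close> and \<open>w\<^sup>* w\<close> for \<open>w = u\<^sup>* f / \<surd>c\<close>. Since \<open>f'\<close> vanishes on the last summand,
the induction hypothesis gives a root \<open>g\<close> of \<open>f'\<^sup>* f'\<close> with values in the other summands, and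
\<open>g + v\<^sub>m w\<close> is a root of \<open>f\<^sup>* f\<close> because the ranges of \<open>g\<close> and \<open>v\<^sub>m\<close> are orthogonal.\<close>

lemma square_root_if_semisimple:
  assumes pos: "\<And>s u. \<lbrakk>simple C s; u \<in> Arr C; Dom C u = s\<rbrakk> \<Longrightarrow> \<exists>c\<ge>0. Str C u \<cdot> u = complex_of_real c \<odot> Idn C s"
    and s: "\<And>i. i < n \<Longrightarrow> simple C (s i)" and v: "is_direct_sum C n s x v"
    and f: "f \<in> Hom C x y"
  shows "\<exists>g\<in>Hom C x x. Str C f \<cdot> f = Str C g \<cdot> g"
proof -
  note t = is_direct_sum_typ[OF v]
  define e where "e m = arr_sum C x x m (\<lambda>i. v i \<cdot> Str C (v i))" for m
  have et: "e m \<in> Arr C" "Dom C (e m) = x" "Cod C (e m) = x" if "m \<le> n" for m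
    using that t unfolding e_def by (auto simp: in_Hom_iff intro!: arr_sum_typ)
  have ve: "Str C (v m) \<cdot> e m = Zer C x (s m)" if "m < n" for m
  proof -
    have "Str C (v m) \<cdot> e m = arr_sum C x (s m) m (\<lambda>i. (Str C (v m) \<cdot> v i) \<cdot> Str C (v i))"
      using t that unfolding e_def by (subst Cmp_arr_sum) (auto simp: in_Hom_iff intro!: arr_sum_cong)
    also have "\<dots> = Zer C x (s m)"
    proof (intro arr_sum_Zer)
      fix i assume "i < m"
      then have "Str C (v m) \<cdot> v i = Zer C (s i) (s m)" using v that unfolding is_direct_sum_def by auto
      then show "(Str C (v m) \<cdot> v i) \<cdot> Str C (v i) = Zer C x (s m)" using t that \<open>i < m\<close> by simp
    qed (use t that in auto)
    finally show ?thesis .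
  qed
  have "\<forall>f. f \<in> Hom C x y \<and> f \<cdot> e m = f \<longrightarrow> (\<exists>g\<in>Hom C x x. e m \<cdot> g = g \<and> Str C f \<cdot> f = Str C g \<cdot> g)"
    if "m \<le> n" for m
    using that
  proof (induction m)
    case 0
    have "\<exists>g\<in>Hom C x x. e 0 \<cdot> g = g \<and> Str C f \<cdot> f = Str C g \<cdot> g" if "f \<in> Hom C x y" "f \<cdot> e 0 = f" for f
      using that t(1) by (intro bexI[of _ "Zer C x x"]) (auto simp: e_def in_Hom_iff)
    then show ?case by blast
  next
    case (Suc m)
    then have m: "m < n" by simp
    note [simp] = et[OF less_imp_le[OF m]] t(1) t(2-5)[OF m]
    have eSuc: "e (Suc m) = e m \<oplus> v m \<cdot> Str C (v m)" by (simp add: e_def)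
    show ?case
    proof (intro allI impI)
      fix f assume "f \<in> Hom C x y \<and> f \<cdot> e (Suc m) = f"
      then have f [simp]: "f \<in> Arr C" "Dom C f = x" "Cod C f = y" and fe: "f \<cdot> e (Suc m) = f"
        and [simp]: "y \<in> Obj C" by (auto simp: in_Hom_iff)
      have fe': "f = f \<cdot> e m \<oplus> f \<cdot> v m \<cdot> Str C (v m)" using fe by (simp add: eSuc Cmp_Add')
      define u where "u = f \<cdot> v m"
      have ut [simp]: "u \<in> Arr C" "Dom C u = s m" "Cod C u = y" by (simp_all add: u_def)
      obtain c where c: "c \<ge> 0" "Str C u \<cdot> u = complex_of_real c \<odot> Idn C (s m)"
        using pos[OF s[OF m], of u] by auto
      have eg: "e (Suc m) \<cdot> g = g" if "g \<in> Hom C x x" "e m \<cdot> g = g" for g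
      proof -
        have [simp]: "g \<in> Arr C" "Dom C g = x" "Cod C g = x" using that by (auto simp: in_Hom_iff)
        have "Str C (v m) \<cdot> g = (Str C (v m) \<cdot> e m) \<cdot> g" using that by simp
        also have "\<dots> = Zer C x (s m)" using ve[OF m] by simp
        finally show ?thesis using that by (simp add: eSuc Add_Cmp')
      qed
      show "\<exists>g\<in>Hom C x x. e (Suc m) \<cdot> g = g \<and> Str C f \<cdot> f = Str C g \<cdot> g"
      proof (cases "c = 0")
        case True
        then have "u = Zer C (s m) y" using c(2) proper[of u] by simp
        then have "f = f \<cdot> e m" using fe' reduce[OF u_def[symmetric], of "Str C (v m)"] by simp
        moreover have "f \<in> Hom C x y" by (simp add: in_Hom_iff)
        ultimately obtain g where "g \<in> Hom C x x" "e m \<cdot> g = g" "Str C f \<cdot> f = Str C g \<cdot> g"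
          using Suc.IH m by (metis less_imp_le)
        then show ?thesis using eg by blast
      next
        case False
        define q where "q = (1 / complex_of_real c) \<odot> (u \<cdot> Str C u)"
        have qt [simp]: "q \<in> Arr C" "Dom C q = y" "Cod C q = y" by (simp_all add: q_def)
        have qs: "Str C q = q" by (simp add: q_def)
        have qu: "q \<cdot> u = u" using False by (simp add: q_def c)
        then have qq: "q \<cdot> q = q" using reduce[OF qu, of "Str C u"] by (simp add: q_def[of] flip: q_def) (simp add: q_def)
        define f' where "f' = f \<oplus> (-1) \<odot> (q \<cdot> f)"
        have f't [simp]: "f' \<in> Arr C" "Dom C f' = x" "Cod C f' = y" by (simp_all add: f'_def)
        have f'v: "f' \<cdot> v m = Zer C (s m) y" using qu by (simp add: f'_def Add_Cmp' flip: u_def)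
        have "f' \<cdot> e (Suc m) = f'" using fe et[OF Suc.prems] by (simp add: f'_def Add_Cmp')
        then have "f' \<cdot> e m = f'" using reduce[OF f'v, of "Str C (v m)"] by (simp add: eSuc Cmp_Add')
        moreover have "f' \<in> Hom C x y" by (simp add: in_Hom_iff)
        ultimately obtain g where g: "g \<in> Hom C x x" "e m \<cdot> g = g" "Str C f' \<cdot> f' = Str C g \<cdot> g"
          using Suc.IH m by (metis less_imp_le)
        have gt [simp]: "g \<in> Arr C" "Dom C g = x" "Cod C g = x" using g by (auto simp: in_Hom_iff)
        \<comment> \<open>The new row of the triangular matrix.\<close>
        define w where "w = (1 / complex_of_real (sqrt c)) \<odot> (Str C u \<cdot> f)"
        have wt [simp]: "w \<in> Arr C" "Dom C w = x" "Cod C w = s m" by (simp_all add: w_def)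
        have cc: "complex_of_real (sqrt c) * complex_of_real (sqrt c) = complex_of_real c"
          using c(1) by (simp flip: of_real_mult)
        have vm: "Str C (v m) \<cdot> v m = Idn C (s m)" using v m unfolding is_direct_sum_def by auto
        have vg: "Str C (v m) \<cdot> g = Zer C x (s m)" 
          using reduce[OF ve[OF m], of g] g(2) by simp
        have gv: "Str C g \<cdot> v m = Zer C (s m) x" using arg_cong[OF vg, of "Str C"] by simp
        have ww: "Str C w \<cdot> w = Str C f \<cdot> q \<cdot> f" 
          by (simp add: w_def q_def cc)
        have ff: "Str C f' \<cdot> f' = Str C f \<cdot> f \<oplus> (-1) \<odot> (Str C f \<cdot> q \<cdot> f)"
          using reduce[OF qq, of f] by (simp add: f'_def Add_Cmp' Cmp_Add' qs)
        have "Str C (g \<oplus> v m \<cdot> w) \<cdot> (g \<oplus> v m \<cdot> w) = Str C g \<cdot> g \<oplus> Str C w \<cdot> w"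
          using reduce[OF vm, of w] reduce[OF vg] reduce[OF gv, of w]
          by (simp add: Add_Cmp' Cmp_Add' vg)
        also have "\<dots> = Str C f \<cdot> f"
          by (simp add: g(3)[symmetric] ff ww Add_assoc')
             (subst Add_commute'; simp)
        finally have 1: "Str C f \<cdot> f = Str C (g \<oplus> v m \<cdot> w) \<cdot> (g \<oplus> v m \<cdot> w)" by simp
        have "e m \<cdot> v m = Zer C (s m) x" 
        proof -
          have "Str C (e m) = e m" using t m unfolding e_def 
            by (subst Str_arr_sum) (auto simp: in_Hom_iff intro!: arr_sum_cong)
          then show ?thesis using arg_cong[OF ve[OF m], of "Str C"] by simp
        qed
        then have "e (Suc m) \<cdot> v m = v m" using vm by (simp add: eSuc Add_Cmp')
        then have "e (Suc m) \<cdot> (g \<oplus> v m \<cdot> w) = g \<oplus> v m \<cdot> w"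
          using eg[OF g(1,2)] reduce[of "e (Suc m)" "v m" "v m" w] et[OF Suc.prems] by (simp add: Cmp_Add')
        then show ?thesis using 1 by (intro bexI[of _ "g \<oplus> v m \<cdot> w"]) (auto simp: in_Hom_iff)
      qed
    qed
  qed
  from this[of n] show ?thesis using v f unfolding e_def is_direct_sum_def
    by (metis Cmp_Idn le_refl)
qed

end

section \<open>Norm bounds for *-functors\<close>

context cstar_category
begin

lemma Nrm_Zer [simp]: "\<lbrakk>x \<in> Obj C; y \<in> Obj C\<rbrakk> \<Longrightarrow> Nrm C (Zer C x y) = 0"
  using Nrm_eq_0[of "Zer C x y" x y] Zer_in by blast

lemma Nrm_Idn_le: assumes "x \<in> Obj C" shows "Nrm C (Idn C x) \<le> 1"
proof (rule ccontr)
  assume *: "\<not> Nrm C (Idn C x) \<le> 1"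
  have "Nrm C (Idn C x) = (Nrm C (Idn C x))\<^sup>2" using cstar_identity[of "Idn C x"] assms by simp
  then show False using * by (simp add: power2_eq_square)
qed

lemma Nrm_isometry_le:
  assumes "v \<in> Arr C" "Str C v \<cdot> v = Idn C (Dom C v)" shows "Nrm C v \<le> 1"
  using cstar_identity[OF assms(1)] assms Nrm_Idn_le[of "Dom C v"]
  by (intro power2_le_imp_le[of "Nrm C v" 1]) auto

lemma Nrm_Cmp': "\<lbrakk>g \<in> Arr C; f \<in> Arr C; Dom C g = Cod C f\<rbrakk> \<Longrightarrow> Nrm C (g \<cdot> f) \<le> Nrm C g * Nrm C f"
  using Nrm_Cmp[of g "Cod C f" "Cod C g" f "Dom C f"] by (simp add: in_Hom_iff)

lemma Nrm_Str_le: assumes f: "f \<in> Arr C" shows "Nrm C (Str C f) \<le> Nrm C f"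
proof (cases "Nrm C (Str C f) = 0")
  case False
  have "(Nrm C (Str C f))\<^sup>2 \<le> Nrm C f * Nrm C (Str C f)"
    using cstar_identity[of "Str C f"] Nrm_Cmp'[of f "Str C f"] f by simp
  then show ?thesis using False Nrm_ge_0[of "Str C f"] f by (simp add: power2_eq_square)
qed (use Nrm_ge_0 f in auto)

lemma Nrm_arr_sum_le:
  assumes "x \<in> Obj C" "y \<in> Obj C" "\<And>i. i < n \<Longrightarrow> f i \<in> Hom C x y" "\<And>i. i < n \<Longrightarrow> Nrm C (f i) \<le> b"
  shows "Nrm C (arr_sum C x y n f) \<le> real n * b"
  using assms(3,4)
proof (induction n)
  case (Suc n)
  have "Nrm C (arr_sum C x y n f \<oplus> f n) \<le> Nrm C (arr_sum C x y n f) + Nrm C (f n)"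
    using Suc.prems(1) assms(1,2) by (intro Nrm_Add[of _ x y]) (auto simp: in_Hom_iff intro!: arr_sum_typ)
  also have "\<dots> \<le> real n * b + b" using Suc by (intro add_mono) auto
  finally show ?case by (simp add: algebra_simps)
qed (use assms(1,2) in simp)

end

context semisimple_cstar_category
begin

text \<open>Endomorphisms of \<open>s\<close> are scalars \<open>a\<close>, so the positivity axiom makes \<open>u\<^sup>* u\<close> equal to some \<open>|a|\<^sup>2\<close>.\<close>

lemma simple_square:
  assumes s: "simple C s" and u: "u \<in> Arr C" "Dom C u = s"
  shows "\<exists>c\<ge>0. Str C u \<cdot> u = complex_of_real c \<odot> Idn C s"
proof -
  obtain g where g: "g \<in> Hom C s s" "Str C u \<cdot> u = Str C g \<cdot> g"
    using positivity[of u s "Cod C u"] u by (auto simp: in_Hom_iff)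
  obtain a where a: "g = a \<odot> Idn C s" using s g(1) unfolding simple_def by blast
  have "Str C u \<cdot> u = complex_of_real ((cmod a)\<^sup>2) \<odot> Idn C s"
    using s by (simp add: g(2) a complex_norm_square mult.commute del: of_real_power)
  then show ?thesis by (intro exI[of _ "(cmod a)\<^sup>2"]) auto
qed

lemma fin_dim_end: "x \<in> Obj C \<Longrightarrow> fin_dim_end C x"
  using semisimple fin_dim_end_if_semisimple by metis

end

locale semisimple_functor = functor_pair A B F + A: semisimple_cstar_category A + B: cstar_category B
  for A :: "'u cat" and B :: "'u cat" and F :: "'u func"
begin

lemma Nrm_simple:
  assumes s: "simple A s" and u: "u \<in> Arr A" "Dom A u = s"
  shows "Nrm B (farr F u) \<le> Nrm A u"
proof -
  note [simp] = A.simple_obj[OF s]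
  obtain c where c: "c \<ge> 0" "Str A u \<cdot>\<^bsub>A\<^esub> u = complex_of_real c \<odot>\<^bsub>A\<^esub> Idn A s"
    using A.simple_square[OF s u] by blast
  have "Nrm A (Idn A s) \<noteq> 0"
    using s A.Nrm_eq_0[OF A.Idn_in[of s]] unfolding simple_def by simp
  moreover have "Nrm A (Idn A s) = (Nrm A (Idn A s))\<^sup>2" using A.cstar_identity[of "Idn A s"] by simp
  ultimately have "Nrm A (Idn A s) = 1" by (simp add: power2_eq_square)
  then have 1: "(Nrm A u)\<^sup>2 = c" using c u A.cstar_identity[of u] by (simp add: A.Nrm_Scl)
  have "(Nrm B (farr F u))\<^sup>2 = Nrm B (farr F (Str A u \<cdot>\<^bsub>A\<^esub> u))"
    using u B.cstar_identity[of "farr F u"] by simp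
  also have "\<dots> = c * Nrm B (Idn B (fobj F s))" using c by (simp add: B.Nrm_Scl)
  also have "\<dots> \<le> c" using c(1) B.Nrm_Idn_le[of "fobj F s"] by (simp add: mult_left_le)
  finally have "(Nrm B (farr F u))\<^sup>2 \<le> (Nrm A u)\<^sup>2" using 1 by simp
  then show ?thesis using A.Nrm_ge_0[OF u(1)] by (rule power2_le_imp_le)
qed

text \<open>On arrows out of a simple object \<open>F\<close> is contractive, since the scalar \<open>u\<^sup>* u\<close> is preserved. Restricting
\<open>f\<close> to the \<open>n\<close> simple summands of \<open>x\<close> gives the bound \<open>n\<close>. That is cruder than the true bound 1,
but it suffices to see that limits of module maps are module maps.\<close>

lemma farr_bounded:
  assumes x: "x \<in> Obj A"
  shows "\<exists>b\<ge>0. \<forall>f\<in>Arr A. Dom A f = x \<longrightarrow> Nrm B (farr F f) \<le> b * Nrm A f"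
proof -
  obtain n s v where s: "\<And>i. i < n \<Longrightarrow> simple A (s i)" and v: "is_direct_sum A n s x v"
    using A.semisimple[OF x] by blast
  note t [simp] = A.is_direct_sum_typ[OF v]
  have vv: "Str A (v i) \<cdot>\<^bsub>A\<^esub> v i = Idn A (s i)" if "i < n" for i
    using v that unfolding is_direct_sum_def by auto
  have "Nrm B (farr F f) \<le> real n * Nrm A f" if f: "f \<in> Arr A" "Dom A f = x" for f
  proof -
    define y where "y = Cod A f"
    have [simp]: "y \<in> Obj A" "Cod A f = y" using f by (auto simp: y_def)
    have "f = f \<cdot>\<^bsub>A\<^esub> arr_sum A x x n (\<lambda>i. v i \<cdot>\<^bsub>A\<^esub> Str A (v i))"
      using v f unfolding is_direct_sum_def by simp
    also have "\<dots> = arr_sum A x y n (\<lambda>i. f \<cdot>\<^bsub>A\<^esub> v i \<cdot>\<^bsub>A\<^esub> Str A (v i))"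
      using f by (subst A.Cmp_arr_sum) (auto simp: A.in_Hom_iff)
    finally have "farr F f = farr F (arr_sum A x y n (\<lambda>i. f \<cdot>\<^bsub>A\<^esub> v i \<cdot>\<^bsub>A\<^esub> Str A (v i)))"
      by (rule arg_cong)
    also have "\<dots> = arr_sum B (fobj F x) (fobj F y) n (\<lambda>i. farr F (f \<cdot>\<^bsub>A\<^esub> v i \<cdot>\<^bsub>A\<^esub> Str A (v i)))"
      using f by (intro farr_arr_sum) (auto simp: A.in_Hom_iff)
    finally have eq: "farr F f = arr_sum B (fobj F x) (fobj F y) n (\<lambda>i. farr F (f \<cdot>\<^bsub>A\<^esub> v i \<cdot>\<^bsub>A\<^esub> Str A (v i)))" .
    have bnd: "Nrm B (farr F (f \<cdot>\<^bsub>A\<^esub> v i \<cdot>\<^bsub>A\<^esub> Str A (v i))) \<le> Nrm A f" if i: "i < n" for i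
    proof -
      have "Nrm B (farr F (f \<cdot>\<^bsub>A\<^esub> v i \<cdot>\<^bsub>A\<^esub> Str A (v i)))
          = Nrm B (farr F (f \<cdot>\<^bsub>A\<^esub> v i) \<cdot>\<^bsub>B\<^esub> Str B (farr F (v i)))"
        using i f by simp
      also have "\<dots> \<le> Nrm B (farr F (f \<cdot>\<^bsub>A\<^esub> v i)) * Nrm B (Str B (farr F (v i)))"
        using i f by (intro B.Nrm_Cmp') auto
      also have "\<dots> \<le> Nrm A (f \<cdot>\<^bsub>A\<^esub> v i) * 1"
      proof (intro mult_mono)
        show "Nrm B (farr F (f \<cdot>\<^bsub>A\<^esub> v i)) \<le> Nrm A (f \<cdot>\<^bsub>A\<^esub> v i)" using i f s by (intro Nrm_simple[of "s i"]) auto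
        have "Str B (farr F (v i)) \<cdot>\<^bsub>B\<^esub> farr F (v i) = Idn B (Dom B (farr F (v i)))"
          using i arg_cong[OF vv[OF i], of "farr F"] by simp
        then have "Nrm B (farr F (v i)) \<le> 1" using i by (intro B.Nrm_isometry_le) auto
        then show "Nrm B (Str B (farr F (v i))) \<le> 1" using B.Nrm_Str_le[of "farr F (v i)"] i by simp
      qed (use i f A.Nrm_ge_0 B.Nrm_ge_0 in auto)
      also have "\<dots> \<le> Nrm A f * Nrm A (v i)" using A.Nrm_Cmp'[of f "v i"] i f by simp
      also have "\<dots> \<le> Nrm A f" using A.Nrm_isometry_le[of "v i"] vv i f A.Nrm_ge_0[of f]
        by (simp add: mult_left_le)
      finally show ?thesis .
    qed
    show ?thesis unfolding eq using f bnd
      by (intro B.Nrm_arr_sum_le) (auto simp: B.in_Hom_iff simp del: farr_Cmp')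
  qed
  then show ?thesis by (intro exI[of _ "real n"]) auto
qed

end

section \<open>Modules over a Q-system of functors\<close>

definition enc :: "'u \<times> 'u \<times> 'u \<Rightarrow> 'u" where "enc = (SOME e. inj e)"

lemma inj_enc: 
  assumes "infinite (UNIV :: 'u set)" shows "inj (enc :: 'u \<times> 'u \<times> 'u \<Rightarrow> 'u)"
proof -
  obtain p :: "'u \<times> 'u \<Rightarrow> 'u" where p: "inj p" 
    using card_of_Times_same_infinite[OF assms] unfolding card_of_ordIso[symmetric] bij_betw_def by auto
  have "inj (\<lambda>(x, y, z). p (x, p (y, z)))"
    by (auto intro!: injI dest!: injD[OF p])
  then show ?thesis unfolding enc_def by (rule someI[where P = inj])
qed

text \<open>A module is represented by its action \<open>r : Q x \<rightarrow> x\<close>, which determines \<open>x\<close>. The last equation is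
unitarity: \<open>r\<^sup>*\<close> is the coaction that the Frobenius structure of \<open>Q\<close> attaches to \<open>r\<close>.\<close>

definition is_module :: "'u cat \<Rightarrow> 'u func \<Rightarrow> ('u \<Rightarrow> 'u) \<Rightarrow> ('u \<Rightarrow> 'u) \<Rightarrow> 'u \<Rightarrow> bool" where
  "is_module M Q m i r \<longleftrightarrow> (let x = Cod M r in r \<in> Hom M (fobj Q x) x \<and>
    r \<cdot>\<^bsub>M\<^esub> farr Q r = r \<cdot>\<^bsub>M\<^esub> m x \<and> r \<cdot>\<^bsub>M\<^esub> i x = Idn M x \<and>
    Str M r = farr Q r \<cdot>\<^bsub>M\<^esub> Str M (m x) \<cdot>\<^bsub>M\<^esub> i x)"

definition mod_hom :: "'u cat \<Rightarrow> 'u func \<Rightarrow> 'u \<Rightarrow> 'u \<Rightarrow> 'u \<Rightarrow> bool" where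
  "mod_hom M Q r s f \<longleftrightarrow> f \<in> Hom M (Cod M r) (Cod M s) \<and> f \<cdot>\<^bsub>M\<^esub> r = s \<cdot>\<^bsub>M\<^esub> farr Q f"

definition src :: "'u \<Rightarrow> 'u" where "src a = fst (inv enc a)"
definition tgt :: "'u \<Rightarrow> 'u" where "tgt a = fst (snd (inv enc a))"
definition und :: "'u \<Rightarrow> 'u" where "und a = snd (snd (inv enc a))"

text \<open>An underlying arrow may carry module maps between many pairs of modules, so source and target are
recorded with it.\<close>

definition Mod :: "'u cat \<Rightarrow> 'u func \<Rightarrow> ('u \<Rightarrow> 'u) \<Rightarrow> ('u \<Rightarrow> 'u) \<Rightarrow> 'u cat" where
  "Mod M Q m i = 
    \<lparr>Obj = {r. is_module M Q m i r},
     Arr = {enc (r, s, f) | r s f. is_module M Q m i r \<and> is_module M Q m i s \<and> mod_hom M Q r s f},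
     Dom = src, Cod = tgt,
     Idn = (\<lambda>r. enc (r, r, Idn M (Cod M r))),
     Cmp = (\<lambda>b a. enc (src a, tgt b, und b \<cdot>\<^bsub>M\<^esub> und a)),
     Zer = (\<lambda>r s. enc (r, s, Zer M (Cod M r) (Cod M s))),
     Add = (\<lambda>a b. enc (src a, tgt a, und a \<oplus>\<^bsub>M\<^esub> und b)),
     Scl = (\<lambda>c a. enc (src a, tgt a, c \<odot>\<^bsub>M\<^esub> und a)),
     Str = (\<lambda>a. enc (tgt a, src a, Str M (und a))),
     Nrm = (\<lambda>a. Nrm M (und a))\<rparr>"

text \<open>A Q-system at a single level, written out on objects.\<close>

locale Q_monad = M: finite_semisimple_cstar_category M + Q: functor_pair M M Q
  for M :: "'u cat" (structure) and Q :: "'u func" +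
  fixes m i :: "'u \<Rightarrow> 'u"
  assumes infinite_universe: "infinite (UNIV :: 'u set)"
    and m_in: "x \<in> Obj M \<Longrightarrow> m x \<in> Hom M (fobj Q (fobj Q x)) (fobj Q x)"
    and i_in: "x \<in> Obj M \<Longrightarrow> i x \<in> Hom M x (fobj Q x)"
    and m_nat: "\<lbrakk>f \<in> Arr M; Cod M f = y\<rbrakk> \<Longrightarrow> m y \<cdot> farr Q (farr Q f) = farr Q f \<cdot> m (Dom M f)"
    and i_nat: "\<lbrakk>f \<in> Arr M; Cod M f = y\<rbrakk> \<Longrightarrow> i y \<cdot> f = farr Q f \<cdot> i (Dom M f)"
    and m_assoc: "x \<in> Obj M \<Longrightarrow> m x \<cdot> m (fobj Q x) = m x \<cdot> farr Q (m x)"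
    and m_unit_left: "x \<in> Obj M \<Longrightarrow> m x \<cdot> i (fobj Q x) = Idn M (fobj Q x)"
    and m_unit_right: "x \<in> Obj M \<Longrightarrow> m x \<cdot> farr Q (i x) = Idn M (fobj Q x)"
    and frobenius_left: "x \<in> Obj M \<Longrightarrow> farr Q (m x) \<cdot> Str M (m (fobj Q x)) = Str M (m x) \<cdot> m x"
    and m_isometry: "x \<in> Obj M \<Longrightarrow> m x \<cdot> Str M (m x) = Idn M (fobj Q x)"
begin

abbreviation "Qo \<equiv> fobj Q"
abbreviation "Qa \<equiv> farr Q"
abbreviation "qmod \<equiv> is_module M Q m i"
abbreviation "hom \<equiv> mod_hom M Q"
abbreviation "D \<equiv> Mod M Q m i"

lemma m_typ [simp]: 
  "x \<in> Obj M \<Longrightarrow> m x \<in> Arr M" "x \<in> Obj M \<Longrightarrow> Dom M (m x) = Qo (Qo x)" "x \<in> Obj M \<Longrightarrow> Cod M (m x) = Qo x"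
  using m_in[of x] by (auto simp: M.in_Hom_iff)

lemma i_typ [simp]: 
  "x \<in> Obj M \<Longrightarrow> i x \<in> Arr M" "x \<in> Obj M \<Longrightarrow> Dom M (i x) = x" "x \<in> Obj M \<Longrightarrow> Cod M (i x) = Qo x"
  using i_in[of x] by (auto simp: M.in_Hom_iff)

lemma Str_m_nat: 
  assumes "f \<in> Arr M" "Cod M f = y" "Dom M f = x" 
  shows "Str M (m y) \<cdot> Qa f = Qa (Qa f) \<cdot> Str M (m x)"
proof -
  have "m x \<cdot> Qa (Qa (Str M f)) = Qa (Str M f) \<cdot> m y" using m_nat[of "Str M f" x] assms by auto
  from arg_cong[OF this, of "Str M"] show ?thesis using assms by auto
qed

lemma moduleD:
  assumes "qmod r" "Cod M r = x"
  shows "r \<in> Arr M" "Dom M r = Qo x" "x \<in> Obj M" "r \<cdot> Qa r = r \<cdot> m x" "r \<cdot> i x = Idn M x"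
    "Str M r = Qa r \<cdot> Str M (m x) \<cdot> i x"
  using assms unfolding is_module_def Let_def M.in_Hom_iff by auto

lemma moduleI:
  assumes "r \<in> Arr M" "Dom M r = Qo x" "Cod M r = x" "r \<cdot> Qa r = r \<cdot> m x" "r \<cdot> i x = Idn M x"
    "Str M r = Qa r \<cdot> Str M (m x) \<cdot> i x"
  shows "qmod r"
  using assms unfolding is_module_def Let_def M.in_Hom_iff by auto

lemma homD:
  assumes "hom r s f"
  shows "f \<in> Arr M" "Dom M f = Cod M r" "Cod M f = Cod M s" "f \<cdot> r = s \<cdot> Qa f"
  using assms unfolding mod_hom_def M.in_Hom_iff by auto

lemma homI:
  assumes "f \<in> Arr M" "Dom M f = Cod M r" "Cod M f = Cod M s" "f \<cdot> r = s \<cdot> Qa f"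
  shows "hom r s f"
  using assms unfolding mod_hom_def M.in_Hom_iff by auto

text \<open>\<open>r r\<^sup>* = r Q(r) m\<^sup>* i = r m m\<^sup>* i = r i = 1\<close>.\<close>

lemma module_isometry:
  assumes r: "qmod r" "Cod M r = x"
  shows "r \<cdot> Str M r = Idn M x"
proof -
  note d [simp] = moduleD[OF r] r(2)
  have "r \<cdot> Str M r = (r \<cdot> Qa r) \<cdot> Str M (m x) \<cdot> i x" by (simp del: d(4,5))
  also have "\<dots> = r \<cdot> m x \<cdot> Str M (m x) \<cdot> i x" by simp
  also have "\<dots> = r \<cdot> i x" using M.reduce[OF m_isometry[OF d(3)], of "i x"] by (simp del: d(4-6))
  finally show ?thesis by simp
qed

text \<open>Here the unitarity of both modules enters, in the form \<open>s = i\<^sup>* m Q(s\<^sup>*)\<close>: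
\<open>f\<^sup>* s = i\<^sup>* Q(f\<^sup>*) m Q(s\<^sup>*) = i\<^sup>* m Q(Q(f\<^sup>*) s\<^sup>*) = i\<^sup>* m Q(r\<^sup>* f\<^sup>*) = r Q(f\<^sup>*)\<close>.\<close>

lemma hom_Str:
  assumes r: "qmod r" and s: "qmod s" and f: "hom r s f"
  shows "hom s r (Str M f)"
proof -
  define x y where "x = Cod M r" and "y = Cod M s"
  note R = moduleD[OF r x_def[symmetric]] and S = moduleD[OF s y_def[symmetric]]
  note F = homD[OF f, folded x_def y_def]
  note [simp] = R(1-3) S(1-3) F(1-3) x_def[symmetric] y_def[symmetric]
  have rs: "r = Str M (i x) \<cdot> m x \<cdot> Str M (Qa r)" and ss: "s = Str M (i y) \<cdot> m y \<cdot> Str M (Qa s)"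
    using arg_cong[OF R(6), of "Str M"] arg_cong[OF S(6), of "Str M"] by simp_all
  have "Str M f \<cdot> s = (Str M f \<cdot> Str M (i y)) \<cdot> m y \<cdot> Str M (Qa s)" by (subst ss) simp
  also have "Str M f \<cdot> Str M (i y) = Str M (i x) \<cdot> Qa (Str M f)"
    using arg_cong[OF i_nat[of f y], of "Str M"] by simp
  also have "(Str M (i x) \<cdot> Qa (Str M f)) \<cdot> m y \<cdot> Str M (Qa s) = Str M (i x) \<cdot> (Qa (Str M f) \<cdot> m y) \<cdot> Qa (Str M s)"
    by simp
  also have "Qa (Str M f) \<cdot> m y = m x \<cdot> Qa (Qa (Str M f))"
    using m_nat[of "Str M f" x] by simp
  also have "Str M (i x) \<cdot> (m x \<cdot> Qa (Qa (Str M f))) \<cdot> Qa (Str M s) 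
      = Str M (i x) \<cdot> m x \<cdot> Qa (Str M (s \<cdot> Qa f))" by simp
  also have "s \<cdot> Qa f = f \<cdot> r" by (simp add: F(4))
  also have "Str M (i x) \<cdot> m x \<cdot> Qa (Str M (f \<cdot> r)) = (Str M (i x) \<cdot> m x \<cdot> Str M (Qa r)) \<cdot> Qa (Str M f)"
    by simp
  also have "\<dots> = r \<cdot> Qa (Str M f)" using rs by simp
  finally show ?thesis by (intro homI) auto
qed

lemma dec_enc [simp]: "src (enc (r, s, f)) = (r :: 'u)" "tgt (enc (r, s, f)) = (s :: 'u)" 
  "und (enc (r, s, f)) = (f :: 'u)"
  using inj_enc[OF infinite_universe] by (simp_all add: src_def tgt_def und_def)

lemma enc_eq_iff [simp]: "enc (r, s, f) = enc (r', s', f') \<longleftrightarrow> r = r' \<and> s = s' \<and> f = (f' :: 'u)"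
  using inj_enc[OF infinite_universe] by (auto simp: inj_eq)

lemma Hom_D: "Hom D r s = {enc (r, s, f) | f. qmod r \<and> qmod s \<and> hom r s f}"
  unfolding Hom_def Mod_def by auto

lemma Arr_D: "Arr D = {enc (r, s, f) | r s f. qmod r \<and> qmod s \<and> hom r s f}"
  and Obj_D: "Obj D = {r. qmod r}"
  unfolding Mod_def by auto

lemma D_simps:
  "Dom D (enc (r, s, f)) = r" "Cod D (enc (r, s, f)) = s"
  "Idn D r = enc (r, r, Idn M (Cod M r))" "Zer D r s = enc (r, s, Zer M (Cod M r) (Cod M s))"
  "enc (s', t, g) \<cdot>\<^bsub>D\<^esub> enc (r, s, f) = enc (r, t, g \<cdot> f)"
  "enc (r, s, f) \<oplus>\<^bsub>D\<^esub> enc (r', s', f') = enc (r, s, f \<oplus> f')"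
  "c \<odot>\<^bsub>D\<^esub> enc (r, s, f) = enc (r, s, c \<odot> f)"
  "Str D (enc (r, s, f)) = enc (s, r, Str M f)" "Nrm D (enc (r, s, f)) = Nrm M f"
  unfolding Mod_def by simp_all

lemma module_typ [simp]:
  assumes "qmod r"
  shows "r \<in> Arr M" "Dom M r = Qo (Cod M r)" "Cod M r \<in> Obj M"
  using moduleD[OF assms refl] by auto

lemma hom_Idn [simp]: "qmod r \<Longrightarrow> hom r r (Idn M (Cod M r))"
  by (intro homI) auto

lemma hom_Zer [simp]: "qmod r \<Longrightarrow> qmod s \<Longrightarrow> hom r s (Zer M (Cod M r) (Cod M s))"
  by (intro homI) auto

lemma hom_Cmp:
  assumes "qmod r" "qmod s" "qmod t" and g: "hom s t g" and f: "hom r s f" 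
  shows "hom r t (g \<cdot> f)"
proof (intro homI)
  note [simp] = assms(1-3) homD(1-3)[OF g] homD(1-3)[OF f]
  show "(g \<cdot> f) \<cdot> r = t \<cdot> Qa (g \<cdot> f)" 
    using M.reduce[OF homD(4)[OF g], of "Qa f"] by (simp add: homD(4)[OF f])
qed (use assms homD(1-3)[OF g] homD(1-3)[OF f] in auto)

lemma hom_Add:
  assumes "qmod r" "qmod s" and g: "hom r s g" and f: "hom r s f" 
  shows "hom r s (g \<oplus> f)"
  using assms homD[OF g] homD[OF f] by (intro homI) (auto simp: M.Add_Cmp' M.Cmp_Add')

lemma hom_Scl:
  assumes "qmod r" "qmod s" and f: "hom r s f" 
  shows "hom r s (a \<odot> f)"
  using assms homD[OF f] by (intro homI) auto

lemma star_category_D: "star_category D"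
proof
  fix f assume "f \<in> Arr D" then show "Dom D f \<in> Obj D" "Cod D f \<in> Obj D"
    by (auto simp: Arr_D Obj_D D_simps)
next
  fix x assume "x \<in> Obj D" then show "Idn D x \<in> Hom D x x"
    by (auto simp: Obj_D Hom_D D_simps)
next
  fix g y z f x assume "g \<in> Hom D y z" "f \<in> Hom D x y" then show "g \<cdot>\<^bsub>D\<^esub> f \<in> Hom D x z"
    by (auto simp: Hom_D D_simps intro: hom_Cmp)
next
  fix f x y assume "f \<in> Hom D x y" 
  then obtain g where f: "f = enc (x, y, g)" "qmod x" "qmod y" "hom x y g" by (auto simp: Hom_D)
  note [simp] = f homD(1-3)[OF f(4)]
  show "f \<cdot>\<^bsub>D\<^esub> Idn D x = f" "Idn D y \<cdot>\<^bsub>D\<^esub> f = f" "a \<odot>\<^bsub>D\<^esub> f \<in> Hom D x y" "f \<oplus>\<^bsub>D\<^esub> Zer D x y = f"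
    "f \<oplus>\<^bsub>D\<^esub> (- 1) \<odot>\<^bsub>D\<^esub> f = Zer D x y" "a \<odot>\<^bsub>D\<^esub> (b \<odot>\<^bsub>D\<^esub> f) = (a * b) \<odot>\<^bsub>D\<^esub> f" "1 \<odot>\<^bsub>D\<^esub> f = f" 
    "(a + b) \<odot>\<^bsub>D\<^esub> f = a \<odot>\<^bsub>D\<^esub> f \<oplus>\<^bsub>D\<^esub> b \<odot>\<^bsub>D\<^esub> f" "Str D f \<in> Hom D y x" for a b
    by (simp_all add: D_simps Hom_D hom_Scl hom_Str M.add_Scl')
next
  fix h y z g x f w assume "h \<in> Hom D y z" "g \<in> Hom D x y" "f \<in> Hom D w x" 
  then show "(h \<cdot>\<^bsub>D\<^esub> g) \<cdot>\<^bsub>D\<^esub> f = h \<cdot>\<^bsub>D\<^esub> g \<cdot>\<^bsub>D\<^esub> f"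
    by (auto simp: Hom_D D_simps mod_hom_def M.in_Hom_iff)
next
  fix x y assume "x \<in> Obj D" "y \<in> Obj D" then show "Zer D x y \<in> Hom D x y"
    by (auto simp: Hom_D D_simps Obj_D)
next
  fix f g x y assume "f \<in> Hom D x y" "g \<in> Hom D x y" 
  then obtain f' g' where f: "f = enc (x, y, f')" "g = enc (x, y, g')" "qmod x" "qmod y" "hom x y f'" "hom x y g'" 
    by (auto simp: Hom_D)
  note [simp] = f homD(1-3)[OF f(5)] homD(1-3)[OF f(6)]
  show "f \<oplus>\<^bsub>D\<^esub> g \<in> Hom D x y" "a \<odot>\<^bsub>D\<^esub> (f \<oplus>\<^bsub>D\<^esub> g) = a \<odot>\<^bsub>D\<^esub> f \<oplus>\<^bsub>D\<^esub> a \<odot>\<^bsub>D\<^esub> g"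
    "Str D (f \<oplus>\<^bsub>D\<^esub> g) = Str D f \<oplus>\<^bsub>D\<^esub> Str D g" for a
    by (simp_all add: Hom_D D_simps hom_Add M.Scl_Add')
  show "f \<oplus>\<^bsub>D\<^esub> g = g \<oplus>\<^bsub>D\<^esub> f" by (simp add: D_simps) (rule M.Add_commute'; simp)
next
  fix f g h x y assume "f \<in> Hom D x y" "g \<in> Hom D x y" "h \<in> Hom D x y" 
  then show "f \<oplus>\<^bsub>D\<^esub> g \<oplus>\<^bsub>D\<^esub> h = f \<oplus>\<^bsub>D\<^esub> (g \<oplus>\<^bsub>D\<^esub> h)"
    by (auto simp: Hom_D D_simps M.Add_assoc' mod_hom_def M.in_Hom_iff)
next
  fix g y z f f' x assume "g \<in> Hom D y z" "f \<in> Hom D x y" "f' \<in> Hom D x y" 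
  then show "g \<cdot>\<^bsub>D\<^esub> (f \<oplus>\<^bsub>D\<^esub> f') = g \<cdot>\<^bsub>D\<^esub> f \<oplus>\<^bsub>D\<^esub> g \<cdot>\<^bsub>D\<^esub> f'"
    by (auto simp: Hom_D D_simps M.Cmp_Add' mod_hom_def M.in_Hom_iff)
next
  fix g g' y z f x assume "g \<in> Hom D y z" "g' \<in> Hom D y z" "f \<in> Hom D x y" 
  then show "(g \<oplus>\<^bsub>D\<^esub> g') \<cdot>\<^bsub>D\<^esub> f = g \<cdot>\<^bsub>D\<^esub> f \<oplus>\<^bsub>D\<^esub> g' \<cdot>\<^bsub>D\<^esub> f"
    by (auto simp: Hom_D D_simps M.Add_Cmp' mod_hom_def M.in_Hom_iff)
next
  fix g y z f x a assume "g \<in> Hom D y z" "f \<in> Hom D x y" 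
  then show "g \<cdot>\<^bsub>D\<^esub> (a \<odot>\<^bsub>D\<^esub> f) = a \<odot>\<^bsub>D\<^esub> (g \<cdot>\<^bsub>D\<^esub> f)" "(a \<odot>\<^bsub>D\<^esub> g) \<cdot>\<^bsub>D\<^esub> f = a \<odot>\<^bsub>D\<^esub> (g \<cdot>\<^bsub>D\<^esub> f)"
    "Str D (g \<cdot>\<^bsub>D\<^esub> f) = Str D f \<cdot>\<^bsub>D\<^esub> Str D g" for a
    by (auto simp: Hom_D D_simps mod_hom_def M.in_Hom_iff)
next
  fix f a assume "f \<in> Arr D" 
  then show "Str D (Str D f) = f" "Str D (a \<odot>\<^bsub>D\<^esub> f) = cnj a \<odot>\<^bsub>D\<^esub> Str D f"
    by (auto simp: Arr_D D_simps mod_hom_def M.in_Hom_iff)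
qed

end

section \<open>The category of modules is finite semisimple\<close>

context category
begin

lemma finite_simples_reps:
  assumes "finite ({s. simple C s} // {(s, t). simple C s \<and> simple C t \<and> iso_obj C s t})"
  obtains R where "finite R" "\<And>s. s \<in> R \<Longrightarrow> simple C s" "\<And>t. simple C t \<Longrightarrow> \<exists>s\<in>R. iso_obj C s t"
proof -
  define E where "E = {(s, t). simple C s \<and> simple C t \<and> iso_obj C s t}"
  have *: "\<exists>s. s \<in> c" "\<And>s. s \<in> c \<Longrightarrow> simple C s" if "c \<in> {s. simple C s} // E" for c
    using that iso_obj_refl unfolding quotient_def E_def simple_def by auto
  define R where "R = (\<lambda>c. SOME s. s \<in> c) ` ({s. simple C s} // E)"
  show ?thesis
  proof
    show "finite R" using assms unfolding R_def E_def by simp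
    show "simple C s" if "s \<in> R" for s
      using that *(1) *(2)[OF _ someI_ex[OF *(1)]] unfolding R_def by blast
    fix t assume t: "simple C t"
    define c where "c = E `` {t}"
    have c: "c \<in> {s. simple C s} // E" using t unfolding c_def by (auto intro: quotientI)
    then have "(SOME s. s \<in> c) \<in> c" using *(1) by (auto intro: someI_ex)
    then have "iso_obj C t (SOME s. s \<in> c)" unfolding c_def E_def by blast
    then show "\<exists>s\<in>R. iso_obj C s t" using c iso_obj_sym unfolding R_def by blast
  qed
qed

lemma finite_simples_if_reps:
  assumes "finite R" "\<And>t. simple C t \<Longrightarrow> \<exists>s\<in>R. iso_obj C s t"
  shows "finite ({s. simple C s} // {(s, t). simple C s \<and> simple C t \<and> iso_obj C s t})"
proof (rule finite_subset)
  show "{s. simple C s} // {(s, t). simple C s \<and> simple C t \<and> iso_obj C s t} 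
      \<subseteq> (\<lambda>s. {t. simple C t \<and> iso_obj C s t}) ` R"
  proof
    fix c assume "c \<in> {s. simple C s} // {(s, t). simple C s \<and> simple C t \<and> iso_obj C s t}"
    then obtain t where t: "simple C t" "c = {u. simple C u \<and> iso_obj C t u}"
      unfolding quotient_def by auto
    obtain s where s: "s \<in> R" "iso_obj C s t" using assms(2)[OF t(1)] by blast
    have "c = {u. simple C u \<and> iso_obj C s u}"
      unfolding t(2) using s(2) iso_obj_sym iso_obj_trans by blast
    then show "c \<in> (\<lambda>s. {t. simple C t \<and> iso_obj C s t}) ` R" using s(1) by blast
  qed
qed (use assms(1) in simp)

end

sublocale Q_monad \<subseteq> Q: semisimple_functor M M Q ..

context Q_monad
begin

interpretation D: star_category D by (rule star_category_D)

lemma proper_D: "proper_star_category D"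
proof
  fix f assume f: "f \<in> Arr D" "Str D f \<cdot>\<^bsub>D\<^esub> f = Zer D (Dom D f) (Dom D f)"
  then obtain r s g where g: "f = enc (r, s, g)" "qmod r" "qmod s" "hom r s g" by (auto simp: Arr_D)
  have "Str M g \<cdot> g = Zer M (Cod M r) (Cod M r)" using f(2) by (simp add: g(1) D_simps)
  then have "g = Zer M (Cod M r) (Cod M s)" using M.proper[of g] homD[OF g(4)] by simp
  then show "f = Zer D (Dom D f) (Cod D f)" by (simp add: g(1) D_simps)
qed

interpretation D: proper_star_category D by (rule proper_D)

text \<open>If \<open>v\<close> splits the projection in the underlying category, the action \<open>r\<close> compresses to \<open>v\<^sup>* r Q(v)\<close>.\<close>

lemma projections_split_D:
  assumes "p \<in> Hom D r r" "p \<cdot>\<^bsub>D\<^esub> p = p" "Str D p = p"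
  shows "\<exists>s \<in> Obj D. \<exists>v \<in> Hom D s r. Str D v \<cdot>\<^bsub>D\<^esub> v = Idn D s \<and> v \<cdot>\<^bsub>D\<^esub> Str D v = p"
proof -
  obtain q where q: "p = enc (r, r, q)" "qmod r" "hom r r q" using assms(1) by (auto simp: Hom_D)
  define x where "x = Cod M r"
  note rd [simp] = moduleD(1-3)[OF q(2) x_def[symmetric]] and [simp] = x_def[symmetric] 
  note r = moduleD(4-6)[OF q(2) x_def[symmetric]]
  have qt [simp]: "q \<in> Arr M" "Dom M q = x" "Cod M q = x" using homD[OF q(3)] by auto
  have qq: "q \<cdot> q = q" "Str M q = q" using assms(2,3) by (auto simp: q(1) D_simps)
  obtain z v where "z \<in> Obj M" "v \<in> Hom M z x" and vv: "Str M v \<cdot> v = Idn M z" "v \<cdot> Str M v = q"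
    using M.projections_split[of q x] qq by (auto simp: M.in_Hom_iff)
  then have [simp]: "z \<in> Obj M" "v \<in> Arr M" "Dom M v = z" "Cod M v = x" by (auto simp: M.in_Hom_iff)
  have qv: "q \<cdot> v = v" "Str M v \<cdot> q = Str M v" using vv(1) by (simp_all flip: vv(2) add: M.reduce[OF vv(1)])
  define s where "s = Str M v \<cdot> r \<cdot> Qa v"
  have st [simp]: "s \<in> Arr M" "Dom M s = Qo z" "Cod M s = z" by (simp_all add: s_def)
  have vs: "v \<cdot> s = r \<cdot> Qa v"
  proof -
    have "v \<cdot> s = (q \<cdot> r) \<cdot> Qa v" using M.reduce[OF vv(2), of "r \<cdot> Qa v"] by (simp add: s_def)
    also have "q \<cdot> r = r \<cdot> Qa q" using homD(4)[OF q(3)] .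
    also have "(r \<cdot> Qa q) \<cdot> Qa v = r \<cdot> Qa (q \<cdot> v)" by simp
    finally show ?thesis by (simp only: qv)
  qed
  have s: "qmod s"
  proof (rule moduleI)
    have "s \<cdot> Qa s = Str M v \<cdot> r \<cdot> Qa (v \<cdot> s)" by (simp add: s_def)
    also have "\<dots> = Str M v \<cdot> (r \<cdot> Qa r) \<cdot> Qa (Qa v)" by (simp add: vs)
    also have "\<dots> = Str M v \<cdot> r \<cdot> m x \<cdot> Qa (Qa v)" by (simp add: r)
    also have "\<dots> = s \<cdot> m z" by (simp add: s_def m_nat)
    finally show "s \<cdot> Qa s = s \<cdot> m z" .
    have "s \<cdot> i z = Str M v \<cdot> (r \<cdot> i x) \<cdot> v" by (simp add: s_def i_nat)
    then show "s \<cdot> i z = Idn M z" using vv by (simp add: r)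
    have "Str M s = Qa (Str M v) \<cdot> Str M r \<cdot> v" by (simp add: s_def)
    also have "\<dots> = Qa (Str M v) \<cdot> Qa r \<cdot> Str M (m x) \<cdot> Qa v \<cdot> i z" by (simp add: r i_nat)
    also have "\<dots> = Qa (Str M v) \<cdot> Qa r \<cdot> Qa (Qa v) \<cdot> Str M (m z) \<cdot> i z"
      using M.reduce[OF Str_m_nat[of v x z], of "i z"] by simp
    also have "\<dots> = Qa s \<cdot> Str M (m z) \<cdot> i z" by (simp add: s_def)
    finally show "Str M s = Qa s \<cdot> Str M (m z) \<cdot> i z" .
  qed simp_all
  have h: "hom s r v" by (rule homI) (simp_all add: vs)
  show ?thesis
    by (rule bexI[of _ s], rule bexI[of _ "enc (s, r, v)"]) (auto simp: Hom_D Obj_D D_simps s h q vv)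
qed

lemma fin_dim_end_D:
  assumes "qmod r" shows "fin_dim_end D r"
proof -
  define x where "x = Cod M r"
  have x: "x \<in> Obj M" using assms by (simp add: x_def)
  obtain K :: "('u \<Rightarrow> complex) set" where K: "finite K" 
    "\<forall>\<kappa>\<in>K. \<forall>f\<in>Hom M x x. \<forall>g\<in>Hom M x x. \<kappa> (f \<oplus> g) = \<kappa> f + \<kappa> g"
    "\<forall>\<kappa>\<in>K. \<forall>a. \<forall>f\<in>Hom M x x. \<kappa> (a \<odot> f) = a * \<kappa> f"
    "\<forall>f\<in>Hom M x x. (\<forall>\<kappa>\<in>K. \<kappa> f = 0) \<longrightarrow> f = Zer M x x"
    using M.fin_dim_end[OF x] unfolding fin_dim_end_def by (elim exE conjE) (rule that)
  define K' where "K' = (\<lambda>\<kappa> f. \<kappa> (und f)) ` K"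
  have H: "und f \<in> Hom M x x \<and> f = enc (r, r, und f)" if "f \<in> Hom D r r" for f
    using that by (auto simp: Hom_D mod_hom_def x_def)
  have U: "und (f \<oplus>\<^bsub>D\<^esub> g) = und f \<oplus> und g" "und (a \<odot>\<^bsub>D\<^esub> f) = a \<odot> und f" for f g a
    by (simp_all add: Mod_def)
  have "finite K'" using K(1) by (simp add: K'_def)
  moreover have "\<forall>\<kappa>\<in>K'. \<forall>f\<in>Hom D r r. \<forall>g\<in>Hom D r r. \<kappa> (f \<oplus>\<^bsub>D\<^esub> g) = \<kappa> f + \<kappa> g"
    using K(2) H unfolding K'_def by (simp add: U)
  moreover have "\<forall>\<kappa>\<in>K'. \<forall>a. \<forall>f\<in>Hom D r r. \<kappa> (a \<odot>\<^bsub>D\<^esub> f) = a * \<kappa> f"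
    using K(3) H unfolding K'_def by (simp add: U)
  moreover have "\<forall>f\<in>Hom D r r. (\<forall>\<kappa>\<in>K'. \<kappa> f = 0) \<longrightarrow> f = Zer D r r"
  proof (intro ballI impI)
    fix f assume f: "f \<in> Hom D r r" "\<forall>\<kappa>\<in>K'. \<kappa> f = 0"
    have "\<forall>\<kappa>\<in>K. \<kappa> (und f) = 0" using f(2) by (simp add: K'_def)
    then have "und f = Zer M x x" by (rule K(4)[THEN bspec, OF conjunct1[OF H[OF f(1)]], THEN mp])
    moreover have "f = enc (r, r, und f)" using H[OF f(1)] by blast
    ultimately show "f = Zer D r r" unfolding D_simps x_def by metis
  qed
  ultimately show ?thesis unfolding fin_dim_end_def by (intro exI[of _ K'] conjI)
qed

lemma semisimple_D:
  assumes "qmod r"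
  shows "\<exists>n s v. (\<forall>i<n. simple D (s i)) \<and> is_direct_sum D n s r v"
  by (rule D.semisimple_if_fin_dim_end)
    (use assms projections_split_D fin_dim_end_D in \<open>auto simp: Obj_D\<close>)

text \<open>The scalar \<open>u\<^sup>* u\<close> does not change when \<open>u\<close> is restricted to a simple summand of the underlying
object, and there it is nonnegative by positivity in \<open>M\<close>.\<close>

lemma simple_square_D:
  assumes s: "simple D s" and u: "u \<in> Arr D" "Dom D u = s"
  shows "\<exists>c\<ge>0. Str D u \<cdot>\<^bsub>D\<^esub> u = complex_of_real c \<odot>\<^bsub>D\<^esub> Idn D s"
proof -
  obtain t g where g: "u = enc (s, t, g)" "qmod s" "qmod t" "hom s t g"
    using u by (auto simp: Arr_D D_simps)
  define x where "x = Cod M s"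
  have [simp]: "x \<in> Obj M" using g by (simp add: x_def)
  have gt [simp]: "g \<in> Arr M" "Dom M g = x" using homD[OF g(4)] by (auto simp: x_def)
  obtain c where c: "Str D u \<cdot>\<^bsub>D\<^esub> u = c \<odot>\<^bsub>D\<^esub> Idn D s"
    using D.scal[OF s, of "Str D u \<cdot>\<^bsub>D\<^esub> u"] u by auto
  then have c': "Str M g \<cdot> g = c \<odot> Idn M x" by (simp add: g(1) D_simps x_def)
  obtain n s' v where s': "\<And>i. i < n \<Longrightarrow> simple M (s' i)" and v: "is_direct_sum M n s' x v"
    using M.semisimple[of x] by auto
  have "n \<noteq> 0"
  proof
    assume "n = 0"
    then have "Idn M x = Zer M x x" using v by (simp add: is_direct_sum_def)
    then show False using s unfolding simple_def by (simp add: D_simps x_def)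
  qed
  then have n: "0 < n" by simp
  note [simp] = M.is_direct_sum_typ(2-5)[OF v n]
  have vv: "Str M (v 0) \<cdot> v 0 = Idn M (s' 0)" using v n unfolding is_direct_sum_def by auto
  obtain c'' where c'': "c'' \<ge> 0" "Str M (g \<cdot> v 0) \<cdot> g \<cdot> v 0 = complex_of_real c'' \<odot> Idn M (s' 0)"
    using M.simple_square[OF s'[OF n], of "g \<cdot> v 0"] by auto
  have "complex_of_real c'' \<odot> Idn M (s' 0) = c \<odot> Idn M (s' 0)"
    using M.reduce[OF c', of "v 0"] vv by (simp flip: c''(2))
  then have "c = complex_of_real c''" using M.simple_Scl_inj[OF s'[OF n]] by blast
  then show ?thesis using c c''(1) by blast
qed

text \<open>For the free module unitarity is the Frobenius equation evaluated on the unit.\<close>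

lemma module_free: assumes "x \<in> Obj M" shows "qmod (m x)"
proof (rule moduleI)
  show "m x \<cdot> Qa (m x) = m x \<cdot> m (Qo x)" using m_assoc assms by simp
  show "m x \<cdot> i (Qo x) = Idn M (Qo x)" using m_unit_left assms by simp
  have "Qa (m x) \<cdot> Str M (m (Qo x)) \<cdot> i (Qo x) = Str M (m x) \<cdot> m x \<cdot> i (Qo x)"
    using M.reduce[OF frobenius_left[of x], of "i (Qo x)"] assms by simp
  then show "Str M (m x) = Qa (m x) \<cdot> Str M (m (Qo x)) \<cdot> i (Qo x)"
    using m_unit_left assms by simp
qed (use assms in simp_all)

lemma arr_sum_D:
  assumes "qmod r" "qmod s" "\<And>i. i < n \<Longrightarrow> f i = enc (r, s, g i)"
  shows "arr_sum D r s n f = enc (r, s, arr_sum M (Cod M r) (Cod M s) n g)"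
  using assms(3) by (induction n) (auto simp: D_simps)

text \<open>The action \<open>r\<close> on the direct sum is characterized by \<open>r Q(v\<^sub>j) = v\<^sub>j xs\<^sub>j\<close>. As \<open>Q\<close> preserves direct
sums, the laws of a module can be checked after composition with \<open>v\<^sub>j\<close>, \<open>Q(v\<^sub>j)\<close> and \<open>Q(Q(v\<^sub>j))\<close>.\<close>

lemma direct_sums_D:
  assumes xs: "\<And>i. i < n \<Longrightarrow> qmod (xs i)"
  shows "\<exists>z v. is_direct_sum D n xs z v"
proof -
  define x where "x i = Cod M (xs i)" for i
  have "\<And>i. i < n \<Longrightarrow> x i \<in> Obj M" using xs by (simp add: x_def)
  then obtain z v where v: "is_direct_sum M n x z v" using M.direct_sums[of n x] by blast
  note t [simp] = M.is_direct_sum_typ[OF v]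
  have X [simp]: "xs i \<in> Arr M" "Dom M (xs i) = Qo (x i)" "Cod M (xs i) = x i" if "i < n" for i
    using moduleD(1,2)[OF xs[OF that] refl] by (auto simp: x_def)
  have Xm: "xs k \<cdot> Qa (xs k) = xs k \<cdot> m (x k)" "xs k \<cdot> i (x k) = Idn M (x k)"
    "Str M (xs k) = Qa (xs k) \<cdot> Str M (m (x k)) \<cdot> i (x k)" if "k < n" for k
    using moduleD(4-6)[OF xs[OF that] refl] that by auto
  have vv: "Str M (v k) \<cdot> v j = (if k = j then Idn M (x k) else Zer M (x j) (x k))" if "k < n" "j < n" for k j
    using v that unfolding is_direct_sum_def by auto
  note Qv = Q.farr_direct_sum[OF v]
  define r where "r = arr_sum M (Qo z) z n (\<lambda>k. v k \<cdot> xs k \<cdot> Qa (Str M (v k)))"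
  have rt [simp]: "r \<in> Arr M" "Dom M r = Qo z" "Cod M r = z"
    unfolding r_def by (auto simp: M.in_Hom_iff intro!: M.arr_sum_typ)
  have rv: "r \<cdot> Qa (v j) = v j \<cdot> xs j" if j: "j < n" for j
  proof -
    have "r \<cdot> Qa (v j) = arr_sum M (Qo (x j)) z n (\<lambda>k. v k \<cdot> xs k \<cdot> Qa (Str M (v k) \<cdot> v j))"
      unfolding r_def using j by (subst M.arr_sum_Cmp) (auto simp: M.in_Hom_iff intro!: M.arr_sum_cong)
    also have "\<dots> = v j \<cdot> xs j \<cdot> Qa (Str M (v j) \<cdot> v j)"
      using j vv by (intro M.arr_sum_delta) (auto simp: M.in_Hom_iff simp del: Q.farr_Cmp')
    also have "\<dots> = v j \<cdot> xs j" using j vv by (simp del: Q.farr_Cmp')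
    finally show ?thesis .
  qed
  have vr: "Str M (v j) \<cdot> r = xs j \<cdot> Qa (Str M (v j))" if j: "j < n" for j
  proof (rule M.direct_sum_jointly_epi[OF Qv, of _ "x j"])
    fix k assume k: "k < n"
    have "(Str M (v j) \<cdot> r) \<cdot> Qa (v k) = (Str M (v j) \<cdot> v k) \<cdot> xs k" using j k by (simp add: rv)
    also have "\<dots> = xs j \<cdot> Qa (Str M (v j) \<cdot> v k)" using j k vv by (simp del: Q.farr_Cmp')
    finally show "(Str M (v j) \<cdot> r) \<cdot> Qa (v k) = (xs j \<cdot> Qa (Str M (v j))) \<cdot> Qa (v k)" using j k by simp
  qed (use j in \<open>auto simp: M.in_Hom_iff\<close>)
  have r: "qmod r"
  proof (rule moduleI)
    show "r \<cdot> Qa r = r \<cdot> m z"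
    proof (rule M.direct_sum_jointly_epi[OF Q.farr_direct_sum[OF Qv], of _ z])
      fix j assume j: "j < n"
      have "(r \<cdot> Qa r) \<cdot> Qa (Qa (v j)) = r \<cdot> Qa (r \<cdot> Qa (v j))" using j by simp
      also have "\<dots> = r \<cdot> Qa (v j \<cdot> xs j)" using j by (simp only: rv)
      also have "\<dots> = (r \<cdot> Qa (v j)) \<cdot> Qa (xs j)" using j by simp
      also have "\<dots> = v j \<cdot> xs j \<cdot> m (x j)" using j by (simp add: rv Xm)
      also have "\<dots> = (r \<cdot> Qa (v j)) \<cdot> m (x j)" using j by (simp only: rv) simp
      also have "\<dots> = (r \<cdot> m z) \<cdot> Qa (Qa (v j))" using j by (simp add: m_nat)
      finally show "(r \<cdot> Qa r) \<cdot> Qa (Qa (v j)) = (r \<cdot> m z) \<cdot> Qa (Qa (v j))" .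
    qed (auto simp: M.in_Hom_iff)
    show "r \<cdot> i z = Idn M z"
    proof (rule M.direct_sum_jointly_epi[OF v, of _ z])
      fix j assume j: "j < n"
      have "(r \<cdot> i z) \<cdot> v j = (r \<cdot> Qa (v j)) \<cdot> i (x j)" using j by (simp add: i_nat)
      also have "\<dots> = Idn M z \<cdot> v j" using j by (simp only: rv) (simp add: Xm)
      finally show "(r \<cdot> i z) \<cdot> v j = Idn M z \<cdot> v j" .
    qed (auto simp: M.in_Hom_iff)
    show "Str M r = Qa r \<cdot> Str M (m z) \<cdot> i z"
    proof (rule M.direct_sum_jointly_epi[OF v, of _ "Qo z"])
      fix j assume j: "j < n"
      have "Str M r \<cdot> v j = Str M (Str M (v j) \<cdot> r)" using j by simp
      also have "\<dots> = Qa (v j) \<cdot> Str M (xs j)" using j by (simp only: vr) simp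
      also have "\<dots> = Qa (v j \<cdot> xs j) \<cdot> Str M (m (x j)) \<cdot> i (x j)" using j by (simp add: Xm)
      also have "\<dots> = Qa (r \<cdot> Qa (v j)) \<cdot> Str M (m (x j)) \<cdot> i (x j)" using j by (simp only: rv)
      also have "\<dots> = Qa r \<cdot> (Str M (m z) \<cdot> Qa (v j)) \<cdot> i (x j)" using j by (simp add: Str_m_nat)
      also have "\<dots> = (Qa r \<cdot> Str M (m z) \<cdot> i z) \<cdot> v j" using j by (simp add: i_nat)
      finally show "Str M r \<cdot> v j = (Qa r \<cdot> Str M (m z) \<cdot> i z) \<cdot> v j" .
    qed (auto simp: M.in_Hom_iff)
  qed simp_all
  have h: "hom (xs j) r (v j)" if "j < n" for j
    using that by (intro homI) (simp_all add: rv)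
  have "arr_sum D r r n (\<lambda>i. enc (xs i, r, v i) \<cdot>\<^bsub>D\<^esub> Str D (enc (xs i, r, v i))) = enc (r, r, Idn M z)"
    using v arr_sum_D[OF r r, of n "\<lambda>i. enc (xs i, r, v i) \<cdot>\<^bsub>D\<^esub> Str D (enc (xs i, r, v i))" "\<lambda>i. v i \<cdot> Str M (v i)"]
    unfolding is_direct_sum_def by (simp add: D_simps)
  moreover have "Str D (enc (xs k, r, v k)) \<cdot>\<^bsub>D\<^esub> enc (xs j, r, v j) =
      (if k = j then Idn D (xs k) else Zer D (xs j) (xs k))" if "k < n" "j < n" for k j
    using that vv by (simp add: D_simps)
  moreover have "enc (xs j, r, v j) \<in> Hom D (xs j) r" if "j < n" for j
    using h r xs that by (simp add: Hom_D)
  ultimately have "is_direct_sum D n xs r (\<lambda>i. enc (xs i, r, v i))"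
    unfolding is_direct_sum_def using r by (simp add: Obj_D D_simps)
  then show ?thesis by blast
qed

text \<open>Let \<open>X\<close> be a simple module on \<open>x\<close>. Since \<open>X \<noteq> 0\<close>, some simple summand of \<open>x\<close> gives a nonzero module map
from its free module to \<open>X\<close>, and that summand may be replaced by one of finitely many
representatives \<open>s\<close>. The map is nonzero on some simple summand of the free module on \<open>s\<close>, which is
therefore isomorphic to \<open>X\<close>.\<close>

lemma finite_simples_D:
  "finite ({s. simple D s} // {(s, t). simple D s \<and> simple D t \<and> iso_obj D s t})"
proof -
  obtain R where R: "finite R" "\<And>s. s \<in> R \<Longrightarrow> simple M s" "\<And>t. simple M t \<Longrightarrow> \<exists>s\<in>R. iso_obj M s t"
    using M.finite_simples_reps[OF M.finite_simples] by metis
  have "\<forall>s. \<exists>n t w. s \<in> R \<longrightarrow> (\<forall>i<n. simple D (t i)) \<and> is_direct_sum D n t (m s) w"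
    using semisimple_D module_free R(2) by (metis M.simple_obj)
  then obtain n t w where w: "\<And>s. s \<in> R \<Longrightarrow> (\<forall>i<n s. simple D (t s i)) \<and> is_direct_sum D (n s) (t s) (m s) (w s)"
    by metis
  show ?thesis
  proof (rule D.finite_simples_if_reps)
    show "finite (\<Union>s\<in>R. t s ` {..<n s})" using R(1) by simp
    fix X assume X: "simple D X"
    have Xm: "qmod X" using D.simple_obj[OF X] by (simp add: Obj_D)
    define x where "x = Cod M X"
    note Xd [simp] = moduleD(1-3)[OF Xm x_def[symmetric]] and [simp] = x_def[symmetric] 
    note X' = moduleD(4-6)[OF Xm x_def[symmetric]]
    obtain n' s' v where s': "\<And>i. i < n' \<Longrightarrow> simple M (s' i)" and v: "is_direct_sum M n' s' x v"
      using M.semisimple[of x] by auto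
    note vt = M.is_direct_sum_typ[OF v]
    have "\<exists>k<n'. X \<cdot> Qa (v k) \<noteq> Zer M (Qo (s' k)) x"
    proof (rule ccontr)
      assume *: "\<not> (\<exists>k<n'. X \<cdot> Qa (v k) \<noteq> Zer M (Qo (s' k)) x)"
      have "X = Zer M (Qo x) x"
        by (rule M.direct_sum_jointly_epi[OF Q.farr_direct_sum[OF v], of _ x])
          (use * vt in \<open>auto simp: M.in_Hom_iff\<close>)
      then have "Idn M x = Zer M x x" using X'(2) by simp
      then show False using X unfolding simple_def by (simp add: D_simps)
    qed
    then obtain k where k: "k < n'" "X \<cdot> Qa (v k) \<noteq> Zer M (Qo (s' k)) x" by blast
    note [simp] = vt(2-5)[OF k(1)]
    obtain s where s: "s \<in> R" "iso_obj M s (s' k)" using R(3)[OF s'[OF k(1)]] by blast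
    have [simp]: "s \<in> Obj M" using R(2)[OF s(1)] by simp
    obtain p q where "p \<in> Hom M s (s' k)" "q \<in> Hom M (s' k) s" and pq: "p \<cdot> q = Idn M (s' k)"
      using s(2) unfolding iso_obj_def by blast
    then have [simp]: "p \<in> Arr M" "Dom M p = s" "Cod M p = s' k" "q \<in> Arr M" "Dom M q = s' k" "Cod M q = s"
      by (auto simp: M.in_Hom_iff)
    define g where "g = v k \<cdot> p"
    have [simp]: "g \<in> Arr M" "Dom M g = s" "Cod M g = x" by (simp_all add: g_def)
    define h where "h = X \<cdot> Qa g"
    have ht [simp]: "h \<in> Arr M" "Dom M h = Qo s" "Cod M h = x" by (simp_all add: h_def)
    have "h \<cdot> Qa q = X \<cdot> Qa (v k) \<cdot> Qa (p \<cdot> q)" by (simp add: h_def g_def)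
    then have "h \<cdot> Qa q = X \<cdot> Qa (v k)" by (simp only: pq) simp
    then have h0: "h \<noteq> Zer M (Qo s) x" using k by auto
    have hh: "hom (m s) X h"
    proof (rule homI)
      have "h \<cdot> m s = (X \<cdot> m x) \<cdot> Qa (Qa g)"
        by (simp add: h_def m_nat)
      also have "\<dots> = (X \<cdot> Qa X) \<cdot> Qa (Qa g)" by (simp add: X')
      finally show "h \<cdot> m s = X \<cdot> Qa h" by (simp add: h_def)
    qed simp_all
    define H where "H = enc (m s, X, h)"
    have H: "H \<in> Hom D (m s) X" using Xm hh module_free by (auto simp: H_def Hom_D)
    have H0: "H \<noteq> Zer D (m s) X" using h0 by (simp add: H_def D_simps)
    have W: "is_direct_sum D (n s) (t s) (m s) (w s)" using w[OF s(1)] by blast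
    note Wt = D.is_direct_sum_typ[OF W]
    have Xo: "X \<in> Obj D" "m s \<in> Obj D" using Xm module_free by (auto simp: Obj_D)
    have "\<exists>j<n s. H \<cdot>\<^bsub>D\<^esub> w s j \<noteq> Zer D (t s j) X"
    proof (rule ccontr)
      assume *: "\<not> (\<exists>j<n s. H \<cdot>\<^bsub>D\<^esub> w s j \<noteq> Zer D (t s j) X)"
      have "H = Zer D (m s) X"
        by (rule D.direct_sum_jointly_epi[OF W H])
          (use * Wt Xo in \<open>auto simp: D.in_Hom_iff\<close>)
      then show False using H0 by simp
    qed
    then obtain j where j: "j < n s" "H \<cdot>\<^bsub>D\<^esub> w s j \<noteq> Zer D (t s j) X" by blast
    have "iso_obj D (t s j) X"
      by (rule D.simple_arrow_iso[OF _ X _ j(2)])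
        (use w[OF s(1)] j Wt H in \<open>auto simp: D.in_Hom_iff\<close>)
    then show "\<exists>s\<in>(\<Union>s\<in>R. t s ` {..<n s}). iso_obj D s X" using j s by blast
  qed
qed

text \<open>The limit \<open>f\<close> exists in \<open>M\<close>. The defect \<open>d = f r - s Q(f)\<close> is bounded by a multiple of the distance
of \<open>f\<close> to any member of the sequence, because \<open>Q\<close> is bounded.\<close>

lemma complete_D:
  assumes a: "\<And>n. a n \<in> Hom D r s"
    and cauchy: "\<And>e. 0 < e \<Longrightarrow> \<exists>N. \<forall>m\<ge>N. \<forall>n\<ge>N. Nrm D (a m \<oplus>\<^bsub>D\<^esub> (- 1) \<odot>\<^bsub>D\<^esub> a n) < e"
  shows "\<exists>f \<in> Hom D r s. (\<lambda>n. Nrm D (a n \<oplus>\<^bsub>D\<^esub> (- 1) \<odot>\<^bsub>D\<^esub> f)) \<longlonglongrightarrow> 0"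
proof -
  have "\<exists>g. a n = enc (r, s, g) \<and> hom r s g" and rs: "qmod r" "qmod s" for n 
    using a[of n] by (auto simp: Hom_D)
  then obtain b where b: "\<And>n. a n = enc (r, s, b n)" "\<And>n. hom r s (b n)" by metis
  define x y where "x = Cod M r" and "y = Cod M s"
  note rt [simp] = moduleD(1-3)[OF rs(1) x_def[symmetric]] moduleD(1-3)[OF rs(2) y_def[symmetric]] 
    and [simp] = x_def[symmetric] y_def[symmetric] 
  have bt [simp]: "b n \<in> Arr M" "Dom M (b n) = x" "Cod M (b n) = y" for n using homD[OF b(2)[of n]] by auto
  have "\<exists>f \<in> Hom M x y. (\<lambda>n. Nrm M (b n \<oplus> (- 1) \<odot> f)) \<longlonglongrightarrow> 0"
    using cauchy by (intro M.complete) (auto simp: M.in_Hom_iff b(1) D_simps)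
  then obtain f where f: "f \<in> Hom M x y" "(\<lambda>n. Nrm M (b n \<oplus> (- 1) \<odot> f)) \<longlonglongrightarrow> 0" by blast
  have ft [simp]: "f \<in> Arr M" "Dom M f = x" "Cod M f = y" using f(1) by (auto simp: M.in_Hom_iff)
  obtain k where k: "k \<ge> 0" "\<And>g. g \<in> Arr M \<Longrightarrow> Dom M g = x \<Longrightarrow> Nrm M (Qa g) \<le> k * Nrm M g"
    using Q.farr_bounded[of x] by auto
  define d where "d = f \<cdot> r \<oplus> (-1) \<odot> (s \<cdot> Qa f)"
  have dt [simp]: "d \<in> Arr M" "Dom M d = Qo x" "Cod M d = y" by (simp_all add: d_def)
  have dn: "d = (-1) \<odot> ((b n \<oplus> (- 1) \<odot> f) \<cdot> r) \<oplus> s \<cdot> Qa (b n \<oplus> (- 1) \<odot> f)" for n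
  proof -
    have 1: "b n \<cdot> r = s \<cdot> Qa (b n)" using homD(4)[OF b(2)[of n]] .
    have "(-1) \<odot> ((b n \<oplus> (- 1) \<odot> f) \<cdot> r) \<oplus> s \<cdot> Qa (b n \<oplus> (- 1) \<odot> f)
      = ((-1) \<odot> (s \<cdot> Qa (b n)) \<oplus> f \<cdot> r) \<oplus> (s \<cdot> Qa (b n) \<oplus> (-1) \<odot> (s \<cdot> Qa f))"
      by (simp add: M.Add_Cmp' M.Cmp_Add' M.Scl_Add' 1)
    also have "\<dots> = (s \<cdot> Qa (b n) \<oplus> (-1) \<odot> (s \<cdot> Qa (b n))) \<oplus> d"
      unfolding d_def by (simp add: M.Add_ac del: M.Add_neg')
    finally show ?thesis by simp
  qed
  have "Nrm M d \<le> (Nrm M r + Nrm M s * k) * Nrm M (b n \<oplus> (- 1) \<odot> f)" for n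
  proof -
    define g where "g = b n \<oplus> (- 1) \<odot> f"
    have [simp]: "g \<in> Arr M" "Dom M g = x" "Cod M g = y" by (simp_all add: g_def)
    have "Nrm M d \<le> Nrm M ((-1) \<odot> (g \<cdot> r)) + Nrm M (s \<cdot> Qa g)"
      unfolding dn[of n] g_def[symmetric] by (intro M.Nrm_Add[of _ "Qo x" y]) (auto simp: M.in_Hom_iff)
    also have "Nrm M ((-1) \<odot> (g \<cdot> r)) \<le> Nrm M g * Nrm M r" using M.Nrm_Cmp'[of g r] by (simp add: M.Nrm_Scl)
    also have "Nrm M (s \<cdot> Qa g) \<le> Nrm M s * Nrm M (Qa g)" by (intro M.Nrm_Cmp') auto
    also have "\<dots> \<le> Nrm M s * (k * Nrm M g)" using k by (intro mult_left_mono) (auto intro: M.Nrm_ge_0)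
    finally show ?thesis unfolding g_def[symmetric] by (simp add: algebra_simps)
  qed
  moreover have "(\<lambda>n. (Nrm M r + Nrm M s * k) * Nrm M (b n \<oplus> (- 1) \<odot> f)) \<longlonglongrightarrow> 0"
    using tendsto_mult_right_zero[OF f(2)] by simp
  ultimately have "Nrm M d \<le> 0" by (intro LIMSEQ_le_const) auto
  then have "Nrm M d = 0" using M.Nrm_ge_0[of d] by simp
  then have "d = Zer M (Qo x) y" using M.Nrm_eq_0[of d "Qo x" y] by (simp add: M.in_Hom_iff)
  then have "f \<cdot> r = s \<cdot> Qa f" unfolding d_def using M.diff_eq_Zer[of "f \<cdot> r" "s \<cdot> Qa f"] by simp
  then have "hom r s f" by (intro homI) auto
  then show ?thesis using f(2) rs by (intro bexI[of _ "enc (r, s, f)"]) (auto simp: b(1) D_simps Hom_D)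
qed

theorem finite_semisimple_D: "finite_semisimple_cstar_category D"
proof
  fix f assume "f \<in> Arr D"
  then obtain r s g where f: "f = enc (r, s, g)" "qmod r" "qmod s" "hom r s g" by (auto simp: Arr_D)
  note [simp] = homD(1-3)[OF f(4)]
  show "0 \<le> Nrm D f" "Nrm D (a \<odot>\<^bsub>D\<^esub> f) = cmod a * Nrm D f" "Nrm D (Str D f \<cdot>\<^bsub>D\<^esub> f) = (Nrm D f)\<^sup>2" for a
    using f M.Nrm_ge_0 M.Nrm_Scl M.cstar_identity by (auto simp: D_simps)
next
  fix f x y assume fH: "f \<in> Hom D x y"
  then obtain g where g: "f = enc (x, y, g)" "qmod x" "qmod y" "hom x y g" by (auto simp: Hom_D)
  show "(Nrm D f = 0) = (f = Zer D x y)"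
    using g M.Nrm_eq_0[of g "Cod M x" "Cod M y"] by (simp add: D_simps mod_hom_def)
  show "\<exists>g\<in>Hom D x x. Str D f \<cdot>\<^bsub>D\<^esub> f = Str D g \<cdot>\<^bsub>D\<^esub> g"
  proof -
    obtain n s v where "\<forall>i<n. simple D (s i)" "is_direct_sum D n s x v"
      using semisimple_D[OF g(2)] by blast
    then show ?thesis using simple_square_D fH by (intro D.square_root_if_semisimple) auto
  qed
next
  fix f g x y assume "f \<in> Hom D x y" "g \<in> Hom D x y" 
  then obtain f' g' where "f = enc (x, y, f')" "g = enc (x, y, g')" "hom x y f'" "hom x y g'"
    by (auto simp: Hom_D)
  then show "Nrm D (f \<oplus>\<^bsub>D\<^esub> g) \<le> Nrm D f + Nrm D g"
    using M.Nrm_Add[of f' "Cod M x" "Cod M y" g'] by (simp add: D_simps mod_hom_def)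
next
  fix f g x y z assume "g \<in> Hom D y z" "f \<in> Hom D x y" 
  then obtain f' g' where "f = enc (x, y, f')" "g = enc (y, z, g')" "hom x y f'" "hom y z g'"
    by (auto simp: Hom_D)
  then show "Nrm D (g \<cdot>\<^bsub>D\<^esub> f) \<le> Nrm D g * Nrm D f"
    using M.Nrm_Cmp[of g' "Cod M y" "Cod M z" f' "Cod M x"] by (simp add: D_simps mod_hom_def)
qed (use complete_D direct_sums_D projections_split_D semisimple_D finite_simples_D in \<open>auto simp: Obj_D\<close>)

end

section \<open>Adjunctions between *-functors\<close>

lemma fobj_id [simp]: "x \<in> Obj A \<Longrightarrow> fobj (id_func A) x = x"
  and farr_id [simp]: "f \<in> Arr A \<Longrightarrow> farr (id_func A) f = f"
  by (simp_all add: id_func_def)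

lemma fobj_comp [simp]: "x \<in> Obj A \<Longrightarrow> fobj (func_comp A G F) x = fobj G (fobj F x)"
  and farr_comp [simp]: "f \<in> Arr A \<Longrightarrow> farr (func_comp A G F) f = farr G (farr F f)"
  by (simp_all add: func_comp_def compose_eq)

lemma star_functor_id: assumes "star_category A" shows "star_functor A A (id_func A)"
proof -
  interpret A: star_category A by fact
  show ?thesis
  proof unfold_locales
    show "fobj (id_func A) \<in> extensional (Obj A)" "farr (id_func A) \<in> extensional (Arr A)"
      by (simp_all add: id_func_def)
  qed (auto simp: A.in_Hom_iff)
qed

lemma star_functor_comp:
  assumes "star_category A" "star_functor A B F" "star_functor B C G"
  shows "star_functor A C (func_comp A G F)"
proof -
  interpret A: star_category A by fact
  interpret F: star_functor A B F by fact
  interpret G: star_functor B C G by fact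
  have *: "f \<in> Hom C x y \<longleftrightarrow> f \<in> Arr C \<and> Dom C f = x \<and> Cod C f = y" for f x y by (simp add: Hom_def)
  show ?thesis
  proof unfold_locales
    show "fobj (func_comp A G F) \<in> extensional (Obj A)" "farr (func_comp A G F) \<in> extensional (Arr A)"
      by (simp_all add: func_comp_def)
  qed (auto simp: A.in_Hom_iff *)
qed

lemma faithful_id: "category A \<Longrightarrow> faithful A (id_func A)"
  by (auto simp: faithful_def inj_on_def Hom_def)

lemma faithful_comp:
  assumes "category A" "star_functor A B F" "faithful A F" "faithful B G"
  shows "faithful A (func_comp A G F)"
proof -
  interpret A: category A by fact
  interpret F: star_functor A B F by fact
  show ?thesis unfolding faithful_def
  proof (intro ballI inj_onI)
    fix x y f g assume a: "x \<in> Obj A" "y \<in> Obj A" "f \<in> Hom A x y" "g \<in> Hom A x y"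
      "farr (func_comp A G F) f = farr (func_comp A G F) g"
    then have "farr G (farr F f) = farr G (farr F g)" by (simp add: A.in_Hom_iff)
    moreover have "farr F f \<in> Hom B (fobj F x) (fobj F y)" "farr F g \<in> Hom B (fobj F x) (fobj F y)"
      using a F.farr_in by auto
    ultimately have "farr F f = farr F g"
      using assms(4) a F.fobj_in unfolding faithful_def inj_on_def by blast
    then show "f = g" using assms(3) a unfolding faithful_def inj_on_def by blast
  qed
qed

lemma adjunctionI:
  assumes A: "category A" and B: "category B" and F: "star_functor A B F" and G: "star_functor B A G"
    and \<eta>: "\<And>x. x \<in> Obj A \<Longrightarrow> \<eta> x \<in> Hom A x (fobj G (fobj F x))"
    and \<eta>_nat: "\<And>f. f \<in> Arr A \<Longrightarrow> \<eta> (Cod A f) \<cdot>\<^bsub>A\<^esub> f = farr G (farr F f) \<cdot>\<^bsub>A\<^esub> \<eta> (Dom A f)"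
    and \<epsilon>: "\<And>y. y \<in> Obj B \<Longrightarrow> \<epsilon> y \<in> Hom B (fobj F (fobj G y)) y"
    and \<epsilon>_nat: "\<And>g. g \<in> Arr B \<Longrightarrow> \<epsilon> (Cod B g) \<cdot>\<^bsub>B\<^esub> farr F (farr G g) = g \<cdot>\<^bsub>B\<^esub> \<epsilon> (Dom B g)"
    and zig: "\<And>x. x \<in> Obj A \<Longrightarrow> \<epsilon> (fobj F x) \<cdot>\<^bsub>B\<^esub> farr F (\<eta> x) = Idn B (fobj F x)"
    and zag: "\<And>y. y \<in> Obj B \<Longrightarrow> farr G (\<epsilon> y) \<cdot>\<^bsub>A\<^esub> \<eta> (fobj G y) = Idn A (fobj G y)"
  shows "adjunction A B F G (\<lambda>x\<in>Obj A. \<eta> x) (\<lambda>y\<in>Obj B. \<epsilon> y)"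
proof -
  interpret A: category A by fact
  interpret B: category B by fact
  interpret F: star_functor A B F by fact
  interpret G: star_functor B A G by fact
  have "(\<lambda>x\<in>Obj A. \<eta> x) \<in> NT A A (id_func A) (func_comp A G F)"
    using \<eta> \<eta>_nat unfolding NT_def by (auto simp: A.in_Hom_iff)
  moreover have "(\<lambda>y\<in>Obj B. \<epsilon> y) \<in> NT B B (func_comp B F G) (id_func B)"
    using \<epsilon> \<epsilon>_nat unfolding NT_def by (auto simp: B.in_Hom_iff)
  ultimately show ?thesis using zig zag unfolding adjunction_def
    by (auto simp: nt_comp_def whisk_right_def whisk_left_def nt_id_def intro!: restrict_ext)
qed

lemma restrict_eqD: "\<lbrakk>(\<lambda>x\<in>S. f x) = (\<lambda>x\<in>S. g x); x \<in> S\<rbrakk> \<Longrightarrow> f x = g x"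
  by (metis restrict_apply')

lemma adjunctionD:
  assumes A: "category A" and B: "category B" and F: "star_functor A B F" and G: "star_functor B A G"
    and adj: "adjunction A B F G \<eta> \<epsilon>"
  shows "\<And>x. x \<in> Obj A \<Longrightarrow> \<eta> x \<in> Hom A x (fobj G (fobj F x))"
    and "\<And>f y. \<lbrakk>f \<in> Arr A; Cod A f = y\<rbrakk> \<Longrightarrow> \<eta> y \<cdot>\<^bsub>A\<^esub> f = farr G (farr F f) \<cdot>\<^bsub>A\<^esub> \<eta> (Dom A f)"
    and "\<And>y. y \<in> Obj B \<Longrightarrow> \<epsilon> y \<in> Hom B (fobj F (fobj G y)) y"
    and "\<And>g y. \<lbrakk>g \<in> Arr B; Cod B g = y\<rbrakk> \<Longrightarrow> \<epsilon> y \<cdot>\<^bsub>B\<^esub> farr F (farr G g) = g \<cdot>\<^bsub>B\<^esub> \<epsilon> (Dom B g)"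
    and "\<And>x. x \<in> Obj A \<Longrightarrow> \<epsilon> (fobj F x) \<cdot>\<^bsub>B\<^esub> farr F (\<eta> x) = Idn B (fobj F x)"
    and "\<And>y. y \<in> Obj B \<Longrightarrow> farr G (\<epsilon> y) \<cdot>\<^bsub>A\<^esub> \<eta> (fobj G y) = Idn A (fobj G y)"
proof -
  interpret A: category A by fact
  interpret B: category B by fact
  interpret F: star_functor A B F by fact
  interpret G: star_functor B A G by fact
  have \<eta>: "\<eta> \<in> NT A A (id_func A) (func_comp A G F)" and \<epsilon>: "\<epsilon> \<in> NT B B (func_comp B F G) (id_func B)"
    using adj unfolding adjunction_def by auto
  show "x \<in> Obj A \<Longrightarrow> \<eta> x \<in> Hom A x (fobj G (fobj F x))" for x
    using \<eta> unfolding NT_def by auto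
  show "y \<in> Obj B \<Longrightarrow> \<epsilon> y \<in> Hom B (fobj F (fobj G y)) y" for y
    using \<epsilon> unfolding NT_def by auto
  show "\<lbrakk>f \<in> Arr A; Cod A f = y\<rbrakk> \<Longrightarrow> \<eta> y \<cdot>\<^bsub>A\<^esub> f = farr G (farr F f) \<cdot>\<^bsub>A\<^esub> \<eta> (Dom A f)" for f y
    using \<eta> A.Arr_in_Hom[of f] unfolding NT_def by fastforce
  show "\<lbrakk>g \<in> Arr B; Cod B g = y\<rbrakk> \<Longrightarrow> \<epsilon> y \<cdot>\<^bsub>B\<^esub> farr F (farr G g) = g \<cdot>\<^bsub>B\<^esub> \<epsilon> (Dom B g)" for g y
    using \<epsilon> B.Arr_in_Hom[of g] unfolding NT_def by fastforce
  have "nt_comp A B (whisk_right A \<epsilon> F) (whisk_left A F \<eta>) = nt_id A B F"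
    "nt_comp B A (whisk_left B G \<epsilon>) (whisk_right B \<eta> G) = nt_id B A G"
    using adj unfolding adjunction_def by auto
  note z = this[unfolded nt_comp_def nt_id_def whisk_left_def whisk_right_def]
  show "x \<in> Obj A \<Longrightarrow> \<epsilon> (fobj F x) \<cdot>\<^bsub>B\<^esub> farr F (\<eta> x) = Idn B (fobj F x)" for x
    using restrict_eqD[OF z(1), of x] by simp
  show "y \<in> Obj B \<Longrightarrow> farr G (\<epsilon> y) \<cdot>\<^bsub>A\<^esub> \<eta> (fobj G y) = Idn A (fobj G y)" for y
    using restrict_eqD[OF z(2), of y] by simp
qed

text \<open>The adjoints of the counit and of the unit are the unit and the counit of an adjunction in the other
direction. So for *-functors every right adjoint is a left adjoint.\<close>

lemma adjunction_star:
  assumes A: "star_category A" and B: "star_category B" and F: "star_functor A B F" and G: "star_functor B A G"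
    and adj: "adjunction A B F G \<eta> \<epsilon>"
  shows "\<exists>\<eta>' \<epsilon>'. adjunction B A G F \<eta>' \<epsilon>'"
proof -
  interpret A: star_category A by fact
  interpret B: star_category B by fact
  interpret F: star_functor A B F by fact
  interpret G: star_functor B A G by fact
  note d = adjunctionD[OF A.category_axioms B.category_axioms F G adj]
  have [simp]: "\<eta> x \<in> Arr A" "Dom A (\<eta> x) = x" "Cod A (\<eta> x) = fobj G (fobj F x)" if "x \<in> Obj A" for x
    using d(1)[OF that] by (auto simp: A.in_Hom_iff)
  have [simp]: "\<epsilon> y \<in> Arr B" "Dom B (\<epsilon> y) = fobj F (fobj G y)" "Cod B (\<epsilon> y) = y" if "y \<in> Obj B" for y
    using d(3)[OF that] by (auto simp: B.in_Hom_iff)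
  show ?thesis
  proof (intro exI, rule adjunctionI[OF B.category_axioms A.category_axioms G F])
    show "Str B (\<epsilon> y) \<in> Hom B y (fobj F (fobj G y))" if "y \<in> Obj B" for y
      using that by (simp add: B.in_Hom_iff)
    show "Str A (\<eta> x) \<in> Hom A (fobj G (fobj F x)) x" if "x \<in> Obj A" for x
      using that by (simp add: A.in_Hom_iff)
    show "Str B (\<epsilon> (Cod B f)) \<cdot>\<^bsub>B\<^esub> f = farr F (farr G f) \<cdot>\<^bsub>B\<^esub> Str B (\<epsilon> (Dom B f))" if f: "f \<in> Arr B" for f
      using f arg_cong[OF d(4)[of "Str B f" "Dom B f"], of "Str B"] by simp
    show "Str A (\<eta> (Cod A g)) \<cdot>\<^bsub>A\<^esub> farr G (farr F g) = g \<cdot>\<^bsub>A\<^esub> Str A (\<eta> (Dom A g))" if g: "g \<in> Arr A" for g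
      using g arg_cong[OF d(2)[of "Str A g" "Dom A g"], of "Str A"] by simp
    show "Str A (\<eta> (fobj G y)) \<cdot>\<^bsub>A\<^esub> farr G (Str B (\<epsilon> y)) = Idn A (fobj G y)" if "y \<in> Obj B" for y
      using that arg_cong[OF d(6)[of y], of "Str A"] by simp
    show "farr F (Str A (\<eta> x)) \<cdot>\<^bsub>B\<^esub> Str B (\<epsilon> (fobj F x)) = Idn B (fobj F x)" if "x \<in> Obj A" for x
      using that arg_cong[OF d(5)[of x], of "Str B"] by simp
  qed
qed

lemma bi_faithfulI:
  assumes "star_category A" "star_category B" "star_functor A B F" "star_functor B A G"
    and "faithful A F" "faithful B G" "adjunction A B F G \<eta> \<epsilon>"
  shows "bi_faithful A B F" "bi_faithful B A G"
  using adjunction_star[OF assms(1-4,7)] assms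
  unfolding bi_faithful_def two_sided_adjoint_def by blast+

lemma bi_faithfulE:
  assumes "bi_faithful A B F"
  obtains G \<eta> \<epsilon> where "star_functor A B F" "star_functor B A G" "faithful A F" "faithful B G" 
    "adjunction A B F G \<eta> \<epsilon>"
  using assms unfolding bi_faithful_def two_sided_adjoint_def by blast

lemma bi_faithful_id: assumes "star_category A" shows "bi_faithful A A (id_func A)"
proof -
  interpret A: star_category A by fact
  note F = star_functor_id[OF assms] and f = faithful_id[OF A.category_axioms]
  have "adjunction A A (id_func A) (id_func A) (\<lambda>x\<in>Obj A. Idn A x) (\<lambda>x\<in>Obj A. Idn A x)"
    by (rule adjunctionI[OF A.category_axioms A.category_axioms F F]) (auto simp: A.in_Hom_iff)
  then show ?thesis by (rule bi_faithfulI(1)[OF assms assms F F f f])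
qed

lemma bi_faithful_comp:
  assumes "star_category A" "star_category B" "star_category C" "bi_faithful A B F" "bi_faithful B C G"
  shows "bi_faithful A C (func_comp A G F)"
proof -
  interpret A: star_category A by fact
  interpret B: star_category B by fact
  interpret C: star_category C by fact
  obtain F' \<eta> \<epsilon> where F: "star_functor A B F" "star_functor B A F'" "faithful A F" "faithful B F'" 
    "adjunction A B F F' \<eta> \<epsilon>" by (rule bi_faithfulE[OF assms(4)])
  obtain G' \<eta>' \<epsilon>' where G: "star_functor B C G" "star_functor C B G'" "faithful B G" "faithful C G'" 
    "adjunction B C G G' \<eta>' \<epsilon>'" by (rule bi_faithfulE[OF assms(5)])
  interpret F: star_functor A B F by fact
  interpret F': star_functor B A F' by fact
  interpret G: star_functor B C G by fact
  interpret G': star_functor C B G' by fact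
  note d = adjunctionD[OF A.category_axioms B.category_axioms F(1,2,5)]
  note e = adjunctionD[OF B.category_axioms C.category_axioms G(1,2,5)]
  have [simp]: "\<eta> x \<in> Arr A" "Dom A (\<eta> x) = x" "Cod A (\<eta> x) = fobj F' (fobj F x)" if "x \<in> Obj A" for x
    using d(1)[OF that] by (auto simp: A.in_Hom_iff)
  have [simp]: "\<epsilon> y \<in> Arr B" "Dom B (\<epsilon> y) = fobj F (fobj F' y)" "Cod B (\<epsilon> y) = y" if "y \<in> Obj B" for y
    using d(3)[OF that] by (auto simp: B.in_Hom_iff)
  have [simp]: "\<eta>' x \<in> Arr B" "Dom B (\<eta>' x) = x" "Cod B (\<eta>' x) = fobj G' (fobj G x)" if "x \<in> Obj B" for x
    using e(1)[OF that] by (auto simp: B.in_Hom_iff)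
  have [simp]: "\<epsilon>' y \<in> Arr C" "Dom C (\<epsilon>' y) = fobj G (fobj G' y)" "Cod C (\<epsilon>' y) = y" if "y \<in> Obj C" for y
    using e(3)[OF that] by (auto simp: C.in_Hom_iff)
  note GF = star_functor_comp[OF assms(1) F(1) G(1)] and GF' = star_functor_comp[OF assms(3) G(2) F(2)]
  have "adjunction A C (func_comp A G F) (func_comp C F' G') 
    (\<lambda>x\<in>Obj A. farr F' (\<eta>' (fobj F x)) \<cdot>\<^bsub>A\<^esub> \<eta> x) (\<lambda>y\<in>Obj C. \<epsilon>' y \<cdot>\<^bsub>C\<^esub> farr G (\<epsilon> (fobj G' y)))"
  proof (rule adjunctionI[OF A.category_axioms C.category_axioms GF GF'])
    fix x assume x: "x \<in> Obj A"
    show "farr F' (\<eta>' (fobj F x)) \<cdot>\<^bsub>A\<^esub> \<eta> x \<in> Hom A x (fobj (func_comp C F' G') (fobj (func_comp A G F) x))"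
      using x by (simp add: A.in_Hom_iff)
    have "\<epsilon> (fobj G' (fobj G (fobj F x))) \<cdot>\<^bsub>B\<^esub> farr F (farr F' (\<eta>' (fobj F x))) \<cdot>\<^bsub>B\<^esub> farr F (\<eta> x)
      = \<eta>' (fobj F x) \<cdot>\<^bsub>B\<^esub> \<epsilon> (fobj F x) \<cdot>\<^bsub>B\<^esub> farr F (\<eta> x)"
      using x by (subst B.reduce[OF d(4)]) auto
    also have "\<dots> = \<eta>' (fobj F x)" using x by (simp add: d(5))
    finally have 1: "\<epsilon> (fobj G' (fobj G (fobj F x))) \<cdot>\<^bsub>B\<^esub> farr F (farr F' (\<eta>' (fobj F x)) \<cdot>\<^bsub>A\<^esub> \<eta> x) = \<eta>' (fobj F x)"
      using x by simp
    show "(\<epsilon>' (fobj (func_comp A G F) x) \<cdot>\<^bsub>C\<^esub> farr G (\<epsilon> (fobj G' (fobj (func_comp A G F) x)))) \<cdot>\<^bsub>C\<^esub>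
         farr (func_comp A G F) (farr F' (\<eta>' (fobj F x)) \<cdot>\<^bsub>A\<^esub> \<eta> x) = Idn C (fobj (func_comp A G F) x)"
      using x arg_cong[OF 1, of "farr G"] e(5)[of "fobj F x"] by simp
  next
    fix y assume y: "y \<in> Obj C"
    show "\<epsilon>' y \<cdot>\<^bsub>C\<^esub> farr G (\<epsilon> (fobj G' y)) \<in> Hom C (fobj (func_comp A G F) (fobj (func_comp C F' G') y)) y"
      using y by (simp add: C.in_Hom_iff)
    have "farr G' (\<epsilon>' y) \<cdot>\<^bsub>B\<^esub> (farr G' (farr G (\<epsilon> (fobj G' y))) \<cdot>\<^bsub>B\<^esub> \<eta>' (fobj F (fobj F' (fobj G' y))))
       = farr G' (\<epsilon>' y) \<cdot>\<^bsub>B\<^esub> \<eta>' (fobj G' y) \<cdot>\<^bsub>B\<^esub> \<epsilon> (fobj G' y)"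
      using y e(2)[of "\<epsilon> (fobj G' y)" "fobj G' y"] by simp
    also have "\<dots> = \<epsilon> (fobj G' y)" using y B.reduce[OF e(6)[of y], of "\<epsilon> (fobj G' y)"] by simp
    finally have 1: "farr G' (\<epsilon>' y) \<cdot>\<^bsub>B\<^esub> farr G' (farr G (\<epsilon> (fobj G' y))) \<cdot>\<^bsub>B\<^esub> \<eta>' (fobj F (fobj F' (fobj G' y))) = \<epsilon> (fobj G' y)" .
    show "farr (func_comp C F' G') (\<epsilon>' y \<cdot>\<^bsub>C\<^esub> farr G (\<epsilon> (fobj G' y))) \<cdot>\<^bsub>A\<^esub>
         farr F' (\<eta>' (fobj F (fobj (func_comp C F' G') y))) \<cdot>\<^bsub>A\<^esub> \<eta> (fobj (func_comp C F' G') y) =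
         Idn A (fobj (func_comp C F' G') y)"
      using y A.reduce[OF refl, of "farr F' (farr G' (\<epsilon>' y) \<cdot>\<^bsub>B\<^esub> farr G' (farr G (\<epsilon> (fobj G' y))))" "farr F' (\<eta>' (fobj F (fobj F' (fobj G' y))))"] 
        arg_cong[OF 1, of "\<lambda>w. farr F' w \<cdot>\<^bsub>A\<^esub> \<eta> (fobj F' (fobj G' y))"] d(6)[of "fobj G' y"] by simp
  next
    fix f assume f: "f \<in> Arr A"
    have 1: "\<eta>' (fobj F (Cod A f)) \<cdot>\<^bsub>B\<^esub> farr F f = farr G' (farr G (farr F f)) \<cdot>\<^bsub>B\<^esub> \<eta>' (fobj F (Dom A f))"
      using f e(2)[of "farr F f"] by simp
    have "(farr F' (\<eta>' (fobj F (Cod A f))) \<cdot>\<^bsub>A\<^esub> \<eta> (Cod A f)) \<cdot>\<^bsub>A\<^esub> f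
      = farr F' (\<eta>' (fobj F (Cod A f)) \<cdot>\<^bsub>B\<^esub> farr F f) \<cdot>\<^bsub>A\<^esub> \<eta> (Dom A f)"
      using f d(2)[of f] by simp
    then show "(farr F' (\<eta>' (fobj F (Cod A f))) \<cdot>\<^bsub>A\<^esub> \<eta> (Cod A f)) \<cdot>\<^bsub>A\<^esub> f =
         farr (func_comp C F' G') (farr (func_comp A G F) f) \<cdot>\<^bsub>A\<^esub>
         farr F' (\<eta>' (fobj F (Dom A f))) \<cdot>\<^bsub>A\<^esub> \<eta> (Dom A f)"
      using f by (simp only: 1) simp
  next
    fix g assume g: "g \<in> Arr C"
    have 1: "\<epsilon> (fobj G' (Cod C g)) \<cdot>\<^bsub>B\<^esub> farr F (farr F' (farr G' g)) = farr G' g \<cdot>\<^bsub>B\<^esub> \<epsilon> (fobj G' (Dom C g))"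
      using g d(4)[of "farr G' g"] by simp
    have "(\<epsilon>' (Cod C g) \<cdot>\<^bsub>C\<^esub> farr G (\<epsilon> (fobj G' (Cod C g)))) \<cdot>\<^bsub>C\<^esub>
         farr (func_comp A G F) (farr (func_comp C F' G') g)
      = \<epsilon>' (Cod C g) \<cdot>\<^bsub>C\<^esub> farr G (\<epsilon> (fobj G' (Cod C g)) \<cdot>\<^bsub>B\<^esub> farr F (farr F' (farr G' g)))"
      using g by simp
    also have "\<dots> = (\<epsilon>' (Cod C g) \<cdot>\<^bsub>C\<^esub> farr G (farr G' g)) \<cdot>\<^bsub>C\<^esub> farr G (\<epsilon> (fobj G' (Dom C g)))"
      using g by (simp only: 1) simp
    also have "\<dots> = g \<cdot>\<^bsub>C\<^esub> \<epsilon>' (Dom C g) \<cdot>\<^bsub>C\<^esub> farr G (\<epsilon> (fobj G' (Dom C g)))"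
      using g by (subst e(4)) auto
    finally show "(\<epsilon>' (Cod C g) \<cdot>\<^bsub>C\<^esub> farr G (\<epsilon> (fobj G' (Cod C g)))) \<cdot>\<^bsub>C\<^esub>
         farr (func_comp A G F) (farr (func_comp C F' G') g) =
         g \<cdot>\<^bsub>C\<^esub> \<epsilon>' (Dom C g) \<cdot>\<^bsub>C\<^esub> farr G (\<epsilon> (fobj G' (Dom C g)))" .
  qed
  then show ?thesis
    by (rule bi_faithfulI(1)[OF assms(1,3) GF GF' faithful_comp[OF A.category_axioms F(1,3) G(3)] 
      faithful_comp[OF C.category_axioms G(2,4) F(4)]])
qed

section \<open>Free modules and unitarization\<close>

context Q_monad
begin

interpretation D: finite_semisimple_cstar_category D by (rule finite_semisimple_D)

definition Forget :: "'u func" where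
  "Forget = \<lparr>fobj = (\<lambda>r\<in>Obj D. Cod M r), farr = (\<lambda>a\<in>Arr D. und a)\<rparr>"

definition Free :: "'u func" where
  "Free = \<lparr>fobj = (\<lambda>x\<in>Obj M. m x), farr = (\<lambda>f\<in>Arr M. enc (m (Dom M f), m (Cod M f), Qa f))\<rparr>"

lemma fobj_Forget [simp]: "qmod r \<Longrightarrow> fobj Forget r = Cod M r"
  by (simp add: Forget_def Obj_D)

lemma enc_in_Arr [simp]: "enc (r, s, f) \<in> Arr D \<longleftrightarrow> qmod r \<and> qmod s \<and> hom r s f"
  by (auto simp: Arr_D)

lemma farr_Forget [simp]: "\<lbrakk>qmod r; qmod s; hom r s f\<rbrakk> \<Longrightarrow> farr Forget (enc (r, s, f)) = f"
  by (simp add: Forget_def)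

lemma fobj_Free [simp]: "x \<in> Obj M \<Longrightarrow> fobj Free x = m x"
  and farr_Free [simp]: "f \<in> Arr M \<Longrightarrow> farr Free f = enc (m (Dom M f), m (Cod M f), Qa f)"
  by (simp_all add: Free_def)

lemma hom_free: "\<lbrakk>f \<in> Arr M; Dom M f = x; Cod M f = y\<rbrakk> \<Longrightarrow> hom (m x) (m y) (Qa f)"
  by (rule homI) (auto simp: m_nat)

lemma hom_action: "qmod r \<Longrightarrow> Cod M r = x \<Longrightarrow> hom (m x) r r"
  using moduleD[of r x] by (intro homI) auto

lemma star_functor_Forget: "star_functor D M Forget"
proof
  show "fobj Forget \<in> extensional (Obj D)" "farr Forget \<in> extensional (Arr D)"
    by (simp_all add: Forget_def)
next
  fix f g x y z assume "g \<in> Hom D y z" "f \<in> Hom D x y"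
  then obtain g' f' where f: "g = enc (y, z, g')" "f = enc (x, y, f')" "qmod x" "qmod y" "qmod z" 
    "hom y z g'" "hom x y f'" by (auto simp: Hom_D)
  then show "farr Forget (g \<cdot>\<^bsub>D\<^esub> f) = farr Forget g \<cdot> farr Forget f"
    using hom_Cmp[OF f(3,4,5,6,7)] by (simp add: D_simps)
qed (auto simp: Obj_D Arr_D Hom_D D_simps hom_Add hom_Scl hom_Str M.in_Hom_iff dest: homD(1-3))

lemma faithful_Forget: "faithful D Forget"
  unfolding faithful_def inj_on_def by (auto simp: Hom_D)

lemma star_functor_Free: "star_functor M D Free"
proof
  show "fobj Free \<in> extensional (Obj M)" "farr Free \<in> extensional (Arr M)"
    by (simp_all add: Free_def)
qed (auto simp: Obj_D Arr_D Hom_D D_simps M.in_Hom_iff module_free hom_free)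

lemma faithful_Free: 
  assumes "faithful M Q" shows "faithful M Free"
  unfolding faithful_def
proof (intro ballI inj_onI)
  fix x y f g assume *: "x \<in> Obj M" "y \<in> Obj M" "f \<in> Hom M x y" "g \<in> Hom M x y" "farr Free f = farr Free g"
  then have "Qa f = Qa g" by (simp add: M.in_Hom_iff)
  then show "f = g" using assms * unfolding faithful_def inj_on_def by blast
qed

lemma adjunction_Free_Forget:
  "adjunction M D Free Forget (\<lambda>x\<in>Obj M. i x) (\<lambda>r\<in>Obj D. enc (m (Cod M r), r, r))"
proof (rule adjunctionI[OF M.category_axioms D.category_axioms star_functor_Free star_functor_Forget])
  fix g assume "g \<in> Arr D"
  then obtain r s f where g: "g = enc (r, s, f)" "qmod r" "qmod s" "hom r s f" by (auto simp: Arr_D)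
  then show "enc (m (Cod M (Cod D g)), Cod D g, Cod D g) \<cdot>\<^bsub>D\<^esub> farr Free (farr Forget g) =
         g \<cdot>\<^bsub>D\<^esub> enc (m (Cod M (Dom D g)), Dom D g, Dom D g)"
    using homD[OF g(4)] by (simp add: D_simps)
qed (auto simp: Obj_D Hom_D D_simps M.in_Hom_iff module_free hom_free hom_action i_nat m_unit_right moduleD(5))

lemma bi_faithful_Free: "faithful M Q \<Longrightarrow> bi_faithful M D Free"
  and bi_faithful_Forget: "faithful M Q \<Longrightarrow> bi_faithful D M Forget"
  using bi_faithfulI[OF M.star_category_axioms D.star_category_axioms star_functor_Free star_functor_Forget
    faithful_Free faithful_Forget adjunction_Free_Forget] by auto

text \<open>Here \<open>t\<close> is an action that need not be unitary. Let \<open>c = Q(t) m\<^sup>* i\<close> be the coaction attached to it, so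
that \<open>t c = 1\<close> and \<open>c t = Q(t) m\<^sup>*\<close>. The endomorphism \<open>T = t t\<^sup>*\<close> is injective, since \<open>T f = 0\<close> implies
\<open>t\<^sup>* f = 0\<close> and \<open>f = c\<^sup>* t\<^sup>* f = 0\<close>; hence it has an inverse \<open>K\<close>. The projection \<open>t\<^sup>* K t\<close> is split as
\<open>v v\<^sup>*\<close>. Then \<open>S = v\<^sup>* t\<^sup>* K\<close> satisfies \<open>S\<^sup>* S = K\<close> and has the inverse \<open>S' = t v\<close>.
By associativity \<open>Q(T) t\<^sup>* = Q(t) m\<^sup>* t\<^sup>* = c T\<close>, that is, \<open>t\<^sup>* K = Q(K) c\<close>, and this is unitarity of
the conjugated action.\<close>

lemma unitarize:
  assumes t: "t \<in> Arr M" "Dom M t = Qo x" "Cod M t = x" "t \<cdot> Qa t = t \<cdot> m x" "t \<cdot> i x = Idn M x"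
  obtains z S S' where "S \<in> Hom M x z" "S' \<in> Hom M z x" "S \<cdot> S' = Idn M z" "S' \<cdot> S = Idn M x"
    "qmod (S \<cdot> t \<cdot> Qa S')" "Str M S \<cdot> S \<cdot> t \<cdot> Str M t = Idn M x" "t \<cdot> Str M t \<cdot> Str M S \<cdot> S = Idn M x"
proof -
  note [simp] = t(1-3)
  have [simp]: "x \<in> Obj M" using M.Cod_in[OF t(1)] by simp
  define T where "T = t \<cdot> Str M t"
  define c where "c = Qa t \<cdot> Str M (m x) \<cdot> i x"
  have [simp]: "T \<in> Arr M" "Dom M T = x" "Cod M T = x" "c \<in> Arr M" "Dom M c = x" "Cod M c = Qo x"
    by (simp_all add: T_def c_def)
  have TS: "Str M T = T" by (simp add: T_def)
  have tc: "t \<cdot> c = Idn M x"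
    using M.reduce[OF t(4), of "Str M (m x) \<cdot> i x"] M.reduce[OF m_isometry[of x], of "i x"] t(5)
    by (simp add: c_def)
  have ct: "c \<cdot> t = Qa t \<cdot> Str M (m x)"
  proof -
    have "c \<cdot> t = Qa t \<cdot> Str M (m x) \<cdot> Qa t \<cdot> i (Qo x)" using i_nat[of t x] by (simp add: c_def)
    also have "\<dots> = Qa (t \<cdot> Qa t) \<cdot> Str M (m (Qo x)) \<cdot> i (Qo x)"
      using M.reduce[OF Str_m_nat[of t x "Qo x"], of "i (Qo x)"] by simp
    also have "\<dots> = Qa t \<cdot> Qa (m x) \<cdot> Str M (m (Qo x)) \<cdot> i (Qo x)" by (simp only: t(4)) simp
    also have "\<dots> = Qa t \<cdot> Str M (m x)" 
      using M.reduce[OF frobenius_left[of x], of "i (Qo x)"] by (simp add: m_unit_left)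
    finally show ?thesis .
  qed
  have inj: "f = Zer M x x" if f: "f \<in> Hom M x x" "T \<cdot> f = Zer M x x" for f
  proof -
    have [simp]: "f \<in> Arr M" "Dom M f = x" "Cod M f = x" using f by (auto simp: M.in_Hom_iff)
    have "Str M (Str M t \<cdot> f) \<cdot> (Str M t \<cdot> f) = Str M f \<cdot> T \<cdot> f" by (simp add: T_def)
    also have "\<dots> = Zer M x x" using f by simp
    finally have "Str M t \<cdot> f = Zer M x (Qo x)" using M.proper[of "Str M t \<cdot> f"] by simp
    then have "Str M c \<cdot> Str M t \<cdot> f = Zer M x x" by simp
    moreover have "Str M c \<cdot> Str M t = Idn M x" using arg_cong[OF tc, of "Str M"] by simp
    ultimately show ?thesis using M.reduce[of "Str M c" "Str M t" "Idn M x" f] by simp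
  qed
  obtain K where K: "K \<in> Hom M x x" "T \<cdot> K = Idn M x" "K \<cdot> T = Idn M x"
    using M.injective_invertible[of T x] inj M.fin_dim_end[of x] by auto
  have [simp]: "K \<in> Arr M" "Dom M K = x" "Cod M K = x" using K by (auto simp: M.in_Hom_iff)
  have KS: "Str M K = K"
  proof -
    have "Str M K \<cdot> T = Idn M x" using arg_cong[OF K(2), of "Str M"] TS by simp
    then have "Str M K \<cdot> (T \<cdot> K) = K" using M.reduce[of "Str M K" T "Idn M x" K] by simp
    then show ?thesis by (simp add: K)
  qed
  have tt: "t \<cdot> Str M t \<cdot> K = Idn M x" using K(2) by (simp add: T_def)
  have Ktt: "K \<cdot> t \<cdot> Str M t = Idn M x" using K(3) by (simp add: T_def)
  have tt': "t \<cdot> Str M t \<cdot> K \<cdot> f = f" if "f \<in> Arr M" "Cod M f = x" for f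
    using that M.reduce[OF K(2), of f] by (simp add: T_def)
  define p where "p = Str M t \<cdot> K \<cdot> t"
  have [simp]: "p \<in> Arr M" "Dom M p = Qo x" "Cod M p = Qo x" by (simp_all add: p_def)
  have "p \<cdot> p = p" by (simp add: p_def tt')
  moreover have "Str M p = p" by (simp add: p_def KS)
  ultimately obtain z v where "z \<in> Obj M" "v \<in> Hom M z (Qo x)" and vv: "Str M v \<cdot> v = Idn M z" "v \<cdot> Str M v = p"
    using M.projections_split[of p "Qo x"] by (auto simp: M.in_Hom_iff)
  then have [simp]: "z \<in> Obj M" "v \<in> Arr M" "Dom M v = z" "Cod M v = Qo x" by (auto simp: M.in_Hom_iff)
  have vv': "v \<cdot> Str M v \<cdot> f = Str M t \<cdot> K \<cdot> t \<cdot> f" if "f \<in> Arr M" "Cod M f = Qo x" for f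
    using that M.reduce[OF vv(2), of f] by (simp add: p_def)
  define S where "S = Str M v \<cdot> Str M t \<cdot> K"
  define S' where "S' = t \<cdot> v"
  have [simp]: "S \<in> Arr M" "Dom M S = x" "Cod M S = z" "S' \<in> Arr M" "Dom M S' = z" "Cod M S' = x"
    by (simp_all add: S_def S'_def)
  have S1: "S \<cdot> S' = Idn M z"
  proof -
    have "S \<cdot> S' = Str M v \<cdot> p \<cdot> v" by (simp add: S_def S'_def p_def)
    also have "\<dots> = (Str M v \<cdot> v) \<cdot> (Str M v \<cdot> v)" by (simp flip: vv(2))
    finally show ?thesis by (simp add: vv(1))
  qed
  have S2: "S' \<cdot> S = Idn M x" by (simp add: S_def S'_def vv' tt' tt)
  have SS: "Str M S \<cdot> S = K" by (simp add: S_def KS vv' tt' tt)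
  have S2': "S' \<cdot> S \<cdot> f = f" if "f \<in> Arr M" "Cod M f = x" for f
    using that M.reduce[OF S2, of f] by simp
  define r where "r = S \<cdot> t \<cdot> Qa S'"
  have [simp]: "r \<in> Arr M" "Dom M r = Qo z" "Cod M r = z" by (simp_all add: r_def)
  have "qmod r"
  proof (rule moduleI)
    have "r \<cdot> Qa r = S \<cdot> t \<cdot> Qa (S' \<cdot> S \<cdot> t \<cdot> Qa S')" by (simp add: r_def)
    also have "\<dots> = S \<cdot> (t \<cdot> Qa t) \<cdot> Qa (Qa S')" by (simp add: S2')
    also have "\<dots> = S \<cdot> t \<cdot> m x \<cdot> Qa (Qa S')" by (simp add: t(4))
    finally show "r \<cdot> Qa r = r \<cdot> m z" by (simp add: m_nat r_def)
    have "r \<cdot> i z = S \<cdot> (t \<cdot> i x) \<cdot> S'" by (simp add: r_def i_nat)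
    then show "r \<cdot> i z = Idn M z" by (simp add: t(5) S1)
    have "Qa T \<cdot> Str M t = Qa t \<cdot> Str M (t \<cdot> Qa t)" by (simp add: T_def)
    also have "\<dots> = Qa t \<cdot> Str M (m x) \<cdot> Str M t" by (simp add: t(4))
    also have "\<dots> = c \<cdot> T" using M.reduce[OF ct, of "Str M t"] by (simp add: T_def)
    finally have 1: "Qa T \<cdot> Str M t = c \<cdot> T" .
    have "Str M t \<cdot> K = Qa (K \<cdot> T) \<cdot> Str M t \<cdot> K" by (simp only: K) simp
    also have "\<dots> = Qa K \<cdot> (Qa T \<cdot> Str M t) \<cdot> K" by simp
    also have "\<dots> = Qa K \<cdot> c \<cdot> T \<cdot> K" by (simp only: 1) simp
    finally have 2: "Str M t \<cdot> K = Qa K \<cdot> c" by (simp add: K)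
    have 3: "Str M S = K \<cdot> S'"
    proof -
      have "(Str M S \<cdot> S) \<cdot> S' = Str M S \<cdot> (S \<cdot> S')" by simp
      then show ?thesis by (simp only: SS S1) simp
    qed
    have 4: "Str M S' \<cdot> K = S"
      using arg_cong[OF 3, of "Str M"] KS by simp
    have "Str M r = Qa (Str M S') \<cdot> (Str M t \<cdot> K) \<cdot> S'" by (simp add: r_def 3)
    also have "\<dots> = Qa (Str M S' \<cdot> K) \<cdot> c \<cdot> S'" by (simp only: 2) simp
    also have "\<dots> = Qa S \<cdot> c \<cdot> S'" by (simp only: 4)
    also have "\<dots> = Qa S \<cdot> Qa t \<cdot> (Str M (m x) \<cdot> Qa S') \<cdot> i z" by (simp add: c_def i_nat)
    also have "\<dots> = Qa r \<cdot> Str M (m z) \<cdot> i z" using Str_m_nat[of S' x z] by (simp add: r_def)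
    finally show "Str M r = Qa r \<cdot> Str M (m z) \<cdot> i z" .
  qed simp_all
  then show ?thesis
    using that[of S z S'] S1 S2 SS Ktt tt M.reduce[OF SS, of "t \<cdot> Str M t"] 
    by (simp add: M.in_Hom_iff r_def)
qed

end

section \<open>The functor induced on module categories\<close>

text \<open>\<open>G\<close> is a step of the 0-cell and \<open>W\<close> the connection of \<open>Q\<close>; the last two assumptions are the exchange
relations of the multiplication and of the unit.\<close>

locale Q_step = M: Q_monad M Q m i + N: Q_monad N P n j + G: functor_pair M N G
  for M :: "'u cat" and Q :: "'u func" and m i :: "'u \<Rightarrow> 'u" 
    and N :: "'u cat" (structure) and P :: "'u func" and n j :: "'u \<Rightarrow> 'u" and G :: "'u func" +
  fixes W :: "'u \<Rightarrow> 'u"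
  assumes W_in: "x \<in> Obj M \<Longrightarrow> W x \<in> Hom N (fobj G (fobj Q x)) (fobj P (fobj G x))"
    and W_unitary: "x \<in> Obj M \<Longrightarrow> unitary N (W x)"
    and W_nat: "f \<in> Arr M \<Longrightarrow> W (Cod M f) \<cdot> farr G (farr Q f) = farr P (farr G f) \<cdot> W (Dom M f)"
    and W_m: "x \<in> Obj M \<Longrightarrow> W x \<cdot> farr G (m x) = n (fobj G x) \<cdot> farr P (W x) \<cdot> W (fobj Q x)"
    and W_i: "x \<in> Obj M \<Longrightarrow> W x \<cdot> farr G (i x) = j (fobj G x)"
begin

abbreviation "Go \<equiv> fobj G"
abbreviation "Ga \<equiv> farr G"
abbreviation "Qo \<equiv> fobj Q"
abbreviation "Qa \<equiv> farr Q"
abbreviation "Po \<equiv> fobj P"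
abbreviation "Pa \<equiv> farr P"
abbreviation "DM \<equiv> Mod M Q m i"
abbreviation "DN \<equiv> Mod N P n j"
abbreviation "Mmod \<equiv> is_module M Q m i"
abbreviation "Nmod \<equiv> is_module N P n j"

lemma W_typ [simp]:
  "x \<in> Obj M \<Longrightarrow> W x \<in> Arr N" "x \<in> Obj M \<Longrightarrow> Dom N (W x) = Go (Qo x)" "x \<in> Obj M \<Longrightarrow> Cod N (W x) = Po (Go x)"
  using W_in by (auto simp: N.M.in_Hom_iff)

lemma Str_W_W [simp]: "x \<in> Obj M \<Longrightarrow> Str N (W x) \<cdot> W x = Idn N (Go (Qo x))"
  and W_Str_W [simp]: "x \<in> Obj M \<Longrightarrow> W x \<cdot> Str N (W x) = Idn N (Po (Go x))"
  using W_unitary unfolding unitary_def by auto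

lemma W_Str_W' [simp]: "\<lbrakk>x \<in> Obj M; f \<in> Arr N; Cod N f = Po (Go x)\<rbrakk> \<Longrightarrow> W x \<cdot> Str N (W x) \<cdot> f = f"
  using N.M.reduce[OF W_Str_W[of x], of f] by simp

lemma Str_W_W' [simp]: "\<lbrakk>x \<in> Obj M; f \<in> Arr N; Cod N f = Go (Qo x)\<rbrakk> \<Longrightarrow> Str N (W x) \<cdot> W x \<cdot> f = f"
  using N.M.reduce[OF Str_W_W[of x], of f] by simp

lemma Str_W_nat: 
  assumes "f \<in> Arr M" "Dom M f = x" "Cod M f = y" 
  shows "Str N (W y) \<cdot> Pa (Ga f) = Ga (Qa f) \<cdot> Str N (W x)"
proof -
  have "Str N (W y) \<cdot> (W y \<cdot> Ga (Qa f)) \<cdot> Str N (W x) = Str N (W y) \<cdot> (Pa (Ga f) \<cdot> W x) \<cdot> Str N (W x)"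
    using W_nat[of f] assms by simp
  then show ?thesis using assms by auto
qed

definition act :: "'u \<Rightarrow> 'u" where "act r = Ga r \<cdot> Str N (W (Cod M r))"

lemma act_typ [simp]:
  assumes "Mmod r" shows "act r \<in> Arr N" "Dom N (act r) = Po (Go (Cod M r))" "Cod N (act r) = Go (Cod M r)"
  using M.moduleD(1-3)[OF assms refl] by (auto simp: act_def)

text \<open>The exchange relation for \<open>m\<close>, solved for the product with \<open>W\<^sup>*\<close> by unitarity of \<open>W\<close>.\<close>

lemma W_m_Str: 
  assumes x: "x \<in> Obj M" 
  shows "Str N (W x) \<cdot> n (Go x) = Ga (m x) \<cdot> Str N (W (Qo x)) \<cdot> Pa (Str N (W x))"
proof -
  have u: "Pa (W x) \<cdot> Str N (Pa (W x)) = Idn N (Po (Po (Go x)))"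
    using N.Q.farr_Cmp'[of "W x" "Str N (W x)", symmetric] x by simp
  have "Ga (m x) \<cdot> Str N (W (Qo x)) \<cdot> Pa (Str N (W x)) 
     = Str N (W x) \<cdot> (W x \<cdot> Ga (m x)) \<cdot> Str N (W (Qo x)) \<cdot> Pa (Str N (W x))"
    using x by simp
  also have "\<dots> = Str N (W x) \<cdot> n (Go x) \<cdot> (Pa (W x) \<cdot> Pa (Str N (W x)))"
    using x by (subst W_m) simp_all
  finally show ?thesis using x u by simp
qed

lemma module_act: assumes r: "Mmod r" shows "Nmod (act r)"
proof -
  define x where "x = Cod M r"
  note [simp] = M.moduleD(1-3)[OF r x_def[symmetric]] x_def[symmetric]
  note R = M.moduleD(4-6)[OF r x_def[symmetric]]
  have a: "act r = Ga r \<cdot> Str N (W x)" by (simp add: act_def)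
  show ?thesis
  proof (rule N.moduleI)
    show "act r \<in> Arr N" "Dom N (act r) = Po (Go x)" "Cod N (act r) = Go x" using r by simp_all
    have "act r \<cdot> Pa (act r) = Ga r \<cdot> (Str N (W x) \<cdot> Pa (Ga r)) \<cdot> Pa (Str N (W x))" by (simp add: a)
    also have "\<dots> = Ga (r \<cdot>\<^bsub>M\<^esub> Qa r) \<cdot> Str N (W (Qo x)) \<cdot> Pa (Str N (W x))"
      by (simp add: Str_W_nat)
    also have "\<dots> = Ga r \<cdot> Ga (m x) \<cdot> Str N (W (Qo x)) \<cdot> Pa (Str N (W x))" by (simp only: R) simp
    also have "\<dots> = Ga r \<cdot> Str N (W x) \<cdot> n (Go x)" by (simp add: W_m_Str)
    finally show "act r \<cdot> Pa (act r) = act r \<cdot> n (Go x)" by (simp add: a)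
    have "act r \<cdot> j (Go x) = Ga r \<cdot> Str N (W x) \<cdot> W x \<cdot> Ga (i x)" by (simp add: a W_i)
    also have "\<dots> = Ga (r \<cdot>\<^bsub>M\<^esub> i x)" by simp
    finally show "act r \<cdot> j (Go x) = Idn N (Go x)" by (simp only: R) simp
    have "Str N (act r) = W x \<cdot> Ga (Str M r)" by (simp add: a)
    also have "\<dots> = (W x \<cdot> Ga (Qa r)) \<cdot> Ga (Str M (m x)) \<cdot> Ga (i x)" by (simp only: R) simp
    also have "\<dots> = Pa (Ga r) \<cdot> (W (Qo x) \<cdot> Ga (Str M (m x))) \<cdot> Ga (i x)"
      using W_nat[of r] by simp
    also have "W (Qo x) \<cdot> Ga (Str M (m x)) = Pa (Str N (W x)) \<cdot> Str N (n (Go x)) \<cdot> W x"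
    proof -
      have "Str N (Str N (W x) \<cdot> n (Go x)) = Str N (Ga (m x) \<cdot> Str N (W (Qo x)) \<cdot> Pa (Str N (W x)))"
        by (rule arg_cong[OF W_m_Str]) simp
      then have "Pa (W x) \<cdot> W (Qo x) \<cdot> Ga (Str M (m x)) = Str N (n (Go x)) \<cdot> W x" by simp
      then have "Pa (Str N (W x)) \<cdot> Pa (W x) \<cdot> W (Qo x) \<cdot> Ga (Str M (m x)) = Pa (Str N (W x)) \<cdot> Str N (n (Go x)) \<cdot> W x" by simp
      moreover have "Pa (Str N (W x)) \<cdot> Pa (W x) = Idn N (Po (Go (Qo x)))"
        using N.Q.farr_Cmp'[of "Str N (W x)" "W x", symmetric] by simp
      ultimately show ?thesis using N.M.reduce[of "Pa (Str N (W x))" "Pa (W x)" "Idn N (Po (Go (Qo x)))" "W (Qo x) \<cdot> Ga (Str M (m x))"]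
        by simp
    qed
    finally have "Str N (act r) = Pa (Ga r) \<cdot> Pa (Str N (W x)) \<cdot> Str N (n (Go x)) \<cdot> W x \<cdot> Ga (i x)" by simp
    then show "Str N (act r) = Pa (act r) \<cdot> Str N (n (Go x)) \<cdot> j (Go x)" by (simp add: a W_i)
  qed
qed

lemma hom_act: 
  assumes rs: "Mmod r" "Mmod s" and f: "mod_hom M Q r s f" 
  shows "mod_hom N P (act r) (act s) (Ga f)"
proof -
  note [simp] = M.moduleD(1-3)[OF rs(1) refl] M.moduleD(1-3)[OF rs(2) refl] M.homD(1-3)[OF f] rs
  have "Ga f \<cdot> act r = Ga (f \<cdot>\<^bsub>M\<^esub> r) \<cdot> Str N (W (Cod M r))" by (simp add: act_def)
  also have "\<dots> = Ga s \<cdot> Ga (Qa f) \<cdot> Str N (W (Cod M r))" by (simp only: M.homD(4)[OF f]) simp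
  also have "\<dots> = act s \<cdot> Pa (Ga f)" by (simp add: act_def Str_W_nat)
  finally show ?thesis by (intro N.homI) auto
qed

interpretation DM: finite_semisimple_cstar_category DM by (rule M.finite_semisimple_D)
interpretation DN: finite_semisimple_cstar_category DN by (rule N.finite_semisimple_D)

definition Ind :: "'u func" where
  "Ind = \<lparr>fobj = (\<lambda>r\<in>Obj DM. act r), farr = (\<lambda>a\<in>Arr DM. enc (act (src a), act (tgt a), Ga (und a)))\<rparr>"

lemma fobj_Ind [simp]: "Mmod r \<Longrightarrow> fobj Ind r = act r"
  by (simp add: Ind_def M.Obj_D)

lemma farr_Ind [simp]: "\<lbrakk>Mmod r; Mmod s; mod_hom M Q r s f\<rbrakk> \<Longrightarrow> farr Ind (enc (r, s, f)) = enc (act r, act s, Ga f)"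
  by (simp add: Ind_def)

lemma star_functor_Ind: "star_functor DM DN Ind"
proof
  show "fobj Ind \<in> extensional (Obj DM)" "farr Ind \<in> extensional (Arr DM)"
    by (simp_all add: Ind_def)
next
  fix f g x y z assume "g \<in> Hom DM y z" "f \<in> Hom DM x y"
  then obtain g' f' where f: "g = enc (y, z, g')" "f = enc (x, y, f')" "Mmod x" "Mmod y" "Mmod z" 
    "mod_hom M Q y z g'" "mod_hom M Q x y f'" by (auto simp: M.Hom_D)
  note [simp] = M.homD(1-3)[OF f(6)] M.homD(1-3)[OF f(7)]
  show "farr Ind (g \<cdot>\<^bsub>DM\<^esub> f) = farr Ind g \<cdot>\<^bsub>DN\<^esub> farr Ind f"
    using f M.hom_Cmp[OF f(3,4,5,6,7)] by (simp add: M.D_simps N.D_simps)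
next
  fix f g x y assume "f \<in> Hom DM x y" "g \<in> Hom DM x y"
  then obtain g' f' where f: "g = enc (x, y, g')" "f = enc (x, y, f')" "Mmod x" "Mmod y"
    "mod_hom M Q x y g'" "mod_hom M Q x y f'" by (auto simp: M.Hom_D)
  note [simp] = M.homD(1-3)[OF f(5)] M.homD(1-3)[OF f(6)]
  show "farr Ind (f \<oplus>\<^bsub>DM\<^esub> g) = farr Ind f \<oplus>\<^bsub>DN\<^esub> farr Ind g"
    using f M.hom_Add[OF f(3,4,6,5)] by (simp add: M.D_simps N.D_simps)
next
  fix f a assume "f \<in> Arr DM"
  then obtain x y f' where f: "f = enc (x, y, f')" "Mmod x" "Mmod y" "mod_hom M Q x y f'"
    by (auto simp: M.Arr_D)
  note [simp] = M.homD(1-3)[OF f(4)]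
  show "farr Ind (a \<odot>\<^bsub>DM\<^esub> f) = a \<odot>\<^bsub>DN\<^esub> farr Ind f" "farr Ind (Str DM f) = Str DN (farr Ind f)"
    using f M.hom_Scl[OF f(2,3,4)] M.hom_Str[OF f(2,3,4)] by (simp_all add: M.D_simps N.D_simps)
qed (auto simp: M.Obj_D N.Obj_D M.Hom_D N.Hom_D M.D_simps N.D_simps module_act hom_act)

lemma faithful_Ind: 
  assumes "faithful M G" shows "faithful DM Ind"
  unfolding faithful_def
proof (intro ballI inj_onI)
  fix x y f g assume "f \<in> Hom DM x y" "g \<in> Hom DM x y" and eq: "farr Ind f = farr Ind g"
  then obtain g' f' where f: "g = enc (x, y, g')" "f = enc (x, y, f')" "Mmod x" "Mmod y"
    "mod_hom M Q x y g'" "mod_hom M Q x y f'" by (auto simp: M.Hom_D)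
  have "Ga f' = Ga g'" using eq f by simp
  then have "f' = g'" using assms f(5,6) M.moduleD(3)[OF f(3) refl] M.moduleD(3)[OF f(4) refl]
    unfolding faithful_def inj_on_def mod_hom_def by blast
  then show "f = g" using f by simp
qed

text \<open>For a module \<open>s\<close> on \<open>y\<close> let \<open>t\<close> be the action of \<open>Q\<close> on \<open>H y\<close> with \<open>\<epsilon> G(t) = s P(\<epsilon>) W\<close>; its laws are
checked after transposition along the adjunction. Let \<open>S\<close> make it unitary and put \<open>K(g) = S H(g) S'\<close>
on arrows, where \<open>S' = S\<^sup>-\<^sup>1\<close>. Naturality of \<open>t\<close> in \<open>s\<close> shows that \<open>T = t t\<^sup>*\<close>, hence also
\<open>R = S\<^sup>* S = T\<^sup>-\<^sup>1\<close>, commutes with \<open>H(g)\<close>, so that \<open>K\<close> preserves adjoints although no naturality of \<open>S\<close> is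
available. Unit and counit are \<open>S \<eta>\<close> and \<open>\<epsilon> G(S')\<close>.\<close>

lemma Ind_adjoint:
  assumes H: "star_functor N M H" "faithful N H" and adj: "adjunction M N G H \<eta> \<epsilon>"
  shows "\<exists>K \<eta>' \<epsilon>'. star_functor DN DM K \<and> faithful DN K \<and> adjunction DM DN Ind K \<eta>' \<epsilon>'"
proof -
  interpret H: functor_pair N M H 
    by (intro functor_pair.intro H N.M.star_category_axioms M.M.star_category_axioms)
  note d = adjunctionD[OF M.M.category_axioms N.M.category_axioms G.star_functor_axioms H(1) adj]
  let ?Ho = "fobj H" and ?Ha = "farr H"
  have [simp]: "\<eta> x \<in> Arr M" "Dom M (\<eta> x) = x" "Cod M (\<eta> x) = ?Ho (Go x)" if "x \<in> Obj M" for x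
    using d(1)[OF that] by (auto simp: M.M.in_Hom_iff)
  have [simp]: "\<epsilon> y \<in> Arr N" "Dom N (\<epsilon> y) = Go (?Ho y)" "Cod N (\<epsilon> y) = y" if "y \<in> Obj N" for y
    using d(3)[OF that] by (auto simp: N.M.in_Hom_iff)
  have transpose: "a = b" if "a \<in> Arr M" "b \<in> Arr M" "Dom M a = w" "Dom M b = w" "Cod M a = ?Ho y" "Cod M b = ?Ho y"
    "y \<in> Obj N" "\<epsilon> y \<cdot> Ga a = \<epsilon> y \<cdot> Ga b" for a b w y
  proof -
    have w: "w \<in> Obj M" using that(1,3) by auto
    have *: "?Ha (\<epsilon> y \<cdot> Ga a) \<cdot>\<^bsub>M\<^esub> \<eta> w = a" if "a \<in> Arr M" "Dom M a = w" "Cod M a = ?Ho y" for a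
      using that \<open>y \<in> Obj N\<close> w d(2)[of a "?Ho y"] M.M.reduce[OF d(6)[OF \<open>y \<in> Obj N\<close>], of a] by simp
    show ?thesis using *[of a] *[of b] that by simp
  qed
  define t where "t s = ?Ha (s \<cdot> Pa (\<epsilon> (Cod N s)) \<cdot> W (?Ho (Cod N s))) \<cdot>\<^bsub>M\<^esub> \<eta> (Qo (?Ho (Cod N s)))" for s
  have tt [simp]: "t s \<in> Arr M" "Dom M (t s) = Qo (?Ho (Cod N s))" "Cod M (t s) = ?Ho (Cod N s)" if s: "Nmod s" for s
    using N.moduleD(1-3)[OF s refl] by (simp_all add: t_def)
  have \<epsilon>t: "\<epsilon> (Cod N s) \<cdot> Ga (t s) = s \<cdot> Pa (\<epsilon> (Cod N s)) \<cdot> W (?Ho (Cod N s))" if s: "Nmod s" for s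
  proof -
    define y where "y = Cod N s"
    note [simp] = N.moduleD(1-3)[OF s y_def[symmetric]] y_def[symmetric]
    define a where "a = s \<cdot> Pa (\<epsilon> y) \<cdot> W (?Ho y)"
    have [simp]: "a \<in> Arr N" "Dom N a = Go (Qo (?Ho y))" "Cod N a = y" by (simp_all add: a_def)
    have "\<epsilon> y \<cdot> Ga (?Ha a \<cdot>\<^bsub>M\<^esub> \<eta> (Qo (?Ho y))) = (\<epsilon> y \<cdot> Ga (?Ha a)) \<cdot> Ga (\<eta> (Qo (?Ho y)))" by simp
    also have "\<dots> = a \<cdot> \<epsilon> (Go (Qo (?Ho y))) \<cdot> Ga (\<eta> (Qo (?Ho y)))"
      by (subst d(4)) auto
    also have "\<dots> = a" by (simp add: d(5))
    finally show ?thesis by (simp add: t_def a_def)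
  qed
  have \<epsilon>t': "\<epsilon> (Cod N s) \<cdot> Ga (t s) \<cdot> f = s \<cdot> Pa (\<epsilon> (Cod N s)) \<cdot> W (?Ho (Cod N s)) \<cdot> f" 
    if s: "Nmod s" "f \<in> Arr N" "Cod N f = Go (Qo (?Ho (Cod N s)))" for s f
    using N.M.reduce[OF \<epsilon>t[OF s(1)], of f] s N.moduleD(1-3)[OF s(1) refl] by simp
  have t_nat: "?Ha g \<cdot>\<^bsub>M\<^esub> t s = t s' \<cdot>\<^bsub>M\<^esub> Qa (?Ha g)" if s: "Nmod s" "Nmod s'" "mod_hom N P s s' g" for s s' g
  proof -
    note [simp] = N.moduleD(1-3)[OF s(1) refl] N.moduleD(1-3)[OF s(2) refl] N.homD(1-3)[OF s(3)]
    show ?thesis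
    proof (rule transpose)
      have "\<epsilon> (Cod N s') \<cdot> Ga (?Ha g \<cdot>\<^bsub>M\<^esub> t s) = (\<epsilon> (Cod N s') \<cdot> Ga (?Ha g)) \<cdot> Ga (t s)" using s by simp
      also have "\<dots> = g \<cdot> \<epsilon> (Cod N s) \<cdot> Ga (t s)" using s by (subst d(4)) auto
      also have "\<dots> = (g \<cdot> s) \<cdot> Pa (\<epsilon> (Cod N s)) \<cdot> W (?Ho (Cod N s))" using s by (simp add: \<epsilon>t)
      also have "\<dots> = s' \<cdot> Pa (g \<cdot> \<epsilon> (Cod N s)) \<cdot> W (?Ho (Cod N s))" using N.homD(4)[OF s(3)] by simp
      also have "g \<cdot> \<epsilon> (Cod N s) = \<epsilon> (Cod N s') \<cdot> Ga (?Ha g)" by (subst d(4)) auto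
      also have "s' \<cdot> Pa (\<epsilon> (Cod N s') \<cdot> Ga (?Ha g)) \<cdot> W (?Ho (Cod N s)) 
        = s' \<cdot> Pa (\<epsilon> (Cod N s')) \<cdot> W (?Ho (Cod N s')) \<cdot> Ga (Qa (?Ha g))"
        using W_nat[of "?Ha g"] by simp
      also have "\<dots> = \<epsilon> (Cod N s') \<cdot> Ga (t s' \<cdot>\<^bsub>M\<^esub> Qa (?Ha g))" using s by (simp add: \<epsilon>t')
      finally show "\<epsilon> (Cod N s') \<cdot> Ga (?Ha g \<cdot>\<^bsub>M\<^esub> t s) = \<epsilon> (Cod N s') \<cdot> Ga (t s' \<cdot>\<^bsub>M\<^esub> Qa (?Ha g))" .
    qed (use s in auto)
  qed
  have t_assoc: "t s \<cdot>\<^bsub>M\<^esub> Qa (t s) = t s \<cdot>\<^bsub>M\<^esub> m (?Ho (Cod N s))" if s: "Nmod s" for s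
  proof -
    define y where "y = Cod N s"
    note [simp] = N.moduleD(1-3)[OF s y_def[symmetric]] y_def[symmetric] s
    note S = N.moduleD(4)[OF s y_def[symmetric]]
    note et = \<epsilon>t[OF s, folded y_def] and et' = \<epsilon>t'[OF s, folded y_def]
    note tt' [simp] = tt[OF s, folded y_def]
    have "t s \<cdot>\<^bsub>M\<^esub> Qa (t s) = t s \<cdot>\<^bsub>M\<^esub> m (?Ho y)"
    proof (rule transpose)
      have "\<epsilon> y \<cdot> Ga (t s \<cdot>\<^bsub>M\<^esub> Qa (t s)) = s \<cdot> Pa (\<epsilon> y) \<cdot> (W (?Ho y) \<cdot> Ga (Qa (t s)))" by (simp add: et')
      also have "W (?Ho y) \<cdot> Ga (Qa (t s)) = Pa (Ga (t s)) \<cdot> W (Qo (?Ho y))" using W_nat[of "t s"] by simp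
      also have "s \<cdot> Pa (\<epsilon> y) \<cdot> (Pa (Ga (t s)) \<cdot> W (Qo (?Ho y))) = s \<cdot> Pa (\<epsilon> y \<cdot> Ga (t s)) \<cdot> W (Qo (?Ho y))" by simp
      also have "\<dots> = (s \<cdot> Pa s) \<cdot> Pa (Pa (\<epsilon> y)) \<cdot> Pa (W (?Ho y)) \<cdot> W (Qo (?Ho y))" by (simp only: et) simp
      also have "\<dots> = s \<cdot> (n y \<cdot> Pa (Pa (\<epsilon> y))) \<cdot> Pa (W (?Ho y)) \<cdot> W (Qo (?Ho y))" by (simp only: S) simp
      also have "n y \<cdot> Pa (Pa (\<epsilon> y)) = Pa (\<epsilon> y) \<cdot> n (Go (?Ho y))" by (subst N.m_nat) auto
      also have "s \<cdot> (Pa (\<epsilon> y) \<cdot> n (Go (?Ho y))) \<cdot> Pa (W (?Ho y)) \<cdot> W (Qo (?Ho y)) 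
         = s \<cdot> Pa (\<epsilon> y) \<cdot> (n (Go (?Ho y)) \<cdot> Pa (W (?Ho y)) \<cdot> W (Qo (?Ho y)))" by simp
      also have "\<dots> = s \<cdot> Pa (\<epsilon> y) \<cdot> W (?Ho y) \<cdot> Ga (m (?Ho y))" by (simp add: W_m)
      also have "\<dots> = \<epsilon> y \<cdot> Ga (t s \<cdot>\<^bsub>M\<^esub> m (?Ho y))" by (simp add: et')
      finally show "\<epsilon> y \<cdot> Ga (t s \<cdot>\<^bsub>M\<^esub> Qa (t s)) = \<epsilon> y \<cdot> Ga (t s \<cdot>\<^bsub>M\<^esub> m (?Ho y))" .
    qed simp_all
    then show ?thesis by simp
  qed
  have t_unit: "t s \<cdot>\<^bsub>M\<^esub> i (?Ho (Cod N s)) = Idn M (?Ho (Cod N s))" if s: "Nmod s" for s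
  proof -
    define y where "y = Cod N s"
    note [simp] = N.moduleD(1-3)[OF s y_def[symmetric]] y_def[symmetric] s
    note S = N.moduleD(5)[OF s y_def[symmetric]]
    note et' = \<epsilon>t'[OF s, folded y_def]
    note tt' [simp] = tt[OF s, folded y_def]
    have "t s \<cdot>\<^bsub>M\<^esub> i (?Ho y) = Idn M (?Ho y)"
    proof (rule transpose)
      have "\<epsilon> y \<cdot> Ga (t s \<cdot>\<^bsub>M\<^esub> i (?Ho y)) = s \<cdot> Pa (\<epsilon> y) \<cdot> (W (?Ho y) \<cdot> Ga (i (?Ho y)))" by (simp add: et')
      also have "\<dots> = s \<cdot> Pa (\<epsilon> y) \<cdot> j (Go (?Ho y))" by (simp add: W_i)
      also have "\<dots> = (s \<cdot> j y) \<cdot> \<epsilon> y" using N.i_nat[of "\<epsilon> y" y] by simp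
      also have "\<dots> = \<epsilon> y \<cdot> Ga (Idn M (?Ho y))" by (simp add: S)
      finally show "\<epsilon> y \<cdot> Ga (t s \<cdot>\<^bsub>M\<^esub> i (?Ho y)) = \<epsilon> y \<cdot> Ga (Idn M (?Ho y))" .
    qed simp_all
    then show ?thesis by simp
  qed
  have "\<exists>z S S'. Nmod s \<longrightarrow> S \<in> Hom M (?Ho (Cod N s)) z \<and> S' \<in> Hom M z (?Ho (Cod N s)) \<and> S \<cdot>\<^bsub>M\<^esub> S' = Idn M z \<and>
    S' \<cdot>\<^bsub>M\<^esub> S = Idn M (?Ho (Cod N s)) \<and> Mmod (S \<cdot>\<^bsub>M\<^esub> t s \<cdot>\<^bsub>M\<^esub> Qa S') \<and> 
    Str M S \<cdot>\<^bsub>M\<^esub> S \<cdot>\<^bsub>M\<^esub> t s \<cdot>\<^bsub>M\<^esub> Str M (t s) = Idn M (?Ho (Cod N s)) \<and> 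
    t s \<cdot>\<^bsub>M\<^esub> Str M (t s) \<cdot>\<^bsub>M\<^esub> Str M S \<cdot>\<^bsub>M\<^esub> S = Idn M (?Ho (Cod N s))" for s
    using M.unitarize[OF tt t_assoc t_unit] by metis
  then obtain z S S' where SS: "\<And>s. Nmod s \<Longrightarrow> S s \<in> Hom M (?Ho (Cod N s)) (z s) \<and> S' s \<in> Hom M (z s) (?Ho (Cod N s)) 
    \<and> S s \<cdot>\<^bsub>M\<^esub> S' s = Idn M (z s) \<and>
    S' s \<cdot>\<^bsub>M\<^esub> S s = Idn M (?Ho (Cod N s)) \<and> Mmod (S s \<cdot>\<^bsub>M\<^esub> t s \<cdot>\<^bsub>M\<^esub> Qa (S' s)) \<and> 
    Str M (S s) \<cdot>\<^bsub>M\<^esub> S s \<cdot>\<^bsub>M\<^esub> t s \<cdot>\<^bsub>M\<^esub> Str M (t s) = Idn M (?Ho (Cod N s)) \<and> 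
    t s \<cdot>\<^bsub>M\<^esub> Str M (t s) \<cdot>\<^bsub>M\<^esub> Str M (S s) \<cdot>\<^bsub>M\<^esub> S s = Idn M (?Ho (Cod N s))"
    by metis
  define \<rho> where "\<rho> s = S s \<cdot>\<^bsub>M\<^esub> t s \<cdot>\<^bsub>M\<^esub> Qa (S' s)" for s
  have z [simp]: "z s \<in> Obj M" if "Nmod s" for s using SS[OF that] M.M.Dom_in[of "S' s"] by (auto simp: M.M.in_Hom_iff)
  have S [simp]: "S s \<in> Arr M" "Dom M (S s) = ?Ho (Cod N s)" "Cod M (S s) = z s" 
    "S' s \<in> Arr M" "Dom M (S' s) = z s" "Cod M (S' s) = ?Ho (Cod N s)" 
    "S s \<cdot>\<^bsub>M\<^esub> S' s = Idn M (z s)" "S' s \<cdot>\<^bsub>M\<^esub> S s = Idn M (?Ho (Cod N s))" "Mmod (\<rho> s)" if s: "Nmod s" for s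
    using SS[OF s] by (auto simp: M.M.in_Hom_iff \<rho>_def)
  have S_red [simp]: "S s \<cdot>\<^bsub>M\<^esub> S' s \<cdot>\<^bsub>M\<^esub> f = f" if "Nmod s" "f \<in> Arr M" "Cod M f = z s" for s f
    using that M.M.reduce[OF S(7)[OF that(1)], of f] by simp
  have S'_red [simp]: "S' s \<cdot>\<^bsub>M\<^esub> S s \<cdot>\<^bsub>M\<^esub> f = f" if "Nmod s" "f \<in> Arr M" "Cod M f = ?Ho (Cod N s)" for s f
    using that M.M.reduce[OF S(8)[OF that(1)], of f] by simp
  have \<rho>t [simp]: "\<rho> s \<in> Arr M" "Dom M (\<rho> s) = Qo (z s)" "Cod M (\<rho> s) = z s" if s: "Nmod s" for s
    using s by (simp_all add: \<rho>_def)
  have hom_conj: "mod_hom M Q (\<rho> s) (\<rho> s') (S s' \<cdot>\<^bsub>M\<^esub> f \<cdot>\<^bsub>M\<^esub> S' s)"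
    if s: "Nmod s" "Nmod s'" and f: "f \<in> Arr M" "Dom M f = ?Ho (Cod N s)" "Cod M f = ?Ho (Cod N s')"
      "f \<cdot>\<^bsub>M\<^esub> t s = t s' \<cdot>\<^bsub>M\<^esub> Qa f" for s s' f
  proof (rule M.homI)
    have 1: "Qa (S' s') \<cdot>\<^bsub>M\<^esub> Qa (S s') = Idn M (Qo (?Ho (Cod N s')))"
      using s M.Q.farr_Cmp'[of "S' s'" "S s'", symmetric] by simp
    have 2: "Qa (S' s') \<cdot>\<^bsub>M\<^esub> Qa (S s') \<cdot>\<^bsub>M\<^esub> g = g" if "g \<in> Arr M" "Cod M g = Qo (?Ho (Cod N s'))" for g
      using that s M.M.reduce[OF 1, of g] by simp
    show "(S s' \<cdot>\<^bsub>M\<^esub> f \<cdot>\<^bsub>M\<^esub> S' s) \<cdot>\<^bsub>M\<^esub> \<rho> s = \<rho> s' \<cdot>\<^bsub>M\<^esub> Qa (S s' \<cdot>\<^bsub>M\<^esub> f \<cdot>\<^bsub>M\<^esub> S' s)"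
      using s f M.M.reduce[OF f(4), of "Qa (S' s)"] by (simp add: \<rho>_def 2)
  qed (use s f in simp_all)
  have hom_K: "mod_hom M Q (\<rho> s) (\<rho> s') (S s' \<cdot>\<^bsub>M\<^esub> ?Ha g \<cdot>\<^bsub>M\<^esub> S' s)" 
    if s: "Nmod s" "Nmod s'" "mod_hom N P s s' g" for s s' g
    using s N.homD[OF s(3)] t_nat[OF s] by (intro hom_conj) auto
  define K where "K = \<lparr>fobj = (\<lambda>s\<in>Obj DN. \<rho> s), 
    farr = (\<lambda>a\<in>Arr DN. enc (\<rho> (src a), \<rho> (tgt a), S (tgt a) \<cdot>\<^bsub>M\<^esub> ?Ha (und a) \<cdot>\<^bsub>M\<^esub> S' (src a)))\<rparr>"
  have Ko [simp]: "fobj K s = \<rho> s" if "Nmod s" for s using that by (simp add: K_def N.Obj_D)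
  have Ka [simp]: "farr K (enc (s, s', g)) = enc (\<rho> s, \<rho> s', S s' \<cdot>\<^bsub>M\<^esub> ?Ha g \<cdot>\<^bsub>M\<^esub> S' s)" 
    if "Nmod s" "Nmod s'" "mod_hom N P s s' g" for s s' g using that by (simp add: K_def)
  have K: "star_functor DN DM K"
  proof
    show "fobj K \<in> extensional (Obj DN)" "farr K \<in> extensional (Arr DN)"
      by (simp_all add: K_def)
  next
    fix f g x y z assume "g \<in> Hom DN y z" "f \<in> Hom DN x y"
    then obtain g' f' where f: "g = enc (y, z, g')" "f = enc (x, y, f')" "Nmod x" "Nmod y" "Nmod z" 
      "mod_hom N P y z g'" "mod_hom N P x y f'" by (auto simp: N.Hom_D)
    note [simp] = N.homD(1-3)[OF f(6)] N.homD(1-3)[OF f(7)]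
    show "farr K (g \<cdot>\<^bsub>DN\<^esub> f) = farr K g \<cdot>\<^bsub>DM\<^esub> farr K f"
      using f N.hom_Cmp[OF f(3,4,5,6,7)] by (simp add: M.D_simps N.D_simps)
  next
    fix f g x y assume "f \<in> Hom DN x y" "g \<in> Hom DN x y"
    then obtain g' f' where f: "g = enc (x, y, g')" "f = enc (x, y, f')" "Nmod x" "Nmod y"
      "mod_hom N P x y g'" "mod_hom N P x y f'" by (auto simp: N.Hom_D)
    note [simp] = N.homD(1-3)[OF f(5)] N.homD(1-3)[OF f(6)]
    show "farr K (f \<oplus>\<^bsub>DN\<^esub> g) = farr K f \<oplus>\<^bsub>DM\<^esub> farr K g"
      using f N.hom_Add[OF f(3,4,6,5)] by (simp add: M.D_simps N.D_simps M.M.Cmp_Add' M.M.Add_Cmp')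
  next
    fix f a assume "f \<in> Arr DN"
    then obtain x y f' where f: "f = enc (x, y, f')" "Nmod x" "Nmod y" "mod_hom N P x y f'"
      by (auto simp: N.Arr_D)
    note [simp] = N.homD(1-3)[OF f(4)] f(2,3) and fS = N.hom_Str[OF f(2,3,4)]
    show "farr K (a \<odot>\<^bsub>DN\<^esub> f) = a \<odot>\<^bsub>DM\<^esub> farr K f"
      using f N.hom_Scl[OF f(2,3,4)] by (simp_all add: M.D_simps N.D_simps)
    define h where "h = ?Ha (Str N f')"
    have [simp]: "h \<in> Arr M" "Dom M h = ?Ho (Cod N y)" "Cod M h = ?Ho (Cod N x)" by (simp_all add: h_def)
    define T where "T s = t s \<cdot>\<^bsub>M\<^esub> Str M (t s)" for s
    define R where "R s = Str M (S s) \<cdot>\<^bsub>M\<^esub> S s" for s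
    have Tt [simp]: "T s \<in> Arr M" "Dom M (T s) = ?Ho (Cod N s)" "Cod M (T s) = ?Ho (Cod N s)" 
      "R s \<in> Arr M" "Dom M (R s) = ?Ho (Cod N s)" "Cod M (R s) = ?Ho (Cod N s)" if "Nmod s" for s
      using that by (simp_all add: T_def R_def)
    have RT: "R s \<cdot>\<^bsub>M\<^esub> T s = Idn M (?Ho (Cod N s))" "T s \<cdot>\<^bsub>M\<^esub> R s = Idn M (?Ho (Cod N s))" if "Nmod s" for s
      using SS[OF that] that by (simp_all add: T_def R_def)
    have 1: "h \<cdot>\<^bsub>M\<^esub> t y = t x \<cdot>\<^bsub>M\<^esub> Qa h" unfolding h_def by (rule t_nat[OF f(3,2) fS])
    have 2: "Str M h \<cdot>\<^bsub>M\<^esub> t x = t y \<cdot>\<^bsub>M\<^esub> Qa (Str M h)" using t_nat[OF f(2-4)] by (simp add: h_def)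
    have "h \<cdot>\<^bsub>M\<^esub> T y = t x \<cdot>\<^bsub>M\<^esub> Qa h \<cdot>\<^bsub>M\<^esub> Str M (t y)"
      using M.M.reduce[OF 1, of "Str M (t y)"] by (simp add: T_def)
    also have "Qa h \<cdot>\<^bsub>M\<^esub> Str M (t y) = Str M (t x) \<cdot>\<^bsub>M\<^esub> h" using arg_cong[OF 2, of "Str M"] by simp
    finally have 3: "h \<cdot>\<^bsub>M\<^esub> T y = T x \<cdot>\<^bsub>M\<^esub> h" by (simp add: T_def)
    have "R x \<cdot>\<^bsub>M\<^esub> h = R x \<cdot>\<^bsub>M\<^esub> (h \<cdot>\<^bsub>M\<^esub> T y) \<cdot>\<^bsub>M\<^esub> R y" by (simp add: RT)
    also have "\<dots> = (R x \<cdot>\<^bsub>M\<^esub> T x) \<cdot>\<^bsub>M\<^esub> h \<cdot>\<^bsub>M\<^esub> R y" by (simp only: 3) simp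
    also have "\<dots> = h \<cdot>\<^bsub>M\<^esub> R y" by (simp add: RT)
    finally have 4: "R x \<cdot>\<^bsub>M\<^esub> h = h \<cdot>\<^bsub>M\<^esub> R y" .
    have 5: "Str M (S y) = R y \<cdot>\<^bsub>M\<^esub> S' y" by (simp add: R_def)
    have "Str M (S' x) \<cdot>\<^bsub>M\<^esub> Str M (S x) = Idn M (z x)"
      using M.M.Str_Cmp'[of "S x" "S' x", symmetric] by simp
    from M.M.reduce[OF this, of "S x"] have 6: "Str M (S' x) \<cdot>\<^bsub>M\<^esub> R x = S x" by (simp add: R_def)
    have "Str M (S y \<cdot>\<^bsub>M\<^esub> ?Ha f' \<cdot>\<^bsub>M\<^esub> S' x) = Str M (S' x) \<cdot>\<^bsub>M\<^esub> (h \<cdot>\<^bsub>M\<^esub> R y) \<cdot>\<^bsub>M\<^esub> S' y"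
      by (simp add: 5 h_def)
    also have "\<dots> = (Str M (S' x) \<cdot>\<^bsub>M\<^esub> R x) \<cdot>\<^bsub>M\<^esub> h \<cdot>\<^bsub>M\<^esub> S' y" by (simp flip: 4)
    finally have "Str M (S y \<cdot>\<^bsub>M\<^esub> ?Ha f' \<cdot>\<^bsub>M\<^esub> S' x) = S x \<cdot>\<^bsub>M\<^esub> h \<cdot>\<^bsub>M\<^esub> S' y" by (simp only: 6)
    then show "farr K (Str DN f) = Str DM (farr K f)"
      using f fS by (simp add: M.D_simps N.D_simps h_def del: M.M.Str_Cmp')
  qed (auto simp: M.Obj_D N.Obj_D M.Hom_D N.Hom_D M.D_simps N.D_simps hom_K)
  have faithful: "faithful DN K"
    unfolding faithful_def
  proof (intro ballI inj_onI)
    fix x y f g assume "f \<in> Hom DN x y" "g \<in> Hom DN x y" and eq: "farr K f = farr K g"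
    then obtain g' f' where f: "g = enc (x, y, g')" "f = enc (x, y, f')" "Nmod x" "Nmod y"
      "mod_hom N P x y g'" "mod_hom N P x y f'" by (auto simp: N.Hom_D)
    note [simp] = N.homD(1-3)[OF f(5)] N.homD(1-3)[OF f(6)] f(3,4)
    have "S y \<cdot>\<^bsub>M\<^esub> ?Ha f' \<cdot>\<^bsub>M\<^esub> S' x = S y \<cdot>\<^bsub>M\<^esub> ?Ha g' \<cdot>\<^bsub>M\<^esub> S' x" using eq f by simp
    then have "S' y \<cdot>\<^bsub>M\<^esub> (S y \<cdot>\<^bsub>M\<^esub> ?Ha f' \<cdot>\<^bsub>M\<^esub> S' x) \<cdot>\<^bsub>M\<^esub> S x = S' y \<cdot>\<^bsub>M\<^esub> (S y \<cdot>\<^bsub>M\<^esub> ?Ha g' \<cdot>\<^bsub>M\<^esub> S' x) \<cdot>\<^bsub>M\<^esub> S x" by simp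
    then have "?Ha f' = ?Ha g'" by simp
    then have "f' = g'" using H(2) f(5,6) N.moduleD(3)[OF f(3) refl] N.moduleD(3)[OF f(4) refl]
      unfolding faithful_def inj_on_def mod_hom_def by blast
    then show "f = g" using f by simp
  qed
  have \<eta>_hom: "\<eta> (Cod M r) \<cdot>\<^bsub>M\<^esub> r = t (act r) \<cdot>\<^bsub>M\<^esub> Qa (\<eta> (Cod M r))" if r: "Mmod r" for r
  proof -
    define x where "x = Cod M r"
    note [simp] = M.moduleD(1-3)[OF r x_def[symmetric]] x_def[symmetric] r module_act[OF r]
    have [simp]: "Cod N (act r) = Go x" using act_typ(3)[OF r] by simp
    have "\<eta> x \<cdot>\<^bsub>M\<^esub> r = t (act r) \<cdot>\<^bsub>M\<^esub> Qa (\<eta> x)"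
    proof (rule transpose)
      have "\<epsilon> (Go x) \<cdot> Ga (t (act r) \<cdot>\<^bsub>M\<^esub> Qa (\<eta> x)) 
          = act r \<cdot> Pa (\<epsilon> (Go x)) \<cdot> (W (?Ho (Go x)) \<cdot> Ga (Qa (\<eta> x)))"
        using \<epsilon>t'[of "act r" "Ga (Qa (\<eta> x))"] by simp
      also have "W (?Ho (Go x)) \<cdot> Ga (Qa (\<eta> x)) = Pa (Ga (\<eta> x)) \<cdot> W x" using W_nat[of "\<eta> x"] by simp
      also have "act r \<cdot> Pa (\<epsilon> (Go x)) \<cdot> (Pa (Ga (\<eta> x)) \<cdot> W x) = act r \<cdot> Pa (\<epsilon> (Go x) \<cdot> Ga (\<eta> x)) \<cdot> W x"
        by simp
      also have "\<dots> = Ga r" by (simp only: d(5)[OF \<open>x \<in> Obj M\<close>]) (simp add: act_def)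
      also have "\<dots> = (\<epsilon> (Go x) \<cdot> Ga (\<eta> x)) \<cdot> Ga r" by (simp only: d(5)[OF \<open>x \<in> Obj M\<close>]) simp
      finally show "\<epsilon> (Go x) \<cdot> Ga (\<eta> x \<cdot>\<^bsub>M\<^esub> r) = \<epsilon> (Go x) \<cdot> Ga (t (act r) \<cdot>\<^bsub>M\<^esub> Qa (\<eta> x))" by simp
    qed simp_all
    then show ?thesis by simp
  qed
  define \<eta>' where "\<eta>' r = enc (r, \<rho> (act r), S (act r) \<cdot>\<^bsub>M\<^esub> \<eta> (Cod M r))" for r
  define \<epsilon>' where "\<epsilon>' s = enc (act (\<rho> s), s, \<epsilon> (Cod N s) \<cdot> Ga (S' s))" for s
  have \<eta>'_hom: "mod_hom M Q r (\<rho> (act r)) (S (act r) \<cdot>\<^bsub>M\<^esub> \<eta> (Cod M r))" if r: "Mmod r" for r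
  proof (rule M.homI)
    note [simp] = M.moduleD(1-3)[OF r refl] r module_act[OF r]
    have 1: "Qa (S' (act r)) \<cdot>\<^bsub>M\<^esub> Qa (S (act r)) = Idn M (Qo (?Ho (Go (Cod M r))))"
      using M.Q.farr_Cmp'[of "S' (act r)" "S (act r)", symmetric] by simp
    show "(S (act r) \<cdot>\<^bsub>M\<^esub> \<eta> (Cod M r)) \<cdot>\<^bsub>M\<^esub> r = \<rho> (act r) \<cdot>\<^bsub>M\<^esub> Qa (S (act r) \<cdot>\<^bsub>M\<^esub> \<eta> (Cod M r))"
      using \<eta>_hom[OF r] M.M.reduce[OF 1, of "Qa (\<eta> (Cod M r))"] by (simp add: \<rho>_def)
  qed (use r module_act[OF r] M.moduleD(1-3)[OF r refl] in simp_all)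
  have \<epsilon>'_hom: "mod_hom N P (act (\<rho> s)) s (\<epsilon> (Cod N s) \<cdot> Ga (S' s))" if s: "Nmod s" for s
  proof (rule N.homI)
    note [simp] = N.moduleD(1-3)[OF s refl] s
    have 1: "Ga (S' s) \<cdot> Ga (S s) = Idn N (Go (?Ho (Cod N s)))"
      using G.farr_Cmp'[of "S' s" "S s", symmetric] by simp
    have "(\<epsilon> (Cod N s) \<cdot> Ga (S' s)) \<cdot> act (\<rho> s) = (\<epsilon> (Cod N s) \<cdot> Ga (t s)) \<cdot> Ga (Qa (S' s)) \<cdot> Str N (W (z s))"
      using N.M.reduce[OF 1, of "Ga (t s) \<cdot> Ga (Qa (S' s)) \<cdot> Str N (W (z s))"]
      by (simp add: act_def) (simp add: \<rho>_def)
    also have "\<dots> = s \<cdot> Pa (\<epsilon> (Cod N s)) \<cdot> (W (?Ho (Cod N s)) \<cdot> Ga (Qa (S' s))) \<cdot> Str N (W (z s))"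
      using s by (simp only: \<epsilon>t) simp
    also have "W (?Ho (Cod N s)) \<cdot> Ga (Qa (S' s)) = Pa (Ga (S' s)) \<cdot> W (z s)"
      using W_nat[of "S' s"] s by simp
    finally show "(\<epsilon> (Cod N s) \<cdot> Ga (S' s)) \<cdot> act (\<rho> s) = s \<cdot> Pa (\<epsilon> (Cod N s) \<cdot> Ga (S' s))"
      using s by simp
  qed (use s N.moduleD(1-3)[OF s refl] in simp_all)
  have "adjunction DM DN Ind K (\<lambda>r\<in>Obj DM. \<eta>' r) (\<lambda>s\<in>Obj DN. \<epsilon>' s)"
  proof (rule adjunctionI[OF DM.category_axioms DN.category_axioms star_functor_Ind K])
    fix r assume "r \<in> Obj DM"
    then have r: "Mmod r" by (simp add: M.Obj_D)
    note [simp] = M.moduleD(1-3)[OF r refl] r module_act[OF r]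
    show "\<eta>' r \<in> Hom DM r (fobj K (fobj Ind r))" using \<eta>'_hom[OF r] by (simp add: \<eta>'_def M.Hom_D)
    have 1: "Ga (S' (act r)) \<cdot> Ga (S (act r)) = Idn N (Go (?Ho (Go (Cod M r))))"
      using G.farr_Cmp'[of "S' (act r)" "S (act r)", symmetric] by simp
    show "\<epsilon>' (fobj Ind r) \<cdot>\<^bsub>DN\<^esub> farr Ind (\<eta>' r) = Idn DN (fobj Ind r)"
      using \<eta>'_hom[OF r] N.M.reduce[OF 1, of "Ga (\<eta> (Cod M r))"] 
      by (simp add: \<eta>'_def \<epsilon>'_def N.D_simps d(5))
  next
    fix s assume "s \<in> Obj DN"
    then have s: "Nmod s" by (simp add: N.Obj_D)
    note [simp] = N.moduleD(1-3)[OF s refl] s module_act[OF S(9)[OF s]]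
    show "\<epsilon>' s \<in> Hom DN (fobj Ind (fobj K s)) s" using \<epsilon>'_hom[OF s] by (simp add: \<epsilon>'_def N.Hom_D)
    define a where "a = act (\<rho> s)"
    have [simp]: "Cod N a = Go (z s)" "Nmod a" by (simp_all add: a_def)
    have "?Ha (Ga (S' s)) \<cdot>\<^bsub>M\<^esub> \<eta> (z s) = \<eta> (?Ho (Cod N s)) \<cdot>\<^bsub>M\<^esub> S' s" using d(2)[of "S' s"] by simp
    then have "S s \<cdot>\<^bsub>M\<^esub> ?Ha (\<epsilon> (Cod N s)) \<cdot>\<^bsub>M\<^esub> ?Ha (Ga (S' s)) \<cdot>\<^bsub>M\<^esub> \<eta> (z s) = Idn M (z s)"
      using M.M.reduce[OF d(6)[of "Cod N s"], of "S' s"] by simp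
    then show "farr K (\<epsilon>' s) \<cdot>\<^bsub>DM\<^esub> \<eta>' (fobj K s) = Idn DM (fobj K s)"
      using \<epsilon>'_hom[OF s] by (simp add: \<eta>'_def \<epsilon>'_def M.D_simps flip: a_def)
  next
    fix f assume "f \<in> Arr DM"
    then obtain r s g where f: "f = enc (r, s, g)" "Mmod r" "Mmod s" "mod_hom M Q r s g" by (auto simp: M.Arr_D)
    note [simp] = M.homD(1-3)[OF f(4)] M.moduleD(1-3)[OF f(2) refl] M.moduleD(1-3)[OF f(3) refl]
      f(2,3) module_act[OF f(2)] module_act[OF f(3)]
    show "\<eta>' (Cod DM f) \<cdot>\<^bsub>DM\<^esub> f = farr K (farr Ind f) \<cdot>\<^bsub>DM\<^esub> \<eta>' (Dom DM f)"
      using f hom_act[OF f(2-4)] d(2)[of g "Cod M s"] by (simp add: \<eta>'_def M.D_simps)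
  next
    fix f assume "f \<in> Arr DN"
    then obtain r s g where f: "f = enc (r, s, g)" "Nmod r" "Nmod s" "mod_hom N P r s g" by (auto simp: N.Arr_D)
    note [simp] = N.homD(1-3)[OF f(4)] N.moduleD(1-3)[OF f(2) refl] N.moduleD(1-3)[OF f(3) refl] f(2,3)
    have 1: "Ga (S' s) \<cdot> Ga (S s) = Idn N (Go (?Ho (Cod N s)))"
      using G.farr_Cmp'[of "S' s" "S s", symmetric] by simp
    show "\<epsilon>' (Cod DN f) \<cdot>\<^bsub>DN\<^esub> farr Ind (farr K f) = f \<cdot>\<^bsub>DN\<^esub> \<epsilon>' (Dom DN f)"
      using f hom_K[OF f(2-4)] N.M.reduce[OF 1, of "Ga (?Ha g) \<cdot> Ga (S' r)"]
        N.M.reduce[OF d(4)[of g "Cod N s"], of "Ga (S' r)"] by (simp add: \<epsilon>'_def N.D_simps)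
  qed
  then show ?thesis using K faithful by blast
qed

theorem bi_faithful_Ind:
  assumes "bi_faithful M N G" shows "bi_faithful DM DN Ind"
proof -
  obtain H \<eta> \<epsilon> where H: "star_functor N M H" "faithful M G" "faithful N H" "adjunction M N G H \<eta> \<epsilon>"
    using bi_faithfulE[OF assms] by metis
  obtain K \<eta>' \<epsilon>' where "star_functor DN DM K" "faithful DN K" "adjunction DM DN Ind K \<eta>' \<epsilon>'"
    using Ind_adjoint[OF H(1,3,4)] by blast
  then show ?thesis
    by (intro bi_faithfulI(1)[OF DM.star_category_axioms DN.star_category_axioms star_functor_Ind _ faithful_Ind[OF H(2)]])
qed

end

section \<open>Calculus of 2-cells\<close>

lemma NT_iff:
  assumes "category A"
  shows "\<eta> \<in> NT A B F G \<longleftrightarrow> \<eta> \<in> extensional (Obj A) \<and> (\<forall>x\<in>Obj A. \<eta> x \<in> Hom B (fobj F x) (fobj G x)) \<and>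
    (\<forall>f\<in>Arr A. \<eta> (Cod A f) \<cdot>\<^bsub>B\<^esub> farr F f = farr G f \<cdot>\<^bsub>B\<^esub> \<eta> (Dom A f))"
proof -
  interpret A: category A by fact
  show ?thesis unfolding NT_def by (auto simp: A.in_Hom_iff)
qed

lemma NT_D:
  assumes "category A" "\<eta> \<in> NT A B F G"
  shows "x \<in> Obj A \<Longrightarrow> \<eta> x \<in> Arr B" "x \<in> Obj A \<Longrightarrow> Dom B (\<eta> x) = fobj F x" 
    "x \<in> Obj A \<Longrightarrow> Cod B (\<eta> x) = fobj G x" 
    "\<lbrakk>f \<in> Arr A; Cod A f = y\<rbrakk> \<Longrightarrow> \<eta> y \<cdot>\<^bsub>B\<^esub> farr F f = farr G f \<cdot>\<^bsub>B\<^esub> \<eta> (Dom A f)"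
    "\<eta> \<in> extensional (Obj A)"
  using assms(2) unfolding NT_iff[OF assms(1)] Hom_def by auto

lemma NT_id: 
  assumes "category A" "category B" "star_functor A B F" shows "nt_id A B F \<in> NT A B F F"
proof -
  interpret A: category A by fact
  interpret B: category B by fact
  interpret F: star_functor A B F by fact
  show ?thesis by (auto simp: NT_iff[OF A.category_axioms] nt_id_def B.in_Hom_iff)
qed

lemma NT_comp:
  assumes "category A" "category B" "star_functor A B F" "star_functor A B G" "star_functor A B H"
    and \<kappa>: "\<kappa> \<in> NT A B G H" and \<eta>: "\<eta> \<in> NT A B F G"
  shows "nt_comp A B \<kappa> \<eta> \<in> NT A B F H"
proof -
  interpret A: category A by fact
  interpret B: category B by fact
  interpret F: star_functor A B F by fact
  interpret G: star_functor A B G by fact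
  interpret H: star_functor A B H by fact
  note [simp] = NT_D(1-3)[OF A.category_axioms \<kappa>] NT_D(1-3)[OF A.category_axioms \<eta>]
  have "(\<kappa> (Cod A f) \<cdot>\<^bsub>B\<^esub> \<eta> (Cod A f)) \<cdot>\<^bsub>B\<^esub> farr F f = farr H f \<cdot>\<^bsub>B\<^esub> \<kappa> (Dom A f) \<cdot>\<^bsub>B\<^esub> \<eta> (Dom A f)" 
    if f: "f \<in> Arr A" for f
    using f NT_D(4)[OF A.category_axioms \<eta> f] 
      B.reduce[OF NT_D(4)[OF A.category_axioms \<kappa> f], of "Cod A f" "\<eta> (Dom A f)"] by simp
  then show ?thesis by (auto simp: NT_iff[OF A.category_axioms] nt_comp_def B.in_Hom_iff)
qed

lemma NT_hcomp:
  assumes "category A" "category B" "category C" "star_functor A B F" "star_functor A B F'" 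
    "star_functor B C G" "star_functor B C G'"
    and \<eta>: "\<eta> \<in> NT A B F F'" and \<kappa>: "\<kappa> \<in> NT B C G G'"
  shows "nt_comp A C (whisk_right A \<kappa> F') (whisk_left A G \<eta>) \<in> NT A C (func_comp A G F) (func_comp A G' F')"
proof -
  interpret A: category A by fact
  interpret B: category B by fact
  interpret C: category C by fact
  interpret F: star_functor A B F by fact
  interpret F': star_functor A B F' by fact
  interpret G: star_functor B C G by fact
  interpret G': star_functor B C G' by fact
  note [simp] = NT_D(1-3)[OF B.category_axioms \<kappa>] NT_D(1-3)[OF A.category_axioms \<eta>]
  have "(\<kappa> (fobj F' (Cod A f)) \<cdot>\<^bsub>C\<^esub> farr G (\<eta> (Cod A f))) \<cdot>\<^bsub>C\<^esub> farr G (farr F f) = 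
    farr G' (farr F' f) \<cdot>\<^bsub>C\<^esub> \<kappa> (fobj F' (Dom A f)) \<cdot>\<^bsub>C\<^esub> farr G (\<eta> (Dom A f))" 
    if f: "f \<in> Arr A" for f
  proof -
    have "(\<kappa> (fobj F' (Cod A f)) \<cdot>\<^bsub>C\<^esub> farr G (\<eta> (Cod A f))) \<cdot>\<^bsub>C\<^esub> farr G (farr F f)
      = \<kappa> (fobj F' (Cod A f)) \<cdot>\<^bsub>C\<^esub> farr G (\<eta> (Cod A f) \<cdot>\<^bsub>B\<^esub> farr F f)" using f by simp
    also have "\<eta> (Cod A f) \<cdot>\<^bsub>B\<^esub> farr F f = farr F' f \<cdot>\<^bsub>B\<^esub> \<eta> (Dom A f)"
      using f by (intro NT_D(4)[OF A.category_axioms \<eta>]) auto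
    also have "\<kappa> (fobj F' (Cod A f)) \<cdot>\<^bsub>C\<^esub> farr G (farr F' f \<cdot>\<^bsub>B\<^esub> \<eta> (Dom A f))
      = (\<kappa> (fobj F' (Cod A f)) \<cdot>\<^bsub>C\<^esub> farr G (farr F' f)) \<cdot>\<^bsub>C\<^esub> farr G (\<eta> (Dom A f))" using f by simp
    also have "\<kappa> (fobj F' (Cod A f)) \<cdot>\<^bsub>C\<^esub> farr G (farr F' f) = farr G' (farr F' f) \<cdot>\<^bsub>C\<^esub> \<kappa> (Dom B (farr F' f))"
      using f by (intro NT_D(4)[OF B.category_axioms \<kappa>]) auto
    finally show ?thesis using f by simp
  qed
  then show ?thesis by (auto simp: NT_iff[OF A.category_axioms] nt_comp_def whisk_left_def whisk_right_def C.in_Hom_iff)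
qed

lemma NT_star:
  assumes "star_category A" "star_category B" "star_functor A B F" "star_functor A B G"
    and \<eta>: "\<eta> \<in> NT A B F G"
  shows "nt_star A B \<eta> \<in> NT A B G F"
proof -
  interpret A: star_category A by fact
  interpret B: star_category B by fact
  interpret F: star_functor A B F by fact
  interpret G: star_functor A B G by fact
  note [simp] = NT_D(1-3)[OF A.category_axioms \<eta>]
  have "Str B (\<eta> (Cod A f)) \<cdot>\<^bsub>B\<^esub> farr G f = farr F f \<cdot>\<^bsub>B\<^esub> Str B (\<eta> (Dom A f))" if f: "f \<in> Arr A" for f
    using f arg_cong[OF NT_D(4)[OF A.category_axioms \<eta>, of "Str A f" "Dom A f"], of "Str B"] by simp
  then show ?thesis by (auto simp: NT_iff[OF A.category_axioms] nt_star_def B.in_Hom_iff)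
qed

text \<open>The rules collected in this locale and the next one hold with the level \<open>k\<close> as a variable, so that
consecutive levels can be treated in one simplification.\<close>

locale UC_obj =
  fixes \<Gamma> :: "'u zero_cell"
  assumes UC_0: "\<Gamma> \<in> UC_0"
begin

lemma fin_ss: "finite_semisimple_cstar_category (level \<Gamma> k)"
  using UC_0 by (simp add: UC_0_def)

lemma star_cat: "star_category (level \<Gamma> k)"
  using fin_ss[of k] unfolding finite_semisimple_cstar_category_def semisimple_cstar_category_def cstar_category_def
  by blast

lemma lin_cat: "linear_category (level \<Gamma> k)"
  using star_cat[of k] unfolding star_category_def by blast

lemma cat: "category (level \<Gamma> k)"
  using lin_cat[of k] unfolding linear_category_def by blast

lemma bi_faithful_step: "bi_faithful (level \<Gamma> k) (level \<Gamma> (Suc k)) (step \<Gamma> k)"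
  using UC_0 by (simp add: UC_0_def)

lemma step_functor: "star_functor (level \<Gamma> k) (level \<Gamma> (Suc k)) (step \<Gamma> k)"
  using bi_faithful_step unfolding bi_faithful_def by blast

lemmas in_Hom_iff = category.in_Hom_iff[OF cat]
lemmas reduce = category.reduce[OF cat]

lemmas cat_simps [simp] = category.Dom_in[OF cat] category.Cod_in[OF cat] category.Cmp_typ[OF cat] category.Idn_typ[OF cat] 
  category.Cmp_Idn'[OF cat] category.Idn_Cmp'[OF cat] category.assoc[OF cat]
  star_category.Str_typ[OF star_cat] star_category.Str_Str'[OF star_cat] star_category.Str_Cmp'[OF star_cat] 
  star_category.Str_Idn[OF star_cat] star_functor.farr_simps[OF step_functor]

end

locale UC_mor = S: UC_obj \<Gamma> + T: UC_obj \<Delta> for \<Gamma> \<Delta> :: "'u zero_cell" +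
  fixes \<Lambda> :: "'u one_cell"
  assumes UC_1: "\<Lambda> \<in> UC_1 \<Gamma> \<Delta>"
begin

lemma src_trg [simp]: "src0 \<Lambda> = \<Gamma>" "trg0 \<Lambda> = \<Delta>"
  using UC_1 by (simp_all add: UC_1_def)

lemma bi_faithful_fun: "bi_faithful (level \<Gamma> k) (level \<Delta> k) (fun1 \<Lambda> k)"
  using UC_1 by (simp add: UC_1_def)

lemma fun1_functor: "star_functor (level \<Gamma> k) (level \<Delta> k) (fun1 \<Lambda> k)"
  using bi_faithful_fun unfolding bi_faithful_def by blast

lemmas fun_simps [simp] = star_functor.farr_simps[OF fun1_functor]

lemma conn_NT: "conn \<Lambda> k \<in> NT (level \<Gamma> k) (level \<Delta> (Suc k))
        (func_comp (level \<Gamma> k) (step \<Delta> k) (fun1 \<Lambda> k)) (func_comp (level \<Gamma> k) (fun1 \<Lambda> (Suc k)) (step \<Gamma> k))"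
  using UC_1 by (simp add: UC_1_def natural_unitary_def)

lemma conn_typ [simp]:
  assumes "x \<in> Obj (level \<Gamma> k)"
  shows "conn \<Lambda> k x \<in> Arr (level \<Delta> (Suc k))" 
    "Dom (level \<Delta> (Suc k)) (conn \<Lambda> k x) = fobj (step \<Delta> k) (fobj (fun1 \<Lambda> k) x)" 
    "Cod (level \<Delta> (Suc k)) (conn \<Lambda> k x) = fobj (fun1 \<Lambda> (Suc k)) (fobj (step \<Gamma> k) x)" 
  using NT_D(1-3)[OF S.cat conn_NT assms] assms by simp_all

lemma conn_nat: 
  assumes "f \<in> Arr (level \<Gamma> k)" "Cod (level \<Gamma> k) f = y"
  shows "conn \<Lambda> k y \<cdot>\<^bsub>level \<Delta> (Suc k)\<^esub> farr (step \<Delta> k) (farr (fun1 \<Lambda> k) f) = 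
    farr (fun1 \<Lambda> (Suc k)) (farr (step \<Gamma> k) f) \<cdot>\<^bsub>level \<Delta> (Suc k)\<^esub> conn \<Lambda> k (Dom (level \<Gamma> k) f)"
  using NT_D(4)[OF S.cat conn_NT assms] assms by simp

lemma conn_ext: "conn \<Lambda> k \<in> extensional (Obj (level \<Gamma> k))"
  using NT_D(5)[OF S.cat conn_NT] .

lemma conn_unitary [simp]:
  assumes "x \<in> Obj (level \<Gamma> k)"
  shows "Str (level \<Delta> (Suc k)) (conn \<Lambda> k x) \<cdot>\<^bsub>level \<Delta> (Suc k)\<^esub> conn \<Lambda> k x = 
      Idn (level \<Delta> (Suc k)) (fobj (step \<Delta> k) (fobj (fun1 \<Lambda> k) x))"
    "conn \<Lambda> k x \<cdot>\<^bsub>level \<Delta> (Suc k)\<^esub> Str (level \<Delta> (Suc k)) (conn \<Lambda> k x) = 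
      Idn (level \<Delta> (Suc k)) (fobj (fun1 \<Lambda> (Suc k)) (fobj (step \<Gamma> k) x))"
  using UC_1 assms by (auto simp: UC_1_def natural_unitary_def unitary_def)

lemma conn_unitary_arr: "x \<in> Obj (level \<Gamma> k) \<Longrightarrow> unitary (level \<Delta> (Suc k)) (conn \<Lambda> k x)"
  by (simp add: unitary_def)

end

text \<open>The exchange relation on objects.\<close>

definition exch :: "'u one_cell \<Rightarrow> 'u one_cell \<Rightarrow> nat \<Rightarrow> ('u \<Rightarrow> 'u) \<Rightarrow> ('u \<Rightarrow> 'u) \<Rightarrow> bool" where
  "exch \<Lambda> \<Omega> k \<eta> \<kappa> \<longleftrightarrow> (\<forall>x\<in>Obj (level (src0 \<Lambda>) k).
    conn \<Omega> k x \<cdot>\<^bsub>level (trg0 \<Lambda>) (Suc k)\<^esub> farr (step (trg0 \<Lambda>) k) (\<eta> x) = 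
    \<kappa> (fobj (step (src0 \<Lambda>) k) x) \<cdot>\<^bsub>level (trg0 \<Lambda>) (Suc k)\<^esub> conn \<Lambda> k x)"

lemma restrict_eq_iff: "(\<lambda>x\<in>S. f x) = (\<lambda>x\<in>S. g x) \<longleftrightarrow> (\<forall>x\<in>S. f x = g x)"
  by (metis restrict_apply' restrict_ext)

lemma exchange_iff: "exchange \<Lambda> \<Omega> k \<eta> \<kappa> \<longleftrightarrow> exch \<Lambda> \<Omega> k \<eta> \<kappa>"
  unfolding exchange_def exch_def Let_def nt_comp_def whisk_left_def whisk_right_def restrict_eq_iff
  by auto

lemma exchange_seqs_iff:
  "\<eta> \<in> exchange_seqs \<Lambda> \<Omega> \<longleftrightarrow> (\<forall>k. \<eta> k \<in> NT (level (src0 \<Lambda>) k) (level (trg0 \<Lambda>) k) (fun1 \<Lambda> k) (fun1 \<Omega> k)) \<and>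
    (\<exists>N. \<forall>k\<ge>N. exch \<Lambda> \<Omega> k (\<eta> k) (\<eta> (Suc k)))"
  unfolding exchange_seqs_def exchange_iff by simp

lemma equiv_eventually_equal: "equiv (exchange_seqs \<Lambda> \<Omega>) (eventually_equal \<Lambda> \<Omega>)"
proof (rule equivI)
  show "trans (eventually_equal \<Lambda> \<Omega>)"
  proof (rule transI)
    fix \<eta> \<zeta> \<xi> assume "(\<eta>, \<zeta>) \<in> eventually_equal \<Lambda> \<Omega>" "(\<zeta>, \<xi>) \<in> eventually_equal \<Lambda> \<Omega>"
    then show "(\<eta>, \<xi>) \<in> eventually_equal \<Lambda> \<Omega>"
      unfolding eventually_equal_def by (auto elim: eventually_elim2)
  qed
qed (auto simp: eventually_equal_def refl_on_def sym_def elim: eventually_mono)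

lemma mk2_in: "\<eta> \<in> exchange_seqs \<Lambda> \<Omega> \<Longrightarrow> mk2 \<Lambda> \<Omega> \<eta> \<in> UC_2 \<Lambda> \<Omega>"
  by (simp add: UC_2_def mk2_def quotientI)

lemma rep2_mk2:
  assumes "\<eta> \<in> exchange_seqs \<Lambda> \<Omega>"
  shows "rep2 (mk2 \<Lambda> \<Omega> \<eta>) \<in> exchange_seqs \<Lambda> \<Omega>" "\<forall>\<^sub>F k in sequentially. rep2 (mk2 \<Lambda> \<Omega> \<eta>) k = \<eta> k"
proof -
  have "(\<eta>, \<eta>) \<in> eventually_equal \<Lambda> \<Omega>" using assms by (simp add: eventually_equal_def)
  then have "rep2 (mk2 \<Lambda> \<Omega> \<eta>) \<in> cls (mk2 \<Lambda> \<Omega> \<eta>)"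
    unfolding rep2_def by (intro someI[where P = "\<lambda>\<zeta>. \<zeta> \<in> cls (mk2 \<Lambda> \<Omega> \<eta>)"]) (simp add: mk2_def)
  then have "(\<eta>, rep2 (mk2 \<Lambda> \<Omega> \<eta>)) \<in> eventually_equal \<Lambda> \<Omega>" by (simp add: mk2_def)
  then show "rep2 (mk2 \<Lambda> \<Omega> \<eta>) \<in> exchange_seqs \<Lambda> \<Omega>" "\<forall>\<^sub>F k in sequentially. rep2 (mk2 \<Lambda> \<Omega> \<eta>) k = \<eta> k"
    by (auto simp: eventually_equal_def elim: eventually_mono)
qed

lemma UC_2_rep:
  assumes "\<mu> \<in> UC_2 \<Lambda> \<Omega>"
  obtains \<eta> where "\<eta> \<in> exchange_seqs \<Lambda> \<Omega>" "\<mu> = mk2 \<Lambda> \<Omega> \<eta>"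
proof -
  have "cls \<mu> \<in> exchange_seqs \<Lambda> \<Omega> // eventually_equal \<Lambda> \<Omega>" "src1 \<mu> = \<Lambda>" "trg1 \<mu> = \<Omega>"
    using assms by (auto simp: UC_2_def)
  then obtain \<eta> where "\<eta> \<in> exchange_seqs \<Lambda> \<Omega>" "cls \<mu> = eventually_equal \<Lambda> \<Omega> `` {\<eta>}"
    by (auto elim: quotientE)
  then show ?thesis using that[of \<eta>] \<open>src1 \<mu> = \<Lambda>\<close> \<open>trg1 \<mu> = \<Omega>\<close> by (simp add: mk2_def)
qed

lemma mk2_eq_iff:
  assumes "\<eta> \<in> exchange_seqs \<Lambda> \<Omega>" "\<zeta> \<in> exchange_seqs \<Lambda> \<Omega>"
  shows "mk2 \<Lambda> \<Omega> \<eta> = mk2 \<Lambda> \<Omega> \<zeta> \<longleftrightarrow> (\<forall>\<^sub>F k in sequentially. \<eta> k = \<zeta> k)"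
  using eq_equiv_class_iff[OF equiv_eventually_equal assms] assms
  by (simp add: mk2_def eventually_equal_def)

lemma mk2_src_trg [simp]: "src1 (mk2 \<Lambda> \<Omega> \<eta>) = \<Lambda>" "trg1 (mk2 \<Lambda> \<Omega> \<eta>) = \<Omega>"
  by (simp_all add: mk2_def)

definition vseq :: "'u one_cell \<Rightarrow> (nat \<Rightarrow> 'u \<Rightarrow> 'u) \<Rightarrow> (nat \<Rightarrow> 'u \<Rightarrow> 'u) \<Rightarrow> nat \<Rightarrow> 'u \<Rightarrow> 'u" where
  "vseq \<Lambda> \<kappa> \<eta> = (\<lambda>k. nt_comp (level (src0 \<Lambda>) k) (level (trg0 \<Lambda>) k) (\<kappa> k) (\<eta> k))"

definition hseq :: "'u one_cell \<Rightarrow> 'u one_cell \<Rightarrow> (nat \<Rightarrow> 'u \<Rightarrow> 'u) \<Rightarrow> (nat \<Rightarrow> 'u \<Rightarrow> 'u) \<Rightarrow> nat \<Rightarrow> 'u \<Rightarrow> 'u" where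
  "hseq \<Omega> \<Lambda>' \<kappa> \<eta> = (\<lambda>k. nt_comp (level (src0 \<Lambda>') k) (level (trg0 \<Omega>) k) 
    (whisk_right (level (src0 \<Lambda>') k) (\<kappa> k) (fun1 \<Lambda>' k)) (whisk_left (level (src0 \<Lambda>') k) (fun1 \<Omega> k) (\<eta> k)))"

definition sseq :: "'u one_cell \<Rightarrow> (nat \<Rightarrow> 'u \<Rightarrow> 'u) \<Rightarrow> nat \<Rightarrow> 'u \<Rightarrow> 'u" where
  "sseq \<Lambda> \<eta> = (\<lambda>k. nt_star (level (src0 \<Lambda>) k) (level (trg0 \<Lambda>) k) (\<eta> k))"

definition idseq :: "'u one_cell \<Rightarrow> nat \<Rightarrow> 'u \<Rightarrow> 'u" where
  "idseq \<Lambda> = (\<lambda>k. nt_id (level (src0 \<Lambda>) k) (level (trg0 \<Lambda>) k) (fun1 \<Lambda> k))"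

lemma UC_one2_mk2: "UC_one2 \<Lambda> = mk2 \<Lambda> \<Lambda> (idseq \<Lambda>)"
  by (simp add: UC_one2_def idseq_def)

lemma vseq_in:
  assumes "\<Gamma> \<in> UC_0" "\<Delta> \<in> UC_0" "\<Lambda> \<in> UC_1 \<Gamma> \<Delta>" "\<Omega> \<in> UC_1 \<Gamma> \<Delta>" "\<Theta> \<in> UC_1 \<Gamma> \<Delta>"
    and \<kappa>: "\<kappa> \<in> exchange_seqs \<Omega> \<Theta>" and \<eta>: "\<eta> \<in> exchange_seqs \<Lambda> \<Omega>"
  shows "vseq \<Lambda> \<kappa> \<eta> \<in> exchange_seqs \<Lambda> \<Theta>"
proof -
  interpret L: UC_mor \<Gamma> \<Delta> \<Lambda> by unfold_locales fact+
  interpret O: UC_mor \<Gamma> \<Delta> \<Omega> by unfold_locales fact+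
  interpret T: UC_mor \<Gamma> \<Delta> \<Theta> by unfold_locales fact+
  have nt: "\<kappa> k \<in> NT (level \<Gamma> k) (level \<Delta> k) (fun1 \<Omega> k) (fun1 \<Theta> k)" 
    "\<eta> k \<in> NT (level \<Gamma> k) (level \<Delta> k) (fun1 \<Lambda> k) (fun1 \<Omega> k)" for k
    using \<kappa> \<eta> by (simp_all add: exchange_seqs_iff)
  note [simp] = NT_D(1-3)[OF L.S.cat nt(1)] NT_D(1-3)[OF L.S.cat nt(2)]
  obtain N where N: "\<And>k. k \<ge> N \<Longrightarrow> exch \<Omega> \<Theta> k (\<kappa> k) (\<kappa> (Suc k))" using \<kappa> by (auto simp: exchange_seqs_iff)
  obtain N' where N': "\<And>k. k \<ge> N' \<Longrightarrow> exch \<Lambda> \<Omega> k (\<eta> k) (\<eta> (Suc k))" using \<eta> by (auto simp: exchange_seqs_iff)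
  have "exch \<Lambda> \<Theta> k (vseq \<Lambda> \<kappa> \<eta> k) (vseq \<Lambda> \<kappa> \<eta> (Suc k))" if "k \<ge> max N N'" for k
    unfolding exch_def
  proof
    fix x assume x: "x \<in> Obj (level (src0 \<Lambda>) k)"
    have 1: "conn \<Theta> k x \<cdot>\<^bsub>level \<Delta> (Suc k)\<^esub> farr (step \<Delta> k) (\<kappa> k x) = \<kappa> (Suc k) (fobj (step \<Gamma> k) x) \<cdot>\<^bsub>level \<Delta> (Suc k)\<^esub> conn \<Omega> k x"
      using N[of k] x that by (simp add: exch_def)
    have 2: "conn \<Omega> k x \<cdot>\<^bsub>level \<Delta> (Suc k)\<^esub> farr (step \<Delta> k) (\<eta> k x) = \<eta> (Suc k) (fobj (step \<Gamma> k) x) \<cdot>\<^bsub>level \<Delta> (Suc k)\<^esub> conn \<Lambda> k x"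
      using N'[of k] x that by (simp add: exch_def)
    show "conn \<Theta> k x \<cdot>\<^bsub>level (trg0 \<Lambda>) (Suc k)\<^esub> farr (step (trg0 \<Lambda>) k) (vseq \<Lambda> \<kappa> \<eta> k x) =
         vseq \<Lambda> \<kappa> \<eta> (Suc k) (fobj (step (src0 \<Lambda>) k) x) \<cdot>\<^bsub>level (trg0 \<Lambda>) (Suc k)\<^esub> conn \<Lambda> k x"
      using x L.T.reduce[OF 1, of "farr (step \<Delta> k) (\<eta> k x)"] by (simp add: vseq_def nt_comp_def 2)
  qed
  moreover have "vseq \<Lambda> \<kappa> \<eta> k \<in> NT (level \<Gamma> k) (level \<Delta> k) (fun1 \<Lambda> k) (fun1 \<Theta> k)" for k
    unfolding vseq_def using nt by (simp add: NT_comp[OF L.S.cat L.T.cat L.fun1_functor O.fun1_functor T.fun1_functor])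
  ultimately show ?thesis unfolding exchange_seqs_iff
    by (intro conjI exI[of _ "max N N'"] allI impI) simp_all
qed

lemma idseq_in:
  assumes "\<Gamma> \<in> UC_0" "\<Delta> \<in> UC_0" "\<Lambda> \<in> UC_1 \<Gamma> \<Delta>" 
  shows "idseq \<Lambda> \<in> exchange_seqs \<Lambda> \<Lambda>"
proof -
  interpret L: UC_mor \<Gamma> \<Delta> \<Lambda> by unfold_locales fact+
  have "idseq \<Lambda> k \<in> NT (level \<Gamma> k) (level \<Delta> k) (fun1 \<Lambda> k) (fun1 \<Lambda> k)" for k
    unfolding idseq_def by (simp add: NT_id[OF L.S.cat L.T.cat L.fun1_functor])
  moreover have "exch \<Lambda> \<Lambda> k (idseq \<Lambda> k) (idseq \<Lambda> (Suc k))" for k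
    by (simp add: idseq_def exch_def nt_id_def)
  ultimately show ?thesis unfolding exchange_seqs_iff by simp
qed

text \<open>Multiplying the adjoint of the exchange relation with the connections on both sides turns it into
the exchange relation for the adjoint sequence, because the connections are unitary.\<close>

lemma sseq_in:
  assumes "\<Gamma> \<in> UC_0" "\<Delta> \<in> UC_0" "\<Lambda> \<in> UC_1 \<Gamma> \<Delta>" "\<Omega> \<in> UC_1 \<Gamma> \<Delta>"
    and \<eta>: "\<eta> \<in> exchange_seqs \<Lambda> \<Omega>"
  shows "sseq \<Lambda> \<eta> \<in> exchange_seqs \<Omega> \<Lambda>"
proof -
  interpret L: UC_mor \<Gamma> \<Delta> \<Lambda> by unfold_locales fact+
  interpret O: UC_mor \<Gamma> \<Delta> \<Omega> by unfold_locales fact+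
  have nt: "\<eta> k \<in> NT (level \<Gamma> k) (level \<Delta> k) (fun1 \<Lambda> k) (fun1 \<Omega> k)" for k
    using \<eta> by (simp_all add: exchange_seqs_iff)
  note [simp] = NT_D(1-3)[OF L.S.cat nt]
  obtain N where N: "\<And>k. k \<ge> N \<Longrightarrow> exch \<Lambda> \<Omega> k (\<eta> k) (\<eta> (Suc k))" using \<eta> by (auto simp: exchange_seqs_iff)
  have "exch \<Omega> \<Lambda> k (sseq \<Lambda> \<eta> k) (sseq \<Lambda> \<eta> (Suc k))" if "k \<ge> N" for k
    unfolding exch_def
  proof
    fix x assume "x \<in> Obj (level (src0 \<Omega>) k)"
    then have x: "x \<in> Obj (level \<Gamma> k)" by simp
    let ?B = "level \<Delta> (Suc k)"
    define a where "a = farr (step \<Delta> k) (\<eta> k x)"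
    define c where "c = \<eta> (Suc k) (fobj (step \<Gamma> k) x)"
    have [simp]: "a \<in> Arr ?B" "Dom ?B a = fobj (step \<Delta> k) (fobj (fun1 \<Lambda> k) x)" "Cod ?B a = fobj (step \<Delta> k) (fobj (fun1 \<Omega> k) x)"
      "c \<in> Arr ?B" "Dom ?B c = fobj (fun1 \<Lambda> (Suc k)) (fobj (step \<Gamma> k) x)" "Cod ?B c = fobj (fun1 \<Omega> (Suc k)) (fobj (step \<Gamma> k) x)"
      using x by (simp_all add: a_def c_def)
    have 1: "conn \<Omega> k x \<cdot>\<^bsub>?B\<^esub> a = c \<cdot>\<^bsub>?B\<^esub> conn \<Lambda> k x"
      using N[OF that] x by (simp add: exch_def a_def c_def)
    have "conn \<Lambda> k x \<cdot>\<^bsub>?B\<^esub> Str ?B a = conn \<Lambda> k x \<cdot>\<^bsub>?B\<^esub> Str ?B (conn \<Omega> k x \<cdot>\<^bsub>?B\<^esub> a) \<cdot>\<^bsub>?B\<^esub> conn \<Omega> k x"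
      using x by simp
    also have "\<dots> = Str ?B c \<cdot>\<^bsub>?B\<^esub> conn \<Omega> k x"
      unfolding 1 using x L.T.reduce[OF L.conn_unitary(2)[OF x], of "Str ?B c \<cdot>\<^bsub>?B\<^esub> conn \<Omega> k x"] by simp
    finally show "conn \<Lambda> k x \<cdot>\<^bsub>level (trg0 \<Omega>) (Suc k)\<^esub> farr (step (trg0 \<Omega>) k) (sseq \<Lambda> \<eta> k x) =
         sseq \<Lambda> \<eta> (Suc k) (fobj (step (src0 \<Omega>) k) x) \<cdot>\<^bsub>level (trg0 \<Omega>) (Suc k)\<^esub> conn \<Omega> k x"
      using x by (simp add: sseq_def nt_star_def a_def c_def)
  qed
  moreover have "sseq \<Lambda> \<eta> k \<in> NT (level \<Gamma> k) (level \<Delta> k) (fun1 \<Omega> k) (fun1 \<Lambda> k)" for k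
    unfolding sseq_def using nt by (simp add: NT_star[OF L.S.star_cat L.T.star_cat L.fun1_functor O.fun1_functor])
  ultimately show ?thesis unfolding exchange_seqs_iff by auto
qed

lemma UC_one1_in:
  assumes "\<Gamma> \<in> UC_0" shows "UC_one1 \<Gamma> \<in> UC_1 \<Gamma> \<Gamma>"
proof -
  interpret UC_obj \<Gamma> by unfold_locales fact
  show ?thesis
    unfolding UC_1_def by (auto simp: UC_one1_def bi_faithful_id[OF star_cat] natural_unitary_def NT_iff[OF cat] 
      nt_id_def in_Hom_iff unitary_def)
qed

lemma UC_comp1_simps:
  "src0 (UC_comp1 \<Omega> \<Lambda>) = src0 \<Lambda>" "trg0 (UC_comp1 \<Omega> \<Lambda>) = trg0 \<Omega>"
  "fun1 (UC_comp1 \<Omega> \<Lambda>) k = func_comp (level (src0 \<Lambda>) k) (fun1 \<Omega> k) (fun1 \<Lambda> k)"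
  "x \<in> Obj (level (src0 \<Lambda>) k) \<Longrightarrow> conn (UC_comp1 \<Omega> \<Lambda>) k x = 
    farr (fun1 \<Omega> (Suc k)) (conn \<Lambda> k x) \<cdot>\<^bsub>level (trg0 \<Omega>) (Suc k)\<^esub> conn \<Omega> k (fobj (fun1 \<Lambda> k) x)"
  by (simp_all add: UC_comp1_def nt_comp_def whisk_left_def whisk_right_def)

lemma UC_comp1_in:
  assumes "\<Gamma> \<in> UC_0" "\<Delta> \<in> UC_0" "\<Sigma> \<in> UC_0" "\<Lambda> \<in> UC_1 \<Gamma> \<Delta>" "\<Omega> \<in> UC_1 \<Delta> \<Sigma>"
  shows "UC_comp1 \<Omega> \<Lambda> \<in> UC_1 \<Gamma> \<Sigma>"
proof -
  interpret L: UC_mor \<Gamma> \<Delta> \<Lambda> by unfold_locales fact+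
  interpret O: UC_mor \<Delta> \<Sigma> \<Omega> by unfold_locales fact+
  have bf: "bi_faithful (level \<Gamma> k) (level \<Sigma> k) (fun1 (UC_comp1 \<Omega> \<Lambda>) k)" for k
    by (simp add: UC_comp1_simps bi_faithful_comp[OF L.S.star_cat L.T.star_cat O.T.star_cat L.bi_faithful_fun O.bi_faithful_fun])
  let ?c = "\<lambda>k. conn (UC_comp1 \<Omega> \<Lambda>) k"
  have c: "?c k x = farr (fun1 \<Omega> (Suc k)) (conn \<Lambda> k x) \<cdot>\<^bsub>level \<Sigma> (Suc k)\<^esub> conn \<Omega> k (fobj (fun1 \<Lambda> k) x)"
    if "x \<in> Obj (level \<Gamma> k)" for k x using that by (simp add: UC_comp1_simps)
  have u: "unitary (level \<Sigma> (Suc k)) (?c k x)" if x: "x \<in> Obj (level \<Gamma> k)" for k x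
  proof -
    let ?C = "level \<Sigma> (Suc k)" and ?F = "farr (fun1 \<Omega> (Suc k))"
    have 1: "?F (conn \<Lambda> k x) \<cdot>\<^bsub>?C\<^esub> Str ?C (?F (conn \<Lambda> k x)) = Idn ?C (fobj (fun1 \<Omega> (Suc k)) (fobj (fun1 \<Lambda> (Suc k)) (fobj (step \<Gamma> k) x)))"
      "Str ?C (?F (conn \<Lambda> k x)) \<cdot>\<^bsub>?C\<^esub> ?F (conn \<Lambda> k x) = Idn ?C (fobj (fun1 \<Omega> (Suc k)) (fobj (step \<Delta> k) (fobj (fun1 \<Lambda> k) x)))"
      using x star_functor.farr_Cmp'[OF O.fun1_functor, of "conn \<Lambda> k x" "Suc k" "Str (level \<Delta> (Suc k)) (conn \<Lambda> k x)", symmetric]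
        star_functor.farr_Cmp'[OF O.fun1_functor, of "Str (level \<Delta> (Suc k)) (conn \<Lambda> k x)" "Suc k" "conn \<Lambda> k x", symmetric] by simp_all
    show ?thesis
      using x O.T.reduce[OF 1(2), of "conn \<Omega> k (fobj (fun1 \<Lambda> k) x)"] 
        O.T.reduce[OF O.conn_unitary(2)[of "fobj (fun1 \<Lambda> k) x" k], of "Str ?C (?F (conn \<Lambda> k x))"] 
      by (simp add: unitary_def c 1)
  qed
  have n: "?c k (Cod (level \<Gamma> k) f) \<cdot>\<^bsub>level \<Sigma> (Suc k)\<^esub> farr (step \<Sigma> k) (farr (fun1 \<Omega> k) (farr (fun1 \<Lambda> k) f)) =
    farr (fun1 \<Omega> (Suc k)) (farr (fun1 \<Lambda> (Suc k)) (farr (step \<Gamma> k) f)) \<cdot>\<^bsub>level \<Sigma> (Suc k)\<^esub> ?c k (Dom (level \<Gamma> k) f)"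
    if f: "f \<in> Arr (level \<Gamma> k)" for k f
  proof -
    let ?C = "level \<Sigma> (Suc k)" and ?F = "farr (fun1 \<Omega> (Suc k))"
    let ?x = "Dom (level \<Gamma> k) f" and ?y = "Cod (level \<Gamma> k) f" 
    have "?c k ?y \<cdot>\<^bsub>?C\<^esub> farr (step \<Sigma> k) (farr (fun1 \<Omega> k) (farr (fun1 \<Lambda> k) f)) =
      ?F (conn \<Lambda> k ?y) \<cdot>\<^bsub>?C\<^esub> (conn \<Omega> k (fobj (fun1 \<Lambda> k) ?y) \<cdot>\<^bsub>?C\<^esub> farr (step \<Sigma> k) (farr (fun1 \<Omega> k) (farr (fun1 \<Lambda> k) f)))"
      using f by (simp add: c)
    also have "\<dots> = ?F (conn \<Lambda> k ?y \<cdot>\<^bsub>level \<Delta> (Suc k)\<^esub> farr (step \<Delta> k) (farr (fun1 \<Lambda> k) f)) \<cdot>\<^bsub>?C\<^esub> conn \<Omega> k (fobj (fun1 \<Lambda> k) ?x)"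
      using f by (simp add: O.conn_nat)
    also have "conn \<Lambda> k ?y \<cdot>\<^bsub>level \<Delta> (Suc k)\<^esub> farr (step \<Delta> k) (farr (fun1 \<Lambda> k) f) = 
      farr (fun1 \<Lambda> (Suc k)) (farr (step \<Gamma> k) f) \<cdot>\<^bsub>level \<Delta> (Suc k)\<^esub> conn \<Lambda> k ?x"
      using f by (simp add: L.conn_nat)
    finally show ?thesis using f by (simp add: c)
  qed
  have "natural_unitary (level \<Gamma> k) (level \<Sigma> (Suc k)) (func_comp (level \<Gamma> k) (step \<Sigma> k) (fun1 (UC_comp1 \<Omega> \<Lambda>) k)) 
    (func_comp (level \<Gamma> k) (fun1 (UC_comp1 \<Omega> \<Lambda>) (Suc k)) (step \<Gamma> k)) (?c k)" for k
    unfolding natural_unitary_def NT_iff[OF L.S.cat]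
  proof (intro conjI ballI)
    show "?c k \<in> extensional (Obj (level \<Gamma> k))" by (simp add: UC_comp1_def nt_comp_def)
  qed (use u n in \<open>auto simp: UC_comp1_simps O.T.in_Hom_iff\<close>)
  then show ?thesis using bf unfolding UC_1_def by (auto simp: UC_comp1_simps)
qed

text \<open>The connection of \<open>\<Omega>\<close> is natural with respect to \<open>\<eta>\<close> and \<open>\<kappa>\<close> is natural with respect to the
connection of \<open>\<Lambda>'\<close>; this moves the two given exchange relations into adjacent positions.\<close>

lemma hseq_in:
  assumes "\<Gamma> \<in> UC_0" "\<Delta> \<in> UC_0" "\<Sigma> \<in> UC_0" 
    and 1: "\<Lambda> \<in> UC_1 \<Gamma> \<Delta>" "\<Lambda>' \<in> UC_1 \<Gamma> \<Delta>" "\<Omega> \<in> UC_1 \<Delta> \<Sigma>" "\<Omega>' \<in> UC_1 \<Delta> \<Sigma>"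
    and \<kappa>: "\<kappa> \<in> exchange_seqs \<Omega> \<Omega>'" and \<eta>: "\<eta> \<in> exchange_seqs \<Lambda> \<Lambda>'"
  shows "hseq \<Omega> \<Lambda>' \<kappa> \<eta> \<in> exchange_seqs (UC_comp1 \<Omega> \<Lambda>) (UC_comp1 \<Omega>' \<Lambda>')"
proof -
  interpret L: UC_mor \<Gamma> \<Delta> \<Lambda> by unfold_locales fact+
  interpret L': UC_mor \<Gamma> \<Delta> \<Lambda>' by unfold_locales fact+
  interpret O: UC_mor \<Delta> \<Sigma> \<Omega> by unfold_locales fact+
  interpret O': UC_mor \<Delta> \<Sigma> \<Omega>' by unfold_locales fact+
  have nt: "\<kappa> k \<in> NT (level \<Delta> k) (level \<Sigma> k) (fun1 \<Omega> k) (fun1 \<Omega>' k)" 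
    "\<eta> k \<in> NT (level \<Gamma> k) (level \<Delta> k) (fun1 \<Lambda> k) (fun1 \<Lambda>' k)" for k
    using \<kappa> \<eta> by (simp_all add: exchange_seqs_iff)
  note [simp] = NT_D(1-3)[OF L.T.cat nt(1)] NT_D(1-3)[OF L.S.cat nt(2)]
  obtain N where N: "\<And>k. k \<ge> N \<Longrightarrow> exch \<Omega> \<Omega>' k (\<kappa> k) (\<kappa> (Suc k))" using \<kappa> by (auto simp: exchange_seqs_iff)
  obtain N' where N': "\<And>k. k \<ge> N' \<Longrightarrow> exch \<Lambda> \<Lambda>' k (\<eta> k) (\<eta> (Suc k))" using \<eta> by (auto simp: exchange_seqs_iff)
  have "exch (UC_comp1 \<Omega> \<Lambda>) (UC_comp1 \<Omega>' \<Lambda>') k (hseq \<Omega> \<Lambda>' \<kappa> \<eta> k) (hseq \<Omega> \<Lambda>' \<kappa> \<eta> (Suc k))" if "k \<ge> max N N'" for k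
    unfolding exch_def
  proof
    let ?C = "level \<Sigma> (Suc k)" and ?B = "level \<Delta> (Suc k)"
    fix x assume "x \<in> Obj (level (src0 (UC_comp1 \<Omega> \<Lambda>)) k)"
    then have x: "x \<in> Obj (level \<Gamma> k)" by (simp add: UC_comp1_simps)
    define y where "y = fobj (fun1 \<Lambda>' k) x"
    define w where "w = fobj (step \<Gamma> k) x"
    have [simp]: "y \<in> Obj (level \<Delta> k)" "w \<in> Obj (level \<Gamma> (Suc k))" "fobj (fun1 \<Lambda>' k) x = y" "fobj (step \<Gamma> k) x = w" 
      using x by (simp_all add: y_def w_def)
    let ?W = "fun1 \<Omega> (Suc k)" and ?W' = "fun1 \<Omega>' (Suc k)"
    have 1: "conn \<Omega>' k y \<cdot>\<^bsub>?C\<^esub> farr (step \<Sigma> k) (\<kappa> k y) = \<kappa> (Suc k) (fobj (step \<Delta> k) y) \<cdot>\<^bsub>?C\<^esub> conn \<Omega> k y"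
      using N[of k] that by (simp add: exch_def)
    have 2: "conn \<Lambda>' k x \<cdot>\<^bsub>?B\<^esub> farr (step \<Delta> k) (\<eta> k x) = \<eta> (Suc k) w \<cdot>\<^bsub>?B\<^esub> conn \<Lambda> k x"
      using N'[of k] x that by (simp add: exch_def)
    have 3: "conn \<Omega> k y \<cdot>\<^bsub>?C\<^esub> farr (step \<Sigma> k) (farr (fun1 \<Omega> k) (\<eta> k x)) = 
      farr ?W (farr (step \<Delta> k) (\<eta> k x)) \<cdot>\<^bsub>?C\<^esub> conn \<Omega> k (fobj (fun1 \<Lambda> k) x)"
      using O.conn_nat[of "\<eta> k x" k y] x by simp
    have 4: "\<kappa> (Suc k) (fobj (fun1 \<Lambda>' (Suc k)) w) \<cdot>\<^bsub>?C\<^esub> farr ?W (conn \<Lambda>' k x) = 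
      farr ?W' (conn \<Lambda>' k x) \<cdot>\<^bsub>?C\<^esub> \<kappa> (Suc k) (fobj (step \<Delta> k) y)"
      using NT_D(4)[OF L.T.cat nt(1), of "conn \<Lambda>' k x" "Suc k"] x by simp
    have "(farr ?W' (conn \<Lambda>' k x) \<cdot>\<^bsub>?C\<^esub> conn \<Omega>' k y) \<cdot>\<^bsub>?C\<^esub> farr (step \<Sigma> k) (\<kappa> k y \<cdot>\<^bsub>level \<Sigma> k\<^esub> farr (fun1 \<Omega> k) (\<eta> k x))
      = farr ?W' (conn \<Lambda>' k x) \<cdot>\<^bsub>?C\<^esub> (conn \<Omega>' k y \<cdot>\<^bsub>?C\<^esub> farr (step \<Sigma> k) (\<kappa> k y)) \<cdot>\<^bsub>?C\<^esub> farr (step \<Sigma> k) (farr (fun1 \<Omega> k) (\<eta> k x))"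
      using x by simp
    also have "\<dots> = (farr ?W' (conn \<Lambda>' k x) \<cdot>\<^bsub>?C\<^esub> \<kappa> (Suc k) (fobj (step \<Delta> k) y)) \<cdot>\<^bsub>?C\<^esub> 
        (conn \<Omega> k y \<cdot>\<^bsub>?C\<^esub> farr (step \<Sigma> k) (farr (fun1 \<Omega> k) (\<eta> k x)))"
      using x by (simp only: 1) simp
    also have "\<dots> = (\<kappa> (Suc k) (fobj (fun1 \<Lambda>' (Suc k)) w) \<cdot>\<^bsub>?C\<^esub> farr ?W (conn \<Lambda>' k x)) \<cdot>\<^bsub>?C\<^esub> 
        (farr ?W (farr (step \<Delta> k) (\<eta> k x)) \<cdot>\<^bsub>?C\<^esub> conn \<Omega> k (fobj (fun1 \<Lambda> k) x))"
      by (simp only: 3 4)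
    also have "\<dots> = \<kappa> (Suc k) (fobj (fun1 \<Lambda>' (Suc k)) w) \<cdot>\<^bsub>?C\<^esub> 
        farr ?W (conn \<Lambda>' k x \<cdot>\<^bsub>?B\<^esub> farr (step \<Delta> k) (\<eta> k x)) \<cdot>\<^bsub>?C\<^esub> conn \<Omega> k (fobj (fun1 \<Lambda> k) x)"
      using x by simp
    also have "\<dots> = (\<kappa> (Suc k) (fobj (fun1 \<Lambda>' (Suc k)) w) \<cdot>\<^bsub>?C\<^esub> farr ?W (\<eta> (Suc k) w)) \<cdot>\<^bsub>?C\<^esub> 
        farr ?W (conn \<Lambda> k x) \<cdot>\<^bsub>?C\<^esub> conn \<Omega> k (fobj (fun1 \<Lambda> k) x)"
      using x by (simp only: 2) simp
    finally show "conn (UC_comp1 \<Omega>' \<Lambda>') k x \<cdot>\<^bsub>level (trg0 (UC_comp1 \<Omega> \<Lambda>)) (Suc k)\<^esub> farr (step (trg0 (UC_comp1 \<Omega> \<Lambda>)) k) (hseq \<Omega> \<Lambda>' \<kappa> \<eta> k x) =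
         hseq \<Omega> \<Lambda>' \<kappa> \<eta> (Suc k) (fobj (step (src0 (UC_comp1 \<Omega> \<Lambda>)) k) x) \<cdot>\<^bsub>level (trg0 (UC_comp1 \<Omega> \<Lambda>)) (Suc k)\<^esub> conn (UC_comp1 \<Omega> \<Lambda>) k x"
      using x by (simp add: UC_comp1_simps hseq_def nt_comp_def whisk_left_def whisk_right_def del: L.T.cat_simps O.T.cat_simps)
  qed
  moreover have "hseq \<Omega> \<Lambda>' \<kappa> \<eta> k \<in> NT (level \<Gamma> k) (level \<Sigma> k) (func_comp (level \<Gamma> k) (fun1 \<Omega> k) (fun1 \<Lambda> k)) (func_comp (level \<Gamma> k) (fun1 \<Omega>' k) (fun1 \<Lambda>' k))" for k
    unfolding hseq_def using nt 
    by (simp add: NT_hcomp[OF L.S.cat L.T.cat O.T.cat L.fun1_functor L'.fun1_functor O.fun1_functor O'.fun1_functor])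
  ultimately show ?thesis unfolding exchange_seqs_iff
    by (intro conjI exI[of _ "max N N'"] allI impI) (simp_all add: UC_comp1_simps)
qed

text \<open>The operations on 2-cells may be computed on arbitrary representatives.\<close>

lemma UC_vcomp_mk2:
  assumes "\<Gamma> \<in> UC_0" "\<Delta> \<in> UC_0" "\<Lambda> \<in> UC_1 \<Gamma> \<Delta>" "\<Omega> \<in> UC_1 \<Gamma> \<Delta>" "\<Theta> \<in> UC_1 \<Gamma> \<Delta>"
    and \<kappa>: "\<kappa> \<in> exchange_seqs \<Omega> \<Theta>" and \<eta>: "\<eta> \<in> exchange_seqs \<Lambda> \<Omega>"
  shows "UC_vcomp (mk2 \<Omega> \<Theta> \<kappa>) (mk2 \<Lambda> \<Omega> \<eta>) = mk2 \<Lambda> \<Theta> (vseq \<Lambda> \<kappa> \<eta>)"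
proof -
  have "UC_vcomp (mk2 \<Omega> \<Theta> \<kappa>) (mk2 \<Lambda> \<Omega> \<eta>) = mk2 \<Lambda> \<Theta> (vseq \<Lambda> (rep2 (mk2 \<Omega> \<Theta> \<kappa>)) (rep2 (mk2 \<Lambda> \<Omega> \<eta>)))"
    by (simp add: UC_vcomp_def vseq_def)
  also have "\<dots> = mk2 \<Lambda> \<Theta> (vseq \<Lambda> \<kappa> \<eta>)"
    using rep2_mk2(2)[OF \<kappa>] rep2_mk2(2)[OF \<eta>]
    by (subst mk2_eq_iff[OF vseq_in[OF assms(1-5) rep2_mk2(1)[OF \<kappa>] rep2_mk2(1)[OF \<eta>]] vseq_in[OF assms(1-5) \<kappa> \<eta>]])
      (auto simp: vseq_def elim: eventually_elim2)
  finally show ?thesis .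
qed

lemma UC_hcomp_mk2:
  assumes "\<Gamma> \<in> UC_0" "\<Delta> \<in> UC_0" "\<Sigma> \<in> UC_0" 
    "\<Lambda> \<in> UC_1 \<Gamma> \<Delta>" "\<Lambda>' \<in> UC_1 \<Gamma> \<Delta>" "\<Omega> \<in> UC_1 \<Delta> \<Sigma>" "\<Omega>' \<in> UC_1 \<Delta> \<Sigma>"
    and \<kappa>: "\<kappa> \<in> exchange_seqs \<Omega> \<Omega>'" and \<eta>: "\<eta> \<in> exchange_seqs \<Lambda> \<Lambda>'"
  shows "UC_hcomp (mk2 \<Omega> \<Omega>' \<kappa>) (mk2 \<Lambda> \<Lambda>' \<eta>) = mk2 (UC_comp1 \<Omega> \<Lambda>) (UC_comp1 \<Omega>' \<Lambda>') (hseq \<Omega> \<Lambda>' \<kappa> \<eta>)"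
proof -
  have "src0 \<Lambda> = src0 \<Lambda>'" using assms(4,5) by (simp add: UC_1_def)
  then have "UC_hcomp (mk2 \<Omega> \<Omega>' \<kappa>) (mk2 \<Lambda> \<Lambda>' \<eta>) = 
    mk2 (UC_comp1 \<Omega> \<Lambda>) (UC_comp1 \<Omega>' \<Lambda>') (hseq \<Omega> \<Lambda>' (rep2 (mk2 \<Omega> \<Omega>' \<kappa>)) (rep2 (mk2 \<Lambda> \<Lambda>' \<eta>)))"
    by (simp add: UC_hcomp_def hseq_def Let_def)
  also have "\<dots> = mk2 (UC_comp1 \<Omega> \<Lambda>) (UC_comp1 \<Omega>' \<Lambda>') (hseq \<Omega> \<Lambda>' \<kappa> \<eta>)"
    using rep2_mk2(2)[OF \<kappa>] rep2_mk2(2)[OF \<eta>]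
    by (subst mk2_eq_iff[OF hseq_in[OF assms(1-7) rep2_mk2(1)[OF \<kappa>] rep2_mk2(1)[OF \<eta>]] hseq_in[OF assms(1-7) \<kappa> \<eta>]])
      (auto simp: hseq_def elim: eventually_elim2)
  finally show ?thesis .
qed

lemma UC_star2_mk2:
  assumes "\<Gamma> \<in> UC_0" "\<Delta> \<in> UC_0" "\<Lambda> \<in> UC_1 \<Gamma> \<Delta>" "\<Omega> \<in> UC_1 \<Gamma> \<Delta>"
    and \<eta>: "\<eta> \<in> exchange_seqs \<Lambda> \<Omega>"
  shows "UC_star2 (mk2 \<Lambda> \<Omega> \<eta>) = mk2 \<Omega> \<Lambda> (sseq \<Lambda> \<eta>)"
proof -
  have "UC_star2 (mk2 \<Lambda> \<Omega> \<eta>) = mk2 \<Omega> \<Lambda> (sseq \<Lambda> (rep2 (mk2 \<Lambda> \<Omega> \<eta>)))"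
    by (simp add: UC_star2_def sseq_def)
  also have "\<dots> = mk2 \<Omega> \<Lambda> (sseq \<Lambda> \<eta>)"
    using rep2_mk2(2)[OF \<eta>]
    by (subst mk2_eq_iff[OF sseq_in[OF assms(1-4) rep2_mk2(1)[OF \<eta>]] sseq_in[OF assms(1-4) \<eta>]])
      (auto simp: sseq_def elim: eventually_mono)
  finally show ?thesis .
qed

text \<open>Functors are extensional, so the laws of composition hold as equalities.\<close>

lemma func_comp_assoc:
  assumes "star_functor A B F"
  shows "func_comp A H (func_comp A G F) = func_comp A (func_comp B H G) F"
proof -
  interpret star_functor A B F by fact
  show ?thesis unfolding func_comp_def by (auto simp: compose_def fun_eq_iff)
qed

lemma func_comp_id_right: assumes "star_functor A B F" shows "func_comp A F (id_func A) = F"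
proof -
  interpret star_functor A B F by fact
  show ?thesis using fobj_ext farr_ext unfolding func_comp_def id_func_def 
    by (cases F) (auto simp: compose_def fun_eq_iff extensional_def)
qed

lemma func_comp_id_left: assumes "star_functor A B F" shows "func_comp A (id_func B) F = F"
proof -
  interpret star_functor A B F by fact
  show ?thesis using fobj_ext farr_ext fobj_in farr_typ(1) unfolding func_comp_def id_func_def 
    by (cases F) (auto simp: compose_def fun_eq_iff extensional_def)
qed

lemma one_cell_eqI:
  assumes "\<Lambda> \<in> UC_1 \<Gamma> \<Delta>" "\<Omega> \<in> UC_1 \<Gamma> \<Delta>" "\<Gamma> \<in> UC_0" "\<Delta> \<in> UC_0" "\<And>k. fun1 \<Lambda> k = fun1 \<Omega> k"
    "\<And>k x. x \<in> Obj (level \<Gamma> k) \<Longrightarrow> conn \<Lambda> k x = conn \<Omega> k x"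
  shows "\<Lambda> = \<Omega>"
proof -
  interpret L: UC_mor \<Gamma> \<Delta> \<Lambda> by unfold_locales fact+
  interpret O: UC_mor \<Gamma> \<Delta> \<Omega> by unfold_locales fact+
  have "conn \<Lambda> k = conn \<Omega> k" for k
    using L.conn_ext[of k] O.conn_ext[of k] assms(6)[of _ k] by (rule extensionalityI)
  then show ?thesis using L.src_trg O.src_trg assms(5) by (intro one_cell.equality) auto
qed

lemma UC_comp1_unit:
  assumes "\<Gamma> \<in> UC_0" "\<Delta> \<in> UC_0" "\<Lambda> \<in> UC_1 \<Gamma> \<Delta>"
  shows "UC_comp1 \<Lambda> (UC_one1 \<Gamma>) = \<Lambda>" "UC_comp1 (UC_one1 \<Delta>) \<Lambda> = \<Lambda>"
proof -
  interpret L: UC_mor \<Gamma> \<Delta> \<Lambda> by unfold_locales fact+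
  note one = UC_one1_in[OF assms(1)] UC_one1_in[OF assms(2)]
  have s: "src0 (UC_one1 \<Gamma>) = \<Gamma>" "trg0 (UC_one1 \<Delta>) = \<Delta>" by (simp_all add: UC_one1_def)
  show "UC_comp1 \<Lambda> (UC_one1 \<Gamma>) = \<Lambda>"
    by (rule one_cell_eqI[OF UC_comp1_in[OF assms(1,1,2) one(1) assms(3)] assms(3,1,2)])
      (auto simp: UC_comp1_simps s, auto simp: UC_one1_def nt_id_def func_comp_id_right[OF L.fun1_functor])
  show "UC_comp1 (UC_one1 \<Delta>) \<Lambda> = \<Lambda>"
    by (rule one_cell_eqI[OF UC_comp1_in[OF assms(1,2,2,3) one(2)] assms(3,1,2)])
      (auto simp: UC_comp1_simps s, auto simp: UC_one1_def nt_id_def func_comp_id_left[OF L.fun1_functor])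
qed

lemma UC_comp1_assoc:
  assumes "\<Gamma> \<in> UC_0" "\<Delta> \<in> UC_0" "\<Sigma> \<in> UC_0" "\<Xi> \<in> UC_0" "\<Lambda> \<in> UC_1 \<Gamma> \<Delta>" "\<Omega> \<in> UC_1 \<Delta> \<Sigma>" "\<Theta> \<in> UC_1 \<Sigma> \<Xi>"
  shows "UC_comp1 (UC_comp1 \<Theta> \<Omega>) \<Lambda> = UC_comp1 \<Theta> (UC_comp1 \<Omega> \<Lambda>)"
proof -
  interpret L: UC_mor \<Gamma> \<Delta> \<Lambda> by unfold_locales fact+
  interpret O: UC_mor \<Delta> \<Sigma> \<Omega> by unfold_locales fact+
  interpret T: UC_mor \<Sigma> \<Xi> \<Theta> by unfold_locales fact+
  show ?thesis
  proof (rule one_cell_eqI[of _ \<Gamma> \<Xi>])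
    show "UC_comp1 (UC_comp1 \<Theta> \<Omega>) \<Lambda> \<in> UC_1 \<Gamma> \<Xi>" "UC_comp1 \<Theta> (UC_comp1 \<Omega> \<Lambda>) \<in> UC_1 \<Gamma> \<Xi>"
      using UC_comp1_in assms by blast+
    show "fun1 (UC_comp1 (UC_comp1 \<Theta> \<Omega>) \<Lambda>) k = fun1 (UC_comp1 \<Theta> (UC_comp1 \<Omega> \<Lambda>)) k" for k
      by (simp add: UC_comp1_simps func_comp_assoc[OF L.fun1_functor])
    show "conn (UC_comp1 (UC_comp1 \<Theta> \<Omega>) \<Lambda>) k x = conn (UC_comp1 \<Theta> (UC_comp1 \<Omega> \<Lambda>)) k x" 
      if "x \<in> Obj (level \<Gamma> k)" for k x
      using that by (simp add: UC_comp1_simps)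
  qed fact+
qed

section \<open>The splitting of a Q-system\<close>

lemma NT_ext:
  assumes "\<eta> \<in> NT A B F G" "\<zeta> \<in> NT A B F G" "\<And>x. x \<in> Obj A \<Longrightarrow> \<eta> x = \<zeta> x"
  shows "\<eta> = \<zeta>"
  using assms unfolding NT_def by (blast intro: extensionalityI)

lemma mk2_eqI:
  assumes "\<eta> \<in> exchange_seqs \<Lambda> \<Omega>" "\<zeta> \<in> exchange_seqs \<Lambda> \<Omega>"
    and "\<And>k x. \<lbrakk>k \<ge> N; x \<in> Obj (level (src0 \<Lambda>) k)\<rbrakk> \<Longrightarrow> \<eta> k x = \<zeta> k x"
  shows "mk2 \<Lambda> \<Omega> \<eta> = mk2 \<Lambda> \<Omega> \<zeta>"
proof -
  have "\<eta> k = \<zeta> k" if "k \<ge> N" for k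
    by (rule NT_ext[of _ "level (src0 \<Lambda>) k" "level (trg0 \<Lambda>) k" "fun1 \<Lambda> k" "fun1 \<Omega> k"])
      (use assms that in \<open>auto simp: exchange_seqs_iff\<close>)
  then show ?thesis unfolding mk2_eq_iff[OF assms(1,2)] eventually_sequentially by blast
qed

lemma mk2_eqD:
  assumes "mk2 \<Lambda> \<Omega> \<eta> = mk2 \<Lambda> \<Omega> \<zeta>" "\<eta> \<in> exchange_seqs \<Lambda> \<Omega>" "\<zeta> \<in> exchange_seqs \<Lambda> \<Omega>" 
  shows "\<forall>\<^sub>F k in sequentially. \<forall>x\<in>Obj (level (src0 \<Lambda>) k). \<eta> k x = \<zeta> k x"
  using assms(1) unfolding mk2_eq_iff[OF assms(2,3)] by (auto elim: eventually_mono)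

lemma seq_at:
  "x \<in> Obj (level (src0 \<Lambda>) k) \<Longrightarrow> vseq \<Lambda> \<kappa> \<eta> k x = \<kappa> k x \<cdot>\<^bsub>level (trg0 \<Lambda>) k\<^esub> \<eta> k x"
  "x \<in> Obj (level (src0 \<Lambda>) k) \<Longrightarrow> hseq \<Omega> \<Lambda> \<kappa> \<eta> k x = \<kappa> k (fobj (fun1 \<Lambda> k) x) \<cdot>\<^bsub>level (trg0 \<Omega>) k\<^esub> farr (fun1 \<Omega> k) (\<eta> k x)"
  "x \<in> Obj (level (src0 \<Lambda>) k) \<Longrightarrow> sseq \<Lambda> \<eta> k x = Str (level (trg0 \<Lambda>) k) (\<eta> k x)"
  "x \<in> Obj (level (src0 \<Lambda>) k) \<Longrightarrow> idseq \<Lambda> k x = Idn (level (trg0 \<Lambda>) k) (fobj (fun1 \<Lambda> k) x)"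
  by (simp_all add: vseq_def hseq_def sseq_def idseq_def nt_comp_def whisk_left_def whisk_right_def nt_star_def nt_id_def)

lemma UC_one1_simps [simp]:
  "src0 (UC_one1 \<Gamma>) = \<Gamma>" "trg0 (UC_one1 \<Gamma>) = \<Gamma>" "fun1 (UC_one1 \<Gamma>) k = id_func (level \<Gamma> k)"
  "x \<in> Obj (level \<Gamma> k) \<Longrightarrow> conn (UC_one1 \<Gamma>) k x = Idn (level \<Gamma> (Suc k)) (fobj (step \<Gamma> k) x)"
  by (simp_all add: UC_one1_def nt_id_def)

lemma natural_unitary_nt_id:
  assumes "category A" "star_category B" "star_functor A B F"
  shows "natural_unitary A B F F (nt_id A B F)"
proof -
  interpret B: star_category B by fact
  interpret F: star_functor A B F by fact
  show ?thesis using NT_id[OF assms(1) B.category_axioms assms(3)]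
    by (simp add: natural_unitary_def unitary_def nt_id_def)
qed

context Q_monad
begin

lemma Forget_Free: "func_comp M Forget Free = Q"
proof -
  have "fobj (func_comp M Forget Free) = fobj Q"
    using Q.fobj_ext by (intro extensionalityI[of _ "Obj M"]) (auto simp: module_free func_comp_def compose_def)
  moreover have "farr (func_comp M Forget Free) = farr Q"
    using Q.farr_ext by (intro extensionalityI[of _ "Arr M"]) (auto simp: module_free func_comp_def compose_def hom_free)
  ultimately show ?thesis by (intro func.equality) auto
qed

lemma counit_NT: "(\<lambda>r\<in>Obj D. enc (m (Cod M r), r, r)) \<in> NT D D (func_comp D Free Forget) (id_func D)"
  using adjunction_Free_Forget unfolding adjunction_def by blast

end

context Q_step
begin

lemma Forget_Ind: "func_comp DM N.Forget Ind = func_comp DM G M.Forget"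
proof -
  have "fobj (func_comp DM N.Forget Ind) = fobj (func_comp DM G M.Forget)"
    by (intro extensionalityI[of _ "Obj DM"]) (auto simp: func_comp_def compose_def M.Obj_D module_act)
  moreover have "farr (func_comp DM N.Forget Ind) = farr (func_comp DM G M.Forget)"
    by (intro extensionalityI[of _ "Arr DM"]) (auto simp: func_comp_def compose_def M.Arr_D module_act hom_act)
  ultimately show ?thesis by (intro func.equality) auto
qed

lemma hom_W: assumes x: "x \<in> Obj M" shows "mod_hom N P (act (m x)) (n (Go x)) (W x)"
proof (rule N.homI)
  note [simp] = x M.module_free
  show "W x \<cdot> act (m x) = n (Go x) \<cdot> Pa (W x)"
    using N.M.reduce[OF W_m[OF x], of "Str N (W (Qo x))"] by (simp add: act_def)
qed (use x M.module_free in auto)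

text \<open>The exchange relation for the multiplication says that \<open>W x\<close> is a map of modules from the image of
the free module on \<open>x\<close> to the free module on \<open>G x\<close>.\<close>

lemma natural_unitary_W:
  "natural_unitary M DN (func_comp M Ind M.Free) (func_comp M N.Free G) (\<lambda>x\<in>Obj M. enc (act (m x), n (Go x), W x))"
proof -
  have 1: "enc (act (m x), n (Go x), W x) \<in> Hom DN (act (m x)) (n (Go x))" if "x \<in> Obj M" for x
    using that by (simp add: N.Hom_D module_act M.module_free N.module_free hom_W)
  have "unitary DN (enc (act (m x), n (Go x), W x))" if x: "x \<in> Obj M" for x
    using x 1[OF x] by (simp add: unitary_def N.D_simps module_act M.module_free N.module_free hom_W)
  then show ?thesis
    unfolding natural_unitary_def NT_iff[OF M.M.category_axioms]
    using 1 W_nat by (auto simp: M.module_free M.hom_free N.D_simps)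
qed

end

text \<open>A Q-system by representatives that satisfy its equations and the exchange relations from level \<open>N\<close> on.\<close>

locale Q_levels = Q: UC_mor b b Q for b :: "'u zero_cell" and Q :: "'u one_cell" +
  fixes \<mu> \<iota> :: "nat \<Rightarrow> 'u \<Rightarrow> 'u" and N :: nat
  assumes mult_in: "\<mu> \<in> exchange_seqs (UC_comp1 Q Q) Q" and unit_in: "\<iota> \<in> exchange_seqs (UC_one1 b) Q"
    and monad: "k \<ge> N \<Longrightarrow> Q_monad (level b k) (fun1 Q k) (\<mu> k) (\<iota> k)"
    and monad_step: "k \<ge> N \<Longrightarrow> Q_step (level b k) (fun1 Q k) (\<mu> k) (\<iota> k) 
      (level b (Suc k)) (fun1 Q (Suc k)) (\<mu> (Suc k)) (\<iota> (Suc k)) (step b k) (conn Q k)"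
begin

abbreviation "Md k \<equiv> Mod (level b k) (fun1 Q k) (\<mu> k) (\<iota> k)"
abbreviation "Fg k \<equiv> Q_monad.Forget (level b k) (fun1 Q k) (\<mu> k) (\<iota> k)"
abbreviation "Fr k \<equiv> Q_monad.Free (level b k) (fun1 Q k) (\<mu> k)"
abbreviation "In k \<equiv> Q_step.Ind (level b k) (fun1 Q k) (\<mu> k) (\<iota> k) (level b (Suc k)) (step b k) (conn Q k)"
abbreviation "ac k \<equiv> Q_step.act (level b k) (level b (Suc k)) (step b k) (conn Q k)"

lemma b: "b \<in> UC_0" by (rule Q.S.UC_0)

lemma faithful_Q: "faithful (level b k) (fun1 Q k)"
  using Q.bi_faithful_fun unfolding bi_faithful_def by blast

lemma fin_ss_Md: "k \<ge> N \<Longrightarrow> finite_semisimple_cstar_category (Md k)"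
  by (rule Q_monad.finite_semisimple_D[OF monad])

lemma star_Md: "k \<ge> N \<Longrightarrow> star_category (Md k)"
  using fin_ss_Md unfolding finite_semisimple_cstar_category_def semisimple_cstar_category_def cstar_category_def
  by blast

lemma cat_Md: "k \<ge> N \<Longrightarrow> category (Md k)"
  using star_Md unfolding star_category_def linear_category_def by blast

text \<open>Below \<open>N\<close> the levels of \<open>b\<close> are kept. The transition to the modules takes place at the step from
\<open>N - 1\<close> to \<open>N\<close>, by the free module functor.\<close>

definition c :: "'u zero_cell" where
  "c = \<lparr>level = (\<lambda>k. if k < N then level b k else Md k),
    step = (\<lambda>k. if Suc k < N then step b k else if k < N then func_comp (level b k) (Fr (Suc k)) (step b k) else In k)\<rparr>"

text \<open>Taking \<open>Q\<close> itself below \<open>N\<close> makes the square at the transition commute up to the connection of \<open>Q\<close>,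
since the forgetful functor after the free one is \<open>Q\<close>.\<close>

definition X :: "'u one_cell" where
  "X = \<lparr>src0 = c, trg0 = b, fun1 = (\<lambda>k. if k < N then fun1 Q k else Fg k),
    conn = (\<lambda>k. if k < N then conn Q k else nt_id (Md k) (level b (Suc k)) (func_comp (Md k) (step b k) (Fg k)))\<rparr>"

definition Xbar :: "'u one_cell" where
  "Xbar = \<lparr>src0 = b, trg0 = c, fun1 = (\<lambda>k. if k < N then id_func (level b k) else Fr k),
    conn = (\<lambda>k. if k < N then nt_id (level b k) (level c (Suc k)) (step c k)
      else (\<lambda>x\<in>Obj (level b k). enc (ac k (\<mu> k x), \<mu> (Suc k) (fobj (step b k) x), conn Q k x)))\<rparr>"

text \<open>From \<open>N\<close> on this is the counit of the adjunction between free modules and the forgetful functor.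
Below \<open>N\<close> it is \<open>\<iota>\<^sup>*\<close>, a transformation of the right type; the 2-cell depends on the tail only.\<close>

definition evs :: "nat \<Rightarrow> 'u \<Rightarrow> 'u" where
  "evs k = (if k < N then nt_star (level b k) (level b k) (\<iota> k)
    else (\<lambda>r\<in>Obj (Md k). enc (\<mu> k (Cod (level b k) r), r, r)))"

lemma c_low [simp]: "k < N \<Longrightarrow> level c k = level b k" "Suc k < N \<Longrightarrow> step c k = step b k"
  and c_mid [simp]: "Suc k = N \<Longrightarrow> step c k = func_comp (level b k) (Fr (Suc k)) (step b k)"
  and c_high [simp]: "\<not> k < N \<Longrightarrow> level c k = Md k" "\<not> k < N \<Longrightarrow> step c k = In k"
  by (simp_all add: c_def)

lemma X_low [simp]: "k < N \<Longrightarrow> fun1 X k = fun1 Q k" "k < N \<Longrightarrow> conn X k = conn Q k"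
  and X_high [simp]: "\<not> k < N \<Longrightarrow> fun1 X k = Fg k" 
    "\<not> k < N \<Longrightarrow> conn X k = nt_id (Md k) (level b (Suc k)) (func_comp (Md k) (step b k) (Fg k))"
  and X_src [simp]: "src0 X = c" "trg0 X = b"
  by (simp_all add: X_def)

lemma Xbar_low [simp]: "k < N \<Longrightarrow> fun1 Xbar k = id_func (level b k)" 
    "k < N \<Longrightarrow> conn Xbar k = nt_id (level b k) (level c (Suc k)) (step c k)"
  and Xbar_high [simp]: "\<not> k < N \<Longrightarrow> fun1 Xbar k = Fr k" 
    "\<not> k < N \<Longrightarrow> conn Xbar k = (\<lambda>x\<in>Obj (level b k). enc (ac k (\<mu> k x), \<mu> (Suc k) (fobj (step b k) x), conn Q k x))"
  and Xbar_src [simp]: "src0 Xbar = b" "trg0 Xbar = c"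
  by (simp_all add: Xbar_def)

lemma level_cases: obtains "Suc k < N" | "Suc k = N" | "\<not> k < N" by linarith

lemma c_in: "c \<in> UC_0"
  unfolding UC_0_def
proof (intro CollectI allI conjI)
  fix k
  show "finite_semisimple_cstar_category (level c k)"
    using Q.S.fin_ss fin_ss_Md by (cases "k < N") auto
  show "bi_faithful (level c k) (level c (Suc k)) (step c k)"
  proof (cases rule: level_cases[of k])
    case 1
    then show ?thesis using Q.S.bi_faithful_step by simp
  next
    case 2
    then have N: "Suc k \<ge> N" by simp
    have "bi_faithful (level b k) (Md (Suc k)) (func_comp (level b k) (Fr (Suc k)) (step b k))"
      by (rule bi_faithful_comp[OF Q.S.star_cat Q.S.star_cat star_Md[OF N] Q.S.bi_faithful_step 
        Q_monad.bi_faithful_Free[OF monad[OF N] faithful_Q]])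
    then show ?thesis using 2 by simp
  next
    case 3
    then show ?thesis using Q_step.bi_faithful_Ind[OF monad_step Q.S.bi_faithful_step] by simp
  qed
qed

sublocale C: UC_obj c by unfold_locales (rule c_in)

lemma Q_natural: "natural_unitary (level b k) (level b (Suc k)) (func_comp (level b k) (step b k) (fun1 Q k)) 
    (func_comp (level b k) (fun1 Q (Suc k)) (step b k)) (conn Q k)"
  using Q.UC_1 by (simp add: UC_1_def)

lemma X_in: "X \<in> UC_1 c b"
  unfolding UC_1_def
proof (intro CollectI conjI allI)
  fix k
  show "bi_faithful (level c k) (level b k) (fun1 X k)"
    using Q.bi_faithful_fun Q_monad.bi_faithful_Forget[OF monad faithful_Q, of k] by (cases "k < N") auto
  show "natural_unitary (level c k) (level b (Suc k)) (func_comp (level c k) (step b k) (fun1 X k)) 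
    (func_comp (level c k) (fun1 X (Suc k)) (step c k)) (conn X k)"
  proof (cases rule: level_cases[of k])
    case 1
    then show ?thesis using Q_natural by simp
  next
    case 2
    then have N: "Suc k \<ge> N" by simp
    have "func_comp (level b k) (Fg (Suc k)) (func_comp (level b k) (Fr (Suc k)) (step b k)) 
      = func_comp (level b k) (fun1 Q (Suc k)) (step b k)"
      by (simp add: func_comp_assoc[OF Q.S.step_functor] Q_monad.Forget_Free[OF monad[OF N]])
    then show ?thesis using 2 Q_natural[of k] by simp
  next
    case 3
    then have N: "k \<ge> N" "Suc k \<ge> N" by auto
    have F: "star_functor (Md k) (level b (Suc k)) (func_comp (Md k) (step b k) (Fg k))"
      by (rule star_functor_comp[OF star_Md[OF N(1)] Q_monad.star_functor_Forget[OF monad[OF N(1)]] Q.S.step_functor])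
    show ?thesis using 3 natural_unitary_nt_id[OF cat_Md[OF N(1)] Q.S.star_cat F]
      by (simp add: Q_step.Forget_Ind[OF monad_step[OF N(1)]])
  qed
qed simp_all

lemma Xbar_in: "Xbar \<in> UC_1 b c"
  unfolding UC_1_def
proof (intro CollectI conjI allI)
  fix k
  show "bi_faithful (level b k) (level c k) (fun1 Xbar k)"
    using bi_faithful_id[OF Q.S.star_cat, of k] Q_monad.bi_faithful_Free[OF monad faithful_Q, of k] by (cases "k < N") auto
  show "natural_unitary (level b k) (level c (Suc k)) (func_comp (level b k) (step c k) (fun1 Xbar k)) 
    (func_comp (level b k) (fun1 Xbar (Suc k)) (step b k)) (conn Xbar k)"
  proof (cases "k < N")
    case True
    then have F: "star_functor (level b k) (level c (Suc k)) (step c k)" using C.step_functor[of k] by simp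
    have "func_comp (level b k) (fun1 Xbar (Suc k)) (step b k) = step c k"
      using True func_comp_id_left[OF Q.S.step_functor, of k] by (cases rule: level_cases[of k]) auto
    then show ?thesis using True natural_unitary_nt_id[OF Q.S.cat C.star_cat F] by (simp add: func_comp_id_right[OF F])
  next
    case False
    then show ?thesis using Q_step.natural_unitary_W[OF monad_step, of k] by simp
  qed
qed simp_all

sublocale X: UC_mor c b X by unfold_locales (rule X_in)
sublocale Xbar: UC_mor b c Xbar by unfold_locales (rule Xbar_in)

lemma X_Xbar: "UC_comp1 X Xbar = Q"
proof (rule one_cell_eqI[OF UC_comp1_in[OF b c_in b Xbar_in X_in] Q.UC_1 b b])
  fix k
  show "fun1 (UC_comp1 X Xbar) k = fun1 Q k"
    using func_comp_id_right[OF Q.fun1_functor] Q_monad.Forget_Free[OF monad]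
    by (cases "k < N") (auto simp: UC_comp1_simps)
  fix x assume x: "x \<in> Obj (level b k)"
  show "conn (UC_comp1 X Xbar) k x = conn Q k x"
  proof (cases rule: level_cases[of k])
    case 1
    then show ?thesis using x by (simp add: UC_comp1_simps nt_id_def)
  next
    case 2
    then interpret K: Q_monad "level b (Suc k)" "fun1 Q (Suc k)" "\<mu> (Suc k)" "\<iota> (Suc k)" by (intro monad) simp
    have [simp]: "k < N" "\<not> Suc k < N" using 2 by simp_all
    show ?thesis using x K.hom_Idn[OF K.module_free, of "fobj (step b k) x"] 
      by (simp add: c_mid[OF 2] UC_comp1_simps nt_id_def K.D_simps K.module_free)
  next
    case 3
    then interpret K: Q_step "level b k" "fun1 Q k" "\<mu> k" "\<iota> k" "level b (Suc k)" "fun1 Q (Suc k)" 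
      "\<mu> (Suc k)" "\<iota> (Suc k)" "step b k" "conn Q k" by (intro monad_step) simp
    show ?thesis using 3 x
      by (simp add: UC_comp1_simps nt_id_def K.M.Obj_D K.M.module_free K.N.module_free K.module_act K.hom_W)
  qed
qed

lemma evs_in: "evs \<in> exchange_seqs (UC_comp1 Xbar X) (UC_one1 c)"
  unfolding exchange_seqs_iff
proof (intro conjI allI exI[of _ N] impI)
  fix k
  show "evs k \<in> NT (level (src0 (UC_comp1 Xbar X)) k) (level (trg0 (UC_comp1 Xbar X)) k)
              (fun1 (UC_comp1 Xbar X) k) (fun1 (UC_one1 c) k)"
  proof (cases "k < N")
    case True
    have "\<iota> k \<in> NT (level b k) (level b k) (id_func (level b k)) (fun1 Q k)"
      using unit_in by (simp add: exchange_seqs_iff)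
    from NT_star[OF Q.S.star_cat Q.S.star_cat star_functor_id[OF Q.S.star_cat] Q.fun1_functor this]
    show ?thesis using True by (simp add: UC_comp1_simps evs_def func_comp_id_left[OF Q.fun1_functor])
  next
    case False
    then show ?thesis using Q_monad.counit_NT[OF monad, of k] by (simp add: UC_comp1_simps evs_def)
  qed
next
  fix k assume k: "k \<ge> N"
  interpret K: Q_step "level b k" "fun1 Q k" "\<mu> k" "\<iota> k" "level b (Suc k)" "fun1 Q (Suc k)" 
      "\<mu> (Suc k)" "\<iota> (Suc k)" "step b k" "conn Q k" by (intro monad_step k)
  show "exch (UC_comp1 Xbar X) (UC_one1 c) k (evs k) (evs (Suc k))"
    unfolding exch_def
  proof
    fix r assume "r \<in> Obj (level (src0 (UC_comp1 Xbar X)) k)"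
    then have r: "K.Mmod r" using k by (simp add: UC_comp1_simps K.M.Obj_D)
    define x where "x = Cod (level b k) r"
    note [simp] = K.M.moduleD(1-3)[OF r x_def[symmetric]] x_def[symmetric] r K.module_act[OF r]
      K.M.module_free K.N.module_free K.module_act K.hom_W
    have h: "mod_hom (level b k) (fun1 Q k) (\<mu> k x) r r" by (rule K.M.hom_action) simp_all
    have g: "mod_hom (level b (Suc k)) (fun1 Q (Suc k)) (K.act (\<mu> k x)) (K.act r) (farr (step b k) r)"
      by (rule K.hom_act) (simp_all add: h)
    have o: "r \<in> Obj (Md k)" "K.act r \<in> Obj (Md (Suc k))" by (simp_all add: K.M.Obj_D K.N.Obj_D)
    have "K.act r \<cdot>\<^bsub>level b (Suc k)\<^esub> conn Q k x = farr (step b k) r"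
      by (simp add: K.act_def)
    then show "conn (UC_one1 c) k r \<cdot>\<^bsub>level (trg0 (UC_comp1 Xbar X)) (Suc k)\<^esub> farr (step (trg0 (UC_comp1 Xbar X)) k) (evs k r) =
         evs (Suc k) (fobj (step (src0 (UC_comp1 Xbar X)) k) r) \<cdot>\<^bsub>level (trg0 (UC_comp1 Xbar X)) (Suc k)\<^esub>
         conn (UC_comp1 Xbar X) k r"
      using k o h g by (simp add: UC_comp1_simps nt_id_def evs_def K.N.D_simps)
  qed
qed

lemma units_simp [simp]: "UC_comp1 X (UC_one1 c) = X" "UC_comp1 (UC_one1 b) X = X"
  "UC_comp1 Xbar (UC_one1 b) = Xbar" "UC_comp1 (UC_one1 c) Xbar = Xbar"
  using UC_comp1_unit[OF c_in b X_in] UC_comp1_unit[OF b c_in Xbar_in] by auto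

lemma assoc_simp: "UC_comp1 Q X = UC_comp1 X (UC_comp1 Xbar X)" "UC_comp1 (UC_comp1 Xbar X) Xbar = UC_comp1 Xbar Q"
  "UC_comp1 X (UC_comp1 Xbar Q) = UC_comp1 Q Q"
  using UC_comp1_assoc[OF c_in b c_in b X_in Xbar_in X_in] UC_comp1_assoc[OF b c_in b c_in Xbar_in X_in Xbar_in]
    UC_comp1_assoc[OF b b c_in b Q.UC_1 Xbar_in X_in] by (simp_all add: X_Xbar)

lemmas XbX_in = UC_comp1_in[OF c_in b c_in X_in Xbar_in]
lemmas one_c_in = UC_one1_in[OF c_in] and one_b_in = UC_one1_in[OF b]
lemmas id_X = idseq_in[OF c_in b X_in] and id_Xbar = idseq_in[OF b c_in Xbar_in]
lemmas XXbX_in = UC_comp1_in[OF c_in c_in b XbX_in X_in]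
lemmas XbQ_in = UC_comp1_in[OF b b c_in Q.UC_1 Xbar_in]
lemmas QQ_in = UC_comp1_in[OF b b b Q.UC_1 Q.UC_1]

abbreviation "ev \<equiv> mk2 (UC_comp1 Xbar X) (UC_one1 c) evs"
abbreviation "coev \<equiv> mk2 (UC_one1 b) Q \<iota>"

lemma ev_Xbar: "UC_hcomp ev (UC_one2 Xbar) = mk2 (UC_comp1 Xbar Q) Xbar (hseq (UC_comp1 Xbar X) Xbar evs (idseq Xbar))"
  and ev_Xbar_in: "hseq (UC_comp1 Xbar X) Xbar evs (idseq Xbar) \<in> exchange_seqs (UC_comp1 Xbar Q) Xbar"
  using UC_hcomp_mk2[OF b c_in c_in Xbar_in Xbar_in XbX_in one_c_in evs_in id_Xbar]
    hseq_in[OF b c_in c_in Xbar_in Xbar_in XbX_in one_c_in evs_in id_Xbar]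
  by (simp_all add: UC_one2_mk2 assoc_simp)

lemma mult_eq: "UC_hcomp (UC_one2 X) (UC_hcomp ev (UC_one2 Xbar)) = mk2 (UC_comp1 Q Q) Q \<mu>"
proof -
  let ?e = "hseq (UC_comp1 Xbar X) Xbar evs (idseq Xbar)"
  have 1: "UC_hcomp (UC_one2 X) (UC_hcomp ev (UC_one2 Xbar)) = mk2 (UC_comp1 Q Q) Q (hseq X Xbar (idseq X) ?e)"
    "hseq X Xbar (idseq X) ?e \<in> exchange_seqs (UC_comp1 Q Q) Q"
    using UC_hcomp_mk2[OF b c_in b XbQ_in Xbar_in X_in X_in id_X ev_Xbar_in]
      hseq_in[OF b c_in b XbQ_in Xbar_in X_in X_in id_X ev_Xbar_in]
    by (simp_all add: UC_one2_mk2[of X] ev_Xbar assoc_simp X_Xbar)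
  show ?thesis unfolding 1(1)
  proof (rule mk2_eqI[OF 1(2) mult_in, of N])
    fix k x assume k: "N \<le> k" and "x \<in> Obj (level (src0 (UC_comp1 Q Q)) k)"
    then have [simp]: "x \<in> Obj (level b k)" by (simp add: UC_comp1_simps)
    interpret K: Q_monad "level b k" "fun1 Q k" "\<mu> k" "\<iota> k" by (intro monad k)
    note [simp] = K.module_free
    have "mod_hom (level b k) (fun1 Q k) (\<mu> k (fobj (fun1 Q k) x)) (\<mu> k x) (\<mu> k x)" by (rule K.hom_action) simp_all
    moreover have "mod_hom (level b k) (fun1 Q k) (\<mu> k x) (\<mu> k x) (Idn (level b k) (fobj (fun1 Q k) x))"
      using K.hom_Idn[of "\<mu> k x"] by simp
    ultimately show "hseq X Xbar (idseq X) ?e k x = \<mu> k x"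
      using k by (simp add: seq_at UC_comp1_simps evs_def K.Obj_D K.D_simps)
  qed
qed

lemma X_has_separable_dual: "unitarily_separable_dual UC c b X Xbar ev coev"
proof -
  have ev: "ev \<in> UC_2 (UC_comp1 Xbar X) (UC_one1 c)" by (rule mk2_in[OF evs_in])
  have coev: "coev \<in> UC_2 (UC_one1 b) (UC_comp1 X Xbar)" using mk2_in[OF unit_in] by (simp add: X_Xbar)
  have a1: "UC_hcomp (UC_one2 X) ev = mk2 (UC_comp1 X (UC_comp1 Xbar X)) X (hseq X (UC_one1 c) (idseq X) evs)"
    "hseq X (UC_one1 c) (idseq X) evs \<in> exchange_seqs (UC_comp1 X (UC_comp1 Xbar X)) X"
    using UC_hcomp_mk2[OF c_in c_in b XbX_in one_c_in X_in X_in id_X evs_in]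
      hseq_in[OF c_in c_in b XbX_in one_c_in X_in X_in id_X evs_in] by (simp_all add: UC_one2_mk2)
  have a2: "UC_hcomp coev (UC_one2 X) = mk2 X (UC_comp1 X (UC_comp1 Xbar X)) (hseq (UC_one1 b) X \<iota> (idseq X))"
    "hseq (UC_one1 b) X \<iota> (idseq X) \<in> exchange_seqs X (UC_comp1 X (UC_comp1 Xbar X))"
    using UC_hcomp_mk2[OF c_in b b X_in X_in one_b_in Q.UC_1 unit_in id_X]
      hseq_in[OF c_in b b X_in X_in one_b_in Q.UC_1 unit_in id_X] by (simp_all add: UC_one2_mk2 assoc_simp)
  note av = vseq_in[OF c_in b X_in XXbX_in X_in a1(2) a2(2)]
  have 1: "UC_vcomp (UC_hcomp (UC_one2 X) ev) (UC_hcomp coev (UC_one2 X)) = UC_one2 X"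
    unfolding a1(1) a2(1) UC_vcomp_mk2[OF c_in b X_in XXbX_in X_in a1(2) a2(2)]
    unfolding UC_one2_mk2
  proof (rule mk2_eqI[OF av id_X, of N])
    fix k r assume k: "N \<le> k" and "r \<in> Obj (level (src0 X) k)"
    then have o: "r \<in> Obj (Md k)" by simp
    interpret K: Q_monad "level b k" "fun1 Q k" "\<mu> k" "\<iota> k" by (intro monad k)
    have r [simp]: "K.qmod r" using o by (simp add: K.Obj_D)
    define x where "x = Cod (level b k) r"
    note [simp] = K.moduleD(1-3)[OF r x_def[symmetric]] x_def[symmetric] K.module_free
    have h: "mod_hom (level b k) (fun1 Q k) (\<mu> k x) r r" by (rule K.hom_action) simp_all
    show "vseq X (hseq X (UC_one1 c) (idseq X) evs) (hseq (UC_one1 b) X \<iota> (idseq X)) k r = idseq X k r"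
      using k o h K.moduleD(5)[OF r x_def[symmetric]] by (simp add: seq_at UC_comp1_simps evs_def)
  qed
  have c1: "UC_hcomp (UC_one2 Xbar) coev = mk2 Xbar (UC_comp1 Xbar Q) (hseq Xbar Q (idseq Xbar) \<iota>)"
    "hseq Xbar Q (idseq Xbar) \<iota> \<in> exchange_seqs Xbar (UC_comp1 Xbar Q)"
    using UC_hcomp_mk2[OF b b c_in one_b_in Q.UC_1 Xbar_in Xbar_in id_Xbar unit_in]
      hseq_in[OF b b c_in one_b_in Q.UC_1 Xbar_in Xbar_in id_Xbar unit_in] by (simp_all add: UC_one2_mk2)
  note cv = vseq_in[OF b c_in Xbar_in XbQ_in Xbar_in ev_Xbar_in c1(2)]
  have 2: "UC_vcomp (UC_hcomp ev (UC_one2 Xbar)) (UC_hcomp (UC_one2 Xbar) coev) = UC_one2 Xbar"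
    unfolding ev_Xbar c1(1) UC_vcomp_mk2[OF b c_in Xbar_in XbQ_in Xbar_in ev_Xbar_in c1(2)]
    unfolding UC_one2_mk2
  proof (rule mk2_eqI[OF cv id_Xbar, of N])
    fix k x assume k: "N \<le> k" and "x \<in> Obj (level (src0 Xbar) k)"
    then have x [simp]: "x \<in> Obj (level b k)" by simp
    interpret K: Q_monad "level b k" "fun1 Q k" "\<mu> k" "\<iota> k" by (intro monad k)
    note [simp] = K.module_free K.hom_free
    have h: "mod_hom (level b k) (fun1 Q k) (\<mu> k (fobj (fun1 Q k) x)) (\<mu> k x) (\<mu> k x)" by (rule K.hom_action) simp_all
    have "mod_hom (level b k) (fun1 Q k) (\<mu> k x) (\<mu> k x) (Idn (level b k) (fobj (fun1 Q k) x))"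
      using K.hom_Idn[of "\<mu> k x"] by simp
    then show "vseq Xbar (hseq (UC_comp1 Xbar X) Xbar evs (idseq Xbar)) (hseq Xbar Q (idseq Xbar) \<iota>) k x = idseq Xbar k x"
      using k h K.m_unit_right[OF x] by (simp add: seq_at UC_comp1_simps evs_def K.Obj_D K.D_simps)
  qed
  note sv = sseq_in[OF c_in c_in XbX_in one_c_in evs_in]
  note ss = vseq_in[OF c_in c_in one_c_in XbX_in one_c_in evs_in sv]
  have 3: "UC_vcomp ev (UC_star2 ev) = UC_one2 (UC_one1 c)"
    unfolding UC_star2_mk2[OF c_in c_in XbX_in one_c_in evs_in] UC_one2_mk2
      UC_vcomp_mk2[OF c_in c_in one_c_in XbX_in one_c_in evs_in sv]
  proof (rule mk2_eqI[OF ss idseq_in[OF c_in c_in one_c_in], of N])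
    fix k r assume k: "N \<le> k" and "r \<in> Obj (level (src0 (UC_one1 c)) k)"
    then have o: "r \<in> Obj (Md k)" by simp
    interpret K: Q_monad "level b k" "fun1 Q k" "\<mu> k" "\<iota> k" by (intro monad k)
    have r: "K.qmod r" using o by (simp add: K.Obj_D)
    show "vseq (UC_one1 c) evs (sseq (UC_comp1 Xbar X) evs) k r = idseq (UC_one1 c) k r"
      using k o K.module_isometry[OF r refl] by (simp add: seq_at UC_comp1_simps evs_def K.D_simps)
  qed
  show ?thesis
    unfolding unitarily_separable_dual_def is_dual_def UC_def
    using X_in Xbar_in ev coev 1 2 3 by simp
qed

lemma Q_iso_X_Xbar: "Q_system_iso UC Q (mk2 (UC_comp1 Q Q) Q \<mu>) coev (UC_comp1 X Xbar) 
  (UC_hcomp (UC_one2 X) (UC_hcomp ev (UC_one2 Xbar))) coev (UC_one2 Q)"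
proof -
  note Q = Q.UC_1
  note id = idseq_in[OF b b Q]
  note s = sseq_in[OF b b Q Q id]
  note h = hseq_in[OF b b b Q Q Q Q id id]
  have 1: "UC_vcomp (UC_star2 (UC_one2 Q)) (UC_one2 Q) = UC_one2 Q" "UC_vcomp (UC_one2 Q) (UC_star2 (UC_one2 Q)) = UC_one2 Q"
    unfolding UC_one2_mk2 UC_star2_mk2[OF b b Q Q id] UC_vcomp_mk2[OF b b Q Q Q id s] UC_vcomp_mk2[OF b b Q Q Q s id]
    by (rule mk2_eqI[OF vseq_in[OF b b Q Q Q s id] id, of 0] mk2_eqI[OF vseq_in[OF b b Q Q Q id s] id, of 0]; simp add: seq_at)+
  have mt: "\<mu> k x \<in> Arr (level b k)" "Dom (level b k) (\<mu> k x) = fobj (fun1 Q k) (fobj (fun1 Q k) x)" 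
    "Cod (level b k) (\<mu> k x) = fobj (fun1 Q k) x" if "x \<in> Obj (level b k)" for k x
  proof -
    have "\<mu> k \<in> NT (level b k) (level b k) (fun1 (UC_comp1 Q Q) k) (fun1 Q k)" 
      using mult_in by (simp add: exchange_seqs_iff UC_comp1_simps)
    from NT_D(1-3)[OF Q.S.cat this that] show "\<mu> k x \<in> Arr (level b k)" 
      "Dom (level b k) (\<mu> k x) = fobj (fun1 Q k) (fobj (fun1 Q k) x)" "Cod (level b k) (\<mu> k x) = fobj (fun1 Q k) x" 
      using that by (simp_all add: UC_comp1_simps)
  qed
  have it: "\<iota> k x \<in> Arr (level b k)" "Dom (level b k) (\<iota> k x) = x" 
    "Cod (level b k) (\<iota> k x) = fobj (fun1 Q k) x" if "x \<in> Obj (level b k)" for k x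
  proof -
    have "\<iota> k \<in> NT (level b k) (level b k) (fun1 (UC_one1 b) k) (fun1 Q k)" 
      using unit_in by (simp add: exchange_seqs_iff)
    from NT_D(1-3)[OF Q.S.cat this that] show "\<iota> k x \<in> Arr (level b k)" 
      "Dom (level b k) (\<iota> k x) = x" "Cod (level b k) (\<iota> k x) = fobj (fun1 Q k) x" 
      using that by simp_all
  qed
  have 2: "UC_vcomp (UC_one2 Q) (mk2 (UC_comp1 Q Q) Q \<mu>) = UC_vcomp (mk2 (UC_comp1 Q Q) Q \<mu>) (UC_hcomp (UC_one2 Q) (UC_one2 Q))"
    unfolding UC_one2_mk2 UC_hcomp_mk2[OF b b b Q Q Q Q id id] UC_vcomp_mk2[OF b b QQ_in QQ_in Q mult_in h]
      UC_vcomp_mk2[OF b b QQ_in Q Q id mult_in]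
    by (rule mk2_eqI[OF vseq_in[OF b b QQ_in Q Q id mult_in] vseq_in[OF b b QQ_in QQ_in Q mult_in h], of 0])
      (simp add: seq_at UC_comp1_simps mt)
  have 3: "UC_vcomp (UC_one2 Q) coev = coev"
    unfolding UC_one2_mk2 UC_vcomp_mk2[OF b b one_b_in Q Q id unit_in]
    by (rule mk2_eqI[OF vseq_in[OF b b one_b_in Q Q id unit_in] unit_in, of 0]) (simp add: seq_at it)
  show ?thesis
    unfolding Q_system_iso_def mult_eq X_Xbar using 1 2 3 mk2_in[OF id] by (simp add: UC_def UC_one2_mk2)
qed

end

text \<open>Each of the equations and exchange relations holds eventually, hence all of them from a common level
on.\<close>

lemma Q_system_levels:
  fixes b :: "'u zero_cell"
  assumes inf: "infinite (UNIV :: 'u set)" and b: "b \<in> UC_0" and Qs: "Q_system UC b Q m i"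
  obtains \<mu> \<iota> N where "Q_levels b Q \<mu> \<iota> N" "m = mk2 (UC_comp1 Q Q) Q \<mu>" "i = mk2 (UC_one1 b) Q \<iota>"
proof -
  have Q: "Q \<in> UC_1 b b" and m: "m \<in> UC_2 (UC_comp1 Q Q) Q" and i: "i \<in> UC_2 (UC_one1 b) Q"
    and eqs: "UC_vcomp m (UC_hcomp m (UC_one2 Q)) = UC_vcomp m (UC_hcomp (UC_one2 Q) m)"
      "UC_vcomp m (UC_hcomp i (UC_one2 Q)) = UC_one2 Q" "UC_vcomp m (UC_hcomp (UC_one2 Q) i) = UC_one2 Q"
      "UC_vcomp (UC_hcomp (UC_one2 Q) m) (UC_hcomp (UC_star2 m) (UC_one2 Q)) = UC_vcomp (UC_star2 m) m"
      "UC_vcomp m (UC_star2 m) = UC_one2 Q"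
    using Qs unfolding Q_system_def UC_def by auto
  interpret Q: UC_mor b b Q by unfold_locales fact+
  let ?QQ = "UC_comp1 Q Q" and ?I = "UC_one1 b"
  obtain \<mu> where \<mu>: "\<mu> \<in> exchange_seqs ?QQ Q" "m = mk2 ?QQ Q \<mu>" using UC_2_rep[OF m] by blast
  obtain \<iota> where \<iota>: "\<iota> \<in> exchange_seqs ?I Q" "i = mk2 ?I Q \<iota>" using UC_2_rep[OF i] by blast
  note QQ = UC_comp1_in[OF b b b Q Q] and one = UC_one1_in[OF b]
  note T = UC_comp1_in[OF b b b QQ Q]
  have assoc: "UC_comp1 ?QQ Q = UC_comp1 Q ?QQ" by (rule UC_comp1_assoc[OF b b b b Q Q Q])
  note T' = T[unfolded assoc]
  note unit = UC_comp1_unit[OF b b Q]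
  note id = idseq_in[OF b b Q]
  have \<mu>nt: "\<mu> k \<in> NT (level b k) (level b k) (fun1 ?QQ k) (fun1 Q k)" for k
    using \<mu>(1) by (simp add: exchange_seqs_iff UC_comp1_simps)
  have \<iota>nt: "\<iota> k \<in> NT (level b k) (level b k) (fun1 ?I k) (fun1 Q k)" for k
    using \<iota>(1) by (simp add: exchange_seqs_iff)
  have [simp]: "\<mu> k x \<in> Arr (level b k)" "Dom (level b k) (\<mu> k x) = fobj (fun1 Q k) (fobj (fun1 Q k) x)" 
    "Cod (level b k) (\<mu> k x) = fobj (fun1 Q k) x" if "x \<in> Obj (level b k)" for k x
    using NT_D(1-3)[OF Q.S.cat \<mu>nt] that by (simp_all add: UC_comp1_simps)
  have [simp]: "\<iota> k x \<in> Arr (level b k)" "Dom (level b k) (\<iota> k x) = x" 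
    "Cod (level b k) (\<iota> k x) = fobj (fun1 Q k) x" if "x \<in> Obj (level b k)" for k x
    using NT_D(1-3)[OF Q.S.cat \<iota>nt] that by simp_all
  have m1: "UC_hcomp (mk2 ?QQ Q \<mu>) (mk2 Q Q (idseq Q)) = mk2 (UC_comp1 Q ?QQ) ?QQ (hseq ?QQ Q \<mu> (idseq Q))"
    "hseq ?QQ Q \<mu> (idseq Q) \<in> exchange_seqs (UC_comp1 Q ?QQ) ?QQ"
    using UC_hcomp_mk2[OF b b b Q Q QQ Q \<mu>(1) id] hseq_in[OF b b b Q Q QQ Q \<mu>(1) id] 
    by (simp_all add: assoc)
  have m2: "UC_hcomp (mk2 Q Q (idseq Q)) (mk2 ?QQ Q \<mu>) = mk2 (UC_comp1 Q ?QQ) ?QQ (hseq Q Q (idseq Q) \<mu>)"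
    "hseq Q Q (idseq Q) \<mu> \<in> exchange_seqs (UC_comp1 Q ?QQ) ?QQ"
    using UC_hcomp_mk2[OF b b b QQ Q Q Q id \<mu>(1)] hseq_in[OF b b b QQ Q Q Q id \<mu>(1)] 
    by simp_all
  have i1: "UC_hcomp (mk2 ?I Q \<iota>) (mk2 Q Q (idseq Q)) = mk2 Q ?QQ (hseq ?I Q \<iota> (idseq Q))"
    "hseq ?I Q \<iota> (idseq Q) \<in> exchange_seqs Q ?QQ"
    using UC_hcomp_mk2[OF b b b Q Q one Q \<iota>(1) id] hseq_in[OF b b b Q Q one Q \<iota>(1) id] 
    by (simp_all add: unit)
  have i2: "UC_hcomp (mk2 Q Q (idseq Q)) (mk2 ?I Q \<iota>) = mk2 Q ?QQ (hseq Q Q (idseq Q) \<iota>)"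
    "hseq Q Q (idseq Q) \<iota> \<in> exchange_seqs Q ?QQ"
    using UC_hcomp_mk2[OF b b b one Q Q Q id \<iota>(1)] hseq_in[OF b b b one Q Q Q id \<iota>(1)] 
    by (simp_all add: unit)
  have s: "UC_star2 (mk2 ?QQ Q \<mu>) = mk2 Q ?QQ (sseq ?QQ \<mu>)" "sseq ?QQ \<mu> \<in> exchange_seqs Q ?QQ"
    using UC_star2_mk2[OF b b QQ Q \<mu>(1)] sseq_in[OF b b QQ Q \<mu>(1)] by simp_all
  have s1: "UC_hcomp (mk2 Q ?QQ (sseq ?QQ \<mu>)) (mk2 Q Q (idseq Q)) = mk2 ?QQ (UC_comp1 Q ?QQ) (hseq Q Q (sseq ?QQ \<mu>) (idseq Q))"
    "hseq Q Q (sseq ?QQ \<mu>) (idseq Q) \<in> exchange_seqs ?QQ (UC_comp1 Q ?QQ)"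
    using UC_hcomp_mk2[OF b b b Q Q Q QQ s(2) id] hseq_in[OF b b b Q Q Q QQ s(2) id] 
    by (simp_all add: assoc)
  note eqs' = eqs[unfolded \<mu>(2) \<iota>(2) UC_one2_mk2]
  note at = seq_at UC_comp1_simps
  let ?B = "level b" and ?q = "\<lambda>k. fobj (fun1 Q k)" and ?Q = "\<lambda>k. farr (fun1 Q k)"
  define P1 where "P1 k x \<longleftrightarrow> \<mu> k x \<cdot>\<^bsub>?B k\<^esub> \<mu> k (?q k x) = \<mu> k x \<cdot>\<^bsub>?B k\<^esub> ?Q k (\<mu> k x)" for k x
  define P2 where "P2 k x \<longleftrightarrow> \<mu> k x \<cdot>\<^bsub>?B k\<^esub> \<iota> k (?q k x) = Idn (?B k) (?q k x)" for k x
  define P3 where "P3 k x \<longleftrightarrow> \<mu> k x \<cdot>\<^bsub>?B k\<^esub> ?Q k (\<iota> k x) = Idn (?B k) (?q k x)" for k x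
  define P4 where "P4 k x \<longleftrightarrow> ?Q k (\<mu> k x) \<cdot>\<^bsub>?B k\<^esub> Str (?B k) (\<mu> k (?q k x)) = Str (?B k) (\<mu> k x) \<cdot>\<^bsub>?B k\<^esub> \<mu> k x" for k x
  define P5 where "P5 k x \<longleftrightarrow> \<mu> k x \<cdot>\<^bsub>?B k\<^esub> Str (?B k) (\<mu> k x) = Idn (?B k) (?q k x)" for k x
  note v1 = vseq_in[OF b b T' QQ Q \<mu>(1) m1(2)] vseq_in[OF b b T' QQ Q \<mu>(1) m2(2)]
    and v2 = vseq_in[OF b b Q QQ Q \<mu>(1) i1(2)] and v3 = vseq_in[OF b b Q QQ Q \<mu>(1) i2(2)]
    and v4 = vseq_in[OF b b QQ T' QQ m2(2) s1(2)] vseq_in[OF b b QQ Q QQ s(2) \<mu>(1)]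
    and v5 = vseq_in[OF b b Q QQ Q \<mu>(1) s(2)]
  have "\<forall>\<^sub>F k in sequentially. \<forall>x\<in>Obj (?B k). P1 k x"
    using mk2_eqD[OF eqs'(1)[unfolded m1(1) m2(1) UC_vcomp_mk2[OF b b T' QQ Q \<mu>(1) m1(2)] 
      UC_vcomp_mk2[OF b b T' QQ Q \<mu>(1) m2(2)]] v1]
    by (rule eventually_mono) (auto simp: at P1_def)
  moreover have "\<forall>\<^sub>F k in sequentially. \<forall>x\<in>Obj (?B k). P2 k x"
    using mk2_eqD[OF eqs'(2)[unfolded i1(1) UC_vcomp_mk2[OF b b Q QQ Q \<mu>(1) i1(2)]] v2 id]
    by (rule eventually_mono) (auto simp: at P2_def)
  moreover have "\<forall>\<^sub>F k in sequentially. \<forall>x\<in>Obj (?B k). P3 k x"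
    using mk2_eqD[OF eqs'(3)[unfolded i2(1) UC_vcomp_mk2[OF b b Q QQ Q \<mu>(1) i2(2)]] v3 id]
    by (rule eventually_mono) (auto simp: at P3_def)
  moreover have "\<forall>\<^sub>F k in sequentially. \<forall>x\<in>Obj (?B k). P4 k x"
    using mk2_eqD[OF eqs'(4)[unfolded s(1) m2(1) s1(1) UC_vcomp_mk2[OF b b QQ T' QQ m2(2) s1(2)] 
      UC_vcomp_mk2[OF b b QQ Q QQ s(2) \<mu>(1)]] v4]
    by (rule eventually_mono) (auto simp: at P4_def)
  moreover have "\<forall>\<^sub>F k in sequentially. \<forall>x\<in>Obj (?B k). P5 k x"
    using mk2_eqD[OF eqs'(5)[unfolded s(1) UC_vcomp_mk2[OF b b Q QQ Q \<mu>(1) s(2)]] v5 id]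
    by (rule eventually_mono) (auto simp: at P5_def)
  moreover have "\<forall>\<^sub>F k in sequentially. exch ?QQ Q k (\<mu> k) (\<mu> (Suc k)) \<and> exch ?I Q k (\<iota> k) (\<iota> (Suc k))" 
    using \<mu>(1) \<iota>(1) unfolding exchange_seqs_iff eventually_conj_iff eventually_sequentially by blast
  ultimately have "\<forall>\<^sub>F k in sequentially. (\<forall>x\<in>Obj (?B k). P1 k x \<and> P2 k x \<and> P3 k x \<and> P4 k x \<and> P5 k x) \<and>
    exch ?QQ Q k (\<mu> k) (\<mu> (Suc k)) \<and> exch ?I Q k (\<iota> k) (\<iota> (Suc k))"
    by eventually_elim blast
  then obtain N where N: "\<And>k x. \<lbrakk>k \<ge> N; x \<in> Obj (?B k)\<rbrakk> \<Longrightarrow> P1 k x \<and> P2 k x \<and> P3 k x \<and> P4 k x \<and> P5 k x"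
    and ex: "\<And>k. k \<ge> N \<Longrightarrow> exch ?QQ Q k (\<mu> k) (\<mu> (Suc k))" "\<And>k. k \<ge> N \<Longrightarrow> exch ?I Q k (\<iota> k) (\<iota> (Suc k))"
    unfolding eventually_sequentially by blast
  note N = N[unfolded P1_def P2_def P3_def P4_def P5_def]
  have fp: "functor_pair (?B k) (?B k) (fun1 Q k)" "functor_pair (?B k) (?B (Suc k)) (step b k)" for k
    using Q.fun1_functor Q.S.step_functor Q.S.star_cat by (auto simp: functor_pair_def)
  have monad: "Q_monad (?B k) (fun1 Q k) (\<mu> k) (\<iota> k)" if k: "k \<ge> N" for k
    unfolding Q_monad_def Q_monad_axioms_def
    using inf Q.S.fin_ss fp N[OF k] NT_D(4)[OF Q.S.cat \<mu>nt, of _ k] NT_D(4)[OF Q.S.cat \<iota>nt, of _ k]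
    by (auto simp: Q.S.in_Hom_iff UC_comp1_simps)
  have step: "Q_step (?B k) (fun1 Q k) (\<mu> k) (\<iota> k) 
      (?B (Suc k)) (fun1 Q (Suc k)) (\<mu> (Suc k)) (\<iota> (Suc k)) (step b k) (conn Q k)" if k: "k \<ge> N" for k
    unfolding Q_step_def Q_step_axioms_def
    using monad[OF k] monad[of "Suc k"] k fp(2) ex[OF k] Q.conn_nat[of _ k] Q.conn_unitary_arr
    by (auto simp: Q.S.in_Hom_iff UC_comp1_simps exch_def)
  show ?thesis
    by (rule that[OF _ \<mu>(2) \<iota>(2)])
      (intro Q_levels.intro Q_levels_axioms.intro Q.UC_mor_axioms \<mu>(1) \<iota>(1) monad step)
qed

lemma Q_system_splits_infinite:
  fixes b :: "'u zero_cell"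
  assumes "infinite (UNIV :: 'u set)" "b \<in> UC_0" "Q_system UC b Q m i"
  shows "\<exists>c \<in> UC_0. \<exists>X Xbar ev coev. unitarily_separable_dual UC c b X Xbar ev coev \<and>
    (\<exists>u. Q_system_iso UC Q m i (UC_comp1 X Xbar) (UC_hcomp (UC_one2 X) (UC_hcomp ev (UC_one2 Xbar))) coev u)"
proof -
  obtain \<mu> \<iota> N where "Q_levels b Q \<mu> \<iota> N" and mi: "m = mk2 (UC_comp1 Q Q) Q \<mu>" "i = mk2 (UC_one1 b) Q \<iota>"
    by (rule Q_system_levels[OF assms])
  then interpret L: Q_levels b Q \<mu> \<iota> N by simp
  show ?thesis using L.c_in L.X_has_separable_dual L.Q_iso_X_Xbar unfolding mi by blast
qed

section \<open>Finite universes\<close>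

text \<open>The complex multiples of a nonzero arrow are pairwise distinct.\<close>

lemma (in linear_category) Hom_singleton_if_finite:
  assumes "finite (UNIV :: 'a set)" "f \<in> Hom C x y"
  shows "f = Zer C x y"
proof (rule ccontr)
  assume "f \<noteq> Zer C x y"
  have ft [simp]: "f \<in> Arr C" "Dom C f = x" "Cod C f = y" using assms(2) by (auto simp: in_Hom_iff)
  have "inj (\<lambda>a. a \<odot> f)"
  proof (rule injI)
    fix a a' assume *: "a \<odot> f = a' \<odot> f"
    have "(a - a') \<odot> f = a \<odot> f \<oplus> (-1) \<odot> (a' \<odot> f)" using add_Scl'[of f a "- a'"] by simp
    also have "\<dots> = Zer C x y" by (subst *) (subst Add_neg'; simp)
    finally show "a = a'" using Scl_eq_Zer[of f "a - a'"] \<open>f \<noteq> Zer C x y\<close> by auto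
  qed
  then have "finite (UNIV :: complex set)" by (rule finite_imageD[OF finite_subset[OF subset_UNIV assms(1)]])
  then show False using infinite_UNIV_char_0 by blast
qed

lemma UC_2_unique_if_finite:
  assumes fin: "finite (UNIV :: 'u set)" and "\<Delta> \<in> UC_0" and L: "\<Lambda> \<in> UC_1 \<Gamma> \<Delta>"
    and "(\<mu> :: 'u two_cell) \<in> UC_2 \<Lambda> \<Omega>" "\<nu> \<in> UC_2 \<Lambda> \<Omega>"
  shows "\<mu> = \<nu>"
proof -
  interpret D: UC_obj \<Delta> by unfold_locales fact
  obtain \<eta> where \<eta>: "\<eta> \<in> exchange_seqs \<Lambda> \<Omega>" "\<mu> = mk2 \<Lambda> \<Omega> \<eta>" using UC_2_rep[OF assms(4)] by blast
  obtain \<zeta> where \<zeta>: "\<zeta> \<in> exchange_seqs \<Lambda> \<Omega>" "\<nu> = mk2 \<Lambda> \<Omega> \<zeta>" using UC_2_rep[OF assms(5)] by blast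
  have trg: "trg0 \<Lambda> = \<Delta>" using L by (simp add: UC_1_def)
  show ?thesis unfolding \<eta>(2) \<zeta>(2)
  proof (rule mk2_eqI[OF \<eta>(1) \<zeta>(1), of 0])
    fix k x assume x: "x \<in> Obj (level (src0 \<Lambda>) k)"
    have "\<eta> k x \<in> Hom (level \<Delta> k) (fobj (fun1 \<Lambda> k) x) (fobj (fun1 \<Omega> k) x)"
      "\<zeta> k x \<in> Hom (level \<Delta> k) (fobj (fun1 \<Lambda> k) x) (fobj (fun1 \<Omega> k) x)"
      using \<eta>(1) \<zeta>(1) x trg unfolding exchange_seqs_iff NT_def by auto
    then show "\<eta> k x = \<zeta> k x" using linear_category.Hom_singleton_if_finite[OF D.lin_cat fin] by metis
  qed
qed

lemma UC_one2_in:
  assumes "\<Gamma> \<in> UC_0" "\<Delta> \<in> UC_0" "\<Lambda> \<in> UC_1 \<Gamma> \<Delta>" shows "UC_one2 \<Lambda> \<in> UC_2 \<Lambda> \<Lambda>"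
  unfolding UC_one2_mk2 by (rule mk2_in[OF idseq_in[OF assms]])

lemma UC_vcomp_in:
  assumes a: "\<Gamma> \<in> UC_0" "\<Delta> \<in> UC_0" "\<Lambda> \<in> UC_1 \<Gamma> \<Delta>" "\<Omega> \<in> UC_1 \<Gamma> \<Delta>" "\<Theta> \<in> UC_1 \<Gamma> \<Delta>" 
    and "\<nu> \<in> UC_2 \<Omega> \<Theta>" "\<mu> \<in> UC_2 \<Lambda> \<Omega>"
  shows "UC_vcomp \<nu> \<mu> \<in> UC_2 \<Lambda> \<Theta>"
proof -
  obtain \<kappa> where \<kappa>: "\<kappa> \<in> exchange_seqs \<Omega> \<Theta>" "\<nu> = mk2 \<Omega> \<Theta> \<kappa>" using UC_2_rep[OF assms(6)] by blast
  obtain \<eta> where \<eta>: "\<eta> \<in> exchange_seqs \<Lambda> \<Omega>" "\<mu> = mk2 \<Lambda> \<Omega> \<eta>" using UC_2_rep[OF assms(7)] by blast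
  show ?thesis unfolding \<kappa>(2) \<eta>(2) UC_vcomp_mk2[OF a \<kappa>(1) \<eta>(1)] by (rule mk2_in[OF vseq_in[OF a \<kappa>(1) \<eta>(1)]])
qed

lemma UC_hcomp_in:
  assumes a: "\<Gamma> \<in> UC_0" "\<Delta> \<in> UC_0" "\<Sigma> \<in> UC_0" "\<Lambda> \<in> UC_1 \<Gamma> \<Delta>" "\<Lambda>' \<in> UC_1 \<Gamma> \<Delta>" "\<Omega> \<in> UC_1 \<Delta> \<Sigma>" "\<Omega>' \<in> UC_1 \<Delta> \<Sigma>"
    and "\<nu> \<in> UC_2 \<Omega> \<Omega>'" "\<mu> \<in> UC_2 \<Lambda> \<Lambda>'"
  shows "UC_hcomp \<nu> \<mu> \<in> UC_2 (UC_comp1 \<Omega> \<Lambda>) (UC_comp1 \<Omega>' \<Lambda>')"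
proof -
  obtain \<kappa> where \<kappa>: "\<kappa> \<in> exchange_seqs \<Omega> \<Omega>'" "\<nu> = mk2 \<Omega> \<Omega>' \<kappa>" using UC_2_rep[OF assms(8)] by blast
  obtain \<eta> where \<eta>: "\<eta> \<in> exchange_seqs \<Lambda> \<Lambda>'" "\<mu> = mk2 \<Lambda> \<Lambda>' \<eta>" using UC_2_rep[OF assms(9)] by blast
  show ?thesis unfolding \<kappa>(2) \<eta>(2) UC_hcomp_mk2[OF a \<kappa>(1) \<eta>(1)] by (rule mk2_in[OF hseq_in[OF a \<kappa>(1) \<eta>(1)]])
qed

lemma UC_star2_in:
  assumes a: "\<Gamma> \<in> UC_0" "\<Delta> \<in> UC_0" "\<Lambda> \<in> UC_1 \<Gamma> \<Delta>" "\<Omega> \<in> UC_1 \<Gamma> \<Delta>" and "\<mu> \<in> UC_2 \<Lambda> \<Omega>"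
  shows "UC_star2 \<mu> \<in> UC_2 \<Omega> \<Lambda>"
proof -
  obtain \<eta> where \<eta>: "\<eta> \<in> exchange_seqs \<Lambda> \<Omega>" "\<mu> = mk2 \<Lambda> \<Omega> \<eta>" using UC_2_rep[OF assms(5)] by blast
  show ?thesis unfolding \<eta>(2) UC_star2_mk2[OF a \<eta>(1)] by (rule mk2_in[OF sseq_in[OF a \<eta>(1)]])
qed

text \<open>Parallel 2-cells coincide, so all equations hold as soon as both sides have the same type. The
adjoint of the unit provides the 2-cell from \<open>Q\<close> to the identity.\<close>

lemma Q_system_splits_finite:
  fixes b :: "'u zero_cell"
  assumes fin: "finite (UNIV :: 'u set)" and b: "b \<in> UC_0" and Qs: "Q_system UC b Q m i"
  shows "\<exists>c \<in> UC_0. \<exists>X Xbar ev coev. unitarily_separable_dual UC c b X Xbar ev coev \<and>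
    (\<exists>u. Q_system_iso UC Q m i (UC_comp1 X Xbar) (UC_hcomp (UC_one2 X) (UC_hcomp ev (UC_one2 Xbar))) coev u)"
proof -
  let ?I = "UC_one1 b"
  have Q: "Q \<in> UC_1 b b" and m: "m \<in> UC_2 (UC_comp1 Q Q) Q" and i: "i \<in> UC_2 ?I Q"
    using Qs unfolding Q_system_def UC_def by auto
  note I = UC_one1_in[OF b]
  have II [simp]: "UC_comp1 ?I ?I = ?I" by (rule UC_comp1_unit(1)[OF b b I])
  note QQ = UC_comp1_in[OF b b b Q Q]
  note uniq = UC_2_unique_if_finite[OF fin b]
  have e: "UC_one2 ?I \<in> UC_2 ?I ?I" by (rule UC_one2_in[OF b b I])
  have h: "UC_hcomp x y \<in> UC_2 ?I ?I" if "x \<in> UC_2 ?I ?I" "y \<in> UC_2 ?I ?I" for x y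
    using UC_hcomp_in[OF b b b I I I I that] by simp
  have v: "UC_vcomp x y \<in> UC_2 ?I ?I" if "x \<in> UC_2 ?I ?I" "y \<in> UC_2 ?I ?I" for x y
    by (rule UC_vcomp_in[OF b b I I I that])
  have s: "UC_star2 x \<in> UC_2 ?I ?I" if "x \<in> UC_2 ?I ?I" for x
    by (rule UC_star2_in[OF b b I I that])
  have "unitarily_separable_dual UC b b ?I ?I (UC_one2 ?I) (UC_one2 ?I)"
    unfolding unitarily_separable_dual_def is_dual_def UC_def
    using I e by (auto intro!: uniq[OF I, of _ ?I] v h s)
  moreover have "Q_system_iso UC Q m i (UC_comp1 ?I ?I) (UC_hcomp (UC_one2 ?I) (UC_hcomp (UC_one2 ?I) (UC_one2 ?I)))
    (UC_one2 ?I) (UC_star2 i)"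
  proof -
    have u: "UC_star2 i \<in> UC_2 Q ?I" by (rule UC_star2_in[OF b b I Q i])
    have us: "UC_star2 (UC_star2 i) \<in> UC_2 ?I Q" by (rule UC_star2_in[OF b b Q I u])
    have uu: "UC_hcomp (UC_star2 i) (UC_star2 i) \<in> UC_2 (UC_comp1 Q Q) ?I"
      using UC_hcomp_in[OF b b b Q I Q I u u] by simp
    have "UC_vcomp (UC_star2 (UC_star2 i)) (UC_star2 i) = UC_one2 Q"
      by (rule uniq[OF Q UC_vcomp_in[OF b b Q I Q us u] UC_one2_in[OF b b Q]])
    moreover have "UC_vcomp (UC_star2 i) (UC_star2 (UC_star2 i)) = UC_one2 ?I"
      by (rule uniq[OF I UC_vcomp_in[OF b b I Q I u us] e])
    moreover have "UC_vcomp (UC_star2 i) m = UC_vcomp (UC_hcomp (UC_one2 ?I) (UC_hcomp (UC_one2 ?I) (UC_one2 ?I))) (UC_hcomp (UC_star2 i) (UC_star2 i))"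
      by (rule uniq[OF QQ UC_vcomp_in[OF b b QQ Q I u m] UC_vcomp_in[OF b b QQ I I h[OF e h[OF e e]] uu]])
    moreover have "UC_vcomp (UC_star2 i) i = UC_one2 ?I"
      by (rule uniq[OF I UC_vcomp_in[OF b b I Q I u i] e])
    ultimately show ?thesis unfolding Q_system_iso_def using u by (simp add: UC_def)
  qed
  ultimately show ?thesis using b by blast
qed

section \<open>Q-system completeness\<close>

theorem theorem1p1:
  shows "Q_system_complete (UC :: ('u zero_cell, 'u one_cell, 'u two_cell) two_cat)"
proof -
  have "\<exists>c \<in> UC_0. \<exists>X Xbar ev coev. unitarily_separable_dual UC c b X Xbar ev coev \<and>
    (\<exists>u. Q_system_iso UC Q m i (UC_comp1 X Xbar) (UC_hcomp (UC_one2 X) (UC_hcomp ev (UC_one2 Xbar))) coev u)"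
    if "b \<in> UC_0" "Q_system UC b Q m i" for b :: "'u zero_cell" and Q m i
    using Q_system_splits_finite[OF _ that] Q_system_splits_infinite[OF _ that] by blast
  then show ?thesis unfolding Q_system_complete_def by (simp add: UC_def)
qed

end
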